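(* Let $d\ge1$, let $F$ be real entire with $F(0)=0$, and let $u_0\in M^{1,1}(\mathbb R^d)$. Then there exists $T^*=T^*(\|u_0\|_{M^{1,1}})>0$ such that the Cauchy problem $$i\partial_t u-Hu=F(u),\qquad u(0,\cdot)=u_0,\qquad H=-\Delta+|x|^2,$$ has a unique solution $u\in C([0,T^* ),M^{1,1}(\mathbb R^d))$.
   Context: Real entire: a function $F:\mathbb R^2\to\mathbb C$ is real entire if $F(s,t)=\sum_{m,n=0}^\infty a_{mn}s^mt^n$ with the series converging absolutely for every $(s,t)\in\mathbb R^2$. For $u=u_1+iu_2$ with $u_1,u_2$ real-valued, $F(u)$ means $F(u_1,u_2)$; $F(0)=0$ means $F(0,0)=0$. Modulation spaces: for a fixed nonzero $g\in\mathcal S(\mathbb R^d)$ and $f\in\mathcal S'(\mathbb R^d)$, the short-time Fourier transform is $V_gf(x,y)=(2\pi)^{-d/2}\langle f,M_yT_xg\rangle$, i.e. $V_gf(x,y)=(2\pi)^{-d/2}\int f(t)\overline{g(t-x)}e^{-iy\cdot t}\,dt$, where $T_xg(t)=g(t-x)$, $M_yg(t)=e^{iy\cdot t}g(t)$. $M^{1,1}(\mathbb R^d)$ is the Banach space of $f\in\mathcal S'(\mathbb R^d)$ with $\|f\|_{M^{1,1}}=\int_{\mathbb R^d}\int_{\mathbb R^d}|V_gf(x,y)|\,dx\,dy<\infty$; different choices of $g$ give equivalent norms. One has $M^{1,1}(\mathbb R^d)\subset L^2(\mathbb R^d)$. The Hermite operator $H$ has the orthonormal basis of eigenfunctions of $L^2(\mathbb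 R^d)$ given by the normalized Hermite functions $\Phi_\alpha$, $\alpha\in\mathbb N^d$ ($0\in\mathbb N$ here), with $H\Phi_\alpha=(2|\alpha|+d)\Phi_\alpha$, and $e^{-itH}f=\sum_\alpha e^{-it(2|\alpha|+d)}\langle f,\Phi_\alpha\rangle\Phi_\alpha$ for $f\in L^2(\mathbb R^d)$. A solution of $i\partial_tu-Hu=F(u)$, $u(0)=u_0$, on $[0,T)$ is understood in the sense of Duhamel's formula: $u(t)=e^{-itH}u_0-i\int_0^te^{-i(t-\tau)H}F(u(\tau))\,d\tau$ for all $t\in[0,T)$. The notation $T^*=T^*(\|u_0\|_{M^{1,1}})$ means that, for the given $F$ and $d$, $T^*$ can be chosen depending on $u_0$ only through $\|u_0\|_{M^{1,1}}$. *)

theory Defs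
  imports "HOL-Analysis.Analysis"
begin

definition partial_deriv :: "'n \<Rightarrow> (real^'n::finite \<Rightarrow> complex) \<Rightarrow> real^'n \<Rightarrow> complex" where
  "partial_deriv i \<phi> x = frechet_derivative \<phi> (at x) (axis i 1)"

text \<open>Iterated partial derivatives are indexed by lists of coordinates. Since all of them are
  required to be Frechet differentiable on the whole space, elements of \<open>schwartz_space\<close> are smooth
  and every multi-index derivative occurs in the list.\<close>

definition schwartz_space :: "(real^'n::finite \<Rightarrow> complex) set" where
  "schwartz_space = {\<phi>. \<forall>js. foldr partial_deriv js \<phi> differentiable_on UNIV \<and>
     (\<forall>k::nat. bounded (range (\<lambda>x. norm x ^ k *\<^sub>R foldr partial_deriv js \<phi> x)))}"

definition schwartz_seminorm :: "nat \<Rightarrow> 'n list \<Rightarrow> (real^'n::finite \<Rightarrow> complex) \<Rightarrow> real" where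
  "schwartz_seminorm k js \<phi> = (SUP x. norm x ^ k * cmod (foldr partial_deriv js \<phi> x))"

text \<open>A tempered distribution is a continuous linear functional on the Schwartz space, continuity
  being expressed by a bound by finitely many of the defining seminorms. Values of the functional
  outside the Schwartz space are irrelevant and never used.\<close>

definition tempered_distribution ::
    "((real^'n::finite \<Rightarrow> complex) \<Rightarrow> complex) \<Rightarrow> bool" where
  "tempered_distribution f \<longleftrightarrow>
     (\<forall>\<phi>\<in>schwartz_space. \<forall>\<psi>\<in>schwartz_space. f (\<lambda>x. \<phi> x + \<psi> x) = f \<phi> + f \<psi>) \<and>
     (\<forall>\<phi>\<in>schwartz_space. \<forall>c. f (\<lambda>x. c * \<phi> x) = c * f \<phi>) \<and>
     (\<exists>C N. \<forall>\<phi>\<in>schwartz_space.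
        cmod (f \<phi>) \<le> C * (\<Sum>k\<le>N. \<Sum>js | length js \<le> N. schwartz_seminorm k js \<phi>))"

text \<open>The pairing is conjugate-linear in the test function, so that it extends the inner
  product of \<open>L\<^sup>2\<close>.\<close>

definition pairing :: "((real^'n::finite \<Rightarrow> complex) \<Rightarrow> complex) \<Rightarrow> (real^'n \<Rightarrow> complex) \<Rightarrow> complex" where
  "pairing f \<phi> = f (\<lambda>x. cnj (\<phi> x))"

definition distribution_of :: "(real^'n::finite \<Rightarrow> complex) \<Rightarrow> (real^'n \<Rightarrow> complex) \<Rightarrow> complex" where
  "distribution_of h = (\<lambda>\<phi>. LINT x|lborel. h x * \<phi> x)"

text \<open>Elements are Borel measurable representatives; equality is equality almost everywhere.\<close>

definition L2_space :: "(real^'n::finite \<Rightarrow> complex) set" where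
  "L2_space = {h. h \<in> borel_measurable lborel \<and> integrable lborel (\<lambda>x. (cmod (h x))\<^sup>2)}"

definition L2_norm :: "(real^'n::finite \<Rightarrow> complex) \<Rightarrow> real" where
  "L2_norm h = sqrt (LINT x|lborel. (cmod (h x))\<^sup>2)"

definition translate :: "real^'n \<Rightarrow> (real^'n::finite \<Rightarrow> complex) \<Rightarrow> real^'n \<Rightarrow> complex" where
  "translate x g = (\<lambda>t. g (t - x))"

definition modulate :: "real^'n \<Rightarrow> (real^'n::finite \<Rightarrow> complex) \<Rightarrow> real^'n \<Rightarrow> complex" where
  "modulate y g = (\<lambda>t. exp (\<i> * complex_of_real (y \<bullet> t)) * g t)"

definition stft :: "(real^'n::finite \<Rightarrow> complex) \<Rightarrow> ((real^'n \<Rightarrow> complex) \<Rightarrow> complex) \<Rightarrow>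
    real^'n \<Rightarrow> real^'n \<Rightarrow> complex" where
  "stft g f x y = complex_of_real ((2 * pi) powr (- real CARD('n) / 2)) *
     pairing f (modulate y (translate x g))"

definition M11 :: "(real^'n::finite \<Rightarrow> complex) \<Rightarrow> ((real^'n \<Rightarrow> complex) \<Rightarrow> complex) set" where
  "M11 g = {f. tempered_distribution f \<and>
     integrable (lborel \<Otimes>\<^sub>M lborel) (\<lambda>(x, y). stft g f x y)}"

definition M11_norm :: "(real^'n::finite \<Rightarrow> complex) \<Rightarrow> ((real^'n \<Rightarrow> complex) \<Rightarrow> complex) \<Rightarrow> real" where
  "M11_norm g f = (LINT (x, y)|(lborel \<Otimes>\<^sub>M lborel). cmod (stft g f x y))"

text \<open>Every distribution in \<open>M\<^sup>1\<^sup>,\<^sup>1\<close> is given by a function in \<open>L\<^sup>2\<close>. The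
  nonlinearity and the propagator act on functions, so the Cauchy problem is stated for these
  function representatives.\<close>

definition M11_fun :: "(real^'n::finite \<Rightarrow> complex) \<Rightarrow> (real^'n \<Rightarrow> complex) set" where
  "M11_fun g = {h \<in> L2_space. distribution_of h \<in> M11 g}"

abbreviation M11_fun_norm :: "(real^'n::finite \<Rightarrow> complex) \<Rightarrow> (real^'n \<Rightarrow> complex) \<Rightarrow> real" where
  "M11_fun_norm g h \<equiv> M11_norm g (distribution_of h)"

definition M11_continuous_on ::
    "(real^'n::finite \<Rightarrow> complex) \<Rightarrow> real set \<Rightarrow> (real \<Rightarrow> real^'n \<Rightarrow> complex) \<Rightarrow> bool" where
  "M11_continuous_on g I u \<longleftrightarrow> (\<forall>t\<in>I. u t \<in> M11_fun g) \<and>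
     (\<forall>t\<in>I. ((\<lambda>s. M11_fun_norm g (\<lambda>x. u s x - u t x)) \<longlongrightarrow> 0) (at t within I))"

text \<open>The \<open>M\<^sup>1\<^sup>,\<^sup>1\<close>-valued Riemann integral over \<open>[a, b]\<close>, as the limit in norm of the Riemann
  sums of tagged divisions whose mesh tends to 0.\<close>

definition has_M11_integral :: "(real^'n::finite \<Rightarrow> complex) \<Rightarrow> (real \<Rightarrow> real^'n \<Rightarrow> complex) \<Rightarrow>
    real \<Rightarrow> real \<Rightarrow> (real^'n \<Rightarrow> complex) \<Rightarrow> bool" where
  "has_M11_integral g G a b w \<longleftrightarrow>
     w \<in> M11_fun g \<and> (\<forall>\<tau>\<in>{a..b}. G \<tau> \<in> M11_fun g) \<and>
     (\<forall>\<epsilon>>0. \<exists>\<delta>>0. \<forall>p. p tagged_division_of {a..b} \<and> (\<lambda>\<tau>. ball \<tau> \<delta>) fine p \<longrightarrow>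
        M11_fun_norm g (\<lambda>x. (\<Sum>(\<tau>, K)\<in>p. measure lborel K *\<^sub>R G \<tau> x) - w x) < \<epsilon>)"

text \<open>Rodrigues' formula for the \<open>L\<^sup>2\<close>-normalized Hermite functions on the real line.\<close>

definition hermite_fun1 :: "nat \<Rightarrow> real \<Rightarrow> real" where
  "hermite_fun1 k s = (-1) ^ k / sqrt (2 ^ k * fact k * sqrt pi) * exp (s\<^sup>2 / 2) *
     (deriv ^^ k) (\<lambda>r. exp (- (r\<^sup>2))) s"

definition hermite_fun :: "('n::finite \<Rightarrow> nat) \<Rightarrow> real^'n \<Rightarrow> complex" where
  "hermite_fun \<alpha> x = complex_of_real (\<Prod>j\<in>UNIV. hermite_fun1 (\<alpha> j) (x $ j))"

definition hermite_coeff :: "(real^'n::finite \<Rightarrow> complex) \<Rightarrow> ('n \<Rightarrow> nat) \<Rightarrow> complex" where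
  "hermite_coeff f \<alpha> = (LINT x|lborel. f x * cnj (hermite_fun \<alpha> x))"

definition hermite_eigenvalue :: "('n::finite \<Rightarrow> nat) \<Rightarrow> real" where
  "hermite_eigenvalue \<alpha> = 2 * real (\<Sum>j\<in>UNIV. \<alpha> j) + real CARD('n)"

text \<open>A representative of \<open>e\<^sup>-\<^sup>i\<^sup>t\<^sup>H f\<close>, the \<open>L\<^sup>2\<close>-sum of the spectral series. For \<open>f\<close>
  in \<open>L\<^sup>2\<close> it exists and is unique up to null sets.\<close>

definition propagator :: "real \<Rightarrow> (real^'n::finite \<Rightarrow> complex) \<Rightarrow> real^'n \<Rightarrow> complex" where
  "propagator t f = (SOME w. w \<in> L2_space \<and>
     ((\<lambda>A. L2_norm (\<lambda>x. w x -
         (\<Sum>\<alpha>\<in>A. exp (- \<i> * complex_of_real (t * hermite_eigenvalue \<alpha>)) *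
                  hermite_coeff f \<alpha> * hermite_fun \<alpha> x))) \<longlongrightarrow> 0)
       (finite_subsets_at_top UNIV))"

definition real_entire :: "(real \<Rightarrow> real \<Rightarrow> complex) \<Rightarrow> bool" where
  "real_entire F \<longleftrightarrow> (\<exists>a :: nat \<Rightarrow> nat \<Rightarrow> complex. \<forall>s t.
     (\<lambda>(m, n). cmod (a m n * complex_of_real (s ^ m * t ^ n))) summable_on UNIV \<and>
     ((\<lambda>(m, n). a m n * complex_of_real (s ^ m * t ^ n)) has_sum (F s t)) UNIV)"

definition nonlinearity ::
    "(real \<Rightarrow> real \<Rightarrow> complex) \<Rightarrow> (real^'n::finite \<Rightarrow> complex) \<Rightarrow> real^'n \<Rightarrow> complex" where
  "nonlinearity F v = (\<lambda>x. F (Re (v x)) (Im (v x)))"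

text \<open>Solutions of \<open>i \<partial>\<^sub>t u - H u = F(u)\<close>, \<open>u(0) = u\<^sub>0\<close>, in \<open>C([0,T), M\<^sup>1\<^sup>,\<^sup>1)\<close>, in the sense of
  Duhamel's formula.\<close>

definition M11_solution :: "(real^'n::finite \<Rightarrow> complex) \<Rightarrow> (real \<Rightarrow> real \<Rightarrow> complex) \<Rightarrow>
    (real^'n \<Rightarrow> complex) \<Rightarrow> real \<Rightarrow> (real \<Rightarrow> real^'n \<Rightarrow> complex) \<Rightarrow> bool" where
  "M11_solution g F u0 T u \<longleftrightarrow> M11_continuous_on g {0..<T} u \<and>
     (\<forall>t\<in>{0..<T}. \<exists>w.
        has_M11_integral g (\<lambda>\<tau>. propagator (t - \<tau>) (nonlinearity F (u \<tau>))) 0 t w \<and>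
        (AE x in lborel. u t x = propagator t u0 x - \<i> * w x))"

end

theory Submission
  imports Defs "HOL-Probability.Probability" "HOL-Computational_Algebra.Polynomial"
begin

text \<open>Inverting the short-time Fourier transform with a Gaussian window writes every element of
  \<open>M\<^sup>1\<^sup>,\<^sup>1\<close> as an absolutely convergent superposition of coherent states, that is, of Gaussians
  translated and modulated by points \<open>z\<close> of phase space. Hence a linear or bilinear operation is
  bounded on \<open>M\<^sup>1\<^sup>,\<^sup>1\<close> as soon as it is bounded on coherent states, uniformly in \<open>z\<close>.

  The product of two coherent states is a translated and modulated Gaussian of half the variance,
  so \<open>M\<^sup>1\<^sup>,\<^sup>1\<close> is an algebra and the power series of \<open>F\<close> defines a locally Lipschitz map.
  The generating function of the Hermite polynomials shows that \<open>e\<^sup>-\<^sup>i\<^sup>t\<^sup>H\<close> maps the coherent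
  state at \<open>z\<close> to a unimodular multiple of the coherent state at \<open>z\<close> rotated by the angle \<open>2t\<close>;
  so \<open>e\<^sup>-\<^sup>i\<^sup>t\<^sup>H\<close> is a strongly continuous, uniformly bounded group on \<open>M\<^sup>1\<^sup>,\<^sup>1\<close>. Existence is
  then Banach's fixed point theorem for Duhamel's formula, and uniqueness is a Gronwall argument.\<close>

section \<open>Integration over \<open>real^'n\<close>\<close>

text \<open>The statement speaks of measurable representatives, of a propagator picked by
  \<open>SOME\<close> among L2 limits and of an integral given by Riemann sums; none of these is
  fixed pointwise. The argument therefore takes place in a type \<open>m11\<close> of continuous
  functions, where a class has exactly one member and norms, series and fixed points make sense; the
  relation \<open>represents\<close> carries each notion across. All bounds rest on one covariance:
  a shift of a function in time and frequency only translates its Gabor transform, up to a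
  unimodular factor. Hence all coherent states have the same norm, whatever the point of phase space
  and the time of the evolution. Two obstacles leave their trace. The given window may be orthogonal
  to the Gaussian, so changing windows uses a suitably modulated Gaussian. Nonzero constants are not
  in the space, so the constant term of the series of F, which vanishes by F(0) = 0, has to be kept
  out of the algebra. The norms for the two windows agree only up to a factor, and this factor
  enters the existence time.\<close>

lemma lborel_integrable_affine:
  fixes f :: "'a::euclidean_space \<Rightarrow> 'b::{banach, second_countable_topology}"
  assumes f: "integrable lborel f" and c: "c \<noteq> 0"
  shows "integrable lborel (\<lambda>x. f (t + c *\<^sub>R x))"
proof -
  have fm[measurable]: "f \<in> borel_measurable borel" using f by auto
  have "integrable (density (distr lborel borel (\<lambda>x. t + c *\<^sub>R x)) (\<lambda>_. ennreal (\<bar>c\<bar>^DIM('a)))) f"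
    using f lborel_affine[OF c, of t] by simp
  hence "integrable (distr lborel borel (\<lambda>x. t + c *\<^sub>R x)) (\<lambda>x. (\<bar>c\<bar>^DIM('a)) *\<^sub>R f x)"
    by (subst (asm) integrable_density) auto
  hence "integrable lborel (\<lambda>x. (\<bar>c\<bar>^DIM('a)) *\<^sub>R f (t + c *\<^sub>R x))"
    by (subst (asm) integrable_distr_eq) auto
  hence "integrable lborel (\<lambda>x. (1 / \<bar>c\<bar>^DIM('a)) *\<^sub>R (\<bar>c\<bar>^DIM('a)) *\<^sub>R f (t + c *\<^sub>R x))"
    by (rule integrable_scaleR_right)
  thus ?thesis using c by simp
qed

lemma lborel_integral_affine:
  fixes f :: "'a::euclidean_space \<Rightarrow> 'b::{banach, second_countable_topology}"
  assumes f[measurable]: "f \<in> borel_measurable borel" and c: "c \<noteq> 0"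
  shows "integral\<^sup>L lborel f = (\<bar>c\<bar>^DIM('a)) *\<^sub>R (\<integral>x. f (t + c *\<^sub>R x) \<partial>lborel)"
proof -
  have "integral\<^sup>L lborel f = integral\<^sup>L (density (distr lborel borel (\<lambda>x. t + c *\<^sub>R x)) (\<lambda>_. ennreal (\<bar>c\<bar>^DIM('a)))) f"
    using lborel_affine[OF c, of t] by simp
  also have "\<dots> = integral\<^sup>L (distr lborel borel (\<lambda>x. t + c *\<^sub>R x)) (\<lambda>x. (\<bar>c\<bar>^DIM('a)) *\<^sub>R f x)"
    by (subst integral_density) auto
  also have "\<dots> = (\<integral>x. (\<bar>c\<bar>^DIM('a)) *\<^sub>R f (t + c *\<^sub>R x) \<partial>lborel)"
    by (subst integral_distr) auto
  finally show ?thesis by simp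
qed

lemma lborel_integrable_translate:
  fixes f :: "'a::euclidean_space \<Rightarrow> 'b::{banach, second_countable_topology}"
  assumes "integrable lborel f"
  shows "integrable lborel (\<lambda>x. f (t + x))" "integrable lborel (\<lambda>x. f (x + t))" "integrable lborel (\<lambda>x. f (x - t))"
        "integrable lborel (\<lambda>x. f (t - x))"
  using lborel_integrable_affine[OF assms, of 1 t] lborel_integrable_affine[OF assms, of 1 "-t"]
    lborel_integrable_affine[OF assms, of "-1" t]
  by (auto simp: add.commute)

lemma lborel_integral_translate:
  fixes f :: "'a::euclidean_space \<Rightarrow> 'b::{banach, second_countable_topology}"
  assumes "f \<in> borel_measurable borel"
  shows "(\<integral>x. f (t + x) \<partial>lborel) = integral\<^sup>L lborel f" "(\<integral>x. f (x + t) \<partial>lborel) = integral\<^sup>L lborel f"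
    "(\<integral>x. f (x - t) \<partial>lborel) = integral\<^sup>L lborel f"
    "(\<integral>x. f (t - x) \<partial>lborel) = integral\<^sup>L lborel f"
  using lborel_integral_affine[OF assms, of 1 t] lborel_integral_affine[OF assms, of 1 "-t"]
    lborel_integral_affine[OF assms, of "-1" t]
  by (auto simp: add.commute)

lemma prod_Basis_vec: "(\<Prod>b\<in>(Basis::(real^'n::finite) set). f b) = (\<Prod>i\<in>UNIV. f (axis i 1))"
proof -
  have B: "(Basis::(real^'n) set) = range (\<lambda>i. axis i 1)" by (auto simp: Basis_vec_def)
  show ?thesis unfolding B
    by (subst prod.reindex) (auto intro!: inj_onI simp: axis_eq_axis)
qed

text \<open>Lebesgue measure on the whole space is the image of a product measure indexed by
  \<open>Basis\<close>, so the product theorems apply once the factors are reindexed by basis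
  vectors; \<open>THE i. b = axis i 1\<close> inverts the map from coordinates to basis vectors.
  Gaussian and Hermite integrals are thereby reduced to the line.\<close>

lemma integral_prod_vec:
  fixes f :: "'n::finite \<Rightarrow> real \<Rightarrow> 'b::{real_normed_field,banach,second_countable_topology}"
  assumes f: "\<And>i. integrable lborel (f i)"
  shows "integrable lborel (\<lambda>x::real^'n. \<Prod>i\<in>UNIV. f i (x $ i))"
    and "(\<integral>x. (\<Prod>i\<in>UNIV. f i ((x::real^'n) $ i)) \<partial>lborel) = (\<Prod>i\<in>UNIV. integral\<^sup>L lborel (f i))"
proof -
  interpret product_sigma_finite "\<lambda>_::real^'n. lborel::real measure" ..
  have eq: "(\<lambda>x::real^'n. \<Prod>i\<in>UNIV. f i (x $ i)) = (\<lambda>x. \<Prod>b\<in>Basis. f (THE i. b = axis i 1) (x \<bullet> b))"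
    by (rule ext) (simp add: prod_Basis_vec axis_eq_axis inner_axis)
  have fm[measurable]: "f i \<in> borel_measurable borel" for i using f[of i] by auto
  have pm: "(\<lambda>x::real^'n. \<Prod>i\<in>UNIV. f i (x $ i)) \<in> borel_measurable borel"
    by measurable
  have lb: "lborel = distr (\<Pi>\<^sub>M b\<in>(Basis::(real^'n) set). lborel) borel (\<lambda>f. \<Sum>b\<in>Basis. f b *\<^sub>R b)"
    unfolding lborel_eq_real by (rule lborel_def)
  have e2: "(\<Prod>b\<in>Basis. f (THE i. b = axis i 1) ((\<Sum>b\<in>Basis. w b *\<^sub>R b) \<bullet> b))
      = (\<Prod>b\<in>Basis. f (THE i. b = axis i 1) (w b))" for w :: "real^'n \<Rightarrow> real"
    by (intro prod.cong refl) simp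
  have pmm: "(\<lambda>x::real^'n. \<Prod>b\<in>Basis. f (THE i. b = axis i 1) (x \<bullet> b)) \<in> borel_measurable borel"
    using pm unfolding eq .
  show "integrable lborel (\<lambda>x::real^'n. \<Prod>i\<in>UNIV. f i (x $ i))"
    unfolding eq
    apply (subst lb)
    apply (subst integrable_distr_eq)
    apply measurable
    apply (rule Bochner_Integration.integrable_cong[THEN iffD2, OF refl e2])
    apply (rule product_integrable_prod)
    using f apply auto
    done
  have "(\<integral>x. (\<Prod>i\<in>UNIV. f i ((x::real^'n) $ i)) \<partial>lborel)
      = (\<Prod>b\<in>(Basis::(real^'n) set). integral\<^sup>L lborel (f (THE i. b = axis i 1)))"
    unfolding eq
    apply (subst lb)
    apply (subst integral_distr)
    apply measurable
    apply (rule trans[OF Bochner_Integration.integral_cong[OF refl e2]])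
    apply (rule product_integral_prod)
    using f apply auto
    done
  thus "(\<integral>x. (\<Prod>i\<in>UNIV. f i ((x::real^'n) $ i)) \<partial>lborel) = (\<Prod>i\<in>UNIV. integral\<^sup>L lborel (f i))"
    by (simp add: prod_Basis_vec axis_eq_axis)
qed

section \<open>Weights of polynomial decay and integrals over products\<close>

definition decay :: "'a::real_normed_vector \<Rightarrow> real" where
  "decay x = 1 / (1 + norm x)"

lemma decay_pos [simp]: "0 < decay x" "0 \<le> decay x"
  unfolding decay_def by (auto intro!: add_pos_nonneg)

lemma decay_le_1 [simp]: "decay x \<le> 1"
  unfolding decay_def by (subst divide_le_eq_1) (auto intro: add_pos_nonneg)

lemma decay_cont [continuous_intros]: "continuous_on A f \<Longrightarrow> continuous_on A (\<lambda>x. decay (f x))"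
  unfolding decay_def by (intro continuous_intros) (auto simp: add_nonneg_eq_0_iff)

lemma decay_measurable [measurable]: "decay \<in> borel_measurable borel"
  by (intro borel_measurable_continuous_onI continuous_intros)

text \<open>Peetre's inequality, from 1 + |x + y| <= (1 + |x|)(1 + |y|): a translation changes the
  weight by a factor that depends only on the length of the translation.\<close>

lemma decay_add: "decay x \<le> (1 + norm y) * decay (x + y)"
proof -
  have "1 + norm (x + y) \<le> (1 + norm y) * (1 + norm x)"
    using norm_triangle_ineq[of x y] by (simp add: algebra_simps) (smt (verit) mult_nonneg_nonneg norm_ge_zero)
  thus ?thesis unfolding decay_def
    by (auto simp: divide_simps add_nonneg_eq_0_iff) (smt (verit) norm_ge_zero)+
qed

lemma decay_diff_power: "decay (x - y) ^ K \<le> (1 + norm y) ^ K * decay x ^ K"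
  using power_mono[OF decay_add[of "x - y" y], of K] by (simp add: power_mult_distrib)

lemma integrable_lborel_inverse_1_plus_square: "integrable lborel (\<lambda>x::real. inverse (1 + x\<^sup>2))"
  using integrable_inverse_1_plus_square by (simp add: set_integrable_def)

text \<open>Each factor 1 / (1 + x_i^2) dominates \<open>decay x ^ 2\<close>, so the power is
  dominated by a product of integrable functions of one variable. This is the origin of the exponent
  \<open>2 * CARD('n)\<close> used throughout.\<close>

lemma integrable_decay:
  assumes "K \<ge> 2 * CARD('n)"
  shows "integrable lborel (\<lambda>x::real^'n::finite. decay x ^ K)"
proof -
  have "integrable lborel (\<lambda>x::real^'n. \<Prod>i\<in>UNIV. inverse (1 + (x $ i)\<^sup>2))"
    by (rule integral_prod_vec(1)) (rule integrable_lborel_inverse_1_plus_square)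
  then show ?thesis
  proof (rule Bochner_Integration.integrable_bound)
    show "AE x in lborel. norm (decay x ^ K) \<le> norm (\<Prod>i\<in>UNIV. inverse (1 + ((x::real^'n) $ i)\<^sup>2))"
    proof (intro AE_I2)
      fix x :: "real^'n"
      have "1 + (x $ i)\<^sup>2 \<le> (1 + norm x)\<^sup>2" for i
      proof -
        have "(x $ i)\<^sup>2 \<le> (norm x)\<^sup>2" using component_le_norm_cart[of x i] by (metis power2_abs power_mono abs_ge_zero)
        thus ?thesis using norm_ge_zero[of x] unfolding power2_sum power_one mult_1_right by linarith
      qed
      hence "inverse ((1 + norm x)\<^sup>2) \<le> inverse (1 + (x $ i)\<^sup>2)" for i
        by (intro le_imp_inverse_le) (auto intro: add_pos_nonneg)
      hence d: "decay x ^ 2 \<le> inverse (1 + (x $ i)\<^sup>2)" for i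
        by (simp add: decay_def power_divide inverse_eq_divide)
      have "decay x ^ K \<le> decay x ^ (2 * CARD('n))"
        using assms by (intro power_decreasing) auto
      also have "\<dots> = (\<Prod>i\<in>(UNIV::'n set). decay x ^ 2)" by (simp add: power_mult)
      also have "\<dots> \<le> (\<Prod>i\<in>UNIV. inverse (1 + (x $ i)\<^sup>2))" by (intro prod_mono) (auto simp: d)
      finally show "norm (decay x ^ K) \<le> norm (\<Prod>i\<in>UNIV. inverse (1 + (x $ i)\<^sup>2))"
        by simp
    qed
  qed simp
qed

lemma integrable_prod_pair:
  fixes a :: "'a::euclidean_space \<Rightarrow> 'c::{real_normed_algebra, banach, second_countable_topology}"
    and b :: "'b::euclidean_space \<Rightarrow> 'c"
  assumes a: "integrable lborel a" and b: "integrable lborel b"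
  shows "integrable (lborel \<Otimes>\<^sub>M lborel) (\<lambda>(x, y). a x * b y)"
proof -
  have [measurable]: "a \<in> borel_measurable borel" "b \<in> borel_measurable borel" using a b by auto
  show ?thesis
  proof (rule integrableI_bounded)
    have "(\<integral>\<^sup>+p. norm (case p of (x, y) \<Rightarrow> a x * b y) \<partial>(lborel \<Otimes>\<^sub>M lborel)) 
       \<le> (\<integral>\<^sup>+p. (case p of (x, y) \<Rightarrow> ennreal (norm (a x)) * ennreal (norm (b y))) \<partial>(lborel \<Otimes>\<^sub>M lborel))"
      by (intro nn_integral_mono) (auto simp: ennreal_mult[symmetric] norm_mult_ineq split: prod.split)
    also have "\<dots> = (\<integral>\<^sup>+x. \<integral>\<^sup>+y. ennreal (norm (a x)) * ennreal (norm (b y)) \<partial>lborel \<partial>lborel)"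
      by (subst lborel.nn_integral_fst[symmetric]) auto
    also have "\<dots> = (\<integral>\<^sup>+x. ennreal (norm (a x)) \<partial>lborel) * (\<integral>\<^sup>+y. ennreal (norm (b y)) \<partial>lborel)"
      by (simp add: nn_integral_cmult nn_integral_multc)
    also have "\<dots> < \<infinity>" using a b unfolding integrable_iff_bounded 
      by (auto simp: ennreal_mult_less_top)
    finally show "(\<integral>\<^sup>+p. norm (case p of (x, y) \<Rightarrow> a x * b y) \<partial>(lborel \<Otimes>\<^sub>M lborel)) < \<infinity>" .
  qed measurable
qed

lemma integral_prod_pair:
  fixes a :: "'a::euclidean_space \<Rightarrow> complex"
    and b :: "'b::euclidean_space \<Rightarrow> complex"
  assumes a: "integrable lborel a" and b: "integrable lborel b"
  shows "(\<integral>(x, y). a x * b y \<partial>(lborel \<Otimes>\<^sub>M lborel)) = integral\<^sup>L lborel a * integral\<^sup>L lborel b"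
  using lborel_pair.integral_fst[OF integrable_prod_pair[OF a b]] by simp

text \<open>Boxes generate the Borel sets and are stable under intersection, and the sets over which
  the integral of a fixed integrable function vanishes form a Dynkin system. As f is only locally
  integrable, the argument runs on f cut off to the cube of half-side k, and these cubes exhaust the
  space.\<close>

lemma integral_zero_boxes_AE_zero:
  fixes f :: "'a::euclidean_space \<Rightarrow> complex"
  assumes m[measurable]: "f \<in> borel_measurable borel"
    and i: "\<And>a b. set_integrable lborel (box a b) f"
    and z: "\<And>a b. (LINT x:box a b|lborel. f x) = 0"
  shows "AE x in lborel. f x = 0"
proof -
  have *: "AE x in lborel. indicator (box (- real k *\<^sub>R One) (real k *\<^sub>R One)) x *\<^sub>R f x = 0" for k :: nat
  proof -
    let ?B = "box (- real k *\<^sub>R One) (real k *\<^sub>R One) :: 'a set"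
    let ?h = "\<lambda>x. indicator ?B x *\<^sub>R f x"
    have int: "integrable lborel ?h" using i unfolding set_integrable_def by auto
    have stable: "Int_stable (range (\<lambda>(a, b). box a b :: 'a set))"
      by (auto simp: Int_stable_def box_Int_box)
    show ?thesis
    proof (rule sigma_finite_measure.density_zero[OF sigma_finite_lborel int])
      fix A :: "'a set" assume A: "A \<in> sets lborel"
      hence As: "A \<in> sigma_sets UNIV (range (\<lambda>(a, b). box a b))"
        by (simp add: borel_eq_box)
      have sub: "range (\<lambda>(a, b). box a b :: 'a set) \<subseteq> Pow UNIV" by simp
      show "set_lebesgue_integral lborel A ?h = 0"
        using stable sub As
      proof (induct A rule: sigma_sets_induct_disjoint)
        case (basic A)
        then obtain a b where A: "A = box a b" by auto
        obtain c d where cd: "box a b \<inter> ?B = box c d" by (auto simp: box_Int_box)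
        have "set_lebesgue_integral lborel A ?h = (LINT x:box c d|lborel. f x)"
          unfolding set_lebesgue_integral_def A cd[symmetric] 
          by (intro Bochner_Integration.integral_cong) (auto simp: indicator_def)
        thus ?case using z by simp
      next
        case empty show ?case by (simp add: set_lebesgue_integral_def)
      next
        case (compl A)
        have [measurable]: "A \<in> sets borel" using compl(1) by (simp add: borel_eq_box)
        have "set_lebesgue_integral lborel (UNIV - A) ?h = integral\<^sup>L lborel ?h - set_lebesgue_integral lborel A ?h"
          unfolding set_lebesgue_integral_def
          apply (subst Bochner_Integration.integral_diff[symmetric])
          apply (rule int)
          using integrable_mult_indicator[OF _ int, of A] apply simp
          by (intro Bochner_Integration.integral_cong) (auto simp: indicator_def)
        also have "integral\<^sup>L lborel ?h = 0" using z unfolding set_lebesgue_integral_def by simp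
        finally show ?case using compl by simp
      next
        case (union A)
        have [measurable]: "A i \<in> sets borel" for i using union(2) by (auto simp add: borel_eq_box)
        have "set_lebesgue_integral lborel (\<Union>i. A i) ?h = (\<Sum>i. set_lebesgue_integral lborel (A i) ?h)"
          by (rule lebesgue_integral_countable_add)
           (use union(1) integrable_mult_indicator[OF _ int, of "\<Union>i. A i"] in \<open>auto simp: disjoint_family_on_def set_integrable_def\<close>)
        thus ?case using union(3) by simp
      qed
    qed
  qed
  have "AE x in lborel. \<forall>k::nat. indicator (box (- real k *\<^sub>R One) (real k *\<^sub>R One)) x *\<^sub>R f x = 0"
    unfolding AE_all_countable using * by blast
  then show ?thesis
  proof eventually_elim
    case (elim x)
    obtain k :: nat where k: "norm x < real k" using reals_Archimedean2 by blast
    have "x \<in> box (- real k *\<^sub>R One) (real k *\<^sub>R One)"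
      unfolding box_def using Basis_le_norm[of _ x] k by (fastforce simp: abs_le_iff)
    thus ?case using elim[rule_format, of k] by simp
  qed
qed

text \<open>The set where two continuous functions differ is open, and a nonempty open set is not
  null. This makes the continuous member of an almost-everywhere class unique.\<close>

lemma continuous_AE_eq:
  fixes f g :: "'a::euclidean_space \<Rightarrow> 'b::real_normed_vector"
  assumes f: "continuous_on UNIV f" and g: "continuous_on UNIV g" and ae: "AE x in lborel. f x = g x"
  shows "f = g"
proof (rule ccontr)
  assume "f \<noteq> g"
  define S where "S = {x. f x \<noteq> g x}"
  have "open S" unfolding S_def using open_Collect_neq[OF f g] .
  moreover have "S \<noteq> {}" using \<open>f \<noteq> g\<close> by (auto simp: S_def)
  ultimately have "\<not> negligible S" using open_not_negligible by blast
  moreover have "S \<in> null_sets lborel"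
    using ae \<open>open S\<close> unfolding S_def by (subst (asm) AE_iff_null) auto
  ultimately show False
    using negligible_iff_null_sets null_sets_completionI by blast
qed

text \<open>The Riesz-Fischer argument: along a subsequence the successive differences have summable
  norms, so they telescope to a series that converges absolutely almost everywhere.\<close>

lemma L1_complete:
  fixes v :: "nat \<Rightarrow> 'a \<Rightarrow> 'b::{banach, second_countable_topology}"
  assumes v: "\<And>k. integrable M (v k)"
    and Cauchy: "\<And>e. e > 0 \<Longrightarrow> \<exists>N. \<forall>m\<ge>N. \<forall>k\<ge>N. (\<integral>x. norm (v m x - v k x) \<partial>M) < e"
  shows "\<exists>w. integrable M w \<and> (\<lambda>k. \<integral>x. norm (v k x - w x) \<partial>M) \<longlonglongrightarrow> 0"
proof -
  have "\<forall>j::nat. \<exists>N. \<forall>m\<ge>N. \<forall>k\<ge>N. (\<integral>x. norm (v m x - v k x) \<partial>M) < (1/2)^j"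
    using Cauchy by simp
  then obtain N where N: "\<And>j m k. m \<ge> N j \<Longrightarrow> k \<ge> N j \<Longrightarrow> (\<integral>x. norm (v m x - v k x) \<partial>M) < (1/2)^j"
    by metis
  \<comment> \<open>Partial sums of the thresholds are nondecreasing in j and still dominate each
    threshold.\<close>
  define r where "r j = (\<Sum>i\<le>j. N i)" for j
  have rN: "r j \<ge> N j" for j unfolding r_def by (auto intro: member_le_sum)
  have rmono: "r (Suc j) \<ge> r j" for j unfolding r_def by simp
  define d where "d j x = v (r (Suc j)) x - v (r j) x" for j x
  have di: "integrable M (d j)" for j unfolding d_def by (intro Bochner_Integration.integrable_diff v)
  have dn: "(\<integral>x. norm (d j x) \<partial>M) < (1/2)^j" for j
    unfolding d_def by (intro N) (use rN rmono order_trans in blast)+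
  have sn: "summable (\<lambda>j. \<integral>x. norm (d j x) \<partial>M)"
    by (rule summable_comparison_test[of _ "\<lambda>j. (1/2::real)^j"])
      (use dn in \<open>auto intro!: exI[of _ 0] less_imp_le simp: abs_of_nonneg summable_geometric\<close>)
  have ae: "AE x in M. summable (\<lambda>j. norm (d j x))"
  proof -
    have "(\<integral>\<^sup>+x. (\<Sum>j. ennreal (norm (d j x))) \<partial>M) = (\<Sum>j. \<integral>\<^sup>+x. ennreal (norm (d j x)) \<partial>M)"
      by (rule nn_integral_suminf) (use di in auto)
    also have "\<dots> = (\<Sum>j. ennreal (\<integral>x. norm (d j x) \<partial>M))"
      using di by (simp add: nn_integral_eq_integral)
    also have "\<dots> = ennreal (\<Sum>j. \<integral>x. norm (d j x) \<partial>M)"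
      by (rule suminf_ennreal2) (use sn in auto)
    finally have "(\<integral>\<^sup>+x. (\<Sum>j. ennreal (norm (d j x))) \<partial>M) \<noteq> \<infinity>" by simp
    hence "AE x in M. (\<Sum>j. ennreal (norm (d j x))) \<noteq> \<infinity>"
      by (intro nn_integral_noteq_infinite) (use di in auto)
    then show ?thesis
      by eventually_elim (rule summable_suminf_not_top, auto)
  qed
  define w where "w x = v (r 0) x + (\<Sum>j. d j x)" for x
  have si: "integrable M (\<lambda>x. \<Sum>j. d j x)"
    by (rule integrable_suminf[OF di ae sn])
  have wi: "integrable M w" unfolding w_def by (intro Bochner_Integration.integrable_add v si)
  have tel: "v (r j) x = v (r 0) x + (\<Sum>i<j. d i x)" for j x
    by (induct j) (auto simp: d_def)
  have bound: "(\<integral>x. norm (v (r j) x - w x) \<partial>M) \<le> 2 * (1/2)^j" for j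
  proof -
    have "AE x in M. norm (v (r j) x - w x) \<le> (\<Sum>i. norm (d (i + j) x))"
      using ae
    proof eventually_elim
      case (elim x)
      have s: "summable (\<lambda>i. d i x)" using summable_norm_cancel[OF elim] .
      have "v (r j) x - w x = - (\<Sum>i. d (i + j) x)"
        unfolding w_def tel[of j] using suminf_minus_initial_segment[OF s, of j] by simp
      hence "norm (v (r j) x - w x) = norm (\<Sum>i. d (i + j) x)" by simp
      also have "\<dots> \<le> (\<Sum>i. norm (d (i + j) x))"
        using summable_norm[OF summable_ignore_initial_segment[OF elim, of j]] .
      finally show ?case .
    qed
    moreover have ii: "integrable M (\<lambda>x. \<Sum>i. norm (d (i + j) x))"
      by (rule integrable_suminf)
        (use di ae summable_ignore_initial_segment[OF sn, of j] in \<open>auto elim!: eventually_mono intro: summable_ignore_initial_segment\<close>)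
    ultimately have "(\<integral>x. norm (v (r j) x - w x) \<partial>M) \<le> (\<integral>x. (\<Sum>i. norm (d (i + j) x)) \<partial>M)"
      by (intro integral_mono_AE) (use v wi in auto)
    also have "\<dots> = (\<Sum>i. \<integral>x. norm (d (i + j) x) \<partial>M)"
      by (rule integral_suminf)
        (use di ae summable_ignore_initial_segment[OF sn, of j] in \<open>auto elim!: eventually_mono intro: summable_ignore_initial_segment\<close>)
    also have "\<dots> \<le> (\<Sum>i. (1/2)^(i + j))"
      by (rule suminf_le) (use dn sn in \<open>auto intro!: less_imp_le summable_ignore_initial_segment[of _ j] summable_geometric\<close>)
    also have "\<dots> = 2 * (1/2)^j"
      using suminf_geometric[of "1/2::real"] suminf_mult2[of "\<lambda>i. (1/2::real)^i" "(1/2)^j"] by (simp add: power_add summable_geometric)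
    finally show ?thesis .
  qed
  have "(\<lambda>k. \<integral>x. norm (v k x - w x) \<partial>M) \<longlonglongrightarrow> 0"
  proof (rule LIMSEQ_I)
    fix e :: real assume e: "e > 0"
    obtain j where j: "3 * (1/2)^j < e"
      using real_arch_pow_inv[of "e/3" "1/2"] e by (auto simp: field_simps)
    have "norm ((\<integral>x. norm (v k x - w x) \<partial>M) - 0) < e" if "k \<ge> r j" for k
    proof -
      have "(\<integral>x. norm (v k x - w x) \<partial>M) \<le> (\<integral>x. norm (v k x - v (r j) x) + norm (v (r j) x - w x) \<partial>M)"
        by (intro integral_mono) (use v wi norm_triangle_ineq[of "v k x - v (r j) x" "v (r j) x - w x" for x] in auto)
      also have "\<dots> = (\<integral>x. norm (v k x - v (r j) x) \<partial>M) + (\<integral>x. norm (v (r j) x - w x) \<partial>M)"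
        by (intro Bochner_Integration.integral_add) (use v wi in auto)
      also have "\<dots> < (1/2)^j + 2 * (1/2)^j"
        using N[of j k "r j"] that rN[of j] bound[of j] by (meson add_less_le_mono order_trans)
      finally show ?thesis using j by (simp add: integral_nonneg_AE)
    qed
    thus "\<exists>no. \<forall>n\<ge>no. norm ((\<integral>x. norm (v n x - w x) \<partial>M) - 0) < e" by blast
  qed
  with wi show ?thesis by blast
qed

section \<open>Gaussian Fourier integrals and the heat kernel\<close>

lemma gaussian_fourier_1:
  fixes e v :: real
  assumes e: "e > 0"
  shows "integrable lborel (\<lambda>y. complex_of_real (exp (- (e * y)\<^sup>2 / 2)) * cis (y * v))"
    and "(\<integral>y. complex_of_real (exp (- (e * y)\<^sup>2 / 2)) * cis (y * v) \<partial>lborel)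
          = complex_of_real (sqrt (2 * pi) / e * exp (- v\<^sup>2 / (2 * e\<^sup>2)))"
proof -
  \<comment> \<open>Up to scaling and normalization the integrand is the standard normal density
    times a character, so its integral is the characteristic function of the normal
    distribution.\<close>
  define f where "f x = std_normal_density x *\<^sub>R cis (v / e * x)" for x
  have cm: "continuous_on UNIV (\<lambda>x. cis (v / e * x))"
    by (intro continuous_intros)
  have [measurable]: "(\<lambda>x. cis (v / e * x)) \<in> borel_measurable borel"
    by (rule borel_measurable_continuous_onI[OF cm])
  have [measurable]: "f \<in> borel_measurable borel" unfolding f_def by measurable
  have fi: "integrable lborel f"
    by (rule Bochner_Integration.integrable_bound[OF integrable_normal_density[of 1 0]])
      (auto simp: f_def)
  have "integral\<^sup>L lborel f = char std_normal_distribution (v / e)"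
    unfolding char_def f_def by (subst integral_density) (auto simp: cis_conv_exp normal_density_nonneg intro!: Bochner_Integration.integral_cong)
  also have "\<dots> = complex_of_real (exp (- v\<^sup>2 / (2 * e\<^sup>2)))"
    unfolding char_std_normal_distribution by (simp add: power_divide field_simps)
  finally have fI: "integral\<^sup>L lborel f = complex_of_real (exp (- v\<^sup>2 / (2 * e\<^sup>2)))" .
  have eq: "complex_of_real (exp (- (e * y)\<^sup>2 / 2)) * cis (y * v) = complex_of_real (sqrt (2 * pi)) * f (0 + e *\<^sub>R y)" for y
    using e by (simp add: f_def std_normal_density_def scaleR_conv_of_real mult.commute)
  show "integrable lborel (\<lambda>y. complex_of_real (exp (- (e * y)\<^sup>2 / 2)) * cis (y * v))"
    unfolding eq by (intro integrable_mult_right lborel_integrable_affine fi) (use e in auto)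
  have "(\<integral>y. f (0 + e *\<^sub>R y) \<partial>lborel) = integral\<^sup>L lborel f / e"
    using lborel_integral_affine[of f e 0] fi e by (simp add: scaleR_conv_of_real)
  thus "(\<integral>y. complex_of_real (exp (- (e * y)\<^sup>2 / 2)) * cis (y * v) \<partial>lborel)
          = complex_of_real (sqrt (2 * pi) / e * exp (- v\<^sup>2 / (2 * e\<^sup>2)))"
    unfolding eq by (simp add: fI)
qed

text \<open>The centred normal density with covariance e^2 times the identity, that is, the kernel
  of the heat semigroup at time e^2 / 2.\<close>

definition heat_kernel :: "real \<Rightarrow> real^'n::finite \<Rightarrow> real" where
  "heat_kernel e v = (1 / (sqrt (2 * pi) * e)) ^ CARD('n) * exp (- (norm v)\<^sup>2 / (2 * e\<^sup>2))"

lemma norm_vec_power2: "(norm (x::real^'n::finite))\<^sup>2 = (\<Sum>i\<in>UNIV. (x $ i)\<^sup>2)"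
  unfolding power2_norm_eq_inner inner_vec_def by (simp add: power2_eq_square)

lemma cis_sum: "cis (sum f A) = (\<Prod>i\<in>A. cis (f i))"
  by (induct A rule: infinite_finite_induct) (auto simp: cis_mult[symmetric])

lemma cis_continuous_on [continuous_intros]: "continuous_on A f \<Longrightarrow> continuous_on A (\<lambda>x. cis (f x))"
  by (simp add: cis_conv_exp continuous_intros)

lemma cis_measurable [measurable]: "cis \<in> borel_measurable borel"
  by (intro borel_measurable_continuous_onI continuous_intros)

lemma cnj_measurable [measurable]: "cnj \<in> borel_measurable borel"
  by (intro borel_measurable_continuous_onI continuous_intros)

lemma gaussian_fourier:
  fixes v :: "real^'n::finite"
  assumes e: "e > 0"
  shows "integrable lborel (\<lambda>y::real^'n. complex_of_real (exp (- e\<^sup>2 * (norm y)\<^sup>2 / 2)) * cis (y \<bullet> v))"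
    and "(\<integral>y. complex_of_real (exp (- e\<^sup>2 * (norm y)\<^sup>2 / 2)) * cis (y \<bullet> v) \<partial>lborel)
          = complex_of_real ((2 * pi) ^ CARD('n) * heat_kernel e v)"
proof -
  have eq: "complex_of_real (exp (- e\<^sup>2 * (norm y)\<^sup>2 / 2)) * cis (y \<bullet> v)
     = (\<Prod>i\<in>UNIV. complex_of_real (exp (- (e * y $ i)\<^sup>2 / 2)) * cis (y $ i * v $ i))" for y
  proof -
    have "exp (- e\<^sup>2 * (norm y)\<^sup>2 / 2) = (\<Prod>i\<in>UNIV. exp (- (e * y $ i)\<^sup>2 / 2))"
      by (subst exp_sum[symmetric]) (auto simp: norm_vec_power2 power_mult_distrib sum_distrib_left sum_negf[symmetric] sum_divide_distrib intro!: arg_cong[of _ _ exp])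
    moreover have "cis (y \<bullet> v) = (\<Prod>i\<in>UNIV. cis (y $ i * v $ i))"
      by (simp add: inner_vec_def cis_sum)
    ultimately show ?thesis by (simp add: prod.distrib)
  qed
  show "integrable lborel (\<lambda>y::real^'n. complex_of_real (exp (- e\<^sup>2 * (norm y)\<^sup>2 / 2)) * cis (y \<bullet> v))"
    unfolding eq by (rule integral_prod_vec(1)) (rule gaussian_fourier_1[OF e])
  have "(\<integral>y. complex_of_real (exp (- e\<^sup>2 * (norm y)\<^sup>2 / 2)) * cis (y \<bullet> v) \<partial>lborel)
     = (\<Prod>i\<in>UNIV. complex_of_real (sqrt (2 * pi) / e * exp (- (v $ i)\<^sup>2 / (2 * e\<^sup>2))))"
    unfolding eq
    apply (subst integral_prod_vec(2)[where f="\<lambda>i r. complex_of_real (exp (- (e * r)\<^sup>2 / 2)) * cis (r * v $ i)"])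
     apply (rule gaussian_fourier_1[OF e])
    by (simp only: gaussian_fourier_1(2)[OF e])
  also have "\<dots> = complex_of_real (\<Prod>i\<in>UNIV. sqrt (2 * pi) / e * exp (- (v $ i)\<^sup>2 / (2 * e\<^sup>2)))"
    by simp
  also have "(\<Prod>i\<in>UNIV. sqrt (2 * pi) / e * exp (- (v $ i)\<^sup>2 / (2 * e\<^sup>2)))
     = (sqrt (2 * pi) / e) ^ CARD('n) * exp (- (norm v)\<^sup>2 / (2 * e\<^sup>2))"
    by (simp only: prod.distrib prod_constant exp_sum[symmetric, OF finite] norm_vec_power2 sum_negf[symmetric] sum_divide_distrib)
  also have "(sqrt (2 * pi) / e) ^ CARD('n) = (2 * pi) ^ CARD('n) * (1 / (sqrt (2 * pi) * e)) ^ CARD('n)"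
  proof -
    have "sqrt (2 * pi) / e = 2 * pi * (1 / (sqrt (2 * pi) * e))"
      using real_div_sqrt[of "2 * pi"] e by (simp add: field_simps)
    thus ?thesis by (simp only: power_mult_distrib)
  qed
  finally show "(\<integral>y. complex_of_real (exp (- e\<^sup>2 * (norm y)\<^sup>2 / 2)) * cis (y \<bullet> v) \<partial>lborel)
          = complex_of_real ((2 * pi) ^ CARD('n) * heat_kernel e v)"
    by (simp add: heat_kernel_def)
qed

lemma integrable_gaussian:
  assumes "a > 0"
  shows "integrable lborel (\<lambda>y::real^'n::finite. exp (- a * (norm y)\<^sup>2))"
proof -
  have "integrable lborel (\<lambda>y::real^'n. complex_of_real (exp (- (sqrt (2 * a))\<^sup>2 * (norm y)\<^sup>2 / 2)) * cis (y \<bullet> 0))"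
    by (rule gaussian_fourier(1)) (use assms in auto)
  hence "integrable lborel (\<lambda>y::real^'n. complex_of_real (exp (- a * (norm y)\<^sup>2)))"
    using assms by simp
  thus ?thesis using integrable_Re by fastforce
qed

lemma heat_kernel_integrable: 
  assumes "e > 0" shows "integrable lborel (heat_kernel e :: real^'n::finite \<Rightarrow> real)"
proof -
  have "integrable lborel (\<lambda>y::real^'n. (1 / (sqrt (2 * pi) * e)) ^ CARD('n) * exp (- (1 / (2 * e\<^sup>2)) * (norm y)\<^sup>2))"
    by (intro integrable_mult_right integrable_gaussian) (use assms in auto)
  thus ?thesis by (simp add: heat_kernel_def[abs_def])
qed

lemma heat_kernel_nonneg: "e > 0 \<Longrightarrow> heat_kernel e v \<ge> 0"
  by (simp add: heat_kernel_def)

text \<open>The total mass is read off from the Gaussian Fourier integral at frequency 0, where the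
  heat kernel on its right-hand side reduces to the normalizing constant.\<close>

lemma heat_kernel_integral_1: "(\<integral>v. heat_kernel 1 (v::real^'n::finite) \<partial>lborel) = 1"
proof -
  have "(\<integral>y. complex_of_real (exp (- 1\<^sup>2 * (norm y)\<^sup>2 / 2)) * cis (y \<bullet> (0::real^'n)) \<partial>lborel)
          = complex_of_real ((2 * pi) ^ CARD('n) * heat_kernel 1 (0::real^'n))"
    by (rule gaussian_fourier(2)) simp
  hence "(\<integral>y. complex_of_real (exp (- (norm (y::real^'n))\<^sup>2 / 2)) \<partial>lborel) = complex_of_real ((2 * pi) ^ CARD('n) * heat_kernel 1 (0::real^'n))"
    by simp
  hence "(\<integral>y. exp (- (norm (y::real^'n))\<^sup>2 / 2) \<partial>lborel) = (2 * pi) ^ CARD('n) * heat_kernel 1 (0::real^'n)"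
    by (simp only: integral_complex_of_real of_real_eq_iff)
  also have "\<dots> = sqrt (2 * pi) ^ CARD('n)"
  proof -
    have "2 * pi * (1 / (sqrt (2 * pi) * 1)) = sqrt (2 * pi)" using real_div_sqrt[of "2 * pi"] by simp
    hence "(2 * pi) ^ CARD('n) * (1 / (sqrt (2 * pi) * 1)) ^ CARD('n) = sqrt (2 * pi) ^ CARD('n)"
      by (metis power_mult_distrib)
    thus ?thesis unfolding heat_kernel_def by simp
  qed
  finally show ?thesis by (simp add: heat_kernel_def power_divide)
qed

lemma heat_kernel_scale:
  assumes e: "e > 0"
  shows "heat_kernel e (e *\<^sub>R w) = heat_kernel 1 (w::real^'n::finite) / e ^ CARD('n)"
  using e by (simp add: heat_kernel_def power_mult_distrib power_divide)

lemma heat_kernel_integral_scale: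
  fixes H :: "real^'n::finite \<Rightarrow> complex"
  assumes e: "e > 0" and [measurable]: "H \<in> borel_measurable borel"
  shows "(\<integral>v. complex_of_real (heat_kernel e v) * H v \<partial>lborel) = (\<integral>w. complex_of_real (heat_kernel 1 w) * H (e *\<^sub>R w) \<partial>lborel)"
proof -
  have [measurable]: "(heat_kernel e :: real^'n \<Rightarrow> real) \<in> borel_measurable borel"
    using heat_kernel_integrable[OF e] by auto
  have [measurable]: "(heat_kernel 1 :: real^'n \<Rightarrow> real) \<in> borel_measurable borel"
    using heat_kernel_integrable[of 1] by auto
  have "(\<integral>v. complex_of_real (heat_kernel e v) * H v \<partial>lborel)
      = (\<integral>w. (\<bar>e\<bar> ^ DIM(real^'n)) *\<^sub>R (complex_of_real (heat_kernel e (0 + e *\<^sub>R w)) * H (0 + e *\<^sub>R w)) \<partial>lborel)"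
    by (subst lborel_integral_affine[where c=e and t=0]) (use e in auto)
  also have "\<dots> = (\<integral>w. complex_of_real (heat_kernel 1 w) * H (e *\<^sub>R w) \<partial>lborel)"
    using e by (intro Bochner_Integration.integral_cong refl) (simp add: heat_kernel_scale, simp add: scaleR_conv_of_real)
  finally show ?thesis .
qed

text \<open>Scaling moves the parameter from the kernel into the argument of H; then one fixed
  multiple of \<open>heat_kernel 1\<close> dominates, and continuity of H at the single point 0
  gives the pointwise limit.\<close>

lemma heat_kernel_tendsto:
  fixes H :: "real^'n::finite \<Rightarrow> complex"
  assumes [measurable]: "H \<in> borel_measurable borel" and b: "\<And>v. norm (H v) \<le> B" and c: "isCont H 0"
  shows "(\<lambda>k. \<integral>v. complex_of_real (heat_kernel (1 / Suc k) v) * H v \<partial>lborel) \<longlonglongrightarrow> H 0"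
proof -
  have [measurable]: "(heat_kernel 1 :: real^'n \<Rightarrow> real) \<in> borel_measurable borel"
    using heat_kernel_integrable[of 1] by auto
  have eq: "(\<integral>v. complex_of_real (heat_kernel (1 / Suc k) v) * H v \<partial>lborel)
     = (\<integral>w. complex_of_real (heat_kernel 1 w) * H ((1 / Suc k) *\<^sub>R w) \<partial>lborel)" for k
    by (rule heat_kernel_integral_scale) auto
  have B: "B \<ge> 0" using b[of 0] norm_ge_zero order_trans by blast
  have "(\<lambda>k. \<integral>w. complex_of_real (heat_kernel 1 w) * H ((1 / Suc k) *\<^sub>R w) \<partial>lborel)
     \<longlonglongrightarrow> (\<integral>w. complex_of_real (heat_kernel 1 (w::real^'n)) * H 0 \<partial>lborel)"
  proof (rule integral_dominated_convergence[where w="\<lambda>w::real^'n. heat_kernel 1 w * B"])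
    show "integrable lborel (\<lambda>w::real^'n. heat_kernel 1 w * B)"
      by (intro integrable_mult_left heat_kernel_integrable) auto
    show "AE w in lborel. (\<lambda>k. complex_of_real (heat_kernel 1 w) * H ((1 / Suc k) *\<^sub>R w)) \<longlonglongrightarrow> complex_of_real (heat_kernel 1 w) * H 0"
    proof (intro AE_I2 tendsto_intros)
      fix w :: "real^'n"
      have "(\<lambda>k. (1 / Suc k) *\<^sub>R w) \<longlonglongrightarrow> 0 *\<^sub>R w"
        using LIMSEQ_inverse_real_of_nat by (intro tendsto_intros) (simp add: inverse_eq_divide)
      thus "(\<lambda>k. H ((1 / Suc k) *\<^sub>R w)) \<longlonglongrightarrow> H 0"
        using isCont_tendsto_compose[OF c] by simp
    qed
    show "AE w in lborel. norm (complex_of_real (heat_kernel 1 w) * H ((1 / Suc k) *\<^sub>R w)) \<le> heat_kernel 1 w * B" for k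
      using b B by (auto simp: norm_mult heat_kernel_nonneg intro!: mult_left_mono)
  qed auto
  also have "(\<integral>w. complex_of_real (heat_kernel 1 (w::real^'n)) * H 0 \<partial>lborel) = H 0"
    using heat_kernel_integral_1[where 'n='n] by simp
  finally show ?thesis unfolding eq .
qed

text \<open>The crude inequality ab <= a^2 + b^2 suffices: what matters later is that the bound does
  not change when one factor is translated.\<close>

lemma L2_mult_integrable:
  fixes h k :: "real^'n::finite \<Rightarrow> complex"
  assumes h: "h \<in> L2_space" and k: "k \<in> L2_space"
  shows "integrable lborel (\<lambda>x. h x * k x)"
    and "(\<integral>x. norm (h x) * norm (k x) \<partial>lborel) \<le> (\<integral>x. (cmod (h x))\<^sup>2 \<partial>lborel) + (\<integral>x. (cmod (k x))\<^sup>2 \<partial>lborel)"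
proof -
  have [measurable]: "h \<in> borel_measurable borel" "k \<in> borel_measurable borel" using h k by (auto simp: L2_space_def)
  have i: "integrable lborel (\<lambda>x. (cmod (h x))\<^sup>2 + (cmod (k x))\<^sup>2)" using h k by (auto simp: L2_space_def)
  have *: "a * b \<le> a\<^sup>2 + b\<^sup>2" if "0 \<le> a" "0 \<le> b" for a b :: real
    using sum_squares_bound[of a b] mult_nonneg_nonneg[OF that] by linarith
  show 1: "integrable lborel (\<lambda>x. h x * k x)"
    by (rule Bochner_Integration.integrable_bound[OF i]) (auto simp: norm_mult *)
  have "integrable lborel (\<lambda>x. norm (h x) * norm (k x))"
    using integrable_norm[OF 1] by (simp add: norm_mult)
  hence "(\<integral>x. norm (h x) * norm (k x) \<partial>lborel) \<le> (\<integral>x. (cmod (h x))\<^sup>2 + (cmod (k x))\<^sup>2 \<partial>lborel)"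
    by (intro integral_mono i) (auto simp: *)
  thus "(\<integral>x. norm (h x) * norm (k x) \<partial>lborel) \<le> (\<integral>x. (cmod (h x))\<^sup>2 \<partial>lborel) + (\<integral>x. (cmod (k x))\<^sup>2 \<partial>lborel)"
    using h k by (simp add: L2_space_def)
qed

lemma L2_spaceI_bounded_integrable:
  fixes h :: "real^'n::finite \<Rightarrow> complex"
  assumes i: "integrable lborel h" and b: "\<And>x. norm (h x) \<le> B"
  shows "h \<in> L2_space"
proof -
  have [measurable]: "h \<in> borel_measurable borel" using i by auto
  have "integrable lborel (\<lambda>x. B * norm (h x))" using i by auto
  hence "integrable lborel (\<lambda>x. (cmod (h x))\<^sup>2)"
    by (rule Bochner_Integration.integrable_bound)
      (use b in \<open>auto simp: power2_eq_square abs_mult intro!: mult_right_mono order_trans[OF b]\<close>)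
  thus ?thesis by (simp add: L2_space_def)
qed

lemma L2_space_add: "h \<in> L2_space \<Longrightarrow> k \<in> L2_space \<Longrightarrow> (\<lambda>x. h x + k x) \<in> L2_space"
proof -
  assume h: "h \<in> L2_space" and k: "k \<in> L2_space"
  have [measurable]: "h \<in> borel_measurable borel" "k \<in> borel_measurable borel" using h k by (auto simp: L2_space_def)
  have "integrable lborel (\<lambda>x. 2 * (cmod (h x))\<^sup>2 + 2 * (cmod (k x))\<^sup>2)" using h k by (auto simp: L2_space_def)
  hence "integrable lborel (\<lambda>x. (cmod (h x + k x))\<^sup>2)"
  proof (rule Bochner_Integration.integrable_bound)
    show "AE x in lborel. norm ((cmod (h x + k x))\<^sup>2) \<le> norm (2 * (cmod (h x))\<^sup>2 + 2 * (cmod (k x))\<^sup>2)"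
    proof (intro AE_I2)
      fix x
      have "(cmod (h x + k x))\<^sup>2 \<le> (cmod (h x) + cmod (k x))\<^sup>2"
        by (intro power_mono norm_triangle_ineq) auto
      also have "\<dots> \<le> 2 * (cmod (h x))\<^sup>2 + 2 * (cmod (k x))\<^sup>2"
        using sum_squares_bound[of "cmod (h x)" "cmod (k x)"] by (simp add: power2_sum)
      finally show "norm ((cmod (h x + k x))\<^sup>2) \<le> norm (2 * (cmod (h x))\<^sup>2 + 2 * (cmod (k x))\<^sup>2)" by simp
    qed
  qed auto
  thus ?thesis by (simp add: L2_space_def)
qed

lemma L2_space_cmult: "h \<in> L2_space \<Longrightarrow> (\<lambda>x. c * h x) \<in> L2_space"
  by (auto simp: L2_space_def norm_mult power_mult_distrib)

lemma L2_space_diff: "h \<in> L2_space \<Longrightarrow> k \<in> L2_space \<Longrightarrow> (\<lambda>x. h x - k x) \<in> L2_space"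
  using L2_space_add[of h "\<lambda>x. (-1) * k x"] L2_space_cmult[of k "-1"] by simp

lemma L2_space_cnj: "h \<in> L2_space \<Longrightarrow> (\<lambda>x. cnj (h x)) \<in> L2_space"
  by (auto simp: L2_space_def)

lemma L2_space_translate: "h \<in> L2_space \<Longrightarrow> (\<lambda>x. h (x + t)) \<in> L2_space" "h \<in> L2_space \<Longrightarrow> (\<lambda>x. h (x - t)) \<in> L2_space"
  using lborel_integrable_translate(2)[of "\<lambda>x. (cmod (h x))\<^sup>2" t] lborel_integrable_translate(3)[of "\<lambda>x. (cmod (h x))\<^sup>2" t]
  by (auto simp: L2_space_def)

section \<open>Inversion of the short-time Fourier transform\<close>

text \<open>The short-time Fourier transform without its factor (2 pi)^(-n/2), as a function on
  phase space taken as one Euclidean space, so that translations and Fubini apply to the pair (x, y)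
  at once.\<close>

definition gabor :: "(real^'n::finite \<Rightarrow> complex) \<Rightarrow> (real^'n \<Rightarrow> complex) \<Rightarrow> (real^'n) \<times> (real^'n) \<Rightarrow> complex" where
  "gabor g h z = (\<integral>t. h t * cnj (g (t - fst z)) * cis (- (snd z \<bullet> t)) \<partial>lborel)"

lemma fst_measurable_borel [measurable]: "fst \<in> borel_measurable (borel :: ('a::topological_space \<times> 'b::topological_space) measure)"
  by (intro borel_measurable_continuous_onI continuous_intros)

lemma snd_measurable_borel [measurable]: "snd \<in> borel_measurable (borel :: ('a::topological_space \<times> 'b::topological_space) measure)"
  by (intro borel_measurable_continuous_onI continuous_intros)

lemma gabor_measurable [measurable]:
  assumes [measurable]: "g \<in> borel_measurable borel" "h \<in> borel_measurable borel"
  shows "gabor g h \<in> borel_measurable borel"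
  unfolding gabor_def by measurable

lemma gabor_measurable_param:
  fixes A :: "'p::euclidean_space \<Rightarrow> real^'n::finite \<Rightarrow> complex"
  assumes [measurable]: "g \<in> borel_measurable borel" "(\<lambda>(p, t). A p t) \<in> borel_measurable (borel \<Otimes>\<^sub>M borel)"
  shows "(\<lambda>(p, z). gabor g (A p) z) \<in> borel_measurable (borel \<Otimes>\<^sub>M borel)"
  unfolding gabor_def by measurable

text \<open>Minkowski's inequality in L1, by Fubini. The final estimate keeps the L1 norm of each
  \<open>K p\<close> instead of the uniform bound B, because continuity in time is later obtained by
  letting these individual norms tend to zero under the integral.\<close>

lemma superposition_integrable:
  fixes K :: "'p::euclidean_space \<Rightarrow> 'q::euclidean_space \<Rightarrow> complex"
  assumes c: "integrable lborel c"
    and Km[measurable]: "(\<lambda>(p, q). K p q) \<in> borel_measurable (borel \<Otimes>\<^sub>M borel)"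
    and Ki: "\<And>p. integrable lborel (K p)" and Kb: "\<And>p. (\<integral>q. cmod (K p q) \<partial>lborel) \<le> B"
  shows "integrable (lborel \<Otimes>\<^sub>M lborel) (\<lambda>(p, q). c p * K p q)"
    and "integrable lborel (\<lambda>q. \<integral>p. c p * K p q \<partial>lborel)"
    and "integrable lborel (\<lambda>p. cmod (c p) * (\<integral>q. cmod (K p q) \<partial>lborel))"
    and "(\<integral>q. cmod (\<integral>p. c p * K p q \<partial>lborel) \<partial>lborel) \<le> (\<integral>p. cmod (c p) * (\<integral>q. cmod (K p q) \<partial>lborel) \<partial>lborel)"
proof -
  have [measurable]: "c \<in> borel_measurable borel" using c by auto
  have B: "cmod (c p) * (\<integral>q. cmod (K p q) \<partial>lborel) \<le> cmod (c p) * B" for p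
    by (intro mult_left_mono Kb) auto
  have nn: "0 \<le> (\<integral>q. cmod (K p q) \<partial>lborel)" for p by simp
  have B0: "0 \<le> B" using nn Kb order_trans by blast
  have N: "integrable lborel (\<lambda>p. cmod (c p) * B)" using c by auto
  show 3: "integrable lborel (\<lambda>p. cmod (c p) * (\<integral>q. cmod (K p q) \<partial>lborel))"
    by (rule Bochner_Integration.integrable_bound[OF N]) (use B nn B0 in \<open>auto simp: abs_mult\<close>)
  show 1: "integrable (lborel \<Otimes>\<^sub>M lborel) (\<lambda>(p, q). c p * K p q)"
  proof (rule lborel_pair.Fubini_integrable)
    show "integrable lborel (\<lambda>x. \<integral>y. norm (case (x, y) of (p, q) \<Rightarrow> c p * K p q) \<partial>lborel)"
      using 3 by (simp add: norm_mult)
    show "AE x in lborel. integrable lborel (\<lambda>y. case (x, y) of (p, q) \<Rightarrow> c p * K p q)"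
      using Ki by auto
  qed measurable
  show 2: "integrable lborel (\<lambda>q. \<integral>p. c p * K p q \<partial>lborel)"
    using lborel_pair.integrable_snd[OF 1] .
  have 4: "integrable (lborel \<Otimes>\<^sub>M lborel) (\<lambda>(p, q). cmod (c p * K p q))"
    using integrable_norm[OF 1] by (simp add: case_prod_unfold)
  have "(\<integral>q. cmod (\<integral>p. c p * K p q \<partial>lborel) \<partial>lborel) \<le> (\<integral>q. (\<integral>p. cmod (c p * K p q) \<partial>lborel) \<partial>lborel)"
    by (intro integral_mono integral_norm_bound integrable_norm 2 lborel_pair.integrable_snd[OF 4])
  also have "\<dots> = (\<integral>p. (\<integral>q. cmod (c p * K p q) \<partial>lborel) \<partial>lborel)"
    by (rule lborel_pair.Fubini_integral[OF 4])
  also have "\<dots> = (\<integral>p. cmod (c p) * (\<integral>q. cmod (K p q) \<partial>lborel) \<partial>lborel)"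
    by (simp add: norm_mult)
  finally show "(\<integral>q. cmod (\<integral>p. c p * K p q \<partial>lborel) \<partial>lborel) \<le> (\<integral>p. cmod (c p) * (\<integral>q. cmod (K p q) \<partial>lborel) \<partial>lborel)" .
qed

text \<open>As the coefficient c is integrable, bounds on the atoms that are uniform in p pass to f.
  The decisive point is that the Gabor transform commutes with the superposition, so that its L1
  norm can be estimated atom by atom.\<close>

lemma superposition:
  fixes A :: "'p::euclidean_space \<Rightarrow> real^'n::finite \<Rightarrow> complex"
  assumes c: "integrable lborel c"
    and Am[measurable]: "(\<lambda>(p, t). A p t) \<in> borel_measurable (borel \<Otimes>\<^sub>M borel)"
    and A0: "\<And>p t. cmod (A p t) \<le> B"
    and A1: "\<And>p. integrable lborel (A p)" and A2: "\<And>p. (\<integral>t. cmod (A p t) \<partial>lborel) \<le> B"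
    and g: "integrable lborel g"
    and G1: "\<And>p. integrable lborel (gabor g (A p))"
    and G2: "\<And>p. (\<integral>z. cmod (gabor g (A p) z) \<partial>lborel) \<le> B'"
  defines "f \<equiv> \<lambda>t. \<integral>p. c p * A p t \<partial>lborel"
  shows "integrable lborel f" and "\<And>t. cmod (f t) \<le> B * (\<integral>p. cmod (c p) \<partial>lborel)"
    and "f \<in> L2_space"
    and "\<And>z. gabor g f z = (\<integral>p. c p * gabor g (A p) z \<partial>lborel)"
    and "integrable lborel (gabor g f)"
    and "(\<integral>z. cmod (gabor g f z) \<partial>lborel) \<le> (\<integral>p. cmod (c p) * (\<integral>z. cmod (gabor g (A p) z) \<partial>lborel) \<partial>lborel)"
    and "(\<integral>z. cmod (gabor g f z) \<partial>lborel) \<le> B' * (\<integral>p. cmod (c p) \<partial>lborel)"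
    and "(\<And>p. continuous_on UNIV (A p)) \<Longrightarrow> continuous_on UNIV f"
proof -
  have cm[measurable]: "c \<in> borel_measurable borel" using c by auto
  have gm[measurable]: "g \<in> borel_measurable borel" using g by auto
  have B0: "0 \<le> B" using A0[of undefined undefined] norm_ge_zero order_trans by blast
  have Atm[measurable]: "(\<lambda>p. A p t) \<in> borel_measurable borel" for t using Am by measurable
  have cAi: "integrable lborel (\<lambda>p. c p * A p t)" for t
  proof (rule Bochner_Integration.integrable_bound)
    show "integrable lborel (\<lambda>p. cmod (c p) * B)" using c by auto
    show "AE p in lborel. norm (c p * A p t) \<le> norm (cmod (c p) * B)"
      using B0 by (auto simp: norm_mult abs_mult intro!: mult_left_mono A0)
  qed measurable
  note SA = superposition_integrable[OF c Am A1 A2]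
  show 1: "integrable lborel f" unfolding f_def by (rule SA(2))
  show 2: "cmod (f t) \<le> B * (\<integral>p. cmod (c p) \<partial>lborel)" for t
  proof -
    have "cmod (f t) \<le> (\<integral>p. cmod (c p * A p t) \<partial>lborel)" unfolding f_def by (rule integral_norm_bound)
    also have "\<dots> \<le> (\<integral>p. B * cmod (c p) \<partial>lborel)"
    proof (intro integral_mono)
      show "integrable lborel (\<lambda>p. cmod (c p * A p t))" by (intro integrable_norm cAi)
      show "cmod (c p * A p t) \<le> B * cmod (c p)" for p
        using mult_left_mono[OF A0[of p t], of "cmod (c p)"] by (simp add: norm_mult mult.commute)
    qed (use c in auto)
    finally show ?thesis by simp
  qed
  show "f \<in> L2_space" by (rule L2_spaceI_bounded_integrable[OF 1 2])
  show 4: "gabor g f z = (\<integral>p. c p * gabor g (A p) z \<partial>lborel)" for z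
  proof -
    define k where "k t = cnj (g (t - fst z)) * cis (- (snd z \<bullet> t))" for t
    have km[measurable]: "k \<in> borel_measurable borel" unfolding k_def by measurable
    have ki: "integrable lborel k"
      by (rule Bochner_Integration.integrable_bound[OF lborel_integrable_translate(3)[OF g, of "fst z"]])
        (auto simp: k_def norm_mult)
    \<comment> \<open>For this exchange only the boundedness of the atoms is used; integrability in
      t is supplied by the window.\<close>
    have int: "integrable (lborel \<Otimes>\<^sub>M lborel) (\<lambda>(p, t). c p * A p t * k t)"
    proof (rule Bochner_Integration.integrable_bound)
      show "integrable (lborel \<Otimes>\<^sub>M lborel) (\<lambda>p. complex_of_real B * (case p of (p, t) \<Rightarrow> c p * k t))"
        by (intro integrable_mult_right integrable_prod_pair c ki)
      show "AE p in lborel \<Otimes>\<^sub>M lborel. norm (case p of (p, t) \<Rightarrow> c p * A p t * k t) \<le> norm (complex_of_real B * (case p of (p, t) \<Rightarrow> c p * k t))"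
      proof (intro AE_I2, clarify)
        fix p t
        show "norm (c p * A p t * k t) \<le> norm (complex_of_real B * (c p * k t))"
          using mult_right_mono[OF A0[of p t], of "cmod (c p) * cmod (k t)"] B0 by (simp add: norm_mult mult_ac)
      qed
    qed measurable
    have "gabor g f z = (\<integral>t. (\<integral>p. c p * A p t * k t \<partial>lborel) \<partial>lborel)"
      unfolding gabor_def f_def k_def by (simp only: mult.assoc integral_mult_left_zero[symmetric])
    also have "\<dots> = (\<integral>p. (\<integral>t. c p * A p t * k t \<partial>lborel) \<partial>lborel)"
      by (rule lborel_pair.Fubini_integral[OF int])
    also have "\<dots> = (\<integral>p. c p * gabor g (A p) z \<partial>lborel)"
      unfolding gabor_def k_def by (simp add: mult.assoc)
    finally show ?thesis .
  qed
  note SG = superposition_integrable[OF c gabor_measurable_param[OF gm Am] G1 G2]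
  show 5: "integrable lborel (gabor g f)" using SG(2) by (simp add: 4[abs_def])
  show 6: "(\<integral>z. cmod (gabor g f z) \<partial>lborel) \<le> (\<integral>p. cmod (c p) * (\<integral>z. cmod (gabor g (A p) z) \<partial>lborel) \<partial>lborel)"
    using SG(4) by (simp add: 4)
  also have "\<dots> \<le> (\<integral>p. B' * cmod (c p) \<partial>lborel)"
  proof (intro integral_mono SG(3))
    show "cmod (c p) * (\<integral>z. cmod (gabor g (A p) z) \<partial>lborel) \<le> B' * cmod (c p)" for p
      using mult_left_mono[OF G2[of p], of "cmod (c p)"] by (simp add: mult.commute)
  qed (use c in auto)
  finally show "(\<integral>z. cmod (gabor g f z) \<partial>lborel) \<le> B' * (\<integral>p. cmod (c p) \<partial>lborel)" by simp
  show "continuous_on UNIV f" if cont: "\<And>p. continuous_on UNIV (A p)"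
  proof (rule continuous_on_sequentiallyI)
    fix u :: "nat \<Rightarrow> real^'n" and a assume u: "u \<longlonglongrightarrow> a"
    show "(\<lambda>n. f (u n)) \<longlonglongrightarrow> f a"
      unfolding f_def
    proof (rule integral_dominated_convergence[where w="\<lambda>p. cmod (c p) * B"])
      show "integrable lborel (\<lambda>p. cmod (c p) * B)" using c by auto
      show "AE p in lborel. (\<lambda>i. c p * A p (u i)) \<longlonglongrightarrow> c p * A p a"
        by (intro AE_I2 tendsto_intros continuous_on_tendsto_compose[OF cont u]) auto
      show "AE p in lborel. norm (c p * A p (u i)) \<le> cmod (c p) * B" for i
        by (auto simp: norm_mult intro!: mult_left_mono A0)
    qed measurable
  qed
qed

lemma AE_not_frontier_box: "AE x in lborel. x \<notin> cbox a b - box a (b::'a::euclidean_space)"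
proof -
  have "negligible (cbox a b - box a b)" by (rule negligible_frontier_interval)
  hence "cbox a b - box a b \<in> null_sets lborel"
    by (simp add: negligible_iff_null_sets null_sets_completion_iff)
  thus ?thesis by (rule AE_not_in)
qed

lemma indicator_L2_space:
  assumes [measurable]: "S \<in> sets borel" and "emeasure lborel S < \<infinity>"
  shows "(indicator S :: real^'n::finite \<Rightarrow> complex) \<in> L2_space"
proof (rule L2_spaceI_bounded_integrable[where B=1])
  have "integrable lborel (indicator S :: real^'n \<Rightarrow> real)"
    by (rule integrable_real_indicator) (use assms in auto)
  hence "integrable lborel (\<lambda>x. complex_of_real (indicator S x))" by auto
  thus "integrable lborel (indicator S :: real^'n \<Rightarrow> complex)"
    by (rule Bochner_Integration.integrable_cong[THEN iffD1, rotated 2]) (auto simp: indicator_def)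
qed (auto simp: indicator_def)

lemma indicator_box_L2_space: "(indicator (box a b) :: real^'n::finite \<Rightarrow> complex) \<in> L2_space"
  by (rule indicator_L2_space) (use emeasure_lborel_box_finite[of a b] in auto)

text \<open>The translation is moved from h, which need not be continuous, to the box. The
  indicators of the moving boxes converge off the boundary of the box, a null set, and all of them
  are dominated by the indicator of one ball, on which h is integrable.\<close>

lemma L2_box_integral_continuous:
  fixes h :: "real^'n::finite \<Rightarrow> complex"
  assumes h: "h \<in> L2_space"
  shows "isCont (\<lambda>v. \<integral>t. indicator (box a b) t * h (t + v) \<partial>lborel) 0"
proof -
  have [measurable]: "h \<in> borel_measurable borel" using h by (auto simp: L2_space_def)
  have eq: "(\<integral>t. indicator (box a b) t * h (t + v) \<partial>lborel) = (\<integral>r. indicator (box a b) (r - v) * h r \<partial>lborel)" for v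
    using lborel_integral_translate(3)[of "\<lambda>t. indicator (box a b) t * h (t + v)" v] by simp
  show ?thesis
    unfolding eq continuous_at_sequentially comp_def
  proof (intro allI impI)
    fix u :: "nat \<Rightarrow> real^'n" assume u: "u \<longlonglongrightarrow> 0"
    obtain M where M: "\<And>k. norm (u k) \<le> M"
      using convergent_imp_bounded[OF u] by (auto simp: bounded_iff)
    obtain N where N: "\<And>x. x \<in> box a b \<Longrightarrow> norm x \<le> N" using bounded_box[of a b] by (auto simp: bounded_iff)
    have iL: "indicator (cball 0 (N + M)) \<in> L2_space"
      by (rule indicator_L2_space) (use emeasure_lborel_cball_finite in auto)
    show "(\<lambda>k. \<integral>r. indicator (box a b) (r - u k) * h r \<partial>lborel) \<longlonglongrightarrow> (\<integral>r. indicator (box a b) (r - 0) * h r \<partial>lborel)"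
    proof (rule integral_dominated_convergence[where w="\<lambda>r. cmod (indicator (cball 0 (N + M)) r * h r)"])
      show "integrable lborel (\<lambda>r. cmod (indicator (cball 0 (N + M)) r * h r))"
        by (intro integrable_norm L2_mult_integrable(1) iL h)
      have *: "norm r \<le> N + M" if "r - u k \<in> box a b" for r k
        using N[OF that] M[of k] norm_triangle_ineq[of "r - u k" "u k"] by auto
      show "AE r in lborel. norm (indicator (box a b) (r - u k) * h r) \<le> cmod (indicator (cball 0 (N + M)) r * h r)" for k
      proof (intro AE_I2)
        fix r show "norm (indicator (box a b) (r - u k) * h r) \<le> cmod (indicator (cball 0 (N + M)) r * h r)"
          using *[of r k] by (cases "r - u k \<in> box a b") (auto simp: norm_mult)
      qed
      show "AE r in lborel. (\<lambda>k. indicator (box a b) (r - u k) * h r) \<longlonglongrightarrow> indicator (box a b) (r - 0) * h r"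
        using AE_not_frontier_box[of a b]
      proof eventually_elim
        case (elim r)
        have lim: "(\<lambda>k. r - u k) \<longlonglongrightarrow> r" using tendsto_diff[OF tendsto_const u] by simp
        have "\<forall>\<^sub>F k in sequentially. (indicator (box a b) (r - u k) :: complex) = indicator (box a b) r"
        proof (cases "r \<in> box a b")
          case True
          have "\<forall>\<^sub>F k in sequentially. r - u k \<in> box a b"
            using topological_tendstoD[OF lim open_box True] .
          thus ?thesis by eventually_elim (use True in auto)
        next
          case False
          hence "r \<in> - cbox a b" using elim by auto
          hence "\<forall>\<^sub>F k in sequentially. r - u k \<in> - cbox a b"
            using topological_tendstoD[OF lim, of "- cbox a b"] closed_cbox by auto
          thus ?thesis by eventually_elim (use False box_subset_cbox[of a b] in \<open>auto simp: indicator_def\<close>)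
        qed
        hence "(\<lambda>k. (indicator (box a b) (r - u k) :: complex)) \<longlonglongrightarrow> indicator (box a b) r"
          by (rule tendsto_eventually)
        thus ?case by (intro tendsto_intros) auto
      qed
    qed measurable
  qed
qed

lemma integrable_indicator_box_translate:
  fixes h :: "real^'n::finite \<Rightarrow> complex"
  assumes h: "h \<in> L2_space"
  shows "integrable lborel (\<lambda>t. indicator (box a b) t * h (t + v))"
    and "cmod (\<integral>t. indicator (box a b) t * h (t + v) \<partial>lborel)
      \<le> (\<integral>x. (cmod (indicator (box a b) x))\<^sup>2 \<partial>lborel) + (\<integral>x. (cmod (h x))\<^sup>2 \<partial>lborel)"
    and "(\<integral>t. cmod (indicator (box a b) t * h (t + v)) \<partial>lborel)
      \<le> (\<integral>x. (cmod (indicator (box a b) x))\<^sup>2 \<partial>lborel) + (\<integral>x. (cmod (h x))\<^sup>2 \<partial>lborel)"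
proof -
  have [measurable]: "h \<in> borel_measurable borel" using h by (auto simp: L2_space_def)
  have hm2: "(\<lambda>x. (cmod (h x))\<^sup>2) \<in> borel_measurable borel" by measurable
  note L = L2_mult_integrable[OF indicator_box_L2_space L2_space_translate(1)[OF h]]
  show "integrable lborel (\<lambda>t. indicator (box a b) t * h (t + v))" by (rule L(1))
  show 3: "(\<integral>t. cmod (indicator (box a b) t * h (t + v)) \<partial>lborel)
      \<le> (\<integral>x. (cmod (indicator (box a b) x))\<^sup>2 \<partial>lborel) + (\<integral>x. (cmod (h x))\<^sup>2 \<partial>lborel)"
    using L(2)[of a b v] unfolding norm_mult lborel_integral_translate(2)[OF hm2, of v] .
  show "cmod (\<integral>t. indicator (box a b) t * h (t + v) \<partial>lborel)
      \<le> (\<integral>x. (cmod (indicator (box a b) x))\<^sup>2 \<partial>lborel) + (\<integral>x. (cmod (h x))\<^sup>2 \<partial>lborel)"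
    by (rule order_trans[OF integral_norm_bound 3])
qed

text \<open>Fubini applies because \<gamma> supplies integrability in position and the Gaussian
  factor supplies it in frequency. Once the order is changed, the frequency integral is a Gaussian
  Fourier integral at t - r, hence the heat kernel, and the position integral is a correlation of
  \<gamma> with g.\<close>

lemma gabor_regularized:
  fixes g h \<gamma> :: "real^'n::finite \<Rightarrow> complex"
  assumes g: "integrable lborel g" "g \<in> L2_space" and h: "h \<in> L2_space"
    and y: "integrable lborel \<gamma>" "\<gamma> \<in> L2_space" and e: "e > 0"
  shows "(\<integral>z. gabor g h z * cis (snd z \<bullet> t) * \<gamma> (t - fst z) * complex_of_real (exp (- e\<^sup>2 * (norm (snd z))\<^sup>2 / 2)) \<partial>lborel)
    = (2 * pi) ^ CARD('n) * (\<integral>v. complex_of_real (heat_kernel e v) * ((\<integral>u. \<gamma> u * cnj (g (u + v)) \<partial>lborel) * h (t + v)) \<partial>lborel)"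
proof -
  have [measurable]: "h \<in> borel_measurable borel" "g \<in> borel_measurable borel" "\<gamma> \<in> borel_measurable borel"
    using g y h by (auto simp: L2_space_def)
  have hkm[measurable]: "(heat_kernel e :: real^'n \<Rightarrow> real) \<in> borel_measurable borel"
    using heat_kernel_integrable[OF e] by auto
  define E where "E y = complex_of_real (exp (- e\<^sup>2 * (norm (y::real^'n))\<^sup>2 / 2))" for y
  have Em[measurable]: "E \<in> borel_measurable borel" unfolding E_def by measurable
  have Ei: "integrable lborel E"
    using gaussian_fourier(1)[OF e, of 0] by (simp add: E_def[abs_def])
  define Q where "Q z r = h r * cnj (g (r - fst z)) * cis (- (snd z \<bullet> r)) * (cis (snd z \<bullet> t) * \<gamma> (t - fst z) * E (snd z))" for z r
  define W where "W v = (\<integral>u. \<gamma> u * cnj (g (u + v)) \<partial>lborel)" for v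
  have Qm[measurable]: "(\<lambda>(z, r). Q z r) \<in> borel_measurable (borel \<Otimes>\<^sub>M borel)"
    unfolding Q_def by measurable
  \<comment> \<open>Bounds the r-integral of |h(r)| |g(r - x)| for every x at once, since the
    integral of |g|^2 is translation invariant.\<close>
  define C where "C = (\<integral>x. (cmod (h x))\<^sup>2 \<partial>lborel) + (\<integral>x. (cmod (g x))\<^sup>2 \<partial>lborel)"
  have C0: "C \<ge> 0" unfolding C_def by simp
  have L: "integrable lborel (\<lambda>r. h r * cnj (g (r - x)))" "(\<integral>r. cmod (h r) * cmod (g (r - x)) \<partial>lborel) \<le> C" for x
    using L2_mult_integrable[OF h L2_space_cnj[OF L2_space_translate(2)[OF g(2), of x]]]
    by (simp_all add: C_def lborel_integral_translate(3)[of "\<lambda>y. (cmod (g y))\<^sup>2" x])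
  have Qr: "integrable lborel (Q z)" for z
  proof -
    have "integrable lborel (\<lambda>r. (cis (snd z \<bullet> t) * \<gamma> (t - fst z) * E (snd z)) * (h r * cnj (g (r - fst z))))"
      by (intro integrable_mult_right L)
    thus ?thesis by (rule Bochner_Integration.integrable_bound) (auto simp: Q_def norm_mult)
  qed
  have gE: "integrable lborel (\<lambda>z. \<gamma> (t - fst z) * E (snd z))"
    using integrable_prod_pair[OF lborel_integrable_translate(4)[OF y(1), of t] Ei] by (simp add: lborel_prod case_prod_unfold)
  have Qint: "integrable (lborel \<Otimes>\<^sub>M lborel) (\<lambda>(z, r). Q z r)"
  proof (rule lborel_pair.Fubini_integrable)
    show "integrable lborel (\<lambda>z. \<integral>r. norm (case (z, r) of (z, r) \<Rightarrow> Q z r) \<partial>lborel)"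
    proof (rule Bochner_Integration.integrable_bound)
      show "integrable lborel (\<lambda>z. C * cmod (\<gamma> (t - fst z) * E (snd z)))"
        using gE by auto
      have *: "(\<integral>r. cmod (Q z r) \<partial>lborel) = cmod (\<gamma> (t - fst z) * E (snd z)) * (\<integral>r. cmod (h r) * cmod (g (r - fst z)) \<partial>lborel)" for z
        unfolding Q_def by (subst integral_mult_right_zero[symmetric]) (simp add: norm_mult mult_ac)
      show "AE z in lborel. norm (\<integral>r. norm (case (z, r) of (z, r) \<Rightarrow> Q z r) \<partial>lborel) \<le> norm (C * cmod (\<gamma> (t - fst z) * E (snd z)))"
      proof (intro AE_I2)
        fix z
        have "cmod (\<gamma> (t - fst z) * E (snd z)) * (\<integral>r. cmod (h r) * cmod (g (r - fst z)) \<partial>lborel) \<le> cmod (\<gamma> (t - fst z) * E (snd z)) * C"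
          by (intro mult_left_mono L) auto
        thus "norm (\<integral>r. norm (case (z, r) of (z, r) \<Rightarrow> Q z r) \<partial>lborel) \<le> norm (C * cmod (\<gamma> (t - fst z) * E (snd z)))"
          using C0 by (simp add: * abs_mult mult.commute)
      qed
    qed measurable
  qed (use Qr in auto)
  have "(\<integral>z. gabor g h z * cis (snd z \<bullet> t) * \<gamma> (t - fst z) * E (snd z) \<partial>lborel) = (\<integral>z. (\<integral>r. Q z r \<partial>lborel) \<partial>lborel)"
    unfolding gabor_def Q_def by (simp only: mult.assoc integral_mult_left_zero[symmetric])
  also have "\<dots> = (\<integral>r. (\<integral>z. Q z r \<partial>lborel) \<partial>lborel)"
    by (rule lborel_pair.Fubini_integral[OF Qint, symmetric])
  also have "\<dots> = (\<integral>r. (2 * pi) ^ CARD('n) * (complex_of_real (heat_kernel e (r - t)) * (W (r - t) * h r)) \<partial>lborel)"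
  proof (rule Bochner_Integration.integral_cong[OF refl])
    fix r
    have ai: "integrable lborel (\<lambda>x. h r * (cnj (g (r - x)) * \<gamma> (t - x)))"
    proof -
      have "integrable lborel (\<lambda>u. cnj (g (u + (r - t))) * \<gamma> u)"
        by (intro L2_mult_integrable(1) L2_space_cnj L2_space_translate g y)
      from lborel_integrable_translate(4)[OF this, of t] show ?thesis by (intro integrable_mult_right) simp
    qed
    have aI: "(\<integral>x. h r * (cnj (g (r - x)) * \<gamma> (t - x)) \<partial>lborel) = h r * W (r - t)"
      using lborel_integral_translate(4)[of "\<lambda>u. \<gamma> u * cnj (g (u + (r - t)))" t]
      by (simp add: W_def mult.commute)
    have bi: "integrable lborel (\<lambda>y. E y * cis (y \<bullet> (t - r)))"
      and bI: "(\<integral>y. E y * cis (y \<bullet> (t - r)) \<partial>lborel) = complex_of_real ((2 * pi) ^ CARD('n) * heat_kernel e (t - r))"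
      unfolding E_def by (rule gaussian_fourier[OF e])+
    have "(\<integral>z. Q z r \<partial>lborel) = (\<integral>(x, y). (h r * (cnj (g (r - x)) * \<gamma> (t - x))) * (E y * cis (y \<bullet> (t - r))) \<partial>(lborel \<Otimes>\<^sub>M lborel))"
      unfolding lborel_prod
    proof (rule Bochner_Integration.integral_cong[OF refl])
      fix z :: "(real^'n) \<times> (real^'n)"
      have c: "cis (snd z \<bullet> (t - r)) = cis (- (snd z \<bullet> r)) * cis (snd z \<bullet> t)"
        by (simp add: cis_mult inner_diff_right)
      show "Q z r = (case z of (x, y) \<Rightarrow> (h r * (cnj (g (r - x)) * \<gamma> (t - x))) * (E y * cis (y \<bullet> (t - r))))"
        unfolding Q_def case_prod_unfold c by (simp only: mult_ac)
    qed
    also have "\<dots> = (h r * W (r - t)) * complex_of_real ((2 * pi) ^ CARD('n) * heat_kernel e (t - r))"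
      by (simp only: integral_prod_pair[OF ai bi] aI bI)
    also have "heat_kernel e (t - r) = heat_kernel e (r - t)" by (simp add: heat_kernel_def norm_minus_commute)
    finally show "(\<integral>z. Q z r \<partial>lborel) = (2 * pi) ^ CARD('n) * (complex_of_real (heat_kernel e (r - t)) * (W (r - t) * h r))"
      by (simp add: mult_ac)
  qed
  also have "\<dots> = (2 * pi) ^ CARD('n) * (\<integral>v. complex_of_real (heat_kernel e v) * (W v * h (t + v)) \<partial>lborel)"
    using lborel_integral_translate(3)[of "\<lambda>v. complex_of_real (heat_kernel e v) * (W v * h (t + v))" t] 
    by (simp add: W_def)
  finally show ?thesis by (simp add: E_def W_def)
qed

text \<open>Inserting \<open>exp (- e\<^sup>2 |y|\<^sup>2 / 2)\<close> turns the inner integral into a convolution with the heat kernel;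
  the limit \<open>e \<rightarrow> 0\<close> is taken after integrating over a box.\<close>

lemma gabor_inversion:
  fixes g h \<gamma> :: "real^'n::finite \<Rightarrow> complex"
  assumes g: "integrable lborel g" "continuous_on UNIV g" "\<And>t. cmod (g t) \<le> Bg" and h: "h \<in> L2_space"
    and y: "integrable lborel \<gamma>" "\<And>t. cmod (\<gamma> t) \<le> By"
    and G: "integrable lborel (gabor g h)"
  shows "AE t in lborel. h t * (\<integral>u. \<gamma> u * cnj (g u) \<partial>lborel) =
    (\<integral>z. gabor g h z * (cis (snd z \<bullet> t) * \<gamma> (t - fst z)) \<partial>lborel) / (2 * pi) ^ CARD('n)"
proof -
  have [measurable]: "h \<in> borel_measurable borel" "g \<in> borel_measurable borel" "\<gamma> \<in> borel_measurable borel"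
    using g y h by (auto simp: L2_space_def)
  have gL: "g \<in> L2_space" and yL: "\<gamma> \<in> L2_space" using L2_spaceI_bounded_integrable g y by blast+
  have By: "By \<ge> 0" using y(2) norm_ge_zero order_trans by blast
  have Bg: "Bg \<ge> 0" using g(3) norm_ge_zero order_trans by blast
  define W where "W v = (\<integral>u. \<gamma> u * cnj (g (u + v)) \<partial>lborel)" for v
  define R where "R t = (\<integral>z. gabor g h z * (cis (snd z \<bullet> t) * \<gamma> (t - fst z)) \<partial>lborel)" for t
  define E where "E k y = complex_of_real (exp (- (1 / real (Suc k))\<^sup>2 * (norm (y::real^'n))\<^sup>2 / 2))" for k y
  define Rk where "Rk k t = (\<integral>z. gabor g h z * cis (snd z \<bullet> t) * \<gamma> (t - fst z) * E k (snd z) \<partial>lborel)" for k t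
  have Em[measurable]: "E k \<in> borel_measurable borel" for k unfolding E_def by measurable
  have Rm[measurable]: "R \<in> borel_measurable borel" "Rk k \<in> borel_measurable borel" for k
    unfolding R_def Rk_def by measurable
  have Wm[measurable]: "W \<in> borel_measurable borel" unfolding W_def by measurable
  have E1: "cmod (E k y) \<le> 1" for k y unfolding E_def by simp
  define I where "I = (\<integral>z. cmod (gabor g h z) \<partial>lborel)"
  have I0: "I \<ge> 0" unfolding I_def by simp
  have I: "integrable lborel (\<lambda>z. cmod (gabor g h z) * By)" using G by auto
  have Rkb: "cmod (Rk k t) \<le> I * By" for k t
  proof -
    have "cmod (Rk k t) \<le> (\<integral>z. cmod (gabor g h z * cis (snd z \<bullet> t) * \<gamma> (t - fst z) * E k (snd z)) \<partial>lborel)"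
      unfolding Rk_def by (rule integral_norm_bound)
    also have "\<dots> \<le> (\<integral>z. cmod (gabor g h z) * By \<partial>lborel)"
    proof (rule integral_mono[OF integrable_norm I])
      show *: "cmod (gabor g h z * cis (snd z \<bullet> t) * \<gamma> (t - fst z) * E k (snd z)) \<le> cmod (gabor g h z) * By" for z
        using mult_mono[OF y(2)[of "t - fst z"] E1[of k "snd z"] By] by (simp add: norm_mult mult.assoc mult_left_mono)
      show "integrable lborel (\<lambda>z. gabor g h z * cis (snd z \<bullet> t) * \<gamma> (t - fst z) * E k (snd z))"
        by (rule Bochner_Integration.integrable_bound[OF I]) (use * By in \<open>auto simp: abs_mult\<close>)
    qed
    finally show ?thesis by (simp add: I_def)
  qed
  have Rklim: "(\<lambda>k. Rk k t) \<longlonglongrightarrow> R t" for t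
    unfolding Rk_def R_def
  proof (rule integral_dominated_convergence[OF _ _ I])
    show "AE z in lborel. norm (gabor g h z * cis (snd z \<bullet> t) * \<gamma> (t - fst z) * E k (snd z)) \<le> cmod (gabor g h z) * By" for k
      using mult_mono[OF y(2)[of "t - fst z" for z] E1[of k "snd z" for z] By] by (auto simp add: norm_mult mult.assoc intro!: mult_left_mono)
    have Elim: "(\<lambda>k. E k y) \<longlonglongrightarrow> 1" for y
    proof -
      have "(\<lambda>k. 1 / real (Suc k)) \<longlonglongrightarrow> 0" using LIMSEQ_inverse_real_of_nat by (simp add: inverse_eq_divide)
      hence "(\<lambda>k. E k y) \<longlonglongrightarrow> complex_of_real (exp (- 0\<^sup>2 * (norm y)\<^sup>2 / 2))"
        unfolding E_def by (intro tendsto_intros) auto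
      thus ?thesis by simp
    qed
    show "AE z in lborel. (\<lambda>k. gabor g h z * cis (snd z \<bullet> t) * \<gamma> (t - fst z) * E k (snd z)) \<longlonglongrightarrow> gabor g h z * (cis (snd z \<bullet> t) * \<gamma> (t - fst z))"
      using tendsto_mult[OF tendsto_const Elim, of "gabor g h z * cis (snd z \<bullet> t) * \<gamma> (t - fst z)" for z] by (auto simp: mult.assoc)
  qed measurable
  have Rb: "cmod (R t) \<le> I * By" for t
    using LIMSEQ_le_const2[OF tendsto_norm[OF Rklim[of t]]] Rkb by blast
  have Wb: "cmod (W v) \<le> (\<integral>u. cmod (\<gamma> u) * Bg \<partial>lborel)" and Wc: "isCont W v" for v
  proof -
    have i: "integrable lborel (\<lambda>u. cmod (\<gamma> u) * Bg)" using y by auto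
    have b: "cmod (\<gamma> u * cnj (g (u + v))) \<le> cmod (\<gamma> u) * Bg" for u v
      by (auto simp: norm_mult intro!: mult_left_mono g)
    have "cmod (W v) \<le> (\<integral>u. cmod (\<gamma> u * cnj (g (u + v))) \<partial>lborel)"
      unfolding W_def by (rule integral_norm_bound)
    also have "\<dots> \<le> (\<integral>u. cmod (\<gamma> u) * Bg \<partial>lborel)"
      by (rule integral_mono[OF integrable_norm i b])
        (rule Bochner_Integration.integrable_bound[OF i], use b Bg in \<open>auto simp: abs_mult\<close>)
    finally show "cmod (W v) \<le> (\<integral>u. cmod (\<gamma> u) * Bg \<partial>lborel)" .
    show "isCont W v"
      unfolding continuous_at_sequentially comp_def W_def
    proof (intro allI impI)
      fix u :: "nat \<Rightarrow> real^'n" assume u: "u \<longlonglongrightarrow> v"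
      show "(\<lambda>k. \<integral>ua. \<gamma> ua * cnj (g (ua + u k)) \<partial>lborel) \<longlonglongrightarrow> (\<integral>u. \<gamma> u * cnj (g (u + v)) \<partial>lborel)"
        by (rule integral_dominated_convergence[OF _ _ i])
          (use b in \<open>auto intro!: AE_I2 tendsto_intros u continuous_on_tendsto_compose[OF g(2)]\<close>)
    qed
  qed
  define D where "D t = (2 * pi) ^ CARD('n) * (W 0 * h t) - R t" for t
  have Dm[measurable]: "D \<in> borel_measurable borel" unfolding D_def by measurable
  have "AE t in lborel. D t = 0"
  proof (rule integral_zero_boxes_AE_zero[OF Dm])
    fix a b :: "real^'n"
    let ?i = "indicator (box a b) :: real^'n \<Rightarrow> complex"
    have ii: "integrable lborel (\<lambda>t. cmod (?i t) * (I * By))"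
    proof -
      have "integrable lborel (indicator (box a b) :: real^'n \<Rightarrow> real)"
        by (rule integrable_real_indicator) (use emeasure_lborel_box_finite[of a b] in auto)
      hence "integrable lborel (\<lambda>t::real^'n. indicator (box a b) t * (I * By))" by auto
      thus ?thesis by (rule Bochner_Integration.integrable_cong[THEN iffD1, rotated 2]) (auto simp: indicator_def)
    qed
    have iR: "integrable lborel (\<lambda>t. ?i t * R t)"
      by (rule Bochner_Integration.integrable_bound[OF ii])
        (use Rb I0 By in \<open>auto simp: norm_mult abs_mult intro!: mult_left_mono order_trans[OF Rb]\<close>)
    have ih: "integrable lborel (\<lambda>t. ?i t * h t)"
      using integrable_indicator_box_translate(1)[OF h, of a b 0] by simp
    have eqD: "indicator (box a b) t *\<^sub>R D t = (2 * pi) ^ CARD('n) * W 0 * (?i t * h t) - ?i t * R t" for t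
      by (auto simp: D_def indicator_def)
    show "set_integrable lborel (box a b) D"
      unfolding set_integrable_def eqD by (intro Bochner_Integration.integrable_diff integrable_mult_right ih iR)
    \<comment> \<open>At a single point the heat-kernel averages of h may fail to converge, as h is
      only square integrable. Integrated over a box they become averages of
      \<open>W v * H v\<close>, a bounded function that is continuous at 0.\<close>
    define H where "H v = (\<integral>t. ?i t * h (t + v) \<partial>lborel)" for v
    define BH where "BH = (\<integral>x. (cmod (?i x))\<^sup>2 \<partial>lborel) + (\<integral>x. (cmod (h x))\<^sup>2 \<partial>lborel)"
    have Hb: "cmod (H v) \<le> BH" for v unfolding H_def BH_def by (rule integrable_indicator_box_translate(2)[OF h])
    have Hm[measurable]: "H \<in> borel_measurable borel" unfolding H_def by measurable
    have Hc: "isCont H 0" unfolding H_def by (rule L2_box_integral_continuous[OF h])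
    have swap: "(\<integral>t. ?i t * Rk k t \<partial>lborel) = (2 * pi) ^ CARD('n) * (\<integral>v. complex_of_real (heat_kernel (1 / Suc k) v) * (W v * H v) \<partial>lborel)" for k
    proof -
      define e where "e = 1 / real (Suc k)"
      have e: "e > 0" by (simp add: e_def)
      have hkm[measurable]: "(heat_kernel e :: real^'n \<Rightarrow> real) \<in> borel_measurable borel"
        using heat_kernel_integrable[OF e] by auto
      define c where "c v = complex_of_real (heat_kernel e v) * W v" for v
      have ci: "integrable lborel c"
      proof (rule Bochner_Integration.integrable_bound)
        show "integrable lborel (\<lambda>v::real^'n. heat_kernel e v * (\<integral>u. cmod (\<gamma> u) * Bg \<partial>lborel))"
          by (intro integrable_mult_left heat_kernel_integrable e)
        show "c \<in> borel_measurable lborel" unfolding c_def by measurable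
        show "AE v in lborel. norm (c v) \<le> norm (heat_kernel e v * (\<integral>u. cmod (\<gamma> u) * Bg \<partial>lborel))"
          using Wb Bg by (auto simp: c_def norm_mult abs_mult intro!: mult_left_mono order_trans[OF Wb])
      qed
      have int: "integrable (lborel \<Otimes>\<^sub>M lborel) (\<lambda>(v, t). c v * (?i t * h (t + v)))"
        by (rule superposition_integrable(1)[OF ci _ _ integrable_indicator_box_translate(3)[OF h]])
          (auto intro: integrable_indicator_box_translate(1)[OF h])
      have "(\<integral>t. ?i t * Rk k t \<partial>lborel) = (\<integral>t. (2 * pi) ^ CARD('n) * (\<integral>v. c v * (?i t * h (t + v)) \<partial>lborel) \<partial>lborel)"
      proof (rule Bochner_Integration.integral_cong[OF refl])
        fix t
        have "Rk k t = (2 * pi) ^ CARD('n) * (\<integral>v. c v * h (t + v) \<partial>lborel)"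
          unfolding Rk_def E_def c_def W_def e_def[symmetric] mult.assoc
          using gabor_regularized[OF g(1) gL h y(1) yL e, of t] by (simp only: mult.assoc)
        hence "?i t * Rk k t = (2 * pi) ^ CARD('n) * (?i t * (\<integral>v. c v * h (t + v) \<partial>lborel))" by simp
        also have "?i t * (\<integral>v. c v * h (t + v) \<partial>lborel) = (\<integral>v. c v * (?i t * h (t + v)) \<partial>lborel)"
          by (subst integral_mult_right_zero[symmetric]) (simp only: mult_ac)
        finally show "?i t * Rk k t = (2 * pi) ^ CARD('n) * (\<integral>v. c v * (?i t * h (t + v)) \<partial>lborel)" .
      qed
      also have "\<dots> = (2 * pi) ^ CARD('n) * (\<integral>t. (\<integral>v. c v * (?i t * h (t + v)) \<partial>lborel) \<partial>lborel)"
        by (rule integral_mult_right_zero)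
      also have "(\<integral>t. (\<integral>v. c v * (?i t * h (t + v)) \<partial>lborel) \<partial>lborel) = (\<integral>v. (\<integral>t. c v * (?i t * h (t + v)) \<partial>lborel) \<partial>lborel)"
        by (rule lborel_pair.Fubini_integral[OF int])
      also have "\<dots> = (\<integral>v. complex_of_real (heat_kernel e v) * (W v * H v) \<partial>lborel)"
        unfolding H_def c_def by (simp only: integral_mult_right_zero mult.assoc)
      finally show ?thesis by (simp only: e_def)
    qed
    have "(\<lambda>k. (2 * pi) ^ CARD('n) * (\<integral>v. complex_of_real (heat_kernel (1 / Suc k) v) * (W v * H v) \<partial>lborel))
        \<longlonglongrightarrow> (2 * pi) ^ CARD('n) * (W 0 * H 0)"
    proof (intro tendsto_mult tendsto_const heat_kernel_tendsto)
      show "(\<lambda>v. W v * H v) \<in> borel_measurable borel" by measurable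
      show "norm (W v * H v) \<le> (\<integral>u. cmod (\<gamma> u) * Bg \<partial>lborel) * BH" for v
        unfolding norm_mult by (intro mult_mono Wb Hb order_trans[OF norm_ge_zero Wb]) auto
      show "isCont (\<lambda>v. W v * H v) 0" by (intro isCont_mult Wc Hc)
    qed
    moreover have "(\<lambda>k. \<integral>t. ?i t * Rk k t \<partial>lborel) \<longlonglongrightarrow> (\<integral>t. ?i t * R t \<partial>lborel)"
    proof (rule integral_dominated_convergence[OF _ _ ii])
      show "AE t in lborel. (\<lambda>k. ?i t * Rk k t) \<longlonglongrightarrow> ?i t * R t" by (intro AE_I2 tendsto_intros Rklim)
      show "AE t in lborel. norm (?i t * Rk k t) \<le> cmod (?i t) * (I * By)" for k
        by (auto simp: norm_mult intro!: mult_left_mono Rkb)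
    qed measurable
    ultimately have lim: "(\<integral>t. ?i t * R t \<partial>lborel) = (2 * pi) ^ CARD('n) * (W 0 * H 0)"
      unfolding swap by (rule LIMSEQ_unique[rotated])
    show "(LINT x:box a b|lborel. D x) = 0"
      unfolding set_lebesgue_integral_def eqD
      apply (subst Bochner_Integration.integral_diff[OF integrable_mult_right[OF ih] iR])
      using lim by (simp only: H_def integral_mult_right_zero add_0_right mult.assoc)  simp
  qed
  then show ?thesis
  proof eventually_elim
    case (elim t)
    hence "(2 * pi) ^ CARD('n) * (W 0 * h t) = R t" by (simp add: D_def)
    moreover have "h t * W 0 = ((2 * pi) ^ CARD('n) * (W 0 * h t)) / (2 * pi) ^ CARD('n)" by simp
    ultimately have "h t * W 0 = R t / (2 * pi) ^ CARD('n)" by simp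
    thus ?case by (simp only: W_def R_def add_0_right)
  qed
qed

section \<open>Schwartz functions\<close>

lemma integral_norm_le:
  fixes f :: "'a \<Rightarrow> 'b::{banach, second_countable_topology}"
  assumes g: "integrable M g" and f: "f \<in> borel_measurable M" and b: "\<And>x. norm (f x) \<le> g x"
  shows "integrable M f" and "norm (integral\<^sup>L M f) \<le> integral\<^sup>L M g" and "(\<integral>x. norm (f x) \<partial>M) \<le> integral\<^sup>L M g"
proof -
  show i: "integrable M f"
    by (rule Bochner_Integration.integrable_bound[OF g f]) (auto intro: order_trans[OF b abs_ge_self])
  show *: "(\<integral>x. norm (f x) \<partial>M) \<le> integral\<^sup>L M g"
    by (rule integral_mono) (use i g b in auto)
  show "norm (integral\<^sup>L M f) \<le> integral\<^sup>L M g"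
    by (rule order_trans[OF integral_norm_bound *])
qed

lemma partial_deriv_eqI:
  assumes "(f has_derivative D) (at x)"
  shows "partial_deriv j f x = D (axis j 1)"
  unfolding partial_deriv_def using frechet_derivative_at[OF assms] by simp

lemma schwartz_partial_deriv:
  assumes "f \<in> schwartz_space" shows "partial_deriv j f \<in> schwartz_space"
proof -
  have "foldr partial_deriv js (partial_deriv j f) = foldr partial_deriv (js @ [j]) f" for js
    by simp
  moreover have "foldr partial_deriv (js @ [j]) f differentiable_on UNIV \<and>
     (\<forall>k::nat. bounded (range (\<lambda>x. norm x ^ k *\<^sub>R foldr partial_deriv (js @ [j]) f x)))" for js
    using assms unfolding schwartz_space_def by blast
  ultimately show ?thesis unfolding schwartz_space_def by simp
qed

lemma schwartz_has_derivative:
  assumes "f \<in> schwartz_space"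
  shows "(f has_derivative frechet_derivative f (at x)) (at x)"
proof -
  have "foldr partial_deriv [] f differentiable_on UNIV"
    using assms unfolding schwartz_space_def by blast
  hence "f differentiable at x" by (simp add: differentiable_on_def)
  thus ?thesis by (simp add: frechet_derivative_works)
qed

lemma schwartz_continuous:
  assumes "f \<in> schwartz_space" shows "continuous_on UNIV f"
  by (intro continuous_at_imp_continuous_on ballI has_derivative_continuous[OF schwartz_has_derivative[OF assms]])

lemma schwartz_measurable: "f \<in> schwartz_space \<Longrightarrow> f \<in> borel_measurable borel"
  by (intro borel_measurable_continuous_onI schwartz_continuous)

lemma one_plus_power_le: "(1 + r) ^ N \<le> 2 ^ N * (1 + r ^ N)" if "0 \<le> r" for r :: real
proof -
  have "(1 + r) ^ N \<le> (2 * max 1 r) ^ N" using that by (intro power_mono) auto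
  also have "\<dots> = 2 ^ N * (max 1 r) ^ N" by (simp add: power_mult_distrib)
  also have "(max 1 r) ^ N \<le> 1 + r ^ N" using that by (auto simp: max_def)
  finally show ?thesis by simp
qed

text \<open>Bounds on f and on |x|^N f add up to a bound on (1 + |x|)^N f.\<close>

lemma schwartz_decay:
  assumes f: "f \<in> schwartz_space"
  shows "\<exists>C\<ge>0. \<forall>x. cmod (f x) \<le> C * decay x ^ N"
proof -
  have "bounded (range (\<lambda>x. norm x ^ k *\<^sub>R foldr partial_deriv [] f x))" for k
    using f unfolding schwartz_space_def by blast
  hence "\<exists>C. \<forall>x. norm (norm x ^ k *\<^sub>R f x) \<le> C" for k
    by (auto simp: bounded_iff)
  then obtain C where C: "\<And>k x. norm (norm x ^ k *\<^sub>R f x) \<le> C k" by metis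
  have "cmod (f x) \<le> (2 ^ N * (C 0 + C N)) * decay x ^ N" for x
  proof -
    have "cmod (f x) * (1 + norm x) ^ N \<le> cmod (f x) * (2 ^ N * (1 + norm x ^ N))"
      by (intro mult_left_mono one_plus_power_le) auto
    also have "\<dots> = 2 ^ N * (cmod (f x) + norm x ^ N * cmod (f x))" by (simp add: algebra_simps)
    also have "\<dots> \<le> 2 ^ N * (C 0 + C N)"
      using C[of x 0] C[of x N] by (intro mult_left_mono add_mono) auto
    finally have "cmod (f x) * (1 + norm x) ^ N \<le> 2 ^ N * (C 0 + C N)" .
    moreover have "(1 + norm x) ^ N > 0" by (auto intro!: zero_less_power add_pos_nonneg)
    ultimately show ?thesis by (simp add: decay_def power_divide field_simps)
  qed
  moreover have "2 ^ N * (C 0 + C N) \<ge> 0"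
    by (intro mult_nonneg_nonneg add_nonneg_nonneg order_trans[OF norm_ge_zero C]) auto
  ultimately show ?thesis by blast
qed

lemma schwartz_integrable:
  fixes f :: "real^'n::finite \<Rightarrow> complex"
  assumes f: "f \<in> schwartz_space" shows "integrable lborel f"
proof -
  obtain C where C: "C \<ge> 0" "\<And>x. cmod (f x) \<le> C * decay x ^ (2 * CARD('n))" using schwartz_decay[OF f] by blast
  have "integrable lborel (\<lambda>x::real^'n. C * decay x ^ (2 * CARD('n)))"
    by (intro integrable_mult_right integrable_decay) auto
  thus ?thesis
    by (rule Bochner_Integration.integrable_bound) (use C schwartz_measurable[OF f] in auto)
qed

lemma schwartz_bounded:
  assumes f: "f \<in> schwartz_space" obtains B where "\<And>x. cmod (f x) \<le> B"
proof -
  obtain C where "\<And>x. cmod (f x) \<le> C * decay x ^ 0" using schwartz_decay[OF f] by blast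
  hence "\<And>x. cmod (f x) \<le> C" by simp
  thus ?thesis by (rule that)
qed

lemma schwartz_L2_space: "f \<in> schwartz_space \<Longrightarrow> f \<in> L2_space"
  by (rule schwartz_bounded) (auto intro: L2_spaceI_bounded_integrable schwartz_integrable)

text \<open>The integral of a difference quotient vanishes by translation invariance.\<close>

lemma integral_partial_deriv_eq_0:
  fixes H :: "real^'n::finite \<Rightarrow> complex"
  assumes D: "\<And>x. (H has_derivative D x) (at x)"
    and H: "\<And>x. cmod (H x) \<le> C * decay x ^ (2 * CARD('n))"
    and DH: "\<And>x. cmod (D x (axis j 1)) \<le> C * decay x ^ (2 * CARD('n))"
    and m[measurable]: "(\<lambda>x. D x (axis j 1)) \<in> borel_measurable borel"
  shows "(\<integral>x. D x (axis j 1) \<partial>lborel) = 0"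
proof -
  let ?K = "2 * CARD('n)"
  define e where "e = (axis j 1 :: real^'n)"
  have e1: "norm e = 1" by (simp add: e_def norm_axis_1)
  have C: "C \<ge> 0" using H[of 0] by (auto simp: decay_def intro: order_trans[OF norm_ge_zero])
  have Hc: "continuous_on UNIV H"
    by (intro continuous_at_imp_continuous_on ballI has_derivative_continuous[OF D])
  have Hm[measurable]: "H \<in> borel_measurable borel" by (intro borel_measurable_continuous_onI Hc)
  have id: "integrable lborel (\<lambda>x::real^'n. C * decay x ^ ?K)" 
    by (intro integrable_mult_right integrable_decay) auto
  have Hi: "integrable lborel H"
    by (rule Bochner_Integration.integrable_bound[OF id]) (use H C in auto)
  have line: "((\<lambda>s. H (x + s *\<^sub>R e)) has_vector_derivative D (x + s *\<^sub>R e) e) (at s)" for x s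
  proof -
    have "((\<lambda>s. H (x + s *\<^sub>R e)) has_derivative (\<lambda>h. D (x + s *\<^sub>R e) (h *\<^sub>R e))) (at s)"
      by (rule has_derivative_compose[OF _ D]) (auto intro!: derivative_eq_intros)
    moreover have "D (x + s *\<^sub>R e) (h *\<^sub>R e) = h *\<^sub>R D (x + s *\<^sub>R e) e" for h
      by (rule linear_cmul[OF bounded_linear.linear[OF has_derivative_bounded_linear[OF D]]])
    ultimately show ?thesis by (simp add: has_vector_derivative_def)
  qed
  define s where "s k = 1 / real (Suc k)" for k
  have s: "0 < s k" "s k \<le> 1" for k by (auto simp: s_def)
  have slim: "s \<longlonglongrightarrow> 0" unfolding s_def using LIMSEQ_inverse_real_of_nat by (simp add: inverse_eq_divide)
  define Q where "Q k x = inverse (s k) *\<^sub>R (H (x + s k *\<^sub>R e) - H x)" for k x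
  have Q0: "(\<integral>x. Q k x \<partial>lborel) = 0" for k
    using Hi by (simp add: Q_def lborel_integrable_translate(2) lborel_integral_translate(2)[OF Hm])
  have Qlim: "(\<lambda>k. Q k x) \<longlonglongrightarrow> D x e" for x
  proof -
    have "((\<lambda>s. H (x + s *\<^sub>R e)) has_derivative (\<lambda>h. h *\<^sub>R D x e)) (at 0)"
      using line[of x 0] by (simp add: has_vector_derivative_def)
    hence "((\<lambda>h. norm (H (x + h *\<^sub>R e) - H x - h *\<^sub>R D x e) / norm h) \<longlongrightarrow> 0) (at 0)"
      by (simp add: has_derivative_at)
    moreover have "filterlim s (at 0) sequentially"
      using slim s by (auto simp: filterlim_at less_imp_neq[symmetric] intro!: always_eventually)
    ultimately have "(\<lambda>k. norm (H (x + s k *\<^sub>R e) - H x - s k *\<^sub>R D x e) / norm (s k)) \<longlonglongrightarrow> 0"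
      by (rule filterlim_compose)
    moreover have "norm (H (x + s k *\<^sub>R e) - H x - s k *\<^sub>R D x e) / norm (s k) = norm (Q k x - D x e)" for k
    proof -
      have "Q k x - D x e = inverse (s k) *\<^sub>R (H (x + s k *\<^sub>R e) - H x - s k *\<^sub>R D x e)"
        using s(1)[of k] by (simp add: Q_def scaleR_right_diff_distrib)
      thus ?thesis using s(1)[of k] by (simp only: norm_scaleR) (simp add: divide_inverse mult.commute)
    qed
    ultimately have "(\<lambda>k. norm (Q k x - D x e)) \<longlonglongrightarrow> 0" by simp
    thus ?thesis by (simp add: tendsto_norm_zero_iff LIM_zero_iff)
  qed
  \<comment> \<open>A mean value estimate along the segment from x to x + s e. The segment has
    length at most 1, so by Peetre's inequality the weight varies along it by at most a factor 2^K,
    and the difference quotients get a majorant that is independent of k.\<close>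
  have Qb: "cmod (Q k x) \<le> 2 ^ ?K * (C * decay x ^ ?K)" for k x
  proof -
    have b: "cmod (D (x + r *\<^sub>R e) e) \<le> 2 ^ ?K * (C * decay x ^ ?K)" if "0 \<le> r" "r \<le> 1" for r
    proof -
      have "cmod (D (x + r *\<^sub>R e) e) \<le> C * decay (x + r *\<^sub>R e) ^ ?K" using DH unfolding e_def .
      also have "decay (x + r *\<^sub>R e) ^ ?K \<le> (1 + norm (- r *\<^sub>R e)) ^ ?K * decay x ^ ?K"
        using decay_diff_power[of x "- r *\<^sub>R e" ?K] by simp
      also have "(1 + norm (- r *\<^sub>R e)) ^ ?K \<le> 2 ^ ?K" using that e1 by (intro power_mono) auto
      finally show ?thesis using C by (simp add: mult_left_mono mult_right_mono mult.left_commute)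
    qed
    have "norm (H (x + s k *\<^sub>R e) - H (x + 0 *\<^sub>R e)) \<le> 2 ^ ?K * (C * decay x ^ ?K) * norm (s k - 0)"
    proof (rule differentiable_bound[of "{0..1}"])
      show "((\<lambda>s. H (x + s *\<^sub>R e)) has_derivative (\<lambda>h. h *\<^sub>R D (x + r *\<^sub>R e) e)) (at r within {0..1})" for r
        using line[of x r] by (auto simp: has_vector_derivative_def intro: has_derivative_at_withinI)
      show "onorm (\<lambda>h. h *\<^sub>R D (x + r *\<^sub>R e) e) \<le> 2 ^ ?K * (C * decay x ^ ?K)" if "r \<in> {0..1}" for r
        using b[of r] that by (intro onorm_le) (auto simp: mult.commute[of _ "\<bar>_\<bar>"] intro!: mult_left_mono)
    qed (use s in \<open>auto intro: less_imp_le\<close>)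
    hence "norm (H (x + s k *\<^sub>R e) - H x) / s k \<le> 2 ^ ?K * (C * decay x ^ ?K)"
      using s(1)[of k] by (simp add: pos_divide_le_eq)
    thus ?thesis using s(1)[of k] unfolding Q_def norm_scaleR by (simp add: divide_inverse mult.commute)
  qed
  have "(\<lambda>k. \<integral>x. Q k x \<partial>lborel) \<longlonglongrightarrow> (\<integral>x. D x e \<partial>lborel)"
  proof (rule integral_dominated_convergence[where w="\<lambda>x. 2 ^ ?K * (C * decay x ^ ?K)"])
    show "integrable lborel (\<lambda>x::real^'n. 2 ^ ?K * (C * decay x ^ ?K))" by (intro integrable_mult_right id)
    show "Q k \<in> borel_measurable lborel" for k unfolding Q_def by measurable
    show "(\<lambda>x. D x e) \<in> borel_measurable lborel" using m unfolding e_def by simp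
  qed (use Qlim Qb in auto)
  hence "(\<integral>x. D x e \<partial>lborel) = 0" using Q0 LIMSEQ_unique[OF _ tendsto_const] by simp
  thus ?thesis by (simp add: e_def)
qed

lemma decay_mult_le: "decay t * decay (t - x) \<le> decay (x::'a::real_normed_vector)"
proof -
  have "1 + norm x \<le> (1 + norm t) * (1 + norm (t - x))"
  proof -
    have "(1 + norm t) * (1 + norm (t - x)) = 1 + (norm t + norm (t - x)) + norm t * norm (t - x)" by (simp add: algebra_simps)
    moreover have "norm x \<le> norm t + norm (t - x)" using norm_triangle_ineq4[of t "t - x"] by simp
    moreover have "0 \<le> norm t * norm (t - x)" by simp
    ultimately show ?thesis by linarith
  qed
  moreover have "0 < (1 + norm t) * (1 + norm (t - x))" "0 < 1 + norm x" by (auto intro!: mult_pos_pos add_pos_nonneg)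
  ultimately show ?thesis unfolding decay_def by (simp add: frac_le)
qed

text \<open>The decay of f is split: 2n powers make the t-integral converge, and the other N are
  paired with those of the window through \<open>decay t * decay (t - x) <= decay x\<close>.\<close>

lemma gabor_schwartz_decay_fst:
  fixes f h :: "real^'n::finite \<Rightarrow> complex"
  assumes f: "f \<in> schwartz_space" and h: "h \<in> schwartz_space"
  shows "\<exists>C. \<forall>x y. cmod (gabor h f (x, y)) \<le> C * decay x ^ N"
proof -
  let ?K = "2 * CARD('n)"
  obtain A where A: "A \<ge> 0" "\<And>x. cmod (f x) \<le> A * decay x ^ (N + ?K)" using schwartz_decay[OF f] by blast
  obtain B where B: "B \<ge> 0" "\<And>x. cmod (h x) \<le> B * decay x ^ N" using schwartz_decay[OF h] by blast
  have [measurable]: "f \<in> borel_measurable borel" "h \<in> borel_measurable borel" using schwartz_measurable f h by auto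
  have "cmod (gabor h f (x, y)) \<le> (A * B * (\<integral>t. decay (t::real^'n) ^ ?K \<partial>lborel)) * decay x ^ N" for x y
  proof -
    have i: "integrable lborel (\<lambda>t::real^'n. (A * B * decay x ^ N) * decay t ^ ?K)"
      by (intro integrable_mult_right integrable_decay) auto
    have b: "cmod (f t * cnj (h (t - x)) * cis (- (y \<bullet> t))) \<le> (A * B * decay x ^ N) * decay t ^ ?K" for t
    proof -
      have "cmod (f t * cnj (h (t - x)) * cis (- (y \<bullet> t))) = cmod (f t) * cmod (h (t - x))" by (simp add: norm_mult)
      also have "\<dots> \<le> (A * decay t ^ (N + ?K)) * (B * decay (t - x) ^ N)"
        by (intro mult_mono A B) (use A in auto)
      also have "\<dots> = (A * B * decay t ^ ?K) * (decay t * decay (t - x)) ^ N"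
        by (simp add: power_add power_mult_distrib mult_ac)
      also have "\<dots> \<le> (A * B * decay t ^ ?K) * decay x ^ N"
        using A B by (intro mult_left_mono power_mono decay_mult_le) auto
      finally show ?thesis by (simp add: mult_ac)
    qed
    have "cmod (gabor h f (x, y)) \<le> (\<integral>t. (A * B * decay x ^ N) * decay (t::real^'n) ^ ?K \<partial>lborel)"
      unfolding gabor_def fst_conv snd_conv by (rule integral_norm_le(2)[OF i _ b]) measurable
    thus ?thesis by (simp add: mult_ac)
  qed
  thus ?thesis by blast
qed

text \<open>Integration by parts: the derivative of the whole integrand has integral zero, and where
  it falls on the exponential it produces the factor -i y_j.\<close>

lemma gabor_schwartz_by_parts:
  fixes f h :: "real^'n::finite \<Rightarrow> complex"
  assumes f: "f \<in> schwartz_space" and h: "h \<in> schwartz_space"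
  shows "\<i> * of_real (y $ j) * gabor h f (x, y) = gabor h (partial_deriv j f) (x, y) + gabor (partial_deriv j h) f (x, y)"
proof -
  let ?K = "2 * CARD('n)"
  note fj = schwartz_partial_deriv[OF f, of j] and hj = schwartz_partial_deriv[OF h, of j]
  have [measurable]: "f \<in> borel_measurable borel" "h \<in> borel_measurable borel"
    "partial_deriv j f \<in> borel_measurable borel" "partial_deriv j h \<in> borel_measurable borel"
    using schwartz_measurable f h fj hj by auto
  define H where "H t = f t * cnj (h (t - x)) * cis (- (y \<bullet> t))" for t
  define D where "D t v = (frechet_derivative f (at t) v * cnj (h (t - x)) + f t * cnj (frechet_derivative h (at (t - x)) v)) * cis (- (y \<bullet> t))
      - \<i> * of_real (y \<bullet> v) * H t" for t v
  have HD: "(H has_derivative D t) (at t)" for t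
  proof -
    have 1: "(f has_derivative frechet_derivative f (at t)) (at t)" by (rule schwartz_has_derivative[OF f])
    have "((\<lambda>t. h (t - x)) has_derivative frechet_derivative h (at (t - x))) (at t)"
      by (rule has_derivative_compose[OF _ schwartz_has_derivative[OF h]]) (auto intro!: derivative_eq_intros)
    hence 2: "((\<lambda>t. cnj (h (t - x))) has_derivative (\<lambda>v. cnj (frechet_derivative h (at (t - x)) v))) (at t)"
      by (rule bounded_linear.has_derivative[OF bounded_linear_cnj])
    have 3: "((\<lambda>t. cis (- (y \<bullet> t))) has_derivative (\<lambda>v. - \<i> * of_real (y \<bullet> v) * cis (- (y \<bullet> t)))) (at t)"
    proof -
      have "((\<lambda>t. \<i> * complex_of_real (- (y \<bullet> t))) has_derivative (\<lambda>v. \<i> * complex_of_real (- (y \<bullet> v)))) (at t)"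
        by (auto intro!: derivative_eq_intros)
      from has_derivative_compose[OF this DERIV_exp[THEN has_field_derivative_imp_has_derivative]]
      show ?thesis unfolding cis_conv_exp by (rule has_derivative_eq_rhs) (auto simp: mult_ac)
    qed
    show ?thesis unfolding H_def D_def
      by (rule has_derivative_eq_rhs[OF has_derivative_mult[OF has_derivative_mult[OF 1 2] 3]])
        (auto simp: algebra_simps)
  qed
  have Dj: "D t (axis j 1) = partial_deriv j f t * cnj (h (t - x)) * cis (- (y \<bullet> t)) + f t * cnj (partial_deriv j h (t - x)) * cis (- (y \<bullet> t))
      - \<i> * of_real (y $ j) * H t" for t
    unfolding D_def partial_deriv_def by (simp add: inner_axis algebra_simps)
  obtain A where A: "A \<ge> 0" "\<And>x. cmod (f x) \<le> A * decay x ^ ?K" using schwartz_decay[OF f] by blast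
  obtain A' where A': "A' \<ge> 0" "\<And>x. cmod (partial_deriv j f x) \<le> A' * decay x ^ ?K" using schwartz_decay[OF fj] by blast
  obtain B where B: "\<And>x. cmod (h x) \<le> B" using schwartz_bounded[OF h] by blast
  obtain B' where B': "\<And>x. cmod (partial_deriv j h x) \<le> B'" using schwartz_bounded[OF hj] by blast
  have B0: "B \<ge> 0" "B' \<ge> 0"
    using order_trans[OF norm_ge_zero B[of 0]] order_trans[OF norm_ge_zero B'[of 0]] .
  have b1: "cmod (f t * cnj (h (t - x)) * cis (- (y \<bullet> t))) \<le> A * B * decay t ^ ?K" for t
    using mult_mono[OF A(2)[of t] B[of "t - x"]] A(1) by (simp add: norm_mult mult_ac)
  have b2: "cmod (partial_deriv j f t * cnj (h (t - x)) * cis (- (y \<bullet> t))) \<le> A' * B * decay t ^ ?K" for t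
    using mult_mono[OF A'(2)[of t] B[of "t - x"]] A'(1) by (simp add: norm_mult mult_ac)
  have b3: "cmod (f t * cnj (partial_deriv j h (t - x)) * cis (- (y \<bullet> t))) \<le> A * B' * decay t ^ ?K" for t
    using mult_mono[OF A(2)[of t] B'[of "t - x"]] A(1) by (simp add: norm_mult mult_ac)
  have id: "integrable lborel (\<lambda>t::real^'n. c * decay t ^ ?K)" for c
    by (intro integrable_mult_right integrable_decay) auto
  have i: "integrable lborel H" 
    "integrable lborel (\<lambda>t. partial_deriv j f t * cnj (h (t - x)) * cis (- (y \<bullet> t)))"
    "integrable lborel (\<lambda>t. f t * cnj (partial_deriv j h (t - x)) * cis (- (y \<bullet> t)))"
    unfolding H_def
    by (rule integral_norm_le(1)[OF id _ b1] integral_norm_le(1)[OF id _ b2] integral_norm_le(1)[OF id _ b3], measurable)+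
  \<comment> \<open>A single constant that dominates both the integrand and its derivative.\<close>
  define C where "C = A * B + (A' * B + A * B' + \<bar>y $ j\<bar> * (A * B))"
  have "(\<integral>t. D t (axis j 1) \<partial>lborel) = 0"
  proof (rule integral_partial_deriv_eq_0[OF HD, where C=C])
    fix t :: "real^'n"
    have "A * B * decay t ^ ?K \<le> C * decay t ^ ?K"
      unfolding C_def using A A' B0 by (intro mult_right_mono) auto
    thus "cmod (H t) \<le> C * decay t ^ ?K" using b1[of t] unfolding H_def by linarith
    have "cmod (D t (axis j 1)) \<le> A' * B * decay t ^ ?K + A * B' * decay t ^ ?K + \<bar>y $ j\<bar> * (A * B * decay t ^ ?K)"
      unfolding Dj using b1[of t] b2[of t] b3[of t]
      by (intro order_trans[OF norm_triangle_ineq4] add_mono order_trans[OF norm_triangle_ineq])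
        (auto simp: norm_mult H_def intro!: mult_left_mono)
    also have "\<dots> \<le> C * decay t ^ ?K"
      unfolding C_def using A A' B0 by (simp add: algebra_simps)
    finally show "cmod (D t (axis j 1)) \<le> C * decay t ^ ?K" .
  qed (unfold Dj H_def, measurable)
  hence "0 = (\<integral>t. partial_deriv j f t * cnj (h (t - x)) * cis (- (y \<bullet> t)) \<partial>lborel) + (\<integral>t. f t * cnj (partial_deriv j h (t - x)) * cis (- (y \<bullet> t)) \<partial>lborel)
      - \<i> * of_real (y $ j) * (\<integral>t. H t \<partial>lborel)"
    unfolding Dj using i by simp
  thus ?thesis by (simp add: gabor_def H_def)
qed

text \<open>Each integration by parts trades a factor y_j for a derivative of f or of the window.
  These derivatives are again Schwartz functions, which is why the induction on M keeps f and h
  arbitrary; |y| is bounded by the sum of the |y_j|.\<close>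

lemma gabor_schwartz_decay_snd:
  fixes f h :: "real^'n::finite \<Rightarrow> complex"
  assumes f: "f \<in> schwartz_space" and h: "h \<in> schwartz_space"
  shows "\<exists>C. \<forall>x y. norm y ^ M * cmod (gabor h f (x, y)) \<le> C * decay x ^ N"
  using f h
proof (induction M arbitrary: f h)
  case 0
  thus ?case using gabor_schwartz_decay_fst by simp
next
  case (Suc M)
  have "\<forall>j. \<exists>C. \<forall>x y. norm y ^ M * cmod (gabor h (partial_deriv j f) (x, y)) \<le> C * decay x ^ N"
    using Suc schwartz_partial_deriv by blast
  then obtain C where C: "\<And>j x y. norm y ^ M * cmod (gabor h (partial_deriv j f) (x, y)) \<le> C j * decay x ^ N" by metis
  have "\<forall>j. \<exists>C. \<forall>x y. norm y ^ M * cmod (gabor (partial_deriv j h) f (x, y)) \<le> C * decay x ^ N"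
    using Suc schwartz_partial_deriv by blast
  then obtain C' where C': "\<And>j x y. norm y ^ M * cmod (gabor (partial_deriv j h) f (x, y)) \<le> C' j * decay x ^ N" by metis
  have "norm y ^ Suc M * cmod (gabor h f (x, y)) \<le> (\<Sum>j\<in>UNIV. C j + C' j) * decay x ^ N" for x y
  proof -
    have "norm y ^ Suc M * cmod (gabor h f (x, y)) = norm y ^ M * (norm y * cmod (gabor h f (x, y)))" by simp
    also have "\<dots> \<le> norm y ^ M * ((\<Sum>j\<in>UNIV. \<bar>y $ j\<bar>) * cmod (gabor h f (x, y)))"
      by (intro mult_left_mono mult_right_mono norm_le_l1_cart) auto
    also have "\<dots> = (\<Sum>j\<in>UNIV. norm y ^ M * (\<bar>y $ j\<bar> * cmod (gabor h f (x, y))))"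
      by (simp add: sum_distrib_left sum_distrib_right)
    also have "\<dots> \<le> (\<Sum>j\<in>UNIV. (C j + C' j) * decay x ^ N)"
    proof (rule sum_mono)
      fix j
      have "\<bar>y $ j\<bar> * cmod (gabor h f (x, y)) = cmod (\<i> * of_real (y $ j) * gabor h f (x, y))" by (simp add: norm_mult)
      also have "\<dots> \<le> cmod (gabor h (partial_deriv j f) (x, y)) + cmod (gabor (partial_deriv j h) f (x, y))"
        unfolding gabor_schwartz_by_parts[OF Suc.prems] by (rule norm_triangle_ineq)
      finally have "norm y ^ M * (\<bar>y $ j\<bar> * cmod (gabor h f (x, y))) \<le> norm y ^ M * (cmod (gabor h (partial_deriv j f) (x, y)) + cmod (gabor (partial_deriv j h) f (x, y)))"
        by (intro mult_left_mono) auto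
      also have "\<dots> \<le> (C j + C' j) * decay x ^ N"
        using C[of y j x] C'[of y j x] by (simp add: algebra_simps)
      finally show "norm y ^ M * (\<bar>y $ j\<bar> * cmod (gabor h f (x, y))) \<le> (C j + C' j) * decay x ^ N" .
    qed
    finally show ?thesis by (simp add: sum_distrib_right)
  qed
  thus ?case by blast
qed

lemma gabor_schwartz_decay:
  fixes f h :: "real^'n::finite \<Rightarrow> complex"
  assumes f: "f \<in> schwartz_space" and h: "h \<in> schwartz_space"
  shows "\<exists>C\<ge>0. \<forall>x y. cmod (gabor h f (x, y)) \<le> C * (decay x ^ N * decay y ^ M)"
proof -
  obtain C where C: "\<And>x y. norm y ^ M * cmod (gabor h f (x, y)) \<le> C * decay x ^ N"
    using gabor_schwartz_decay_snd[OF f h] by blast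
  obtain C0 where C0: "\<And>x y. cmod (gabor h f (x, y)) \<le> C0 * decay x ^ N"
    using gabor_schwartz_decay_fst[OF f h] by blast
  have "cmod (gabor h f (x, y)) \<le> (2 ^ M * (C0 + C)) * (decay x ^ N * decay y ^ M)" for x y
  proof -
    have "cmod (gabor h f (x, y)) * (1 + norm y) ^ M \<le> cmod (gabor h f (x, y)) * (2 ^ M * (1 + norm y ^ M))"
      by (intro mult_left_mono one_plus_power_le) auto
    also have "\<dots> = 2 ^ M * (cmod (gabor h f (x, y)) + norm y ^ M * cmod (gabor h f (x, y)))" by (simp add: algebra_simps)
    also have "\<dots> \<le> 2 ^ M * (C0 * decay x ^ N + C * decay x ^ N)"
      by (intro mult_left_mono add_mono C C0) auto
    finally have "cmod (gabor h f (x, y)) * (1 + norm y) ^ M \<le> 2 ^ M * (C0 + C) * decay x ^ N" by (simp add: algebra_simps)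
    moreover have "(1 + norm y) ^ M > 0" by (auto intro!: zero_less_power add_pos_nonneg)
    ultimately have "cmod (gabor h f (x, y)) \<le> (2 ^ M * (C0 + C) * decay x ^ N) / (1 + norm y) ^ M"
      by (simp add: pos_le_divide_eq)
    also have "\<dots> = (2 ^ M * (C0 + C)) * (decay x ^ N * decay y ^ M)" by (simp add: decay_def[of y] power_divide)
    finally show ?thesis .
  qed
  moreover from this[of 0 0] have "0 \<le> 2 ^ M * (C0 + C)" using order_trans[OF norm_ge_zero[of "gabor h f (0,0)"]] by (simp add: decay_def)
  ultimately show ?thesis by blast
qed

lemma integrable_decay_pair:
  assumes "N \<ge> 2 * CARD('n)" "M \<ge> 2 * CARD('n)"
  shows "integrable lborel (\<lambda>z::(real^'n::finite) \<times> (real^'n). decay (fst z) ^ N * decay (snd z) ^ M)"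
  using integrable_prod_pair[OF integrable_decay[OF assms(1)] integrable_decay[OF assms(2)]]
  by (simp add: lborel_prod case_prod_unfold)

lemma gabor_schwartz_integrable:
  fixes f h :: "real^'n::finite \<Rightarrow> complex"
  assumes f: "f \<in> schwartz_space" and h: "h \<in> schwartz_space"
  shows "integrable lborel (gabor h f)"
proof -
  obtain C where C: "C \<ge> 0" "\<And>x y. cmod (gabor h f (x, y)) \<le> C * (decay x ^ (2 * CARD('n)) * decay y ^ (2 * CARD('n)))"
    using gabor_schwartz_decay[OF f h] by blast
  have [measurable]: "f \<in> borel_measurable borel" "h \<in> borel_measurable borel" using schwartz_measurable f h by auto
  have "integrable lborel (\<lambda>z::(real^'n) \<times> (real^'n). C * (decay (fst z) ^ (2 * CARD('n)) * decay (snd z) ^ (2 * CARD('n))))"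
    by (intro integrable_mult_right integrable_decay_pair) auto
  thus ?thesis
    by (rule Bochner_Integration.integrable_bound) (use C in \<open>auto simp: abs_mult split_paired_all\<close>)
qed

section \<open>Gaussians are Schwartz functions\<close>

definition gaussian :: "real \<Rightarrow> real^'n::finite \<Rightarrow> complex" where
  "gaussian a t = of_real (exp (- a * (norm t)\<^sup>2))"

text \<open>The polynomial multiples of one Gaussian. Generating them by rules gives stability under
  partial derivatives, and decay, by rule induction without any handling of multivariate
  polynomials.\<close>

inductive poly_gaussian :: "real \<Rightarrow> (real^'n::finite \<Rightarrow> complex) \<Rightarrow> bool" for a where
  base: "poly_gaussian a (gaussian a)"
| coord: "poly_gaussian a f \<Longrightarrow> poly_gaussian a (\<lambda>t. of_real (t $ j) * f t)"
| add: "poly_gaussian a f \<Longrightarrow> poly_gaussian a h \<Longrightarrow> poly_gaussian a (\<lambda>t. f t + h t)"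
| cmult: "poly_gaussian a f \<Longrightarrow> poly_gaussian a (\<lambda>t. c * f t)"

lemma gaussian_has_derivative:
  "(gaussian a has_derivative (\<lambda>v. - 2 * of_real a * of_real (t \<bullet> v) * gaussian a t)) (at t)"
  unfolding gaussian_def power2_norm_eq_inner
  by (auto intro!: derivative_eq_intros simp: inner_commute)

lemma poly_gaussian_derivative:
  assumes "poly_gaussian a f"
  shows "(\<forall>t. f differentiable at t) \<and> poly_gaussian a (partial_deriv j f)"
  using assms
proof induction
  case base
  have "partial_deriv j (gaussian a) = (\<lambda>t. (- 2 * of_real a) * (of_real (t $ j) * gaussian a t))"
    by (rule ext) (simp add: partial_deriv_eqI[OF gaussian_has_derivative] inner_axis mult.assoc)
  moreover have "poly_gaussian a (\<lambda>t. (- 2 * of_real a) * (of_real (t $ j) * gaussian a t))"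
    by (intro poly_gaussian.intros)
  ultimately show ?case using gaussian_has_derivative by (metis differentiableI)
next
  case (coord f i)
  have "(f has_derivative frechet_derivative f (at t)) (at t)" for t
    using coord frechet_derivative_works by blast
  hence d: "((\<lambda>t. of_real (t $ i) * f t) has_derivative (\<lambda>v. of_real (t $ i) * frechet_derivative f (at t) v + of_real (v $ i) * f t)) (at t)" for t
    by (intro has_derivative_mult) (auto intro!: derivative_eq_intros bounded_linear.has_derivative[OF bounded_linear_vec_nth])
  have "partial_deriv j (\<lambda>t. of_real (t $ i) * f t) = (\<lambda>t. of_real (t $ i) * partial_deriv j f t + (if i = j then 1 else 0) * f t)"
    by (rule ext) (subst partial_deriv_eqI[OF d], auto simp: axis_def partial_deriv_def)
  thus ?case using coord d by (auto simp: differentiable_def intro!: poly_gaussian.intros)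
next
  case (add f h)
  have "(f has_derivative frechet_derivative f (at t)) (at t)" "(h has_derivative frechet_derivative h (at t)) (at t)" for t
    using add frechet_derivative_works by blast+
  hence d: "((\<lambda>t. f t + h t) has_derivative (\<lambda>v. frechet_derivative f (at t) v + frechet_derivative h (at t) v)) (at t)" for t
    by (intro has_derivative_add)
  have "partial_deriv j (\<lambda>t. f t + h t) = (\<lambda>t. partial_deriv j f t + partial_deriv j h t)"
    by (rule ext) (subst partial_deriv_eqI[OF d], auto simp: partial_deriv_def)
  thus ?case using add d by (auto simp: differentiable_def intro!: poly_gaussian.intros)
next
  case (cmult f c)
  have "(f has_derivative frechet_derivative f (at t)) (at t)" for t
    using cmult frechet_derivative_works by blast
  hence d: "((\<lambda>t. c * f t) has_derivative (\<lambda>v. c * frechet_derivative f (at t) v)) (at t)" for t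
    by (intro has_derivative_mult_right)
  have "partial_deriv j (\<lambda>t. c * f t) = (\<lambda>t. c * partial_deriv j f t)"
    by (rule ext) (subst partial_deriv_eqI[OF d], auto simp: partial_deriv_def)
  thus ?case using cmult d by (auto simp: differentiable_def intro!: poly_gaussian.intros)
qed

text \<open>From x <= e^x at x = a r^2 / k, raised to the power k, the product of r^(2k) and the
  Gaussian is at most (k/a)^k; then r^k <= 1 + r^(2k).\<close>

lemma gaussian_power_bounded:
  assumes a: "a > 0"
  shows "\<exists>C. \<forall>r\<ge>0. r ^ k * exp (- a * r\<^sup>2) \<le> (C::real)"
proof (cases "k = 0")
  case True
  thus ?thesis using a by (intro exI[of _ 1]) auto
next
  case False
  have "r ^ k * exp (- a * r\<^sup>2) \<le> 1 + (real k / a) ^ k" if r: "r \<ge> 0" for r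
  proof -
    have "r\<^sup>2 ^ k * exp (- a * r\<^sup>2) \<le> (real k / a) ^ k"
    proof -
      have "a * r\<^sup>2 / real k \<le> exp (a * r\<^sup>2 / real k)"
        using exp_ge_add_one_self[of "a * r\<^sup>2 / real k"] by linarith
      hence "(a * r\<^sup>2 / real k) ^ k \<le> exp (a * r\<^sup>2 / real k) ^ k"
        using a by (intro power_mono) auto
      also have "\<dots> = exp (a * r\<^sup>2)" using False by (simp flip: exp_of_nat_mult)
      finally have "(a * r\<^sup>2 / real k) ^ k * exp (- (a * r\<^sup>2)) \<le> exp (a * r\<^sup>2) * exp (- (a * r\<^sup>2))"
        by (intro mult_right_mono) auto
      hence "(a * r\<^sup>2 / real k) ^ k * exp (- a * r\<^sup>2) \<le> 1" by (simp only: exp_minus_inverse mult_minus_left)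
      hence "(real k / a) ^ k * ((a * r\<^sup>2 / real k) ^ k * exp (- a * r\<^sup>2)) \<le> (real k / a) ^ k"
        using a by (intro mult_left_le) auto
      thus ?thesis using a False by (simp add: power_mult_distrib power_divide)
    qed
    moreover have "r ^ k \<le> 1 + r\<^sup>2 ^ k"
    proof (cases "r \<le> 1")
      case True
      thus ?thesis using power_le_one[OF r True, of k] zero_le_power[of "r\<^sup>2" k, OF zero_le_power2] by linarith
    next
      case False
      hence "r ^ k \<le> r\<^sup>2 ^ k" using r by (intro power_mono) (auto simp: power2_eq_square)
      thus ?thesis by simp
    qed
    moreover have "(1 + r\<^sup>2 ^ k) * exp (- a * r\<^sup>2) \<le> exp (- a * r\<^sup>2) + r\<^sup>2 ^ k * exp (- a * r\<^sup>2)"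
      by (simp add: algebra_simps)
    moreover have "exp (- a * r\<^sup>2) \<le> 1" using a by simp
    ultimately show ?thesis
      using mult_right_mono[of "r ^ k" "1 + r\<^sup>2 ^ k" "exp (- a * r\<^sup>2)"] exp_ge_zero[of "- a * r\<^sup>2"] by linarith
  qed
  thus ?thesis by blast
qed

lemma poly_gaussian_decay:
  assumes "poly_gaussian a f" and a: "a > 0"
  shows "\<exists>C. \<forall>x. norm x ^ k * cmod (f x) \<le> C"
  using assms(1)
proof (induction arbitrary: k)
  case base
  obtain C where "\<And>r. r \<ge> 0 \<Longrightarrow> r ^ k * exp (- a * r\<^sup>2) \<le> C" using gaussian_power_bounded[OF a] by blast
  thus ?case by (intro exI[of _ C]) (auto simp: gaussian_def)
next
  case (coord f j)
  \<comment> \<open>A coordinate factor costs one power of the norm, hence the bound for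
    \<open>Suc k\<close>; this is why k stays arbitrary in the induction.\<close>
  obtain C where C: "\<And>x. norm x ^ Suc k * cmod (f x) \<le> C" using coord.IH[of "Suc k"] by blast
  have "norm x ^ k * cmod (of_real (x $ j) * f x) \<le> C" for x
  proof -
    have "norm x ^ k * cmod (of_real (x $ j) * f x) = norm x ^ k * cmod (f x) * \<bar>x $ j\<bar>" by (simp add: norm_mult)
    also have "\<dots> \<le> norm x ^ k * cmod (f x) * norm x"
      by (intro mult_left_mono component_le_norm_cart) auto
    also have "\<dots> \<le> C" using C[of x] by (simp add: mult_ac)
    finally show ?thesis .
  qed
  thus ?case by blast
next
  case (add f h)
  obtain C D where "\<And>x. norm x ^ k * cmod (f x) \<le> C" "\<And>x. norm x ^ k * cmod (h x) \<le> D" using add by metis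
  hence "norm x ^ k * cmod (f x) + norm x ^ k * cmod (h x) \<le> C + D" for x by (intro add_mono)
  hence "norm x ^ k * (cmod (f x) + cmod (h x)) \<le> C + D" for x by (simp add: distrib_left)
  hence "norm x ^ k * cmod (f x + h x) \<le> C + D" for x
    by (rule order_trans[OF mult_left_mono[OF norm_triangle_ineq], rotated]) auto
  thus ?case by blast
next
  case (cmult f c)
  obtain C where "\<And>x. norm x ^ k * cmod (f x) \<le> C" using cmult by metis
  hence "norm x ^ k * cmod (c * f x) \<le> cmod c * C" for x
    using mult_left_mono[of "norm x ^ k * cmod (f x)" C "cmod c"] by (simp add: norm_mult mult_ac)
  thus ?case by blast
qed

lemma gaussian_schwartz:
  assumes "a > 0" shows "gaussian a \<in> schwartz_space"
proof -
  have "poly_gaussian a (foldr partial_deriv js (gaussian a))" for js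
    by (induct js) (auto intro: poly_gaussian.base simp: poly_gaussian_derivative)
  moreover have "f differentiable_on UNIV" if "poly_gaussian a f" for f
    using poly_gaussian_derivative[OF that] by (simp add: differentiable_on_def)
  moreover have "bounded (range (\<lambda>x. norm x ^ k *\<^sub>R f x))" if "poly_gaussian a f" for f k
    using poly_gaussian_decay[OF that assms, of k] by (auto simp: bounded_iff)
  ultimately show ?thesis unfolding schwartz_space_def by blast
qed

section \<open>Gaussian packets and coherent states\<close>

definition packet :: "real \<Rightarrow> real^'n::finite \<Rightarrow> real^'n \<Rightarrow> real^'n \<Rightarrow> complex" where
  "packet a x y t = cis (y \<bullet> t) * gaussian a (t - x)"

lemma gaussian_continuous_on [continuous_intros]:
  "continuous_on A f \<Longrightarrow> continuous_on A (\<lambda>x. gaussian a (f x))"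
  unfolding gaussian_def by (intro continuous_intros)

lemma gaussian_measurable [measurable]: "gaussian a \<in> borel_measurable borel"
  by (intro borel_measurable_continuous_onI continuous_intros)

lemma gaussian_le_1: "a \<ge> 0 \<Longrightarrow> cmod (gaussian a t) \<le> 1"
  by (simp add: gaussian_def)

lemma cnj_gaussian [simp]: "cnj (gaussian a t) = gaussian a t"
  by (simp add: gaussian_def)

text \<open>Covariance under time-frequency shifts, by the substitution t = u + x: shifting the
  function translates its Gabor transform, up to a unimodular factor. All packets of one width
  therefore have Gabor transforms of the same L1 norm.\<close>

lemma gabor_packet:
  assumes [measurable]: "g \<in> borel_measurable borel"
  shows "gabor g (packet a x y) z = cis ((y - snd z) \<bullet> x) * gabor g (gaussian a) (z - (x, y))"
proof -
  have "gabor g (packet a x y) z = (\<integral>u. packet a x y (u + x) * cnj (g (u + x - fst z)) * cis (- (snd z \<bullet> (u + x))) \<partial>lborel)"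
    unfolding gabor_def packet_def
    by (rule lborel_integral_translate(2)[symmetric]) measurable
  also have "\<dots> = (\<integral>u. cis ((y - snd z) \<bullet> x) * (gaussian a u * cnj (g (u - fst (z - (x, y)))) * cis (- (snd (z - (x, y)) \<bullet> u))) \<partial>lborel)"
  proof (rule Bochner_Integration.integral_cong[OF refl])
    fix u
    have c: "cis (y \<bullet> (u + x)) * cis (- (snd z \<bullet> (u + x))) = cis ((y - snd z) \<bullet> x) * cis (- (snd (z - (x, y)) \<bullet> u))"
      by (simp add: cis_mult inner_simps algebra_simps)
    have d: "u + x - fst z = u - fst (z - (x, y))" by simp
    have "packet a x y (u + x) * cnj (g (u + x - fst z)) * cis (- (snd z \<bullet> (u + x)))
      = (cis (y \<bullet> (u + x)) * cis (- (snd z \<bullet> (u + x)))) * (gaussian a u * cnj (g (u + x - fst z)))"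
      by (simp add: packet_def)
    thus "packet a x y (u + x) * cnj (g (u + x - fst z)) * cis (- (snd z \<bullet> (u + x)))
      = cis ((y - snd z) \<bullet> x) * (gaussian a u * cnj (g (u - fst (z - (x, y)))) * cis (- (snd (z - (x, y)) \<bullet> u)))"
      unfolding c d by (simp only: mult_ac)
  qed
  also have "\<dots> = cis ((y - snd z) \<bullet> x) * gabor g (gaussian a) (z - (x, y))"
    unfolding gabor_def by (rule integral_mult_right_zero)
  finally show ?thesis .
qed

lemma gabor_cmult: "gabor g (\<lambda>t. c * h t) z = c * gabor g h z"
  unfolding gabor_def by (simp only: mult.assoc integral_mult_right_zero)

lemma L2_gabor_integrable:
  assumes h: "h \<in> L2_space" and g: "g \<in> L2_space"
  shows "integrable lborel (\<lambda>t. h t * cnj (g (t - fst z)) * cis (- (snd z \<bullet> t)))"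
proof -
  have [measurable]: "h \<in> borel_measurable borel" "g \<in> borel_measurable borel" using h g by (auto simp: L2_space_def)
  have "integrable lborel (\<lambda>t. h t * cnj (g (t - fst z)))"
    by (intro L2_mult_integrable(1) h L2_space_cnj L2_space_translate g)
  thus ?thesis by (rule Bochner_Integration.integrable_bound) (auto simp: norm_mult)
qed

lemma gabor_add:
  assumes "h \<in> L2_space" "k \<in> L2_space" "g \<in> L2_space"
  shows "gabor g (\<lambda>t. h t + k t) z = gabor g h z + gabor g k z"
  unfolding gabor_def using L2_gabor_integrable[OF assms(1,3)] L2_gabor_integrable[OF assms(2,3)]
  by (simp add: distrib_right)

lemma gabor_diff:
  assumes "h \<in> L2_space" "k \<in> L2_space" "g \<in> L2_space"
  shows "gabor g (\<lambda>t. h t - k t) z = gabor g h z - gabor g k z"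
  unfolding gabor_def using L2_gabor_integrable[OF assms(1,3)] L2_gabor_integrable[OF assms(2,3)]
  by (simp add: left_diff_distrib)

lemma gabor_cong_AE:
  assumes [measurable]: "h \<in> borel_measurable borel" "k \<in> borel_measurable borel" "g \<in> borel_measurable borel"
    and ae: "AE t in lborel. h t = k t"
  shows "gabor g h = gabor g k"
  unfolding gabor_def by (rule ext, rule integral_cong_AE) (use ae in \<open>auto elim!: eventually_mono\<close>)

lemma gabor_packet_integral:
  assumes g: "g \<in> schwartz_space" and a: "a > 0" and w: "cmod w = 1"
  shows "integrable lborel (gabor g (\<lambda>t. w * packet a x y t))"
    and "(\<integral>z. cmod (gabor g (\<lambda>t. w * packet a x y t) z) \<partial>lborel) = (\<integral>z. cmod (gabor g (gaussian a) z) \<partial>lborel)"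
proof -
  have gm[measurable]: "g \<in> borel_measurable borel" using schwartz_measurable[OF g] .
  have G: "integrable lborel (gabor g (gaussian a))" by (intro gabor_schwartz_integrable gaussian_schwartz g a)
  have n: "cmod (gabor g (\<lambda>t. w * packet a x y t) z) = cmod (gabor g (gaussian a) (z - (x, y)))" for z
    using w by (simp add: gabor_cmult gabor_packet[OF gm] norm_mult)
  have [measurable]: "(\<lambda>t. w * packet a x y t) \<in> borel_measurable borel" unfolding packet_def by measurable
  show "integrable lborel (gabor g (\<lambda>t. w * packet a x y t))"
    by (rule Bochner_Integration.integrable_bound[OF lborel_integrable_translate(3)[OF G, of "(x, y)"]]) (auto simp: n)
  show "(\<integral>z. cmod (gabor g (\<lambda>t. w * packet a x y t) z) \<partial>lborel) = (\<integral>z. cmod (gabor g (gaussian a) z) \<partial>lborel)"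
    unfolding n by (rule lborel_integral_translate(3)) measurable
qed

text \<open>By covariance the constants in the superposition principle do not depend on the points
  at which the packets sit. The centres x, y and the phase w are arbitrary measurable functions of
  the parameter, because products, conjugates and evolved functions come as superpositions with
  transformed parameters.\<close>

lemma packet_superposition:
  fixes c w :: "'p::euclidean_space \<Rightarrow> complex" and x y :: "'p \<Rightarrow> real^'n::finite"
  assumes a: "a > 0" and g: "g \<in> schwartz_space" and c: "integrable lborel c"
    and w: "\<And>p. cmod (w p) = 1"
    and m[measurable]: "w \<in> borel_measurable borel" "x \<in> borel_measurable borel" "y \<in> borel_measurable borel"
  defines "f \<equiv> \<lambda>t. \<integral>p. c p * (w p * packet a (x p) (y p) t) \<partial>lborel"
  shows "integrable lborel f" and "f \<in> L2_space" and "continuous_on UNIV f"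
    and "integrable lborel (gabor g f)"
    and "(\<integral>z. cmod (gabor g f z) \<partial>lborel) \<le> (\<integral>z. cmod (gabor g (gaussian a) z) \<partial>lborel) * (\<integral>p. cmod (c p) \<partial>lborel)"
    and "\<And>t. cmod (f t) \<le> (\<integral>p. cmod (c p) \<partial>lborel)"
proof -
  define A where "A p t = w p * packet a (x p) (y p) t" for p t
  have Am: "(\<lambda>(p, t). A p t) \<in> borel_measurable (borel \<Otimes>\<^sub>M borel)"
    unfolding A_def packet_def by measurable
  have gi: "integrable lborel (gaussian a :: real^'n \<Rightarrow> complex)" by (intro schwartz_integrable gaussian_schwartz a)
  define B where "B = max 1 (\<integral>t. cmod (gaussian a (t::real^'n)) \<partial>lborel)"
  have An: "cmod (A p t) = cmod (gaussian a (t - x p))" for p t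
    by (simp add: A_def packet_def norm_mult w)
  have A00: "cmod (A p t) \<le> 1" for p t unfolding An using gaussian_le_1[of a] a by simp
  have A0: "cmod (A p t) \<le> B" for p t using A00[of p t] by (simp add: B_def)
  have At[measurable]: "A p \<in> borel_measurable borel" for p unfolding A_def packet_def by measurable
  have A1: "integrable lborel (A p)" for p
    by (rule Bochner_Integration.integrable_bound[OF lborel_integrable_translate(3)[OF gi, of "x p"]]) (auto simp: An)
  have A2: "(\<integral>t. cmod (A p t) \<partial>lborel) \<le> B" for p
    unfolding An B_def by (subst lborel_integral_translate(3)[of "\<lambda>t. cmod (gaussian a t)"]) auto
  have Ac: "continuous_on UNIV (A p)" for p unfolding A_def packet_def by (intro continuous_intros)
  have G1: "integrable lborel (gabor g (A p))" for p
    unfolding A_def[abs_def] by (rule gabor_packet_integral(1)[OF g a w])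
  have G2: "(\<integral>z. cmod (gabor g (A p) z) \<partial>lborel) \<le> (\<integral>z. cmod (gabor g (gaussian a) z) \<partial>lborel)" for p
    unfolding A_def[abs_def] by (rule eq_refl[OF gabor_packet_integral(2)[OF g a w]])
  note S = superposition[OF c Am A0 A1 A2 schwartz_integrable[OF g] G1 G2]
  have f: "f = (\<lambda>t. \<integral>p. c p * A p t \<partial>lborel)" unfolding f_def A_def ..
  show "integrable lborel f" "f \<in> L2_space" "continuous_on UNIV f" "integrable lborel (gabor g f)"
    "(\<integral>z. cmod (gabor g f z) \<partial>lborel) \<le> (\<integral>z. cmod (gabor g (gaussian a) z) \<partial>lborel) * (\<integral>p. cmod (c p) \<partial>lborel)"
    unfolding f by (rule S(1) S(3) S(8)[OF Ac] S(5) S(7))+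
  have cm[measurable]: "c \<in> borel_measurable borel" using c by auto
  have Atm[measurable]: "(\<lambda>p. A p t) \<in> borel_measurable borel" for t unfolding A_def packet_def by measurable
  show "cmod (f t) \<le> (\<integral>p. cmod (c p) \<partial>lborel)" for t
    unfolding f
    by (rule integral_norm_le(2)) (use c A00 in \<open>auto simp: norm_mult intro!: mult_left_le\<close>)
qed

lemma gaussian_square_integral:
  "(\<integral>u. gaussian (1/2) u * cnj (gaussian (1/2) (u::real^'n::finite)) \<partial>lborel) \<noteq> 0"
proof -
  have eq: "gaussian (1/2) u * cnj (gaussian (1/2) u) = complex_of_real (exp (- (sqrt 2)\<^sup>2 * (norm u)\<^sup>2 / 2)) * cis (u \<bullet> 0)" for u :: "real^'n"
    by (simp add: gaussian_def flip: of_real_mult exp_add)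
  show ?thesis
    unfolding eq by (subst gaussian_fourier(2)) (auto simp: heat_kernel_def)
qed

text \<open>If every pairing vanished, the Fourier transform of the Gaussian times the conjugate of
  g would be zero. So would the heat-kernel averages of this product, which are Gaussian-weighted
  integrals of its Fourier transform; by continuity they converge to the product itself, and the
  Gaussian has no zeros. The modulation found here makes a Gaussian usable as a synthesis window for
  g.\<close>

lemma window_modulation_nonzero:
  fixes g :: "real^'n::finite \<Rightarrow> complex"
  assumes g: "integrable lborel g" "continuous_on UNIV g" "\<And>t. cmod (g t) \<le> B" and nz: "g \<noteq> (\<lambda>_. 0)"
  shows "\<exists>y. (\<integral>u. (cis (y \<bullet> u) * gaussian (1/2) u) * cnj (g u) \<partial>lborel) \<noteq> 0"
proof (rule ccontr)
  assume "\<not> ?thesis"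
  hence z: "(\<integral>u. (cis (y \<bullet> u) * gaussian (1/2) u) * cnj (g u) \<partial>lborel) = 0" for y by blast
  have gm[measurable]: "g \<in> borel_measurable borel" using g by auto
  have "g t = 0" for t
  proof -
    define p where "p u = gaussian (1/2) u * cnj (g u)" for u
    have pm[measurable]: "p \<in> borel_measurable borel" unfolding p_def by measurable
    have pb: "cmod (p u) \<le> cmod (g u)" for u
      using mult_right_mono[OF gaussian_le_1[of "1/2" u], of "cmod (g u)"] by (simp add: p_def norm_mult)
    have pi: "integrable lborel p"
      by (rule Bochner_Integration.integrable_bound[OF g(1)]) (use pb in auto)
    have zero: "(\<integral>v. complex_of_real (heat_kernel (1 / Suc k) v) * p (v + t) \<partial>lborel) = 0" for k
    proof -
      define e where "e = 1 / real (Suc k)"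
      have e: "e > 0" by (simp add: e_def)
      have hkm[measurable]: "(heat_kernel e :: real^'n \<Rightarrow> real) \<in> borel_measurable borel"
        using heat_kernel_integrable[OF e] by auto
      define E where "E y = complex_of_real (exp (- e\<^sup>2 * (norm (y::real^'n))\<^sup>2 / 2))" for y
      have Em[measurable]: "E \<in> borel_measurable borel" unfolding E_def by measurable
      have Ei: "integrable lborel E"
        using gaussian_fourier(1)[OF e, of 0] by (simp add: E_def[abs_def])
      have int: "integrable (lborel \<Otimes>\<^sub>M lborel) (\<lambda>(u, y). p u * (E y * cis (y \<bullet> (u - t))))"
        by (rule Bochner_Integration.integrable_bound[OF integrable_prod_pair[OF pi Ei]]) (auto simp: norm_mult)
      have "0 = (\<integral>y. E y * cis (- (y \<bullet> t)) * (\<integral>u. (cis (y \<bullet> u) * gaussian (1/2) u) * cnj (g u) \<partial>lborel) \<partial>lborel)"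
        unfolding z by simp
      also have "\<dots> = (\<integral>y. (\<integral>u. p u * (E y * cis (y \<bullet> (u - t))) \<partial>lborel) \<partial>lborel)"
      proof (rule Bochner_Integration.integral_cong[OF refl])
        fix y
        have "E y * cis (- (y \<bullet> t)) * ((cis (y \<bullet> u) * gaussian (1/2) u) * cnj (g u)) = p u * (E y * cis (y \<bullet> (u - t)))" for u
        proof -
          have "cis (y \<bullet> (u - t)) = cis (- (y \<bullet> t)) * cis (y \<bullet> u)" by (simp add: cis_mult inner_diff_right)
          thus ?thesis by (simp only: p_def mult_ac)
        qed
        thus "E y * cis (- (y \<bullet> t)) * (\<integral>u. (cis (y \<bullet> u) * gaussian (1/2) u) * cnj (g u) \<partial>lborel) = (\<integral>u. p u * (E y * cis (y \<bullet> (u - t))) \<partial>lborel)"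
          by (simp only: integral_mult_right_zero[symmetric])
      qed
      also have "\<dots> = (\<integral>u. (\<integral>y. p u * (E y * cis (y \<bullet> (u - t))) \<partial>lborel) \<partial>lborel)"
        by (rule lborel_pair.Fubini_integral[OF int])
      also have "\<dots> = (\<integral>u. (2 * pi) ^ CARD('n) * (complex_of_real (heat_kernel e (u - t)) * p u) \<partial>lborel)"
        by (rule Bochner_Integration.integral_cong[OF refl])
          (simp only: integral_mult_right_zero E_def gaussian_fourier(2)[OF e], simp add: mult_ac)
      also have "\<dots> = (2 * pi) ^ CARD('n) * (\<integral>u. complex_of_real (heat_kernel e (u - t)) * p u \<partial>lborel)"
        by (rule integral_mult_right_zero)
      also have "(\<integral>u. complex_of_real (heat_kernel e (u - t)) * p u \<partial>lborel) = (\<integral>v. complex_of_real (heat_kernel e v) * p (v + t) \<partial>lborel)"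
        by (subst lborel_integral_translate(2)[of _ t, symmetric]) auto
      finally show ?thesis by (simp add: e_def)
    qed
    have "(\<lambda>k. \<integral>v. complex_of_real (heat_kernel (1 / Suc k) v) * p (v + t) \<partial>lborel) \<longlonglongrightarrow> p (0 + t)"
    proof (rule heat_kernel_tendsto)
      show "norm (p (v + t)) \<le> B" for v by (rule order_trans[OF pb g(3)])
      have "continuous_on UNIV (\<lambda>v. p (v + t))"
        unfolding p_def by (intro continuous_intros continuous_on_compose2[OF g(2)]) auto
      thus "isCont (\<lambda>v. p (v + t)) 0" by (simp add: continuous_on_eq_continuous_at)
    qed measurable
    hence "p t = 0" unfolding zero using LIMSEQ_unique[OF tendsto_const] by fastforce
    thus "g t = 0" by (auto simp: p_def gaussian_def)
  qed
  with nz show False by auto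
qed

text \<open>The exponent 1/2 makes this, up to normalization, the ground state of the Hermite
  operator; only for this width does the evolution send coherent states to coherent states.\<close>

abbreviation base_window :: "real^'n::finite \<Rightarrow> complex" where
  "base_window \<equiv> gaussian (1/2)"

lemma base_window_schwartz: "base_window \<in> schwartz_space"
  by (rule gaussian_schwartz) simp

lemmas base_window_L2 = schwartz_L2_space[OF base_window_schwartz]

text \<open>Continuity selects one function from each almost-everywhere class, so that the Banach
  space can be a subtype instead of a quotient.\<close>

definition m11_set :: "(real^'n::finite \<Rightarrow> complex) set" where
  "m11_set = {f. continuous_on UNIV f \<and> f \<in> L2_space \<and> integrable lborel (gabor base_window f)}"

definition m11_set_norm :: "(real^'n::finite \<Rightarrow> complex) \<Rightarrow> real" where
  "m11_set_norm f = (\<integral>z. cmod (gabor base_window f z) \<partial>lborel)"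

text \<open>With the phase \<open>exp (- i x \<cdot> y / 2)\<close> the Hermite propagator acts on coherent states by a
  rotation of \<open>(x, y)\<close> and a scalar factor that does not depend on \<open>(x, y)\<close>.\<close>

definition coherent :: "(real^'n::finite) \<times> (real^'n) \<Rightarrow> real^'n \<Rightarrow> complex" where
  "coherent z t = cis (- (fst z \<bullet> snd z) / 2) * packet (1/2) (fst z) (snd z) t"

text \<open>The normalizing factor of the inversion formula when the Gaussian serves both for
  analysis and for synthesis; the type argument carries the dimension.\<close>

definition coherent_const :: "'n::finite itself \<Rightarrow> complex" where
  "coherent_const _ = 1 / ((2 * pi) ^ CARD('n) * (\<integral>u. base_window u * cnj (base_window (u::real^'n)) \<partial>lborel))"

text \<open>The phase undoes the one built into \<open>coherent\<close>. The modulus is a constant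
  multiple of the Gabor transform, so the L1 norm of the coefficients is proportional to the norm of
  f.\<close>

definition coherent_coeff :: "(real^'n::finite \<Rightarrow> complex) \<Rightarrow> (real^'n) \<times> (real^'n) \<Rightarrow> complex" where
  "coherent_coeff f z = coherent_const TYPE('n) * cis ((fst z \<bullet> snd z) / 2) * gabor base_window f z"

lemma m11_set_measurable: "f \<in> m11_set \<Longrightarrow> f \<in> borel_measurable borel"
  by (auto simp: m11_set_def intro: borel_measurable_continuous_onI)

lemma coherent_coeff_integrable:
  assumes f: "f \<in> m11_set"
  shows "integrable lborel (coherent_coeff f)"
    and "(\<integral>z. cmod (coherent_coeff f z) \<partial>lborel) = cmod (coherent_const TYPE('n::finite)) * m11_set_norm (f :: real^'n \<Rightarrow> complex)"
proof -
  have [measurable]: "f \<in> borel_measurable borel" using m11_set_measurable[OF f] .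
  have "integrable lborel (\<lambda>z. coherent_const TYPE('n) * gabor base_window f z)"
    using f by (auto simp: m11_set_def)
  thus "integrable lborel (coherent_coeff f)"
    by (rule Bochner_Integration.integrable_bound) (auto simp: coherent_coeff_def[abs_def] norm_mult)
  show "(\<integral>z. cmod (coherent_coeff f z) \<partial>lborel) = cmod (coherent_const TYPE('n)) * m11_set_norm f"
    by (simp add: coherent_coeff_def norm_mult m11_set_norm_def)
qed

text \<open>Both sides are continuous, so the inversion formula, known almost everywhere, holds at
  every point.\<close>

lemma m11_inversion:
  fixes f :: "real^'n::finite \<Rightarrow> complex"
  assumes f: "f \<in> m11_set"
  shows "f = (\<lambda>t. \<integral>z. coherent_coeff f z * coherent z t \<partial>lborel)"
proof (rule continuous_AE_eq)
  show "continuous_on UNIV f" using f by (simp add: m11_set_def)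
  show "continuous_on UNIV (\<lambda>t. \<integral>z. coherent_coeff f z * coherent z t \<partial>lborel)"
    unfolding coherent_def
    by (rule packet_superposition(3)[OF _ base_window_schwartz coherent_coeff_integrable(1)[OF f]]) auto
  have ae: "AE t in lborel. f t * (\<integral>u. base_window u * cnj (base_window (u::real^'n)) \<partial>lborel) =
    (\<integral>z. gabor base_window f z * (cis (snd z \<bullet> t) * base_window (t - fst z)) \<partial>lborel) / (2 * pi) ^ CARD('n)"
    by (rule gabor_inversion[where Bg=1 and By=1])
      (use f schwartz_integrable[OF base_window_schwartz] schwartz_continuous[OF base_window_schwartz] in
        \<open>simp_all add: m11_set_def gaussian_le_1\<close>)
  have eq: "coherent_coeff f z * coherent z t = coherent_const TYPE('n) * (gabor base_window f z * (cis (snd z \<bullet> t) * base_window (t - fst z)))" for z t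
  proof -
    have "cis ((fst z \<bullet> snd z) / 2) * cis (- (fst z \<bullet> snd z) / 2) = 1" by (simp add: cis_mult)
    hence "coherent_const TYPE('n) * (gabor base_window f z * (cis (snd z \<bullet> t) * base_window (t - fst z)))
      = coherent_const TYPE('n) * (gabor base_window f z * (cis (snd z \<bullet> t) * base_window (t - fst z))) * (cis ((fst z \<bullet> snd z) / 2) * cis (- (fst z \<bullet> snd z) / 2))"
      by simp
    thus ?thesis unfolding coherent_coeff_def coherent_def packet_def by (simp only: mult_ac)
  qed
  show "AE t in lborel. f t = (\<integral>z. coherent_coeff f z * coherent z t \<partial>lborel)"
    using ae
  proof eventually_elim
    case (elim t)
    let ?I = "\<integral>u. base_window u * cnj (base_window (u::real^'n)) \<partial>lborel"
    let ?J = "\<integral>z. gabor base_window f z * (cis (snd z \<bullet> t) * base_window (t - fst z)) \<partial>lborel"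
    have "(\<integral>z. coherent_coeff f z * coherent z t \<partial>lborel) = coherent_const TYPE('n) * ?J"
      unfolding eq by (rule integral_mult_right_zero)
    also have "\<dots> = (?J / (2 * pi) ^ CARD('n)) / ?I" by (simp add: coherent_const_def)
    also have "\<dots> = f t" unfolding elim[symmetric] using gaussian_square_integral[where 'n='n] by simp
    finally show ?case by simp
  qed
qed

lemma packet_superposition_m11:
  fixes c w :: "'p::euclidean_space \<Rightarrow> complex" and x y :: "'p \<Rightarrow> real^'n::finite"
  assumes a: "a > 0" and c: "integrable lborel c"
    and w: "\<And>p. cmod (w p) = 1"
    and m: "w \<in> borel_measurable borel" "x \<in> borel_measurable borel" "y \<in> borel_measurable borel"
  shows "(\<lambda>t. \<integral>p. c p * (w p * packet a (x p) (y p) t) \<partial>lborel) \<in> m11_set"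
    and "m11_set_norm (\<lambda>t. \<integral>p. c p * (w p * packet a (x p) (y p) t) \<partial>lborel)
      \<le> m11_set_norm (gaussian a :: real^'n \<Rightarrow> complex) * (\<integral>p. cmod (c p) \<partial>lborel)"
  using packet_superposition[OF a base_window_schwartz c w m]
  by (auto simp: m11_set_def m11_set_norm_def)

section \<open>The Banach space \<open>M\<^sup>1\<^sup>,\<^sup>1\<close>\<close>

typedef (overloaded) ('n::finite) m11 = "m11_set :: (real^'n \<Rightarrow> complex) set"
  morphisms rep_m11 abs_m11
proof
  have "gabor base_window (\<lambda>_::real^'n. 0) = (\<lambda>_. 0)" by (rule ext) (simp add: gabor_def)
  thus "(\<lambda>_. 0) \<in> (m11_set :: (real^'n \<Rightarrow> complex) set)"
    by (auto simp: m11_set_def L2_space_def)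
qed

lemma m11_eqI: "(\<And>x. rep_m11 f x = rep_m11 g x) \<Longrightarrow> f = g"
  by (metis ext rep_m11_inject)

lemma rep_m11_L2 [simp]: "rep_m11 f \<in> L2_space"
  using rep_m11[of f] by (simp add: m11_set_def)

lemma rep_m11_continuous: "continuous_on UNIV (rep_m11 f)"
  using rep_m11[of f] by (simp add: m11_set_def)

lemma rep_m11_measurable [measurable]: "rep_m11 f \<in> borel_measurable borel"
  using rep_m11_continuous by (rule borel_measurable_continuous_onI)

lemma rep_m11_gabor_integrable: "integrable lborel (gabor base_window (rep_m11 f))"
  using rep_m11[of f] by (simp add: m11_set_def)

lemma m11_set_add:
  assumes "f \<in> m11_set" "g \<in> m11_set" shows "(\<lambda>x. f x + g x) \<in> m11_set"
proof -
  have "gabor base_window (\<lambda>x. f x + g x) = (\<lambda>z. gabor base_window f z + gabor base_window g z)"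
    using assms by (intro ext gabor_add base_window_L2) (auto simp: m11_set_def)
  thus ?thesis using assms by (auto simp: m11_set_def intro!: continuous_intros L2_space_add)
qed

lemma m11_set_cmult:
  assumes "f \<in> m11_set" shows "(\<lambda>x. c * f x) \<in> m11_set"
proof -
  have "gabor base_window (\<lambda>x. c * f x) = (\<lambda>z. c * gabor base_window f z)"
    by (intro ext gabor_cmult)
  thus ?thesis using assms by (auto simp: m11_set_def intro!: continuous_intros L2_space_cmult)
qed

lemma coherent_le_1: "cmod (coherent z t) \<le> 1"
  using gaussian_le_1[of "1/2" "t - fst z"] by (simp add: coherent_def packet_def norm_mult)

lemma coherent_measurable [measurable]:
  "(\<lambda>z. coherent z t) \<in> borel_measurable borel" "coherent z \<in> borel_measurable borel"
  unfolding coherent_def[abs_def] packet_def by measurable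

text \<open>The type class offers real scalars only, while the coefficients of F and the factor -i
  in Duhamel's formula are complex.\<close>

definition cscale :: "complex \<Rightarrow> 'n::finite m11 \<Rightarrow> 'n m11" where
  "cscale c f = abs_m11 (\<lambda>x. c * rep_m11 f x)"

lemma rep_cscale: "rep_m11 (cscale c f) = (\<lambda>x. c * rep_m11 f x)"
  unfolding cscale_def by (rule abs_m11_inverse[OF m11_set_cmult[OF rep_m11]])

instantiation m11 :: (finite) real_normed_vector
begin

definition zero_m11 where "zero_m11 = (abs_m11 (\<lambda>_. 0) :: 'a m11)"
definition plus_m11 where "plus_m11 f g = (abs_m11 (\<lambda>x. rep_m11 f x + rep_m11 g x) :: 'a m11)"
definition scaleR_m11 where "scaleR_m11 r f = cscale (of_real r) (f :: 'a m11)"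
definition uminus_m11 where "uminus_m11 f = cscale (-1) (f :: 'a m11)"
definition minus_m11 where "minus_m11 f g = f + - (g :: 'a m11)"
definition norm_m11 where "norm_m11 (f :: 'a m11) = m11_set_norm (rep_m11 f)"
definition dist_m11 where "dist_m11 f g = norm (f - g :: 'a m11)"
definition sgn_m11 where "sgn_m11 f = inverse (norm f) *\<^sub>R (f :: 'a m11)"
definition uniformity_m11 where
  "uniformity_m11 = (INF e\<in>{0 <..}. principal {(x, y). dist (x :: 'a m11) y < e})"
definition open_m11 where
  "open_m11 (U :: 'a m11 set) \<longleftrightarrow> (\<forall>x\<in>U. eventually (\<lambda>(x', y). x' = x \<longrightarrow> y \<in> U) uniformity)"

lemma rep_zero_m11: "rep_m11 (0 :: 'a m11) = (\<lambda>_. 0)"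
proof -
  have "(\<lambda>_. 0) \<in> (m11_set :: (real^'a \<Rightarrow> complex) set)" using m11_set_cmult[OF rep_m11, of 0] by simp
  thus ?thesis unfolding zero_m11_def by (rule abs_m11_inverse)
qed

lemma rep_plus_m11: "rep_m11 (f + g) = (\<lambda>x. rep_m11 f x + rep_m11 g x)"
  unfolding plus_m11_def by (rule abs_m11_inverse[OF m11_set_add[OF rep_m11 rep_m11]])

lemma rep_uminus_m11: "rep_m11 (- f) = (\<lambda>x. - rep_m11 f x)"
  by (simp add: uminus_m11_def rep_cscale)

lemma rep_minus_m11: "rep_m11 (f - g) = (\<lambda>x. rep_m11 f x - rep_m11 g x)"
  by (simp add: minus_m11_def rep_plus_m11 rep_uminus_m11)

lemma rep_scaleR_m11: "rep_m11 (r *\<^sub>R f) = (\<lambda>x. of_real r * rep_m11 f x)"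
  by (simp add: scaleR_m11_def rep_cscale)

lemma norm_cscale: "norm (cscale c f) = cmod c * norm f"
  by (simp add: norm_m11_def m11_set_norm_def rep_cscale gabor_cmult norm_mult)

text \<open>Definiteness comes from inversion: a Gabor transform that vanishes almost everywhere
  leaves nothing to superpose.\<close>

lemma norm_m11_eq_0: "norm f = 0 \<longleftrightarrow> f = 0" for f :: "'a m11"
proof
  assume "norm f = 0"
  hence "AE z in lborel. cmod (gabor base_window (rep_m11 f) z) = 0"
    unfolding norm_m11_def m11_set_norm_def
    by (subst (asm) integral_nonneg_eq_0_iff_AE) (auto intro: rep_m11_gabor_integrable)
  hence "AE z in lborel. coherent_coeff (rep_m11 f) z * coherent z t = 0" for t
    by eventually_elim (simp add: coherent_coeff_def)
  hence "(\<integral>z. coherent_coeff (rep_m11 f) z * coherent z t \<partial>lborel) = 0" for t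
    by (rule integral_eq_zero_AE)
  hence "rep_m11 f = (\<lambda>_. 0)" by (subst m11_inversion[OF rep_m11]) simp
  thus "f = 0" by (intro m11_eqI) (simp add: rep_zero_m11)
next
  assume "f = 0"
  moreover have "gabor base_window (\<lambda>_::real^'a. 0) = (\<lambda>_. 0)" by (rule ext) (simp add: gabor_def)
  ultimately show "norm f = 0" by (simp add: norm_m11_def m11_set_norm_def rep_zero_m11)
qed

lemma norm_m11_triangle: "norm (f + g) \<le> norm f + norm g" for f g :: "'a m11"
proof -
  have "norm (f + g) = (\<integral>z. cmod (gabor base_window (rep_m11 f) z + gabor base_window (rep_m11 g) z) \<partial>lborel)"
    unfolding norm_m11_def m11_set_norm_def rep_plus_m11 by (subst gabor_add) (auto intro: base_window_L2)
  also have "\<dots> \<le> (\<integral>z. cmod (gabor base_window (rep_m11 f) z) + cmod (gabor base_window (rep_m11 g) z) \<partial>lborel)"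
    by (intro integral_mono norm_triangle_ineq integrable_norm Bochner_Integration.integrable_add rep_m11_gabor_integrable)
  also have "\<dots> = norm f + norm g"
    unfolding norm_m11_def m11_set_norm_def by (intro Bochner_Integration.integral_add integrable_norm rep_m11_gabor_integrable)
  finally show ?thesis .
qed

text \<open>The coefficients of the sequence are Cauchy in L1. Their limit w is not shown to be the
  coefficient function of anything, but this does not matter: superposing with w gives an element of
  the space, and superposition is bounded from L1 to the norm of the space.\<close>

lemma m11_Cauchy_convergent:
  fixes X :: "nat \<Rightarrow> 'a m11"
  assumes C: "\<And>e. e > 0 \<Longrightarrow> \<exists>N. \<forall>m\<ge>N. \<forall>k\<ge>N. norm (X m - X k) < e"
  shows "\<exists>f. (\<lambda>k. norm (X k - f)) \<longlonglongrightarrow> 0"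
proof -
  define v where "v k = coherent_coeff (rep_m11 (X k))" for k
  have vi: "integrable lborel (v k)" for k unfolding v_def by (rule coherent_coeff_integrable[OF rep_m11])
  have vd: "v m z - v k z = coherent_coeff (rep_m11 (X m - X k)) z" for m k z
    unfolding v_def coherent_coeff_def rep_minus_m11
    by (subst gabor_diff) (auto intro: base_window_L2 simp: algebra_simps)
  have vn: "(\<integral>z. cmod (v m z - v k z) \<partial>lborel) = cmod (coherent_const TYPE('a)) * norm (X m - X k)" for m k
    unfolding vd norm_m11_def by (rule coherent_coeff_integrable(2)[OF rep_m11])
  have "\<exists>N. \<forall>m\<ge>N. \<forall>k\<ge>N. (\<integral>z. cmod (v m z - v k z) \<partial>lborel) < e" if e: "e > 0" for e
  proof -
    have pos: "cmod (coherent_const TYPE('a)) + 1 > 0" by (simp add: add_nonneg_pos)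
    from C[of "e / (cmod (coherent_const TYPE('a)) + 1)"] e pos
    obtain N where N: "\<And>m k. m \<ge> N \<Longrightarrow> k \<ge> N \<Longrightarrow> norm (X m - X k) < e / (cmod (coherent_const TYPE('a)) + 1)"
      by auto
    have "(\<integral>z. cmod (v m z - v k z) \<partial>lborel) < e" if "m \<ge> N" "k \<ge> N" for m k
    proof -
      have nn: "0 \<le> norm (X m - X k)" by (simp add: norm_m11_def m11_set_norm_def)
      have "cmod (coherent_const TYPE('a)) * norm (X m - X k) \<le> (cmod (coherent_const TYPE('a)) + 1) * norm (X m - X k)"
        using nn by (intro mult_right_mono) auto
      also have "\<dots> < e" using N[OF that] pos by (simp add: field_simps)
      finally show ?thesis by (simp add: vn)
    qed
    thus ?thesis by blast
  qed
  from L1_complete[OF vi this] obtain w where w: "integrable lborel w" and lim: "(\<lambda>k. \<integral>z. cmod (v k z - w z) \<partial>lborel) \<longlonglongrightarrow> 0"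
    by blast
  have coh: "c z * coherent z t = c z * (cis (- (fst z \<bullet> snd z) / 2) * packet (1/2) (fst z) (snd z) t)" for c :: "_ \<Rightarrow> complex" and z :: "(real^'a) \<times> (real^'a)" and t
    by (simp add: coherent_def)
  note PS = packet_superposition_m11[where a="1/2" and w="\<lambda>z::(real^'a) \<times> (real^'a). cis (- (fst z \<bullet> snd z) / 2)" and x=fst and y=snd, folded coherent_def]
  define f where "f = abs_m11 (\<lambda>t. \<integral>z. w z * coherent z t \<partial>lborel)"
  have fr: "rep_m11 f = (\<lambda>t. \<integral>z. w z * coherent z t \<partial>lborel)"
    unfolding f_def by (rule abs_m11_inverse) (rule PS(1)[OF _ w], auto)
  have ci: "integrable lborel (\<lambda>z. c z * coherent z t)" if "integrable lborel c" for c :: "_ \<Rightarrow> complex" and t :: "real^'a"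
    by (rule integral_norm_le(1)[OF integrable_norm[OF that]])
      (use that in \<open>auto simp: norm_mult intro!: mult_left_le coherent_le_1\<close>)
  have up: "norm (X k - f) \<le> m11_set_norm (base_window :: real^'a \<Rightarrow> complex) * (\<integral>z. cmod (v k z - w z) \<partial>lborel)" for k
  proof -
    have "rep_m11 (X k - f) = (\<lambda>t. \<integral>z. (v k z - w z) * coherent z t \<partial>lborel)"
      unfolding rep_minus_m11 fr
      by (subst m11_inversion[OF rep_m11], rule ext)
        (simp add: v_def[symmetric] left_diff_distrib ci[OF vi] ci[OF w])
    thus ?thesis unfolding norm_m11_def
      by (simp only:) (rule PS(2), use vi w in auto)
  qed
  have lim0: "(\<lambda>k. m11_set_norm (base_window :: real^'a \<Rightarrow> complex) * (\<integral>z. cmod (v k z - w z) \<partial>lborel)) \<longlonglongrightarrow> 0"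
    using tendsto_mult_right_zero[OF lim] .
  have nn: "0 \<le> norm (X k - f)" for k by (simp add: norm_m11_def m11_set_norm_def)
  have "(\<lambda>k. norm (X k - f)) \<longlonglongrightarrow> 0"
    by (rule tendsto_sandwich[OF always_eventually always_eventually tendsto_const lim0]) (use up nn in simp_all)
  thus ?thesis by blast
qed

instance
proof
  fix f g h :: "'a m11" and r s :: real
  show "f + g + h = f + (g + h)" by (intro m11_eqI) (simp add: rep_plus_m11)
  show "f + g = g + f" by (intro m11_eqI) (simp add: rep_plus_m11)
  show "0 + f = f" by (intro m11_eqI) (simp add: rep_plus_m11 rep_zero_m11)
  show "- f + f = 0" by (intro m11_eqI) (simp add: rep_plus_m11 rep_zero_m11 rep_uminus_m11)
  show "f - g = f + - g" by (simp add: minus_m11_def)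
  show "r *\<^sub>R (f + g) = r *\<^sub>R f + r *\<^sub>R g" by (intro m11_eqI) (simp add: rep_plus_m11 rep_scaleR_m11 algebra_simps)
  show "(r + s) *\<^sub>R f = r *\<^sub>R f + s *\<^sub>R f" by (intro m11_eqI) (simp add: rep_plus_m11 rep_scaleR_m11 algebra_simps)
  show "r *\<^sub>R s *\<^sub>R f = (r * s) *\<^sub>R f" by (intro m11_eqI) (simp add: rep_scaleR_m11 algebra_simps)
  show "1 *\<^sub>R f = f" by (intro m11_eqI) (simp add: rep_scaleR_m11)
  show "dist f g = norm (f - g)" by (simp add: dist_m11_def)
  show "sgn f = inverse (norm f) *\<^sub>R f" by (simp add: sgn_m11_def)
  show "uniformity = (INF e\<in>{0 <..}. principal {(x, y). dist (x :: 'a m11) y < e})" by (simp add: uniformity_m11_def)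
  show "open U \<longleftrightarrow> (\<forall>x\<in>U. \<forall>\<^sub>F (x', y) in uniformity. x' = x \<longrightarrow> y \<in> U)" for U :: "'a m11 set" by (simp add: open_m11_def)
  show "norm f = 0 \<longleftrightarrow> f = 0" by (rule norm_m11_eq_0)
  show "norm (f + g) \<le> norm f + norm g" by (rule norm_m11_triangle)
  show "norm (r *\<^sub>R f) = \<bar>r\<bar> * norm f" by (simp add: scaleR_m11_def norm_cscale)
qed

end

instance m11 :: (finite) banach
proof
  fix X :: "nat \<Rightarrow> 'a m11"
  assume "Cauchy X"
  hence "\<exists>N. \<forall>m\<ge>N. \<forall>k\<ge>N. norm (X m - X k) < e" if "e > 0" for e
    using that unfolding Cauchy_def dist_norm by blast
  from m11_Cauchy_convergent[OF this] obtain f where "(\<lambda>k. norm (X k - f)) \<longlonglongrightarrow> 0" by blast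
  hence "X \<longlonglongrightarrow> f" by (simp add: tendsto_norm_zero_iff LIM_zero_iff)
  thus "convergent X" by (rule convergentI)
qed

text \<open>Relates a measurable representative to the continuous member of its class. It is a
  relation rather than a function because a solution may use an arbitrary representative at each
  time.\<close>

definition represents :: "(real^'n::finite \<Rightarrow> complex) \<Rightarrow> 'n m11 \<Rightarrow> bool" where
  "represents h f \<longleftrightarrow> h \<in> borel_measurable borel \<and> (AE x in lborel. h x = rep_m11 f x)"

lemma represents_rep_m11 [simp]: "represents (rep_m11 f) f"
  by (simp add: represents_def)

lemma represents_AE_eq:
  assumes "represents h f" "represents k f" shows "AE x in lborel. h x = k x"
proof -
  have "AE x in lborel. h x = rep_m11 f x" "AE x in lborel. k x = rep_m11 f x"
    using assms by (simp_all add: represents_def)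
  thus ?thesis by eventually_elim simp
qed

lemma represents_unique:
  assumes "represents h f" "represents h f'" shows "f = f'"
proof -
  have "AE x in lborel. h x = rep_m11 f x" "AE x in lborel. h x = rep_m11 f' x"
    using assms by (simp_all add: represents_def)
  hence "AE x in lborel. rep_m11 f x = rep_m11 f' x" by eventually_elim simp
  hence "rep_m11 f = rep_m11 f'" by (rule continuous_AE_eq[OF rep_m11_continuous rep_m11_continuous])
  thus ?thesis by (simp add: rep_m11_inject)
qed

lemma represents_diff:
  assumes "represents h f" "represents k f'" shows "represents (\<lambda>x. h x - k x) (f - f')"
proof -
  have "AE x in lborel. h x = rep_m11 f x" "AE x in lborel. k x = rep_m11 f' x"
    using assms by (simp_all add: represents_def)
  hence "AE x in lborel. h x - k x = rep_m11 (f - f') x" by eventually_elim (simp add: rep_minus_m11)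
  thus ?thesis using assms by (auto simp: represents_def)
qed

lemma represents_add:
  assumes "represents h f" "represents k f'" shows "represents (\<lambda>x. h x + k x) (f + f')"
proof -
  have "AE x in lborel. h x = rep_m11 f x" "AE x in lborel. k x = rep_m11 f' x"
    using assms by (simp_all add: represents_def)
  hence "AE x in lborel. h x + k x = rep_m11 (f + f') x" by eventually_elim (simp add: rep_plus_m11)
  thus ?thesis using assms by (auto simp: represents_def)
qed

lemma represents_cscale:
  assumes "represents h f" shows "represents (\<lambda>x. c * h x) (cscale c f)"
  using assms unfolding represents_def rep_cscale by auto

lemma represents_scaleR:
  assumes "represents h f" shows "represents (\<lambda>x. r *\<^sub>R h x) (r *\<^sub>R f)"
  using represents_cscale[OF assms, of "of_real r"] by (simp add: scaleR_m11_def scaleR_conv_of_real)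

lemma represents_sum:
  assumes "\<And>i. i \<in> I \<Longrightarrow> represents (h i) (f i)"
  shows "represents (\<lambda>x. \<Sum>i\<in>I. h i x) (\<Sum>i\<in>I. f i)"
  using assms
proof (induct I rule: infinite_finite_induct)
  case (insert i I)
  thus ?case by (simp add: represents_add)
qed (simp_all add: represents_def rep_zero_m11)

lemma represents_L2:
  assumes "represents h f" shows "h \<in> L2_space"
proof -
  have [measurable]: "h \<in> borel_measurable borel" and ae: "AE x in lborel. h x = rep_m11 f x"
    using assms by (auto simp: represents_def)
  have "integrable lborel (\<lambda>x. (cmod (rep_m11 f x))\<^sup>2)" using rep_m11_L2[of f] by (simp add: L2_space_def)
  hence "integrable lborel (\<lambda>x. (cmod (h x))\<^sup>2)"
    by (rule integrable_cong_AE[THEN iffD2, rotated 3]) (use ae in \<open>auto elim!: eventually_mono\<close>)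
  thus ?thesis by (simp add: L2_space_def)
qed

section \<open>Comparison with the distributional definition of the space\<close>

lemma stft_gabor:
  fixes g h :: "real^'n::finite \<Rightarrow> complex"
  shows "stft g (distribution_of h) x y = complex_of_real ((2 * pi) powr (- real CARD('n) / 2)) * gabor g h (x, y)"
proof -
  have "cnj (modulate y (translate x g) t) = cnj (g (t - x)) * cis (- (y \<bullet> t))" for t
    by (simp add: modulate_def translate_def cis_conv_exp[symmetric] cis_cnj mult.commute)
  thus ?thesis unfolding stft_def pairing_def distribution_of_def gabor_def by (simp add: mult.assoc)
qed

lemma schwartz_seminorm_bound:
  fixes \<phi> :: "real^'n::finite \<Rightarrow> complex"
  assumes "\<phi> \<in> schwartz_space"
  shows "norm x ^ k * cmod (foldr partial_deriv js \<phi> x) \<le> schwartz_seminorm k js \<phi>"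
    and "0 \<le> schwartz_seminorm k js \<phi>"
proof -
  have "bounded (range (\<lambda>x. norm x ^ k *\<^sub>R foldr partial_deriv js \<phi> x))"
    using assms unfolding schwartz_space_def by blast
  then obtain B where B: "\<And>x. norm (norm x ^ k *\<^sub>R foldr partial_deriv js \<phi> x) \<le> B" by (auto simp: bounded_iff)
  hence bdd: "bdd_above (range (\<lambda>x. norm x ^ k * cmod (foldr partial_deriv js \<phi> x)))"
    by (intro bdd_aboveI[of _ B]) auto
  show 1: "norm x ^ k * cmod (foldr partial_deriv js \<phi> x) \<le> schwartz_seminorm k js \<phi>" for x
    unfolding schwartz_seminorm_def by (rule cSUP_upper[OF _ bdd]) simp
  show "0 \<le> schwartz_seminorm k js \<phi>"
    using order_trans[OF _ 1[of 0]] by simp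
qed

text \<open>The weight \<open>decay x ^ K\<close> is square integrable for K = 2n, so h times this
  weight is integrable, while a test function is bounded by the weight with a constant formed from
  two seminorms: no derivative, with powers 0 and K. These are two of the nonnegative terms of the
  double sum.\<close>

lemma L2_tempered:
  fixes h :: "real^'n::finite \<Rightarrow> complex"
  assumes h: "h \<in> L2_space"
  shows "tempered_distribution (distribution_of h)"
proof -
  let ?K = "2 * CARD('n)"
  have hm[measurable]: "h \<in> borel_measurable borel" using h by (simp add: L2_space_def)
  have i: "integrable lborel (\<lambda>x. h x * \<phi> x)" if "\<phi> \<in> schwartz_space" for \<phi>
    by (intro L2_mult_integrable h schwartz_L2_space that)
  have dL: "(\<lambda>x::real^'n. complex_of_real (decay x ^ ?K)) \<in> L2_space"
  proof (rule L2_spaceI_bounded_integrable)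
    show "integrable lborel (\<lambda>x::real^'n. complex_of_real (decay x ^ ?K))"
      by (intro integrable_of_real integrable_decay) simp
    show "norm (complex_of_real (decay x ^ ?K)) \<le> 1" for x :: "real^'n"
      by (simp add: power_le_one norm_power)
  qed
  have "integrable lborel (\<lambda>x. h x * complex_of_real (decay x ^ ?K))" by (rule L2_mult_integrable[OF h dL])
  hence J: "integrable lborel (\<lambda>x. cmod (h x) * decay x ^ ?K)"
    using integrable_norm by (fastforce simp: norm_mult norm_power)
  define I where "I = (\<integral>x. cmod (h x) * decay x ^ ?K \<partial>lborel)"
  have I0: "I \<ge> 0" unfolding I_def by simp
  have bound: "cmod (distribution_of h \<phi>) \<le> (2 ^ ?K * I) * (\<Sum>k\<le>?K. \<Sum>js | length js \<le> ?K. schwartz_seminorm k js \<phi>)"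
    if p: "\<phi> \<in> schwartz_space" for \<phi>
  proof -
    define S where "S = (\<Sum>k\<le>?K. \<Sum>js | length js \<le> ?K. schwartz_seminorm k js \<phi>)"
    have fin: "finite {js :: 'n list. length js \<le> ?K}"
      using finite_lists_length_le[of "UNIV :: 'n set" ?K] by simp
    have nn: "0 \<le> schwartz_seminorm k js \<phi>" for k js by (rule schwartz_seminorm_bound(2)[OF p])
    have le: "schwartz_seminorm k [] \<phi> \<le> (\<Sum>js | length js \<le> ?K. schwartz_seminorm k js \<phi>)" for k
      by (rule member_le_sum) (use fin nn in auto)
    have "(\<Sum>k\<in>{0, ?K}. (\<Sum>js | length js \<le> ?K. schwartz_seminorm k js \<phi>)) \<le> S"
      unfolding S_def by (rule sum_mono2) (auto intro!: sum_nonneg nn)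
    hence SS: "schwartz_seminorm 0 [] \<phi> + schwartz_seminorm ?K [] \<phi> \<le> S"
      using le[of 0] le[of ?K] by simp
    have pd: "cmod (\<phi> x) \<le> 2 ^ ?K * S * decay x ^ ?K" for x
    proof -
      have "cmod (\<phi> x) * (1 + norm x) ^ ?K \<le> cmod (\<phi> x) * (2 ^ ?K * (1 + norm x ^ ?K))"
        by (intro mult_left_mono one_plus_power_le) auto
      also have "\<dots> = 2 ^ ?K * (cmod (\<phi> x) + norm x ^ ?K * cmod (\<phi> x))" by (simp add: algebra_simps)
      also have "\<dots> \<le> 2 ^ ?K * S"
        using schwartz_seminorm_bound(1)[OF p, of x 0 "[]"] schwartz_seminorm_bound(1)[OF p, of x ?K "[]"] SS
        by (intro mult_left_mono) auto
      finally have "cmod (\<phi> x) * (1 + norm x) ^ ?K \<le> 2 ^ ?K * S" .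
      moreover have "(1 + norm x) ^ ?K > 0" by (auto intro!: zero_less_power add_pos_nonneg)
      ultimately have "cmod (\<phi> x) \<le> (2 ^ ?K * S) / (1 + norm x) ^ ?K" by (simp add: pos_le_divide_eq)
      thus ?thesis by (simp add: decay_def power_divide)
    qed
    have "cmod (distribution_of h \<phi>) \<le> (\<integral>x. (2 ^ ?K * S) * (cmod (h x) * decay x ^ ?K) \<partial>lborel)"
      unfolding distribution_of_def
    proof (rule integral_norm_le(2))
      show "norm (h x * \<phi> x) \<le> (2 ^ ?K * S) * (cmod (h x) * decay x ^ ?K)" for x
        using mult_left_mono[OF pd[of x], of "cmod (h x)"] by (simp add: norm_mult mult_ac)
      show "(\<lambda>x. h x * \<phi> x) \<in> borel_measurable lborel" using i[OF p] by auto
    qed (intro integrable_mult_right J)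
    also have "\<dots> = (2 ^ ?K * S) * I" unfolding I_def by (rule integral_mult_right_zero)
    finally show ?thesis by (simp only: S_def mult_ac)
  qed
  show ?thesis unfolding tempered_distribution_def
  proof (intro conjI ballI allI)
    show "distribution_of h (\<lambda>x. \<phi> x + \<psi> x) = distribution_of h \<phi> + distribution_of h \<psi>"
      if "\<phi> \<in> schwartz_space" "\<psi> \<in> schwartz_space" for \<phi> \<psi>
      unfolding distribution_of_def using i that by (simp add: distrib_left)
    show "distribution_of h (\<lambda>x. c * \<phi> x) = c * distribution_of h \<phi>" for \<phi> c
    proof -
      have "distribution_of h (\<lambda>x. c * \<phi> x) = (\<integral>x. c * (h x * \<phi> x) \<partial>lborel)"
        unfolding distribution_of_def by (intro Bochner_Integration.integral_cong refl) (simp add: mult_ac)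
      also have "\<dots> = c * distribution_of h \<phi>" unfolding distribution_of_def by (rule integral_mult_right_zero)
      finally show ?thesis .
    qed
    show "\<exists>C N. \<forall>\<phi>\<in>schwartz_space.
        cmod (distribution_of h \<phi>) \<le> C * (\<Sum>k\<le>N. \<Sum>js | length js \<le> N. schwartz_seminorm k js \<phi>)"
      using bound by blast
  qed
qed

lemma M11_fun_iff:
  fixes g h :: "real^'n::finite \<Rightarrow> complex"
  shows "h \<in> M11_fun g \<longleftrightarrow> h \<in> L2_space \<and> integrable lborel (gabor g h)"
proof -
  define s where "s = complex_of_real ((2 * pi) powr (- real CARD('n) / 2))"
  have s: "s \<noteq> 0" by (simp add: s_def)
  have eq: "(\<lambda>(x, y). stft g (distribution_of h) x y) = (\<lambda>z. s * gabor g h z)"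
    by (auto simp: stft_gabor s_def)
  have "integrable lborel (\<lambda>z. s * gabor g h z) \<longleftrightarrow> integrable lborel (gabor g h)"
    using s integrable_mult_right[of "1 / s" lborel "\<lambda>z. s * gabor g h z"] by auto
  moreover have "h \<in> M11_fun g \<longleftrightarrow> h \<in> L2_space \<and> tempered_distribution (distribution_of h)
      \<and> integrable lborel (\<lambda>(x, y). stft g (distribution_of h) x y)"
    by (simp only: M11_fun_def M11_def lborel_prod mem_Collect_eq)
  ultimately show ?thesis unfolding eq using L2_tempered by blast
qed

lemma M11_fun_norm_gabor:
  fixes g h :: "real^'n::finite \<Rightarrow> complex"
  shows "M11_fun_norm g h = (2 * pi) powr (- real CARD('n) / 2) * (\<integral>z. cmod (gabor g h z) \<partial>lborel)"
  unfolding M11_norm_def lborel_prod by (simp add: case_prod_unfold stft_gabor norm_mult)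

text \<open>Inversion with g as analysis window and a modulated Gaussian as synthesis window, the
  modulation y0 being chosen so that the pairing b of the two is nonzero. The result is a
  superposition of Gaussian packets with coefficient \<open>gabor g h\<close>, hence continuous and
  controlled by the norm taken with g.\<close>

lemma M11_fun_represented:
  fixes g :: "real^'n::finite \<Rightarrow> complex"
  assumes g: "g \<in> schwartz_space" and nz: "g \<noteq> (\<lambda>_. 0)"
  shows "\<exists>K>0. \<forall>h\<in>M11_fun g. \<exists>f. represents h f \<and> norm f \<le> K * M11_fun_norm g h"
proof -
  have gi: "integrable lborel g" and gc: "continuous_on UNIV g" using g by (auto intro: schwartz_integrable schwartz_continuous)
  obtain B where B: "\<And>t. cmod (g t) \<le> B" using schwartz_bounded[OF g] by blast
  obtain y0 where y0: "(\<integral>u. (cis (y0 \<bullet> u) * base_window u) * cnj (g u) \<partial>lborel) \<noteq> 0"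
    using window_modulation_nonzero[OF gi gc B nz] by blast
  define b where "b = (\<integral>u. (cis (y0 \<bullet> u) * base_window u) * cnj (g u) \<partial>lborel)"
  define \<kappa> where "\<kappa> = 1 / ((2 * pi) ^ CARD('n) * b)"
  define N where "N = m11_set_norm (base_window :: real^'n \<Rightarrow> complex)"
  define s where "s = (2 * pi) powr (- real CARD('n) / 2)"
  have s: "s > 0" by (simp add: s_def)
  have N0: "N \<ge> 0" by (simp add: N_def m11_set_norm_def)
  \<comment> \<open>The summand 1 keeps the constant positive.\<close>
  have main: "\<exists>f. represents h f \<and> norm f \<le> (N * cmod \<kappa> / s + 1) * M11_fun_norm g h" if h: "h \<in> M11_fun g" for h
  proof -
    have hL: "h \<in> L2_space" and hG: "integrable lborel (gabor g h)" using h by (auto simp: M11_fun_iff)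
    have hm[measurable]: "h \<in> borel_measurable borel" using hL by (simp add: L2_space_def)
    have gm[measurable]: "g \<in> borel_measurable borel" using gi by auto
    define c where "c z = \<kappa> * gabor g h z" for z
    have ci: "integrable lborel c" unfolding c_def using hG by auto
    \<comment> \<open>The synthesis window moved to (x, y) is a Gaussian packet at (x, y + y0) with
      the phase -y0 . x.\<close>
    define f where "f = abs_m11 (\<lambda>t. \<integral>z. c z * (cis (- (y0 \<bullet> fst z)) * packet (1/2) (fst z) (snd z + y0) t) \<partial>lborel)"
    have mm: "(\<lambda>z. cis (- (y0 \<bullet> fst z))) \<in> borel_measurable (borel :: ((real^'n) \<times> (real^'n)) measure)"
       "fst \<in> borel_measurable (borel :: ((real^'n) \<times> (real^'n)) measure)"
       "(\<lambda>z. snd z + y0) \<in> borel_measurable (borel :: ((real^'n) \<times> (real^'n)) measure)"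
      by measurable
    note PS = packet_superposition_m11[where a="1/2", OF _ ci _ mm]
    have rf: "rep_m11 f = (\<lambda>t. \<integral>z. c z * (cis (- (y0 \<bullet> fst z)) * packet (1/2) (fst z) (snd z + y0) t) \<partial>lborel)"
      unfolding f_def by (rule abs_m11_inverse) (rule PS(1), auto)
    have nf: "norm f \<le> N * (\<integral>z. cmod (c z) \<partial>lborel)"
      unfolding norm_m11_def rf N_def by (rule PS(2)) auto
    have "AE t in lborel. h t * b = (\<integral>z. gabor g h z * (cis (snd z \<bullet> t) * (cis (y0 \<bullet> (t - fst z)) * base_window (t - fst z))) \<partial>lborel) / (2 * pi) ^ CARD('n)"
      unfolding b_def
    proof (rule gabor_inversion[OF gi gc B hL _ _ hG, where By=1])
      show "integrable lborel (\<lambda>t::real^'n. cis (y0 \<bullet> t) * base_window t)"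
        by (rule Bochner_Integration.integrable_bound[OF schwartz_integrable[OF base_window_schwartz]]) (auto simp: norm_mult)
      show "cmod (cis (y0 \<bullet> t) * base_window t) \<le> 1" for t
        using gaussian_le_1[of "1/2" t] by (simp add: norm_mult)
    qed
    hence ae: "AE t in lborel. h t = rep_m11 f t"
    proof eventually_elim
      case (elim t)
      let ?J = "\<integral>z. gabor g h z * (cis (snd z \<bullet> t) * (cis (y0 \<bullet> (t - fst z)) * base_window (t - fst z))) \<partial>lborel"
      have "rep_m11 f t = (\<integral>z. \<kappa> * (gabor g h z * (cis (snd z \<bullet> t) * (cis (y0 \<bullet> (t - fst z)) * base_window (t - fst z)))) \<partial>lborel)"
        unfolding rf
      proof (rule Bochner_Integration.integral_cong[OF refl])
        fix z :: "(real^'n) \<times> (real^'n)"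
        have "cis (- (y0 \<bullet> fst z)) * cis ((snd z + y0) \<bullet> t) = cis (snd z \<bullet> t) * cis (y0 \<bullet> (t - fst z))"
          by (simp add: cis_mult inner_simps algebra_simps)
        thus "c z * (cis (- (y0 \<bullet> fst z)) * packet (1/2) (fst z) (snd z + y0) t) = \<kappa> * (gabor g h z * (cis (snd z \<bullet> t) * (cis (y0 \<bullet> (t - fst z)) * base_window (t - fst z))))"
          unfolding c_def packet_def by (metis (no_types, opaque_lifting) mult.assoc)
      qed
      also have "\<dots> = \<kappa> * ?J" by (rule integral_mult_right_zero)
      also have "\<dots> = (?J / (2 * pi) ^ CARD('n)) / b" by (simp add: \<kappa>_def)
      also have "\<dots> = h t" unfolding elim[symmetric] using y0 by (simp add: b_def)
      finally show ?case by simp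
    qed
    have Mn: "(\<integral>z. cmod (c z) \<partial>lborel) = cmod \<kappa> * M11_fun_norm g h / s"
      using s by (simp add: c_def norm_mult M11_fun_norm_gabor s_def)
    have M0: "0 \<le> M11_fun_norm g h" by (simp add: M11_fun_norm_gabor)
    have "norm f \<le> (N * cmod \<kappa> / s + 1) * M11_fun_norm g h"
      using nf M0 unfolding Mn by (simp add: distrib_right)
    thus ?thesis using ae by (auto simp: represents_def)
  qed
  show ?thesis
    by (rule exI[of _ "N * cmod \<kappa> / s + 1"]) (use main N0 s in \<open>auto intro!: add_nonneg_pos divide_nonneg_pos\<close>)
qed

text \<open>The converse comparison of windows: the coherent states have Gabor transforms of one
  common L1 norm also for the window g, and f is a superposition of them with integrable
  coefficients.\<close>

lemma represents_M11_fun: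
  fixes g :: "real^'n::finite \<Rightarrow> complex"
  assumes g: "g \<in> schwartz_space"
  shows "\<exists>K>0. \<forall>h f. represents h f \<longrightarrow> h \<in> M11_fun g \<and> M11_fun_norm g h \<le> K * norm f"
proof -
  define s where "s = (2 * pi) powr (- real CARD('n) / 2)"
  have s: "s > 0" by (simp add: s_def)
  define N where "N = (\<integral>z. cmod (gabor g (base_window :: real^'n \<Rightarrow> complex) z) \<partial>lborel)"
  have N0: "N \<ge> 0" by (simp add: N_def)
  define K where "K = s * (N * cmod (coherent_const TYPE('n))) + 1"
  have K: "K > 0" unfolding K_def using s N0 by (intro add_nonneg_pos mult_nonneg_nonneg) auto
  have gm[measurable]: "g \<in> borel_measurable borel" using schwartz_measurable[OF g] .
  have "h \<in> M11_fun g \<and> M11_fun_norm g h \<le> K * norm f" if r: "represents h f" for h f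
  proof -
    have hL: "h \<in> L2_space" by (rule represents_L2[OF r])
    have hm[measurable]: "h \<in> borel_measurable borel" and ae: "AE x in lborel. h x = rep_m11 f x" using r by (auto simp: represents_def)
    have eq: "gabor g h = gabor g (rep_m11 f)" by (rule gabor_cong_AE[OF _ _ _ ae]) auto
    note PS = packet_superposition[where a="1/2" and w="\<lambda>z::(real^'n) \<times> (real^'n). cis (- (fst z \<bullet> snd z) / 2)" and x=fst and y=snd, folded coherent_def,
      OF _ g coherent_coeff_integrable(1)[OF rep_m11[of f]]]
    have G: "integrable lborel (gabor g h)" unfolding eq
      by (subst m11_inversion[OF rep_m11]) (rule PS(4), auto)
    have "(\<integral>z. cmod (gabor g h z) \<partial>lborel) \<le> N * (\<integral>z. cmod (coherent_coeff (rep_m11 f) z) \<partial>lborel)"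
      unfolding eq N_def by (subst m11_inversion[OF rep_m11]) (rule PS(5), auto)
    also have "\<dots> = N * cmod (coherent_const TYPE('n)) * norm f"
      by (simp add: coherent_coeff_integrable(2)[OF rep_m11] norm_m11_def)
    finally have "s * (\<integral>z. cmod (gabor g h z) \<partial>lborel) \<le> s * (N * cmod (coherent_const TYPE('n)) * norm f)"
      using s by (intro mult_left_mono) auto
    also have "\<dots> \<le> K * norm f" by (simp add: K_def distrib_right mult.assoc)
    finally have "M11_fun_norm g h \<le> K * norm f" by (simp add: M11_fun_norm_gabor s_def)
    thus ?thesis using G hL by (simp add: M11_fun_iff)
  qed
  thus ?thesis using K by blast
qed

section \<open>Real entire nonlinearities\<close>

text \<open>By the parallelogram law, |t - x|^2 + |t - x'|^2 is twice the squared distance of t from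
  the midpoint plus half of |x - x'|^2. The exponent doubles from 1/2 to 1, and the remaining factor
  is at most 1.\<close>

lemma gaussian_mult:
  "gaussian (1/2) (t - x) * gaussian (1/2) (t - x') =
    of_real (exp (- (norm (x - x'))\<^sup>2 / 4)) * gaussian 1 (t - (1/2) *\<^sub>R (x + x'))"
proof -
  have "(norm (t - x))\<^sup>2 + (norm (t - x'))\<^sup>2 = 2 * (norm (t - (1/2) *\<^sub>R (x + x')))\<^sup>2 + (norm (x - x'))\<^sup>2 / 2"
    by (simp add: power2_norm_eq_inner inner_simps inner_commute field_simps)
  hence "- (1/2) * (norm (t - x))\<^sup>2 + - (1/2) * (norm (t - x'))\<^sup>2
     = - (norm (x - x'))\<^sup>2 / 4 + - 1 * (norm (t - (1/2) *\<^sub>R (x + x')))\<^sup>2" by (simp add: field_simps)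
  thus ?thesis unfolding gaussian_def of_real_mult[symmetric] exp_add[symmetric] by (simp only:)
qed

lemma coherent_mult:
  "coherent z t * coherent z' t = of_real (exp (- (norm (fst z - fst z'))\<^sup>2 / 4)) *
    (cis (- (fst z \<bullet> snd z + fst z' \<bullet> snd z') / 2) * packet 1 ((1/2) *\<^sub>R (fst z + fst z')) (snd z + snd z') t)"
proof -
  have c: "cis (- (fst z \<bullet> snd z + fst z' \<bullet> snd z') / 2) = cis (- (fst z \<bullet> snd z) / 2) * cis (- (fst z' \<bullet> snd z') / 2)"
    "cis ((snd z + snd z') \<bullet> t) = cis (snd z \<bullet> t) * cis (snd z' \<bullet> t)"
    by (simp_all add: cis_mult inner_simps field_simps)
  have "coherent z t * coherent z' t = (cis (- (fst z \<bullet> snd z) / 2) * cis (- (fst z' \<bullet> snd z') / 2)) * (cis (snd z \<bullet> t) * cis (snd z' \<bullet> t)) *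
     (gaussian (1/2) (t - fst z) * gaussian (1/2) (t - fst z'))"
    unfolding coherent_def packet_def by (simp only: mult_ac)
  thus ?thesis unfolding gaussian_mult c packet_def by (simp only: mult_ac)
qed

lemma coherent_coeff_mult_integrable:
  assumes "integrable lborel c" shows "integrable lborel (\<lambda>z. c z * coherent z t)"
  by (rule integral_norm_le(1)[OF integrable_norm[OF assms]])
    (use assms in \<open>auto simp: norm_mult intro!: mult_left_le coherent_le_1\<close>)

text \<open>A product of two superpositions is a superposition over pairs of phase-space points. The
  scalar Gaussian in the distance of the two centres goes into the coefficient c, where it can only
  decrease the modulus, and what remains is a unimodular multiple of a packet of width parameter
  1.\<close>

lemma m11_set_mult:
  fixes f h :: "real^'n::finite \<Rightarrow> complex"
  assumes f: "f \<in> m11_set" and h: "h \<in> m11_set"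
  shows "(\<lambda>t. f t * h t) \<in> m11_set"
    and "m11_set_norm (\<lambda>t. f t * h t) \<le> (m11_set_norm (gaussian 1 :: real^'n \<Rightarrow> complex) * (cmod (coherent_const TYPE('n)))\<^sup>2)
      * (m11_set_norm f * m11_set_norm h)"
proof -
  define cf where "cf = coherent_coeff f"
  define ch where "ch = coherent_coeff h"
  have cfi: "integrable lborel cf" and chi: "integrable lborel ch"
    unfolding cf_def ch_def by (intro coherent_coeff_integrable f h)+
  define c where "c p = cf (fst p) * ch (snd p) * of_real (exp (- (norm (fst (fst p) - fst (snd p)))\<^sup>2 / 4))" for p
  define w where "w p = cis (- (fst (fst p) \<bullet> snd (fst p) + fst (snd p) \<bullet> snd (snd p)) / 2)" for p :: "((real^'n) \<times> (real^'n)) \<times> ((real^'n) \<times> (real^'n))"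
  define x where "x p = (1/2) *\<^sub>R (fst (fst p) + fst (snd p))" for p :: "((real^'n) \<times> (real^'n)) \<times> ((real^'n) \<times> (real^'n))"
  define y where "y p = snd (fst p) + snd (snd p)" for p :: "((real^'n) \<times> (real^'n)) \<times> ((real^'n) \<times> (real^'n))"
  have [measurable]: "cf \<in> borel_measurable borel" "ch \<in> borel_measurable borel" using cfi chi by auto
  have m: "w \<in> borel_measurable borel" "x \<in> borel_measurable borel" "y \<in> borel_measurable borel"
    unfolding w_def x_def y_def by measurable
  have cfh: "integrable lborel (\<lambda>p. cf (fst p) * ch (snd p))"
    using integrable_prod_pair[OF cfi chi] by (simp add: lborel_prod case_prod_unfold)
  have cb: "cmod (c p) \<le> cmod (cf (fst p) * ch (snd p))" for p
    unfolding c_def norm_mult by (rule mult_left_le) auto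
  have cm: "c \<in> borel_measurable borel" unfolding c_def by measurable
  have ci: "integrable lborel c"
    by (rule Bochner_Integration.integrable_bound[OF cfh]) (use cb cm in auto)
  have cint: "(\<integral>p. cmod (c p) \<partial>lborel) \<le> (\<integral>z. cmod (cf z) \<partial>lborel) * (\<integral>z. cmod (ch z) \<partial>lborel)"
  proof -
    have "(\<integral>p. cmod (c p) \<partial>lborel) \<le> (\<integral>p. cmod (cf (fst p) * ch (snd p)) \<partial>lborel)"
      by (intro integral_mono integrable_norm ci cfh cb)
    also have "\<dots> = (\<integral>(z, z'). cmod (cf z) * cmod (ch z') \<partial>(lborel \<Otimes>\<^sub>M lborel))"
      by (simp add: lborel_prod norm_mult case_prod_unfold)
    also have "\<dots> = (\<integral>z. cmod (cf z) \<partial>lborel) * (\<integral>z. cmod (ch z) \<partial>lborel)"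
      using lborel_pair.integral_fst[OF integrable_prod_pair[OF integrable_norm[OF cfi] integrable_norm[OF chi]]] by simp
    finally show ?thesis .
  qed
  have eq: "(\<lambda>t. f t * h t) = (\<lambda>t. \<integral>p. c p * (w p * packet 1 (x p) (y p) t) \<partial>lborel)"
  proof
    fix t
    have "f t * h t = (\<integral>z. cf z * coherent z t \<partial>lborel) * (\<integral>z. ch z * coherent z t \<partial>lborel)"
      unfolding cf_def ch_def by (subst m11_inversion[OF f], subst m11_inversion[OF h]) simp
    also have "\<dots> = (\<integral>(z, z'). (cf z * coherent z t) * (ch z' * coherent z' t) \<partial>(lborel \<Otimes>\<^sub>M lborel))"
      by (rule integral_prod_pair[symmetric]) (intro coherent_coeff_mult_integrable cfi chi)+
    also have "\<dots> = (\<integral>p. c p * (w p * packet 1 (x p) (y p) t) \<partial>lborel)"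
      unfolding lborel_prod
    proof (rule Bochner_Integration.integral_cong[OF refl])
      fix p :: "((real^'n) \<times> (real^'n)) \<times> ((real^'n) \<times> (real^'n))"
      have "cf (fst p) * coherent (fst p) t * (ch (snd p) * coherent (snd p) t) = cf (fst p) * ch (snd p) * (coherent (fst p) t * coherent (snd p) t)"
        by (simp only: mult_ac)
      also have "\<dots> = c p * (w p * packet 1 (x p) (y p) t)"
        unfolding coherent_mult c_def w_def x_def y_def by (simp only: mult.assoc)
      finally show "(case p of (z, z') \<Rightarrow> cf z * coherent z t * (ch z' * coherent z' t)) = c p * (w p * packet 1 (x p) (y p) t)"
        by (simp add: case_prod_unfold)
    qed
    finally show "f t * h t = (\<integral>p. c p * (w p * packet 1 (x p) (y p) t) \<partial>lborel)" .
  qed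
  have w1: "cmod (w p) = 1" for p by (simp add: w_def)
  note PS = packet_superposition_m11[OF zero_less_one ci w1 m]
  show "(\<lambda>t. f t * h t) \<in> m11_set" unfolding eq by (rule PS(1))
  let ?N = "m11_set_norm (gaussian 1 :: real^'n \<Rightarrow> complex)"
  have N0: "?N \<ge> 0" by (simp add: m11_set_norm_def)
  have "m11_set_norm (\<lambda>t. f t * h t) \<le> ?N * (\<integral>p. cmod (c p) \<partial>lborel)" unfolding eq by (rule PS(2))
  also have "\<dots> \<le> ?N * ((\<integral>z. cmod (cf z) \<partial>lborel) * (\<integral>z. cmod (ch z) \<partial>lborel))"
    by (intro mult_left_mono cint N0)
  finally show "m11_set_norm (\<lambda>t. f t * h t) \<le> (?N * (cmod (coherent_const TYPE('n)))\<^sup>2) * (m11_set_norm f * m11_set_norm h)"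
    unfolding cf_def ch_def coherent_coeff_integrable(2)[OF f] coherent_coeff_integrable(2)[OF h]
    by (simp add: power2_eq_square mult_ac)
qed

text \<open>Conjugation sends the coherent state at (x, y) to the one at (x, -y). It is wanted
  because F is a power series in the real and imaginary parts of u and not in u alone.\<close>

lemma m11_set_cnj:
  fixes f :: "real^'n::finite \<Rightarrow> complex"
  assumes f: "f \<in> m11_set"
  shows "(\<lambda>t. cnj (f t)) \<in> m11_set"
    and "m11_set_norm (\<lambda>t. cnj (f t)) \<le> (m11_set_norm (base_window :: real^'n \<Rightarrow> complex) * cmod (coherent_const TYPE('n))) * m11_set_norm f"
proof -
  define c where "c z = cnj (coherent_coeff f z)" for z
  have ci: "integrable lborel c" unfolding c_def using coherent_coeff_integrable(1)[OF f] by simp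
  have eq: "(\<lambda>t. cnj (f t)) = (\<lambda>t. \<integral>z. c z * (cis ((fst z \<bullet> snd z) / 2) * packet (1/2) (fst z) (- snd z) t) \<partial>lborel)"
  proof
    fix t :: "real^'n"
    have cc: "cnj (coherent z t) = cis ((fst z \<bullet> snd z) / 2) * packet (1/2) (fst z) (- snd z) t" for z :: "(real^'n) \<times> (real^'n)"
      by (simp add: coherent_def packet_def cis_cnj)
    have "cnj (f t) = cnj (\<integral>z. coherent_coeff f z * coherent z t \<partial>lborel)" by (subst m11_inversion[OF f]) simp
    also have "\<dots> = (\<integral>z. cnj (coherent_coeff f z * coherent z t) \<partial>lborel)"
      using coherent_coeff_mult_integrable[OF coherent_coeff_integrable(1)[OF f], of t] by (rule integral_bounded_linear[OF bounded_linear_cnj, symmetric])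
    finally show "cnj (f t) = (\<integral>z. c z * (cis ((fst z \<bullet> snd z) / 2) * packet (1/2) (fst z) (- snd z) t) \<partial>lborel)"
      by (simp only: complex_cnj_mult cc c_def)
  qed
  have mm: "(\<lambda>z. cis ((fst z \<bullet> snd z) / 2)) \<in> borel_measurable (borel :: ((real^'n) \<times> (real^'n)) measure)"
       "fst \<in> borel_measurable (borel :: ((real^'n) \<times> (real^'n)) measure)"
       "(\<lambda>z. - snd z) \<in> borel_measurable (borel :: ((real^'n) \<times> (real^'n)) measure)"
    by measurable
  note PS = packet_superposition_m11[where a="1/2", OF _ ci _ mm]
  show "(\<lambda>t. cnj (f t)) \<in> m11_set" unfolding eq by (rule PS(1)) auto
  have "m11_set_norm (\<lambda>t. cnj (f t)) \<le> m11_set_norm (base_window :: real^'n \<Rightarrow> complex) * (\<integral>z. cmod (c z) \<partial>lborel)"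
    unfolding eq by (rule PS(2)) auto
  thus "m11_set_norm (\<lambda>t. cnj (f t)) \<le> (m11_set_norm (base_window :: real^'n \<Rightarrow> complex) * cmod (coherent_const TYPE('n))) * m11_set_norm f"
    by (simp add: c_def coherent_coeff_integrable(2)[OF f] mult_ac)
qed

text \<open>Coherent states are bounded by 1, so point evaluation is continuous. This allows sums
  formed in the Banach space to be evaluated pointwise.\<close>

lemma rep_m11_bound: "cmod (rep_m11 f x) \<le> cmod (coherent_const TYPE('n)) * norm (f :: 'n::finite m11)"
proof -
  note PS = packet_superposition(6)[where a="1/2" and w="\<lambda>z::(real^'n) \<times> (real^'n). cis (- (fst z \<bullet> snd z) / 2)" and x=fst and y=snd, folded coherent_def,
      OF _ base_window_schwartz coherent_coeff_integrable(1)[OF rep_m11[of f]]]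
  have "cmod (rep_m11 f x) \<le> (\<integral>z. cmod (coherent_coeff (rep_m11 f) z) \<partial>lborel)"
    by (subst m11_inversion[OF rep_m11]) (rule PS, auto)
  thus ?thesis by (simp add: coherent_coeff_integrable(2)[OF rep_m11] norm_m11_def)
qed

lemma bounded_linear_rep_m11: "bounded_linear (\<lambda>f :: 'n::finite m11. rep_m11 f x)"
  by (rule bounded_linear_intro[where K="cmod (coherent_const TYPE('n))"])
    (auto simp: rep_plus_m11 rep_scaleR_m11 scaleR_conv_of_real mult.commute intro: order_trans[OF rep_m11_bound])

section \<open>Algebra operations on the Banach space and monomials\<close>

definition m11_mult :: "'n::finite m11 \<Rightarrow> 'n m11 \<Rightarrow> 'n m11" where
  "m11_mult f h = abs_m11 (\<lambda>t. rep_m11 f t * rep_m11 h t)"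

definition m11_cnj :: "'n::finite m11 \<Rightarrow> 'n m11" where
  "m11_cnj f = abs_m11 (\<lambda>t. cnj (rep_m11 f t))"

lemma rep_m11_mult: "rep_m11 (m11_mult f h) = (\<lambda>t. rep_m11 f t * rep_m11 h t)"
  unfolding m11_mult_def by (rule abs_m11_inverse[OF m11_set_mult(1)[OF rep_m11 rep_m11]])

lemma rep_m11_cnj: "rep_m11 (m11_cnj f) = (\<lambda>t. cnj (rep_m11 f t))"
  unfolding m11_cnj_def by (rule abs_m11_inverse[OF m11_set_cnj(1)[OF rep_m11]])

lemma m11_mult_bound: "\<exists>M\<ge>1. \<forall>f h :: 'n::finite m11. norm (m11_mult f h) \<le> M * (norm f * norm h)"
proof -
  define K where "K = m11_set_norm (gaussian 1 :: real^'n \<Rightarrow> complex) * (cmod (coherent_const TYPE('n)))\<^sup>2"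
  have "norm (m11_mult f h) \<le> max 1 K * (norm f * norm h)" for f h :: "'n m11"
  proof -
    have "norm (m11_mult f h) \<le> K * (norm f * norm h)"
      unfolding norm_m11_def rep_m11_mult K_def by (rule m11_set_mult(2)[OF rep_m11 rep_m11])
    also have "\<dots> \<le> max 1 K * (norm f * norm h)" by (intro mult_right_mono) auto
    finally show ?thesis .
  qed
  thus ?thesis by (intro exI[of _ "max 1 K"]) auto
qed

lemma m11_mult_diff: "m11_mult f h - m11_mult f' h' = m11_mult (f - f') h + m11_mult f' (h - h')"
  by (rule m11_eqI) (simp add: rep_minus_m11 rep_plus_m11 rep_m11_mult algebra_simps)

definition m11_Re :: "'n::finite m11 \<Rightarrow> 'n m11" where "m11_Re f = cscale (1/2) (f + m11_cnj f)"
definition m11_Im :: "'n::finite m11 \<Rightarrow> 'n m11" where "m11_Im f = cscale (- \<i> / 2) (f - m11_cnj f)"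

lemma rep_m11_Re: "rep_m11 (m11_Re f) x = of_real (Re (rep_m11 f x))"
  by (simp add: m11_Re_def rep_cscale rep_plus_m11 rep_m11_cnj complex_eq_iff)

lemma rep_m11_Im: "rep_m11 (m11_Im f) x = of_real (Im (rep_m11 f x))"
  by (simp add: m11_Im_def rep_cscale rep_minus_m11 rep_m11_cnj complex_eq_iff)

lemma m11_Re_Im_diff: "m11_Re f - m11_Re h = m11_Re (f - h)" "m11_Im f - m11_Im h = m11_Im (f - h)"
  by (rule m11_eqI; simp add: rep_m11_Re rep_m11_Im rep_minus_m11)+

lemma m11_Re_Im_bound: "\<exists>B\<ge>1. \<forall>f :: 'n::finite m11. norm (m11_Re f) \<le> B * norm f \<and> norm (m11_Im f) \<le> B * norm f"
proof -
  define K where "K = m11_set_norm (base_window :: real^'n \<Rightarrow> complex) * cmod (coherent_const TYPE('n))"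
  have K0: "K \<ge> 0" by (simp add: K_def m11_set_norm_def)
  have c: "norm (m11_cnj f) \<le> K * norm f" for f :: "'n m11"
    unfolding norm_m11_def rep_m11_cnj K_def by (rule m11_set_cnj(2)[OF rep_m11])
  have "norm (m11_Re f) \<le> (1 + K) * norm f \<and> norm (m11_Im f) \<le> (1 + K) * norm f" for f :: "'n m11"
  proof -
    have n: "0 \<le> norm f" "0 \<le> K * norm f" using K0 by auto
    have "norm (m11_Re f) = norm (f + m11_cnj f) / 2" "norm (m11_Im f) = norm (f - m11_cnj f) / 2"
      by (simp_all add: m11_Re_def m11_Im_def norm_cscale norm_divide)
    thus ?thesis
      using norm_triangle_ineq[of f "m11_cnj f"] norm_triangle_ineq4[of f "m11_cnj f"] c[of f] n
      unfolding distrib_right by linarith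
  qed
  thus ?thesis using K0 by (intro exI[of _ "1 + K"]) auto
qed

text \<open>The algebra has no unit, so an empty product has no natural value; 0 is a dummy.
  Monomials are products of lists in order to avoid powers with exponent 0.\<close>

fun m11_prod_list :: "'n::finite m11 list \<Rightarrow> 'n m11" where
  "m11_prod_list [] = 0"
| "m11_prod_list [f] = f"
| "m11_prod_list (f # g # fs) = m11_mult f (m11_prod_list (g # fs))"

lemma rep_m11_prod_list: "fs \<noteq> [] \<Longrightarrow> rep_m11 (m11_prod_list fs) x = prod_list (map (\<lambda>f. rep_m11 f x) fs)"
  by (induct fs rule: m11_prod_list.induct) (auto simp: rep_m11_mult)

text \<open>A product of k factors takes only k - 1 multiplications; as M and R are at least 1, the
  rounder bound (M R)^k holds and covers the dummy value as well.\<close>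

lemma m11_prod_list_bound:
  fixes M R :: real and fs :: "'n::finite m11 list"
  assumes M: "M \<ge> 1" "\<And>f h :: 'n::finite m11. norm (m11_mult f h) \<le> M * (norm f * norm h)" and R: "R \<ge> 1"
    and fs: "\<And>f. f \<in> set fs \<Longrightarrow> norm f \<le> R"
  shows "norm (m11_prod_list fs) \<le> (M * R) ^ length fs"
  using fs
proof (induct fs rule: m11_prod_list.induct)
  case 1 thus ?case by simp
next
  case (2 f)
  have "R \<le> M * R" using M R by simp
  thus ?case using 2[of f] by simp
next
  case (3 f g fs)
  have "norm (m11_prod_list (f # g # fs)) \<le> M * (norm f * norm (m11_prod_list (g # fs)))"
    unfolding m11_prod_list.simps by (rule M(2))
  also have "\<dots> \<le> M * (R * (M * R) ^ length (g # fs))"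
    using M R 3 by (intro mult_left_mono mult_mono) auto
  finally show ?case by (simp add: mult_ac)
qed

text \<open>The factors are exchanged one at a time through fg - f'g' = (f - f')g + f'(g - g'), and
  every exchange costs at most d times (M R)^k.\<close>

lemma m11_prod_list_lipschitz:
  fixes M R d :: real and fs :: "'n::finite m11 list"
  assumes M: "M \<ge> 1" "\<And>f h :: 'n::finite m11. norm (m11_mult f h) \<le> M * (norm f * norm h)" and R: "R \<ge> 1"
    and fs: "list_all2 (\<lambda>f h. norm f \<le> R \<and> norm h \<le> R \<and> norm (f - h) \<le> d) fs hs" and d: "d \<ge> 0"
  shows "norm (m11_prod_list fs - m11_prod_list hs) \<le> real (length fs) * (M * R) ^ length fs * d"
  using fs
proof (induct fs arbitrary: hs rule: m11_prod_list.induct)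
  case 1 thus ?case by simp
next
  case (2 f)
  then obtain h where hs: "hs = [h]" and h: "norm (f - h) \<le> d" by (auto simp: list_all2_Cons1)
  have "1 \<le> M * R" using mult_mono[of 1 M 1 R] M R by simp
  hence "d \<le> M * R * d" using d mult_right_mono[of 1 "M * R" d] by simp
  thus ?case using h by (simp add: hs)
next
  case (3 f g fs)
  then obtain h k hs' where hs: "hs = h # k # hs'" and h: "norm f \<le> R" "norm h \<le> R" "norm (f - h) \<le> d"
    and l: "list_all2 (\<lambda>f h. norm f \<le> R \<and> norm h \<le> R \<and> norm (f - h) \<le> d) (g # fs) (k # hs')"
    by (auto simp: list_all2_Cons1)
  let ?n = "length (g # fs)"
  have IH: "norm (m11_prod_list (g # fs) - m11_prod_list (k # hs')) \<le> real ?n * (M * R) ^ ?n * d"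
    by (rule 3(1)[OF l])
  have gen: "list_all2 (\<lambda>f h. norm f \<le> R \<and> norm h \<le> R \<and> norm (f - h) \<le> d) xs ys \<Longrightarrow> x \<in> set xs \<Longrightarrow> norm x \<le> R"
    for xs ys :: "'n m11 list" and x
    by (induct rule: list_all2_induct) auto
  have b: "norm (m11_prod_list (g # fs)) \<le> (M * R) ^ ?n" by (rule m11_prod_list_bound[OF M R gen[OF l]])
  have MR: "0 \<le> (M * R) ^ ?n" using M R by simp
  have "norm (m11_prod_list (f # g # fs) - m11_prod_list (h # k # hs'))
     \<le> norm (m11_mult (f - h) (m11_prod_list (g # fs))) + norm (m11_mult h (m11_prod_list (g # fs) - m11_prod_list (k # hs')))"
    by (simp add: m11_mult_diff norm_triangle_ineq)
  also have "\<dots> \<le> M * (d * (M * R) ^ ?n) + M * (R * (real ?n * (M * R) ^ ?n * d))"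
  proof (rule add_mono)
    have "norm (m11_mult (f - h) (m11_prod_list (g # fs))) \<le> M * (norm (f - h) * norm (m11_prod_list (g # fs)))"
      by (rule M(2))
    also have "\<dots> \<le> M * (d * (M * R) ^ ?n)"
      using M(1) h(3) b d by (intro mult_left_mono mult_mono) auto
    finally show "norm (m11_mult (f - h) (m11_prod_list (g # fs))) \<le> M * (d * (M * R) ^ ?n)" .
    have "norm (m11_mult h (m11_prod_list (g # fs) - m11_prod_list (k # hs'))) \<le> M * (norm h * norm (m11_prod_list (g # fs) - m11_prod_list (k # hs')))"
      by (rule M(2))
    also have "\<dots> \<le> M * (R * (real ?n * (M * R) ^ ?n * d))"
      using M(1) R h(2) IH d by (intro mult_left_mono mult_mono) auto
    finally show "norm (m11_mult h (m11_prod_list (g # fs) - m11_prod_list (k # hs'))) \<le> M * (R * (real ?n * (M * R) ^ ?n * d))" .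
  qed
  also have "M * (d * (M * R) ^ ?n) \<le> M * R * (M * R) ^ ?n * d"
    using M R d MR mult_left_mono[of 1 R "M * (d * (M * R) ^ ?n)"] by (simp add: mult_ac)
  also have "M * R * (M * R) ^ ?n * d + M * (R * (real ?n * (M * R) ^ ?n * d)) = real (Suc ?n) * (M * R) ^ Suc ?n * d"
    by (simp add: algebra_simps)
  finally show ?case by (simp add: hs)
qed

lemma real_entire_abs_summable:
  assumes a: "\<And>s t. (\<lambda>(m, n). cmod (a m n * complex_of_real (s ^ m * t ^ n))) summable_on UNIV" and r: "r \<ge> 0"
  shows "(\<lambda>(m, n). cmod (a m n) * r ^ (m + n)) summable_on UNIV"
proof -
  have "(\<lambda>(m, n). cmod (a m n) * r ^ (m + n)) = (\<lambda>(m, n). cmod (a m n * complex_of_real (r ^ m * r ^ n)))"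
    using r by (auto simp: fun_eq_iff norm_mult norm_power power_add)
  thus ?thesis using a[of r r] by simp
qed

text \<open>Since 0^0 = 1, only the term with index (0, 0) survives at the origin.\<close>

lemma real_entire_at_0:
  assumes "((\<lambda>(m, n). a m n * complex_of_real (0 ^ m * 0 ^ n)) has_sum (F 0 0)) UNIV"
  shows "a 0 0 = F 0 0"
proof -
  have "((\<lambda>(m, n). a m n * complex_of_real (0 ^ m * 0 ^ n)) has_sum (a 0 0)) {(0, 0)}"
    using has_sum_finite[of "{(0::nat, 0::nat)}" "\<lambda>(m, n). a m n * complex_of_real (0 ^ m * 0 ^ n)"] by simp
  hence "((\<lambda>(m, n). a m n * complex_of_real (0 ^ m * 0 ^ n)) has_sum (a 0 0)) UNIV"
    by (rule has_sum_cong_neutral[THEN iffD1, rotated -1]) (auto split: prod.splits simp: power_0_left)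
  thus ?thesis using assms by (rule has_sum_unique)
qed

definition m11_monomial :: "(nat \<Rightarrow> nat \<Rightarrow> complex) \<Rightarrow> 'n::finite m11 \<Rightarrow> nat \<times> nat \<Rightarrow> 'n m11" where
  "m11_monomial a f = (\<lambda>(m, n). cscale (a m n) (m11_prod_list (replicate m (m11_Re f) @ replicate n (m11_Im f))))"

text \<open>The coefficients of F are absolutely summable against every power r^(m + n), so the
  series in the real and imaginary parts converges absolutely in the Banach algebra, and its
  Lipschitz bounds can be summed term by term. Continuity of point evaluation shows that the sum is
  F(u).\<close>

lemma m11_nonlinearity:
  fixes F :: "real \<Rightarrow> real \<Rightarrow> complex"
  assumes F: "real_entire F" and F0: "F 0 0 = 0"
  shows "\<exists>N :: 'n::finite m11 \<Rightarrow> 'n m11. (\<forall>f x. rep_m11 (N f) x = F (Re (rep_m11 f x)) (Im (rep_m11 f x))) \<and>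
    (\<forall>R. \<exists>L\<ge>0. \<forall>f h. norm f \<le> R \<longrightarrow> norm h \<le> R \<longrightarrow> norm (N f - N h) \<le> L * norm (f - h))"
proof -
  obtain a where a: "\<And>s t. (\<lambda>(m, n). cmod (a m n * complex_of_real (s ^ m * t ^ n))) summable_on UNIV"
    "\<And>s t. ((\<lambda>(m, n). a m n * complex_of_real (s ^ m * t ^ n)) has_sum (F s t)) UNIV"
    using F unfolding real_entire_def by blast
  have a0: "a 0 0 = 0" using real_entire_at_0[of a F, OF a(2)[of 0 0]] F0 by simp
  obtain M where M: "M \<ge> 1" "\<And>f h :: 'n m11. norm (m11_mult f h) \<le> M * (norm f * norm h)" using m11_mult_bound by blast
  obtain B where B: "B \<ge> 1" "\<And>f :: 'n m11. norm (m11_Re f) \<le> B * norm f" "\<And>f :: 'n m11. norm (m11_Im f) \<le> B * norm f"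
    using m11_Re_Im_bound by blast
  define T where "T = (m11_monomial a :: 'n m11 \<Rightarrow> _)"
  have Tb: "norm (T f (m, n)) \<le> cmod (a m n) * (M * R) ^ (m + n)" if R: "R \<ge> 1" "B * norm f \<le> R" for f m n R
  proof -
    have "norm (m11_prod_list (replicate m (m11_Re f) @ replicate n (m11_Im f))) \<le> (M * R) ^ length (replicate m (m11_Re f) @ replicate n (m11_Im f))"
      by (rule m11_prod_list_bound[OF M R(1)]) (use order_trans[OF B(2) R(2)] order_trans[OF B(3) R(2)] in \<open>auto split: if_splits\<close>)
    thus ?thesis unfolding T_def m11_monomial_def by (auto simp: norm_cscale intro!: mult_left_mono)
  qed
  have Tl: "norm (T f (m, n) - T h (m, n)) \<le> cmod (a m n) * (2 * (M * R)) ^ (m + n) * (B * norm (f - h))"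
    if R: "R \<ge> 1" "B * norm f \<le> R" "B * norm h \<le> R" for f h m n R
  proof -
    let ?fs = "\<lambda>f. replicate m (m11_Re f) @ replicate n (m11_Im f)"
    have "norm (m11_prod_list (?fs f) - m11_prod_list (?fs h)) \<le> real (length (?fs f)) * (M * R) ^ length (?fs f) * (B * norm (f - h))"
    proof (rule m11_prod_list_lipschitz[OF M R(1)])
      show "list_all2 (\<lambda>x y. norm x \<le> R \<and> norm y \<le> R \<and> norm (x - y) \<le> B * norm (f - h)) (?fs f) (?fs h)"
        using order_trans[OF B(2) R(2)] order_trans[OF B(3) R(2)] order_trans[OF B(2) R(3)] order_trans[OF B(3) R(3)]
          B(2)[of "f - h"] B(3)[of "f - h"]
        by (intro list_all2_appendI) (auto simp: list_all2_conv_all_nth m11_Re_Im_diff)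
    qed (use B in auto)
    \<comment> \<open>The linear factor m + n of the Lipschitz bound is absorbed by doubling the
      radius; this explains the 2 in the radius r below.\<close>
    also have "\<dots> \<le> 2 ^ (m + n) * (M * R) ^ (m + n) * (B * norm (f - h))"
    proof -
      have "real (length (?fs f)) \<le> 2 ^ (m + n)"
        using less_imp_le[OF of_nat_less_two_power[of "m + n", where 'a=real]] by simp
      hence "real (length (?fs f)) * (M * R) ^ (m + n) \<le> 2 ^ (m + n) * (M * R) ^ (m + n)"
        using M(1) R(1) by (intro mult_right_mono) auto
      thus ?thesis using B(1) by (intro mult_right_mono) auto
    qed
    also have "\<dots> = (2 * (M * R)) ^ (m + n) * (B * norm (f - h))" by (simp only: power_mult_distrib)
    finally have "cmod (a m n) * norm (m11_prod_list (?fs f) - m11_prod_list (?fs h)) \<le> cmod (a m n) * ((2 * (M * R)) ^ (m + n) * (B * norm (f - h)))"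
      by (intro mult_left_mono) auto
    moreover have "T f (m, n) - T h (m, n) = cscale (a m n) (m11_prod_list (?fs f) - m11_prod_list (?fs h))"
      unfolding T_def m11_monomial_def by (rule m11_eqI) (simp add: rep_cscale rep_minus_m11 algebra_simps)
    ultimately show ?thesis by (simp add: norm_cscale mult.assoc)
  qed
  have sumR: "(\<lambda>(m, n). cmod (a m n) * r ^ (m + n)) summable_on UNIV" if "r \<ge> 0" for r
    by (rule real_entire_abs_summable[OF a(1) that])
  have Ts: "T f summable_on UNIV" for f
  proof -
    define R where "R = max 1 (B * norm f)"
    have "(\<lambda>x. norm (T f x)) summable_on UNIV"
    proof (rule summable_on_comparison_test)
      show "(\<lambda>(m, n). cmod (a m n) * (M * R) ^ (m + n)) summable_on UNIV" by (rule sumR) (use M in \<open>auto simp: R_def\<close>)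
      show "norm (T f x) \<le> (case x of (m, n) \<Rightarrow> cmod (a m n) * (M * R) ^ (m + n))" for x
        using Tb[of R f "fst x" "snd x"] by (auto simp: R_def case_prod_unfold)
    qed auto
    thus ?thesis by (rule abs_summable_summable)
  qed
  define N where "N f = infsum (T f) UNIV" for f
  have "rep_m11 (N f) x = F (Re (rep_m11 f x)) (Im (rep_m11 f x))" for f x
  proof -
    have "((\<lambda>i. rep_m11 (T f i) x) has_sum rep_m11 (N f) x) UNIV"
      using has_sum_bounded_linear[OF bounded_linear_rep_m11 has_sum_infsum[OF Ts[of f]]] by (simp add: N_def o_def)
    moreover have "(\<lambda>i. rep_m11 (T f i) x) = (\<lambda>(m, n). a m n * complex_of_real (Re (rep_m11 f x) ^ m * Im (rep_m11 f x) ^ n))"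
    proof (rule ext, clarify)
      fix m n
      show "rep_m11 (T f (m, n)) x = a m n * complex_of_real (Re (rep_m11 f x) ^ m * Im (rep_m11 f x) ^ n)"
      \<comment> \<open>The empty product has the dummy value 0, and this agrees with the true
        constant term because \<open>a 0 0 = 0\<close>.\<close>
      proof (cases "m = 0 \<and> n = 0")
        case True thus ?thesis by (simp add: T_def m11_monomial_def a0 rep_cscale)
      next
        case False
        thus ?thesis by (simp add: T_def m11_monomial_def rep_cscale rep_m11_prod_list rep_m11_Re rep_m11_Im prod_list_replicate)
      qed
    qed
    ultimately show ?thesis using a(2)[of "Re (rep_m11 f x)" "Im (rep_m11 f x)"] has_sum_unique by fastforce
  qed
  moreover have "\<exists>L\<ge>0. \<forall>f h. norm f \<le> R \<longrightarrow> norm h \<le> R \<longrightarrow> norm (N f - N h) \<le> L * norm (f - h)" for R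
  proof -
    define S where "S = max 1 (B * R)"
    define r where "r = 2 * (M * S)"
    have r: "r \<ge> 0" using M by (simp add: r_def S_def)
    define L where "L = infsum (\<lambda>(m, n). cmod (a m n) * r ^ (m + n)) UNIV"
    have L0: "L \<ge> 0" unfolding L_def by (rule infsum_nonneg) (use r in auto)
    have "norm (N f - N h) \<le> (L * B) * norm (f - h)" if "norm f \<le> R" "norm h \<le> R" for f h
    proof -
      have fS: "B * norm f \<le> S" "B * norm h \<le> S" "S \<ge> 1" 
        using mult_left_mono[OF that(1), of B] mult_left_mono[OF that(2), of B] B(1) by (simp_all add: S_def le_max_iff_disj)
      have hs: "((\<lambda>i. T f i - T h i) has_sum (N f - N h)) UNIV"
      proof -
        have "((\<lambda>i. - T h i) has_sum - N h) UNIV" unfolding N_def by (simp add: has_sum_uminus has_sum_infsum Ts)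
        from has_sum_add[OF has_sum_infsum[OF Ts[of f]] this] show ?thesis by (simp add: N_def)
      qed
      have cs: "((\<lambda>i. (case i of (m, n) \<Rightarrow> cmod (a m n) * r ^ (m + n)) * (B * norm (f - h))) has_sum (L * (B * norm (f - h)))) UNIV"
        unfolding L_def by (intro has_sum_cmult_left has_sum_infsum sumR r)
      have "norm (N f - N h) \<le> L * (B * norm (f - h))"
        by (rule norm_infsum_le[OF hs cs]) (use Tl[OF fS(3) fS(1,2)] in \<open>auto simp: r_def\<close>)
      thus ?thesis by simp
    qed
    thus ?thesis using L0 B by (intro exI[of _ "L * B"]) auto
  qed
  ultimately show ?thesis by blast
qed

text \<open>F(h) is a pointwise limit of polynomials in Re h and Im h: the squares of side k are
  cofinal among the finite sets of exponents, which turns the unordered sum into the limit of a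
  sequence.\<close>

lemma nonlinearity_measurable:
  assumes F: "real_entire F" and [measurable]: "h \<in> borel_measurable borel"
  shows "nonlinearity F h \<in> borel_measurable borel"
proof -
  obtain a where a: "\<And>s t. ((\<lambda>(m, n). a m n * complex_of_real (s ^ m * t ^ n)) has_sum (F s t)) UNIV"
    using F unfolding real_entire_def by blast
  have ex: "\<exists>k. X \<subseteq> {..<k} \<times> {..<k}" if X: "finite X" for X :: "(nat \<times> nat) set"
  proof -
    have "finite (fst ` X \<union> snd ` X)" using X by auto
    then obtain k where k: "\<And>i. i \<in> fst ` X \<union> snd ` X \<Longrightarrow> i < k" using finite_nat_set_iff_bounded by metis
    have "X \<subseteq> {..<k} \<times> {..<k}"
    proof
      fix x assume "x \<in> X"
      hence "fst x < k" "snd x < k" using k by auto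
      thus "x \<in> {..<k} \<times> {..<k}" by (cases x) auto
    qed
    thus ?thesis ..
  qed
  have fl: "filterlim (\<lambda>k. {..<k::nat} \<times> {..<k}) (finite_subsets_at_top UNIV) sequentially"
    unfolding filterlim_finite_subsets_at_top
  proof (intro allI impI, elim conjE)
    fix X :: "(nat \<times> nat) set" assume "finite X"
    then obtain k where k: "X \<subseteq> {..<k} \<times> {..<k}" using ex by blast
    show "\<forall>\<^sub>F y in sequentially. finite ({..<y} \<times> {..<y}) \<and> X \<subseteq> {..<y} \<times> {..<y} \<and> {..<y} \<times> {..<y} \<subseteq> UNIV"
      using eventually_ge_at_top[of k]
    proof eventually_elim
      case (elim y)
      hence "{..<k} \<times> {..<k} \<subseteq> {..<y} \<times> {..<y}" by (intro Sigma_mono) auto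
      thus ?case using k by (intro conjI order_trans[OF k]) auto
    qed
  qed
  show ?thesis
  proof (rule borel_measurable_LIMSEQ_metric)
    show "(\<lambda>x. \<Sum>(m, n)\<in>{..<k} \<times> {..<k}. a m n * complex_of_real (Re (h x) ^ m * Im (h x) ^ n)) \<in> borel_measurable borel" for k
      by measurable
    show "(\<lambda>k. \<Sum>(m, n)\<in>{..<k} \<times> {..<k}. a m n * complex_of_real (Re (h x) ^ m * Im (h x) ^ n)) \<longlonglongrightarrow> nonlinearity F h x" for x
      using filterlim_compose[OF a[of "Re (h x)" "Im (h x)", unfolded has_sum_def] fl] by (simp add: nonlinearity_def)
  qed
qed

section \<open>Hermite expansion of coherent states\<close>

text \<open>The orthogonality weight exp(-s^2) of the Hermite polynomials, tilted by a complex
  exponent b. A coherent state times the Gaussian factor of a Hermite function has this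
  form.\<close>

definition hgauss :: "complex \<Rightarrow> real \<Rightarrow> complex" where
  "hgauss b s = exp (b * of_real s - (of_real s)\<^sup>2)"

lemma hgauss_continuous: "continuous_on A (hgauss b)"
  unfolding hgauss_def by (intro continuous_intros)

lemma hgauss_measurable [measurable]: "hgauss b \<in> borel_measurable borel"
  by (intro borel_measurable_continuous_onI hgauss_continuous)

lemma poly_measurable [measurable]: "poly (p :: real poly) \<in> borel_measurable borel"
  by (intro borel_measurable_continuous_onI continuous_intros)

lemma norm_hgauss: "cmod (hgauss b s) = exp (Re b * s - s\<^sup>2)"
  by (simp add: hgauss_def norm_exp_eq_Re flip: of_real_power)

lemma poly_exp_bound: "\<exists>C\<ge>0. \<exists>k\<ge>0. \<forall>s. \<bar>poly p s\<bar> \<le> C * exp (k * \<bar>s::real\<bar>)"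
proof (induct p)
  case 0
  show ?case by (rule exI[of _ 0]) auto
next
  case (pCons a p)
  then obtain C k where C: "C \<ge> 0" "k \<ge> 0" "\<And>s. \<bar>poly p s\<bar> \<le> C * exp (k * \<bar>s\<bar>)" by blast
  have "\<bar>poly (pCons a p) s\<bar> \<le> (\<bar>a\<bar> + C) * exp ((k + 1) * \<bar>s\<bar>)" for s
  proof -
    have "\<bar>s\<bar> \<le> exp \<bar>s\<bar>" using exp_ge_add_one_self[of "\<bar>s\<bar>"] by linarith
    hence "\<bar>s\<bar> * \<bar>poly p s\<bar> \<le> exp \<bar>s\<bar> * (C * exp (k * \<bar>s\<bar>))" using C by (intro mult_mono) auto
    also have "\<dots> = C * exp ((k + 1) * \<bar>s\<bar>)" by (simp add: distrib_right exp_add)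
    finally have 1: "\<bar>s * poly p s\<bar> \<le> C * exp ((k + 1) * \<bar>s\<bar>)" by (simp add: abs_mult)
    have "\<bar>a\<bar> * 1 \<le> \<bar>a\<bar> * exp ((k + 1) * \<bar>s\<bar>)" using C by (intro mult_left_mono) auto
    with 1 show ?thesis unfolding poly_pCons distrib_right by linarith
  qed
  moreover have "\<bar>a\<bar> + C \<ge> 0" "k + 1 \<ge> 0" using C by auto
  ultimately show ?case by blast
qed

text \<open>One half of the exponent -s^2 absorbs all exponential growth, by m |s| <= m^2 / 2 + s^2
  / 2.\<close>

lemma poly_hgauss_bound:
  "\<exists>C\<ge>0. \<forall>s. cmod (of_real (poly p s) * hgauss b s) \<le> C * exp (- s\<^sup>2 / 2)"
proof -
  obtain C k where C: "C \<ge> 0" "k \<ge> 0" "\<And>s. \<bar>poly p s\<bar> \<le> C * exp (k * \<bar>s\<bar>)" using poly_exp_bound by blast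
  define m where "m = k + \<bar>Re b\<bar>"
  have "cmod (of_real (poly p s) * hgauss b s) \<le> (C * exp (m\<^sup>2 / 2)) * exp (- s\<^sup>2 / 2)" for s
  proof -
    have "cmod (of_real (poly p s) * hgauss b s) = \<bar>poly p s\<bar> * exp (Re b * s - s\<^sup>2)"
      by (simp add: norm_mult norm_hgauss)
    also have "\<dots> \<le> (C * exp (k * \<bar>s\<bar>)) * exp (Re b * s - s\<^sup>2)" by (intro mult_right_mono C) auto
    also have "\<dots> = C * exp (k * \<bar>s\<bar> + (Re b * s - s\<^sup>2))" by (simp only: exp_add mult.assoc)
    also have "\<dots> \<le> C * exp (m\<^sup>2 / 2 + - s\<^sup>2 / 2)"
    proof -
      have "Re b * s \<le> \<bar>Re b\<bar> * \<bar>s\<bar>" by (metis abs_ge_self abs_mult)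
      moreover have "m * \<bar>s\<bar> \<le> m\<^sup>2 / 2 + s\<^sup>2 / 2"
        using sum_squares_bound[of m "\<bar>s\<bar>"] by simp
      moreover have "m * \<bar>s\<bar> = k * \<bar>s\<bar> + \<bar>Re b\<bar> * \<bar>s\<bar>" by (simp add: m_def distrib_right)
      ultimately have "k * \<bar>s\<bar> + (Re b * s - s\<^sup>2) \<le> m\<^sup>2 / 2 + - s\<^sup>2 / 2" by linarith
      thus ?thesis using C by (intro mult_left_mono) auto
    qed
    also have "\<dots> = (C * exp (m\<^sup>2 / 2)) * exp (- s\<^sup>2 / 2)" by (simp only: exp_add mult.assoc)
    finally show ?thesis .
  qed
  moreover have "C * exp (m\<^sup>2 / 2) \<ge> 0" using C by auto
  ultimately show ?thesis by blast
qed

lemma integrable_exp_square: "integrable lborel (\<lambda>s::real. exp (- s\<^sup>2 / 2))"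
proof -
  have "integrable lborel (\<lambda>y. complex_of_real (exp (- (1 * y)\<^sup>2 / 2)) * cis (y * 0))"
    by (rule gaussian_fourier_1(1)) simp
  hence "integrable lborel (\<lambda>y. Re (complex_of_real (exp (- (1 * y)\<^sup>2 / 2)) * cis (y * 0)))"
    by (rule integrable_Re)
  thus ?thesis by simp
qed

lemma poly_hgauss_integrable: "integrable lborel (\<lambda>s. of_real (poly p s) * hgauss b s)"
proof -
  obtain C where C: "\<And>s. cmod (of_real (poly p s) * hgauss b s) \<le> C * exp (- s\<^sup>2 / 2)"
    using poly_hgauss_bound by blast
  show ?thesis
    by (rule integral_norm_le(1)[OF _ _ C]) (auto intro!: integrable_mult_right integrable_exp_square[simplified])
qed

lemma exp_square_tendsto_0: "((\<lambda>s::real. exp (- s\<^sup>2 / 2)) \<longlongrightarrow> 0) at_top" "((\<lambda>s::real. exp (- s\<^sup>2 / 2)) \<longlongrightarrow> 0) at_bot"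
proof -
  have "filterlim (\<lambda>s::real. (1/2) * s ^ 2) at_top at_top"
    by (rule filterlim_tendsto_pos_mult_at_top[OF tendsto_const _ filterlim_pow_at_top[OF _ filterlim_ident]]) auto
  hence "filterlim (\<lambda>s::real. - ((1/2) * s ^ 2)) at_bot at_top" by (simp add: filterlim_uminus_at_top)
  from filterlim_compose[OF exp_at_bot this] show "((\<lambda>s::real. exp (- s\<^sup>2 / 2)) \<longlongrightarrow> 0) at_top" by simp
  thus "((\<lambda>s::real. exp (- s\<^sup>2 / 2)) \<longlongrightarrow> 0) at_bot" by (simp add: filterlim_at_bot_mirror)
qed

text \<open>The integral over the line of the derivative of p(s) exp(b s - s^2) vanishes, and this
  derivative is p' + b p - 2 s p times the exponential.\<close>

lemma poly_hgauss_by_parts: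
  "(\<integral>s. of_real (poly (pderiv p) s) * hgauss b s \<partial>lborel) + b * (\<integral>s. of_real (poly p s) * hgauss b s \<partial>lborel)
    = (\<integral>s. of_real (poly ([:0, 2:] * p) s) * hgauss b s \<partial>lborel)"
proof -
  define F where "F s = of_real (poly p s) * hgauss b s" for s
  define f where "f s = of_real (poly (pderiv p) s) * hgauss b s + b * (of_real (poly p s) * hgauss b s) - of_real (poly ([:0, 2:] * p) s) * hgauss b s" for s
  have hd: "(hgauss b has_vector_derivative (b - 2 * of_real s) * hgauss b s) (at s)" for s
  proof -
    have 1: "((\<lambda>s. b * complex_of_real s - (complex_of_real s)\<^sup>2) has_vector_derivative (b - 2 * of_real s)) (at s)"
      unfolding power2_eq_square by (auto intro!: derivative_eq_intros)
    from field_vector_diff_chain_at[OF 1 DERIV_exp]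
    show ?thesis by (simp add: hgauss_def[abs_def] o_def)
  qed
  have pd: "((\<lambda>s. complex_of_real (poly p s)) has_vector_derivative of_real (poly (pderiv p) s)) (at s)" for s
    by (intro has_vector_derivative_of_real poly_DERIV[THEN DERIV_subset, THEN has_real_derivative_iff_has_vector_derivative[THEN iffD1]]) auto
  have Fd: "(F has_vector_derivative f s) (at s)" for s
    unfolding F_def f_def
    by (rule has_vector_derivative_eq_rhs[OF has_vector_derivative_mult[OF pd hd]]) (simp add: algebra_simps)
  have fi: "integrable lborel f"
    unfolding f_def by (intro Bochner_Integration.integrable_diff Bochner_Integration.integrable_add integrable_mult_right poly_hgauss_integrable)
  obtain C where C: "C \<ge> 0" "\<And>s. cmod (F s) \<le> C * exp (- s\<^sup>2 / 2)" unfolding F_def using poly_hgauss_bound by blast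
  have "(LBINT s=-\<infinity>..\<infinity>. f s) = 0 - 0"
  proof (rule interval_integral_FTC_integrable[where F=F])
    show "(F has_vector_derivative f s) (at s)" for s by (rule Fd)
    show "isCont f s" for s
    proof -
      have "continuous_on UNIV f" unfolding f_def by (intro continuous_intros hgauss_continuous)
      thus ?thesis by (simp add: continuous_on_eq_continuous_at)
    qed
    show "set_integrable lborel (einterval (- \<infinity>) \<infinity>) f" using fi by (simp add: set_integrable_def)
    have "(F \<longlongrightarrow> 0) at_bot"
      by (rule Lim_null_comparison[where g="\<lambda>s. C * exp (- s\<^sup>2 / 2)"])
        (use C tendsto_mult_right_zero[OF exp_square_tendsto_0(2)] in \<open>auto intro: always_eventually\<close>)
    thus "((F \<circ> real_of_ereal) \<longlongrightarrow> 0) (at_right (- \<infinity>))" by (simp add: ereal_tendsto_simps)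
    have "(F \<longlongrightarrow> 0) at_top"
      by (rule Lim_null_comparison[where g="\<lambda>s. C * exp (- s\<^sup>2 / 2)"])
        (use C tendsto_mult_right_zero[OF exp_square_tendsto_0(1)] in \<open>auto intro: always_eventually\<close>)
    thus "((F \<circ> real_of_ereal) \<longlongrightarrow> 0) (at_left \<infinity>)" by (simp add: ereal_tendsto_simps)
  qed simp
  hence "integral\<^sup>L lborel f = 0" by (simp add: interval_lebesgue_integral_def set_lebesgue_integral_def)
  moreover have "integral\<^sup>L lborel f = (\<integral>s. of_real (poly (pderiv p) s) * hgauss b s \<partial>lborel) + b * (\<integral>s. of_real (poly p s) * hgauss b s \<partial>lborel)
    - (\<integral>s. of_real (poly ([:0, 2:] * p) s) * hgauss b s \<partial>lborel)"
    unfolding f_def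
    by (simp only: Bochner_Integration.integral_diff Bochner_Integration.integral_add integral_mult_right_zero
       poly_hgauss_integrable Bochner_Integration.integrable_add integrable_mult_right)
  ultimately show ?thesis by simp
qed

text \<open>Completing the square is done for the real part of b only, by a real translation; the
  imaginary part becomes a frequency in the Gaussian Fourier integral, so no contour has to be
  moved.\<close>

lemma hgauss_integral: "(\<integral>s. hgauss b s \<partial>lborel) = of_real (sqrt pi) * exp (b\<^sup>2 / 4)"
proof -
  define x y where "x = Re b" and "y = Im b"
  have b: "b = of_real x + \<i> * of_real y" by (simp add: x_def y_def complex_eq)
  define G where "G u = complex_of_real (exp (- (sqrt 2 * u)\<^sup>2 / 2)) * cis (u * y)" for u
  have Gm[measurable]: "G \<in> borel_measurable borel" unfolding G_def by measurable
  have GI: "integral\<^sup>L lborel G = of_real (sqrt pi * exp (- y\<^sup>2 / 4))"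
    unfolding G_def by (subst gaussian_fourier_1(2)) (auto simp: real_sqrt_mult)
  have eq: "hgauss b s = (of_real (exp (x\<^sup>2 / 4)) * cis (x * y / 2)) * G (s - x / 2)" for s
  proof -
    have "b * of_real s - (of_real s)\<^sup>2 = of_real (x\<^sup>2 / 4) + \<i> * of_real (x * y / 2) + (of_real (- (sqrt 2 * (s - x / 2))\<^sup>2 / 2) + \<i> * of_real ((s - x / 2) * y))"
    proof -
      have r1: "(sqrt 2 * (s - x / 2))\<^sup>2 = 2 * (s - x / 2)\<^sup>2" by (simp add: power_mult_distrib)
      show ?thesis unfolding b r1 by (rule complex_eqI) (simp_all add: power2_eq_square field_simps)
    qed
    thus ?thesis unfolding hgauss_def G_def cis_conv_exp by (simp only: exp_add of_real_exp[symmetric] exp_of_real)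
  qed
  have "(\<integral>s. hgauss b s \<partial>lborel) = (\<integral>s. (of_real (exp (x\<^sup>2 / 4)) * cis (x * y / 2)) * G (s - x / 2) \<partial>lborel)"
    by (simp only: eq)
  also have "\<dots> = (of_real (exp (x\<^sup>2 / 4)) * cis (x * y / 2)) * (\<integral>s. G (s - x / 2) \<partial>lborel)"
    by (rule integral_mult_right_zero)
  also have "(\<integral>s. G (s - x / 2) \<partial>lborel) = of_real (sqrt pi * exp (- y\<^sup>2 / 4))"
    using lborel_integral_translate(3)[OF Gm, of "x / 2"] GI by (simp only:)
  also have "(of_real (exp (x\<^sup>2 / 4)) * cis (x * y / 2)) * of_real (sqrt pi * exp (- y\<^sup>2 / 4)) = of_real (sqrt pi) * (of_real (exp (x\<^sup>2 / 4 - y\<^sup>2 / 4)) * cis (x * y / 2))"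
  proof -
    have "exp (x\<^sup>2 / 4 - y\<^sup>2 / 4) = exp (x\<^sup>2 / 4) * exp (- y\<^sup>2 / 4)" by (simp flip: exp_add)
    thus ?thesis by (simp only: of_real_mult mult_ac)
  qed
  also have "of_real (exp (x\<^sup>2 / 4 - y\<^sup>2 / 4)) * cis (x * y / 2) = exp (b\<^sup>2 / 4)"
  proof -
    have "b\<^sup>2 / 4 = of_real (x\<^sup>2 / 4 - y\<^sup>2 / 4) + \<i> * of_real (x * y / 2)"
      unfolding b by (simp add: power2_eq_square complex_eq_iff)
    thus ?thesis by (simp only: exp_add cis_conv_exp exp_of_real)
  qed
  finally show ?thesis .
qed

text \<open>The physicists' Hermite polynomials, through the recursion that repeated differentiation
  of exp(-s^2) produces in Rodrigues' formula.\<close>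

primrec hermite_poly :: "nat \<Rightarrow> real poly" where
  "hermite_poly 0 = 1"
| "hermite_poly (Suc k) = [:0, 2:] * hermite_poly k - pderiv (hermite_poly k)"

lemma deriv_exp_square:
  "(deriv ^^ k) (\<lambda>r::real. exp (- (r\<^sup>2))) = (\<lambda>s. (-1) ^ k * poly (hermite_poly k) s * exp (- (s\<^sup>2)))"
proof (induct k)
  case (Suc k)
  have "((\<lambda>s. (-1) ^ k * poly (hermite_poly k) s * exp (- (s\<^sup>2))) has_real_derivative
      (-1) ^ Suc k * poly (hermite_poly (Suc k)) s * exp (- (s\<^sup>2))) (at s)" for s :: real
    by (auto intro!: derivative_eq_intros simp: algebra_simps)
  hence "deriv (\<lambda>s. (-1) ^ k * poly (hermite_poly k) s * exp (- (s\<^sup>2))) s = (-1) ^ Suc k * poly (hermite_poly (Suc k)) s * exp (- (s\<^sup>2))" for s :: real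
    by (rule DERIV_imp_deriv)
  thus ?case unfolding funpow.simps o_apply Suc by (rule ext)
qed simp

definition hermite_const :: "nat \<Rightarrow> real" where
  "hermite_const k = 1 / sqrt (2 ^ k * fact k * sqrt pi)"

lemma hermite_fun1_eq: "hermite_fun1 k s = hermite_const k * poly (hermite_poly k) s * exp (- s\<^sup>2 / 2)"
proof -
  have 1: "(-1) ^ k * (-1) ^ k = (1::real)" by (simp flip: power_mult_distrib)
  have 2: "exp (s\<^sup>2 / 2) * exp (- (s\<^sup>2)) = exp (- s\<^sup>2 / 2)" by (simp flip: exp_add)
  have gen: "u / d * e * (u * p * e') = (u * u) / d * p * (e * e')" for u d e p e' :: real
    by (simp add: divide_inverse mult_ac)
  show ?thesis unfolding hermite_fun1_def deriv_exp_square gen 1 2 hermite_const_def ..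
qed

text \<open>The generating function in integrated form: under the integral, integration by parts
  turns the raising operator 2s - d/ds into multiplication by b.\<close>

lemma hermite_poly_hgauss: "(\<integral>s. of_real (poly (hermite_poly k) s) * hgauss b s \<partial>lborel) = b ^ k * (of_real (sqrt pi) * exp (b\<^sup>2 / 4))"
proof (induct k)
  case 0
  thus ?case by (simp add: hgauss_integral)
next
  case (Suc k)
  have "(\<integral>s. of_real (poly (hermite_poly (Suc k)) s) * hgauss b s \<partial>lborel)
    = (\<integral>s. of_real (poly ([:0, 2:] * hermite_poly k) s) * hgauss b s - of_real (poly (pderiv (hermite_poly k)) s) * hgauss b s \<partial>lborel)"
    by (simp only: hermite_poly.simps poly_diff of_real_diff left_diff_distrib)
  also have "\<dots> = (\<integral>s. of_real (poly ([:0, 2:] * hermite_poly k) s) * hgauss b s \<partial>lborel) - (\<integral>s. of_real (poly (pderiv (hermite_poly k)) s) * hgauss b s \<partial>lborel)"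
    by (intro Bochner_Integration.integral_diff poly_hgauss_integrable)
  also have "\<dots> = b * (\<integral>s. of_real (poly (hermite_poly k) s) * hgauss b s \<partial>lborel)"
    unfolding poly_hgauss_by_parts[symmetric] by simp
  finally show ?case unfolding Suc by simp
qed

lemma pderiv_hermite_poly: "pderiv (hermite_poly (Suc k)) = smult (2 * real (Suc k)) (hermite_poly k)"
proof (induct k)
  case 0
  show ?case by (simp add: pderiv_mult pderiv_pCons)
next
  case (Suc k)
  have "pderiv (hermite_poly (Suc (Suc k))) = smult 2 (hermite_poly (Suc k)) + [:0, 2:] * pderiv (hermite_poly (Suc k)) - pderiv (pderiv (hermite_poly (Suc k)))"
    by (simp only: hermite_poly.simps(2)[of "Suc k"] pderiv_diff pderiv_mult) (simp add: pderiv_pCons algebra_simps del: hermite_poly.simps)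
  also have "\<dots> = smult 2 (hermite_poly (Suc k)) + smult (2 * real (Suc k)) ([:0, 2:] * hermite_poly k - pderiv (hermite_poly k))"
    unfolding Suc by (simp add: pderiv_smult smult_diff_right mult_smult_right del: hermite_poly.simps)
  also have "[:0, 2:] * hermite_poly k - pderiv (hermite_poly k) = hermite_poly (Suc k)" by simp
  finally show ?case by (simp add: smult_add_left[symmetric] algebra_simps del: hermite_poly.simps)
qed

text \<open>For the weight exp(-s^2) the raising operator 2s - d/ds is the adjoint of
  differentiation.\<close>

lemma hermite_poly_pairing_Suc:
  "(\<integral>s. of_real (poly (p * hermite_poly (Suc k)) s) * hgauss 0 s \<partial>lborel) = (\<integral>s. of_real (poly (pderiv p * hermite_poly k) s) * hgauss 0 s \<partial>lborel)"
proof -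
  have e: "p * hermite_poly (Suc k) = [:0, 2:] * (p * hermite_poly k) - p * pderiv (hermite_poly k)"
    by (simp add: algebra_simps)
  have "(\<integral>s. of_real (poly (p * hermite_poly (Suc k)) s) * hgauss 0 s \<partial>lborel)
    = (\<integral>s. of_real (poly ([:0, 2:] * (p * hermite_poly k)) s) * hgauss 0 s - of_real (poly (p * pderiv (hermite_poly k)) s) * hgauss 0 s \<partial>lborel)"
    unfolding e by (simp only: poly_diff of_real_diff left_diff_distrib)
  also have "\<dots> = (\<integral>s. of_real (poly ([:0, 2:] * (p * hermite_poly k)) s) * hgauss 0 s \<partial>lborel) - (\<integral>s. of_real (poly (p * pderiv (hermite_poly k)) s) * hgauss 0 s \<partial>lborel)"
    by (intro Bochner_Integration.integral_diff poly_hgauss_integrable)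
  also have "(\<integral>s. of_real (poly ([:0, 2:] * (p * hermite_poly k)) s) * hgauss 0 s \<partial>lborel) = (\<integral>s. of_real (poly (pderiv (p * hermite_poly k)) s) * hgauss 0 s \<partial>lborel)"
    unfolding poly_hgauss_by_parts[symmetric] by simp
  also have "\<dots> = (\<integral>s. of_real (poly (p * pderiv (hermite_poly k)) s) * hgauss 0 s + of_real (poly (pderiv p * hermite_poly k) s) * hgauss 0 s \<partial>lborel)"
    by (simp only: pderiv_mult poly_add of_real_add distrib_right mult.commute[of _ "pderiv p"])
  also have "\<dots> = (\<integral>s. of_real (poly (p * pderiv (hermite_poly k)) s) * hgauss 0 s \<partial>lborel) + (\<integral>s. of_real (poly (pderiv p * hermite_poly k) s) * hgauss 0 s \<partial>lborel)"
    by (intro Bochner_Integration.integral_add poly_hgauss_integrable)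
  finally show ?thesis by simp
qed

text \<open>Moving a raising operator across the pairing lowers both indices by one and leaves a
  factor 2(j + 1); the process ends when one of the indices is 0.\<close>

lemma hermite_poly_orthogonal:
  "(\<integral>s. of_real (poly (hermite_poly m * hermite_poly k) s) * hgauss 0 s \<partial>lborel) = (if m = k then of_real (2 ^ k * fact k * sqrt pi) else 0)"
proof (induct k arbitrary: m)
  case 0
  have "(\<integral>s. of_real (poly (hermite_poly m * hermite_poly 0) s) * hgauss 0 s \<partial>lborel) = 0 ^ m * (of_real (sqrt pi) * exp (0\<^sup>2 / 4))"
    using hermite_poly_hgauss[of m 0] by simp
  thus ?case by (cases m) auto
next
  case (Suc k)
  show ?case
  proof (cases m)
    case 0
    thus ?thesis unfolding hermite_poly_pairing_Suc by simp
  next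
    case (Suc j)
    have "(\<integral>s. of_real (poly (hermite_poly m * hermite_poly (Suc k)) s) * hgauss 0 s \<partial>lborel) = (\<integral>s. of_real (2 * real (Suc j)) * (of_real (poly (hermite_poly j * hermite_poly k) s) * hgauss 0 s) \<partial>lborel)"
      unfolding hermite_poly_pairing_Suc Suc pderiv_hermite_poly
      by (rule Bochner_Integration.integral_cong[OF refl]) (simp only: poly_mult poly_smult of_real_mult mult_ac)
    also have "\<dots> = of_real (2 * real (Suc j)) * (if j = k then of_real (2 ^ k * fact k * sqrt pi) else 0)"
      by (simp only: integral_mult_right_zero \<open>\<And>m. (\<integral>s. of_real (poly (hermite_poly m * hermite_poly k) s) * hgauss 0 s \<partial>lborel) = (if m = k then of_real (2 ^ k * fact k * sqrt pi) else 0)\<close>)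
    finally show ?thesis using Suc by (auto simp: mult_ac)
  qed
qed

lemma hermite_const_square: "hermite_const k * hermite_const k * (2 ^ k * fact k * sqrt pi) = 1"
  unfolding hermite_const_def by (simp add: divide_simps flip: real_sqrt_mult)

lemma hermite_fun1_orthonormal:
  "integrable lborel (\<lambda>s. complex_of_real (hermite_fun1 m s) * complex_of_real (hermite_fun1 k s))"
  "(\<integral>s. complex_of_real (hermite_fun1 m s) * complex_of_real (hermite_fun1 k s) \<partial>lborel) = (if m = k then 1 else 0)"
proof -
  have eq: "complex_of_real (hermite_fun1 m s) * complex_of_real (hermite_fun1 k s)
    = of_real (hermite_const m * hermite_const k) * (of_real (poly (hermite_poly m * hermite_poly k) s) * hgauss 0 s)" for s
  proof -
    have "hgauss 0 s = of_real (exp (- s\<^sup>2 / 2) * exp (- s\<^sup>2 / 2))"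
      by (simp add: hgauss_def flip: exp_add exp_of_real)
    thus ?thesis by (simp add: hermite_fun1_eq mult_ac)
  qed
  show "integrable lborel (\<lambda>s. complex_of_real (hermite_fun1 m s) * complex_of_real (hermite_fun1 k s))"
    unfolding eq by (intro integrable_mult_right poly_hgauss_integrable)
  have "(\<integral>s. complex_of_real (hermite_fun1 m s) * complex_of_real (hermite_fun1 k s) \<partial>lborel)
    = of_real (hermite_const m * hermite_const k) * (if m = k then of_real (2 ^ k * fact k * sqrt pi) else 0)"
    unfolding eq by (simp only: integral_mult_right_zero hermite_poly_orthogonal)
  also have "\<dots> = (if m = k then of_real (hermite_const k * hermite_const k * (2 ^ k * fact k * sqrt pi)) else 0)" by simp
  finally show "(\<integral>s. complex_of_real (hermite_fun1 m s) * complex_of_real (hermite_fun1 k s) \<partial>lborel) = (if m = k then 1 else 0)"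
    unfolding hermite_const_square by simp
qed

text \<open>Absolute integrability, in addition to square integrability, lets Fubini pair a Hermite
  function with a superposition of functions of which only a uniform bound is used. One half of the
  Gaussian exponent absorbs the polynomial.\<close>

lemma hermite_fun1_integrable: "integrable lborel (\<lambda>s. complex_of_real (hermite_fun1 k s))"
proof -
  obtain C l where C: "C \<ge> 0" "l \<ge> 0" "\<And>s. \<bar>poly (hermite_poly k) s\<bar> \<le> C * exp (l * \<bar>s\<bar>)" using poly_exp_bound by blast
  have m: "(\<lambda>s. complex_of_real (hermite_fun1 k s)) \<in> borel_measurable lborel" unfolding hermite_fun1_eq by measurable
  have i: "integrable lborel (\<lambda>s. exp (- (s::real)\<^sup>2 / 4))"
    using lborel_integrable_affine[OF integrable_exp_square, of "1 / sqrt 2" 0] by (simp add: power_divide)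
  have "cmod (complex_of_real (hermite_fun1 k s)) \<le> (\<bar>hermite_const k\<bar> * (C * exp (l\<^sup>2))) * exp (- s\<^sup>2 / 4)" for s
  proof -
    have "cmod (complex_of_real (hermite_fun1 k s)) = \<bar>hermite_const k\<bar> * (\<bar>poly (hermite_poly k) s\<bar> * exp (- s\<^sup>2 / 2))"
      unfolding norm_of_real hermite_fun1_eq by (simp add: abs_mult)
    also have "\<dots> \<le> \<bar>hermite_const k\<bar> * ((C * exp (l * \<bar>s\<bar>)) * exp (- s\<^sup>2 / 2))"
      by (intro mult_left_mono mult_right_mono C) auto
    also have "\<dots> = \<bar>hermite_const k\<bar> * (C * exp (l * \<bar>s\<bar> + - s\<^sup>2 / 2))" by (simp only: exp_add mult.assoc)
    also have "\<dots> \<le> \<bar>hermite_const k\<bar> * (C * exp (l\<^sup>2 + - s\<^sup>2 / 4))"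
    proof -
      have "l * \<bar>s\<bar> \<le> l\<^sup>2 + s\<^sup>2 / 4"
        using sum_squares_bound[of l "\<bar>s\<bar> / 2"] by (simp add: power_divide)
      thus ?thesis using C by (intro mult_left_mono) auto
    qed
    also have "\<dots> = (\<bar>hermite_const k\<bar> * (C * exp (l\<^sup>2))) * exp (- s\<^sup>2 / 4)" by (simp only: exp_add mult.assoc)
    finally show ?thesis .
  qed
  from integral_norm_le(1)[OF integrable_mult_right[OF i] m this] show ?thesis .
qed

section \<open>Overlaps of coherent states with Hermite functions\<close>

definition coherent1 :: "real \<Rightarrow> real \<Rightarrow> real \<Rightarrow> complex" where
  "coherent1 x y s = of_real (exp (- (s - x)\<^sup>2 / 2)) * cis (y * s - x * y / 2)"

text \<open>A coherent state times exp(-s^2 / 2) is a scalar multiple of \<open>hgauss b\<close>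
  with b = x + i y, so the overlap with the Hermite function of degree k is a multiple of b^k, as in
  the Bargmann transform. Thanks to the phase of the coherent state the scalar depends on (x, y)
  only through x^2 + y^2.\<close>

lemma coherent1_hermite:
  "integrable lborel (\<lambda>s. coherent1 x y s * complex_of_real (hermite_fun1 k s))"
  "(\<integral>s. coherent1 x y s * complex_of_real (hermite_fun1 k s) \<partial>lborel)
    = of_real (hermite_const k * sqrt pi * exp (- (x\<^sup>2 + y\<^sup>2) / 4)) * (of_real x + \<i> * of_real y) ^ k"
proof -
  define b where "b = of_real x + \<i> * of_real y"
  have bb: "b\<^sup>2 / 4 = of_real (x\<^sup>2 / 4 - y\<^sup>2 / 4) + \<i> * of_real (x * y / 2)"
    unfolding b_def by (simp add: power2_eq_square complex_eq_iff)
  have eq: "coherent1 x y s * complex_of_real (hermite_fun1 k s)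
    = (of_real (hermite_const k * exp (- (x\<^sup>2 + y\<^sup>2) / 4)) * exp (- (b\<^sup>2 / 4))) * (of_real (poly (hermite_poly k) s) * hgauss b s)" for s
  proof -
    have "of_real (- (s - x)\<^sup>2 / 2) + \<i> * of_real (y * s - x * y / 2) + of_real (- s\<^sup>2 / 2)
      = of_real (- (x\<^sup>2 + y\<^sup>2) / 4) + - (b\<^sup>2 / 4) + (b * of_real s - (of_real s)\<^sup>2)"
      unfolding bb b_def by (simp add: complex_eq_iff power2_eq_square algebra_simps diff_divide_distrib add_divide_distrib)
    hence "exp (of_real (- (s - x)\<^sup>2 / 2) + \<i> * of_real (y * s - x * y / 2) + of_real (- s\<^sup>2 / 2))
      = exp (of_real (- (x\<^sup>2 + y\<^sup>2) / 4) + - (b\<^sup>2 / 4) + (b * of_real s - (of_real s)\<^sup>2))" by (simp only:)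
    hence "coherent1 x y s * of_real (exp (- s\<^sup>2 / 2)) = of_real (exp (- (x\<^sup>2 + y\<^sup>2) / 4)) * exp (- (b\<^sup>2 / 4)) * hgauss b s"
      unfolding exp_add coherent1_def cis_conv_exp hgauss_def exp_of_real by (simp only: mult_ac)
    hence "of_real (hermite_const k * poly (hermite_poly k) s) * (coherent1 x y s * of_real (exp (- s\<^sup>2 / 2)))
      = of_real (hermite_const k * poly (hermite_poly k) s) * (of_real (exp (- (x\<^sup>2 + y\<^sup>2) / 4)) * exp (- (b\<^sup>2 / 4)) * hgauss b s)" by (simp only:)
    thus ?thesis unfolding hermite_fun1_eq of_real_mult by (simp only: mult_ac)
  qed
  show "integrable lborel (\<lambda>s. coherent1 x y s * complex_of_real (hermite_fun1 k s))"
    unfolding eq by (intro integrable_mult_right poly_hgauss_integrable)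
  have "(\<integral>s. coherent1 x y s * complex_of_real (hermite_fun1 k s) \<partial>lborel)
    = (of_real (hermite_const k * exp (- (x\<^sup>2 + y\<^sup>2) / 4)) * exp (- (b\<^sup>2 / 4))) * (b ^ k * (of_real (sqrt pi) * exp (b\<^sup>2 / 4)))"
    unfolding eq by (simp only: integral_mult_right_zero hermite_poly_hgauss)
  also have "\<dots> = of_real (hermite_const k * sqrt pi * exp (- (x\<^sup>2 + y\<^sup>2) / 4)) * b ^ k * (exp (b\<^sup>2 / 4) * exp (- (b\<^sup>2 / 4)))"
    by (simp only: of_real_mult mult_ac)
  also have "exp (b\<^sup>2 / 4) * exp (- (b\<^sup>2 / 4)) = 1" by (rule exp_minus_inverse)
  finally show "(\<integral>s. coherent1 x y s * complex_of_real (hermite_fun1 k s) \<partial>lborel)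
    = of_real (hermite_const k * sqrt pi * exp (- (x\<^sup>2 + y\<^sup>2) / 4)) * (of_real x + \<i> * of_real y) ^ k"
    by (simp add: b_def)
qed

lemma coherent1_norm:
  "integrable lborel (\<lambda>s. complex_of_real ((cmod (coherent1 x y s))\<^sup>2))"
  "(\<integral>s. complex_of_real ((cmod (coherent1 x y s))\<^sup>2) \<partial>lborel) = of_real (sqrt pi)"
proof -
  have eq: "complex_of_real ((cmod (coherent1 x y s))\<^sup>2) = of_real (poly 1 (s - x)) * hgauss 0 (s - x)" for s
  proof -
    have "(cmod (coherent1 x y s))\<^sup>2 = exp (- (s - x)\<^sup>2 / 2 + - (s - x)\<^sup>2 / 2)"
      unfolding exp_add by (simp add: coherent1_def norm_mult power2_eq_square[of "exp _"])
    thus ?thesis by (simp add: hgauss_def flip: exp_of_real)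
  qed
  show "integrable lborel (\<lambda>s. complex_of_real ((cmod (coherent1 x y s))\<^sup>2))"
    unfolding eq by (rule lborel_integrable_translate(3)[OF poly_hgauss_integrable])
  show "(\<integral>s. complex_of_real ((cmod (coherent1 x y s))\<^sup>2) \<partial>lborel) = of_real (sqrt pi)"
    unfolding eq by (subst lborel_integral_translate(3)[where f="\<lambda>s. of_real (poly 1 s) * hgauss 0 s"]) (auto simp: hgauss_integral)
qed

text \<open>Up to the factor sqrt pi these are the Poisson probabilities of mean (x^2 + y^2) / 2.
  Their sum over k is 1, which is Parseval's identity for one coherent state.\<close>

lemma coherent1_coeff_square:
  "(cmod (of_real (hermite_const k * sqrt pi * exp (- (x\<^sup>2 + y\<^sup>2) / 4)) * (of_real x + \<i> * of_real y) ^ k))\<^sup>2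
    = sqrt pi * exp (- ((x\<^sup>2 + y\<^sup>2) / 2)) * (((x\<^sup>2 + y\<^sup>2) / 2) ^ k /\<^sub>R fact k)"
proof -
  have n: "(cmod (of_real x + \<i> * of_real y))\<^sup>2 = x\<^sup>2 + y\<^sup>2" by (simp add: cmod_power2)
  have h: "(hermite_const k)\<^sup>2 = 1 / (2 ^ k * fact k * sqrt pi)" by (simp add: hermite_const_def power_divide)
  have e: "(exp (- (x\<^sup>2 + y\<^sup>2) / 4))\<^sup>2 = exp (- ((x\<^sup>2 + y\<^sup>2) / 2))"
    unfolding power2_eq_square[of "exp _"] exp_add[symmetric] by (rule arg_cong[of _ _ exp]) (simp add: field_simps)
  have "(cmod (of_real (hermite_const k * sqrt pi * exp (- (x\<^sup>2 + y\<^sup>2) / 4)) * (of_real x + \<i> * of_real y) ^ k))\<^sup>2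
    = (hermite_const k)\<^sup>2 * (sqrt pi)\<^sup>2 * (exp (- (x\<^sup>2 + y\<^sup>2) / 4))\<^sup>2 * ((cmod (of_real x + \<i> * of_real y))\<^sup>2) ^ k"
    unfolding norm_mult norm_power norm_of_real power_mult_distrib power2_abs by (simp only: power_mult[symmetric] mult.commute[of k 2])
  also have "\<dots> = (1 / (2 ^ k * fact k * sqrt pi)) * (sqrt pi * sqrt pi) * exp (- ((x\<^sup>2 + y\<^sup>2) / 2)) * (x\<^sup>2 + y\<^sup>2) ^ k"
    unfolding n h e by (simp only: power2_eq_square[of "sqrt pi"])
  also have "\<dots> = sqrt pi * exp (- ((x\<^sup>2 + y\<^sup>2) / 2)) * (((x\<^sup>2 + y\<^sup>2) / 2) ^ k /\<^sub>R fact k)"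
  proof -
    have gen: "1 / (A * f * p) * (p * p) * E * R = p * E * (inverse f * (R / A))" if "p \<noteq> 0" for A f p E R :: real
      using that by (simp add: divide_inverse)
    show ?thesis unfolding power_divide real_scaleR_def by (rule gen) simp
  qed
  finally show ?thesis .
qed

text \<open>The closed form of the Hermite coefficients of \<open>coherent z\<close>; the effect of
  a rotation and Parseval's identity are read off from this product.\<close>

definition coherent_hermite :: "('n::finite \<Rightarrow> nat) \<Rightarrow> (real^'n) \<times> (real^'n) \<Rightarrow> complex" where
  "coherent_hermite \<alpha> z = (\<Prod>j\<in>UNIV. of_real (hermite_const (\<alpha> j) * sqrt pi * exp (- ((fst z $ j)\<^sup>2 + (snd z $ j)\<^sup>2) / 4)) *
     (of_real (fst z $ j) + \<i> * of_real (snd z $ j)) ^ \<alpha> j)"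

lemma coherent_prod: "coherent z t = (\<Prod>j\<in>UNIV. coherent1 (fst z $ j) (snd z $ j) (t $ j))"
proof -
  have "cis (- (fst z \<bullet> snd z) / 2) * cis (snd z \<bullet> t) = cis (\<Sum>j\<in>UNIV. snd z $ j * t $ j - fst z $ j * snd z $ j / 2)"
    by (simp add: cis_mult inner_vec_def sum_subtractf sum_divide_distrib algebra_simps)
  also have "\<dots> = (\<Prod>j\<in>UNIV. cis (snd z $ j * t $ j - fst z $ j * snd z $ j / 2))" by (rule cis_sum)
  finally have c: "cis (- (fst z \<bullet> snd z) / 2) * cis (snd z \<bullet> t) = (\<Prod>j\<in>UNIV. cis (snd z $ j * t $ j - fst z $ j * snd z $ j / 2))" .
  have "exp (- (1/2) * (norm (t - fst z))\<^sup>2) = exp (\<Sum>j\<in>UNIV. - (t $ j - fst z $ j)\<^sup>2 / 2)"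
    by (simp add: norm_vec_power2 sum_divide_distrib sum_negf)
  also have "\<dots> = (\<Prod>j\<in>UNIV. exp (- (t $ j - fst z $ j)\<^sup>2 / 2))" by (rule exp_sum) simp
  finally have "gaussian (1/2) (t - fst z) = (\<Prod>j\<in>UNIV. of_real (exp (- (t $ j - fst z $ j)\<^sup>2 / 2)))"
    unfolding gaussian_def by simp
  thus ?thesis unfolding coherent_def packet_def coherent1_def prod.distrib c[symmetric] by (simp only: mult_ac)
qed

lemma cnj_hermite_fun: "cnj (hermite_fun \<alpha> x) = hermite_fun \<alpha> x"
  by (simp add: hermite_fun_def)

lemma hermite_fun_prod: "hermite_fun \<alpha> x = (\<Prod>j\<in>UNIV. complex_of_real (hermite_fun1 (\<alpha> j) (x $ j)))"
  by (simp add: hermite_fun_def)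

lemma hermite_fun_integrable: "integrable lborel (hermite_fun \<alpha>)"
  unfolding hermite_fun_prod[abs_def] by (rule integral_prod_vec(1)[OF hermite_fun1_integrable])

lemma hermite_fun_measurable [measurable]: "hermite_fun \<alpha> \<in> borel_measurable borel"
  using hermite_fun_integrable[of \<alpha>] by auto

lemma hermite_fun_orthonormal:
  "integrable lborel (\<lambda>x. hermite_fun \<alpha> x * cnj (hermite_fun \<beta> x))"
  "(\<integral>x. hermite_fun \<alpha> x * cnj (hermite_fun \<beta> x) \<partial>lborel) = (if \<alpha> = \<beta> then 1 else 0)"
proof -
  have eq: "hermite_fun \<alpha> x * cnj (hermite_fun \<beta> x)
    = (\<Prod>j\<in>UNIV. complex_of_real (hermite_fun1 (\<alpha> j) (x $ j)) * complex_of_real (hermite_fun1 (\<beta> j) (x $ j)))" for x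
    unfolding cnj_hermite_fun unfolding hermite_fun_prod prod.distrib ..
  show "integrable lborel (\<lambda>x. hermite_fun \<alpha> x * cnj (hermite_fun \<beta> x))"
    unfolding eq by (rule integral_prod_vec(1)[OF hermite_fun1_orthonormal(1)])
  have "(\<integral>x. hermite_fun \<alpha> x * cnj (hermite_fun \<beta> x) \<partial>lborel) = (\<Prod>j\<in>UNIV. if \<alpha> j = \<beta> j then 1 else 0)"
    unfolding eq
    by (subst integral_prod_vec(2)[where f="\<lambda>j s. complex_of_real (hermite_fun1 (\<alpha> j) s) * complex_of_real (hermite_fun1 (\<beta> j) s)", OF hermite_fun1_orthonormal(1)])
      (simp only: hermite_fun1_orthonormal(2))
  also have "\<dots> = (if \<alpha> = \<beta> then 1 else 0)"
    by (auto simp: fun_eq_iff)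
  finally show "(\<integral>x. hermite_fun \<alpha> x * cnj (hermite_fun \<beta> x) \<partial>lborel) = (if \<alpha> = \<beta> then 1 else 0)" .
qed

lemma hermite_fun_L2: "hermite_fun \<alpha> \<in> L2_space"
proof -
  have "integrable lborel (\<lambda>x. Re (hermite_fun \<alpha> x * cnj (hermite_fun \<alpha> x)))"
    by (rule integrable_Re[OF hermite_fun_orthonormal(1)])
  thus ?thesis by (simp add: L2_space_def complex_mult_cnj cmod_power2)
qed

lemma hermite_fun_norm: "(\<integral>x. (cmod (hermite_fun \<alpha> x))\<^sup>2 \<partial>lborel) = 1"
proof -
  have "complex_of_real (\<integral>x. (cmod (hermite_fun \<alpha> x))\<^sup>2 \<partial>lborel) = (\<integral>x. hermite_fun \<alpha> x * cnj (hermite_fun \<alpha> x) \<partial>lborel)"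
    unfolding complex_norm_square[symmetric] by (rule integral_complex_of_real[symmetric])
  thus ?thesis by (simp add: hermite_fun_orthonormal(2))
qed

lemma hermite_coeff_coherent:
  "integrable lborel (\<lambda>t. coherent z t * cnj (hermite_fun \<alpha> t))"
  "hermite_coeff (coherent z) \<alpha> = coherent_hermite \<alpha> z"
proof -
  have eq: "coherent z t * cnj (hermite_fun \<alpha> t)
    = (\<Prod>j\<in>UNIV. coherent1 (fst z $ j) (snd z $ j) (t $ j) * complex_of_real (hermite_fun1 (\<alpha> j) (t $ j)))" for t
    unfolding cnj_hermite_fun unfolding hermite_fun_prod coherent_prod prod.distrib ..
  show "integrable lborel (\<lambda>t. coherent z t * cnj (hermite_fun \<alpha> t))"
    unfolding eq by (rule integral_prod_vec(1)[OF coherent1_hermite(1)])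
  show "hermite_coeff (coherent z) \<alpha> = coherent_hermite \<alpha> z"
    unfolding hermite_coeff_def coherent_hermite_def eq
    by (subst integral_prod_vec(2)[where f="\<lambda>j s. coherent1 (fst z $ j) (snd z $ j) s * complex_of_real (hermite_fun1 (\<alpha> j) s)", OF coherent1_hermite(1)])
      (simp only: coherent1_hermite(2))
qed

lemma coherent_norm:
  fixes z :: "(real^'n::finite) \<times> (real^'n)"
  shows "(\<integral>t. (cmod (coherent z t))\<^sup>2 \<partial>lborel) = sqrt pi ^ CARD('n)"
proof -
  have eq: "complex_of_real ((cmod (coherent z t))\<^sup>2) = (\<Prod>j\<in>UNIV. complex_of_real ((cmod (coherent1 (fst z $ j) (snd z $ j) (t $ j)))\<^sup>2))" for t
    by (simp add: coherent_prod prod_norm[symmetric] prod_power_distrib)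
  have "complex_of_real (\<integral>t. (cmod (coherent z t))\<^sup>2 \<partial>lborel) = (\<integral>t. complex_of_real ((cmod (coherent z t))\<^sup>2) \<partial>lborel)"
    by (rule integral_complex_of_real[symmetric])
  also have "\<dots> = (\<Prod>j\<in>(UNIV::'n set). of_real (sqrt pi))"
    unfolding eq
    by (subst integral_prod_vec(2)[where f="\<lambda>j s. complex_of_real ((cmod (coherent1 (fst z $ j) (snd z $ j) s))\<^sup>2)", OF coherent1_norm(1)])
      (simp only: coherent1_norm(2))
  also have "\<dots> = complex_of_real (sqrt pi ^ CARD('n))" by simp
  finally show ?thesis by (simp only: of_real_eq_iff)
qed

text \<open>On such cubes a sum of products of one-variable terms factorizes into a product of
  sums.\<close>

definition multi_box :: "nat \<Rightarrow> ('n::finite \<Rightarrow> nat) set" where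
  "multi_box k = PiE UNIV (\<lambda>_. {..<k})"

lemma finite_multi_box: "finite (multi_box k)"
  unfolding multi_box_def by (intro finite_PiE) auto

text \<open>Every factor is a partial sum of an exponential series, and the limit is the squared L2
  norm of the coherent state. This takes the place of completeness of the Hermite basis: coherent
  states suffice, as all elements of the space are superpositions of them.\<close>

lemma coherent_parseval:
  fixes z :: "(real^'n::finite) \<times> (real^'n)"
  shows "(\<lambda>k. \<Sum>\<alpha>\<in>multi_box k. (cmod (coherent_hermite \<alpha> z))\<^sup>2) \<longlonglongrightarrow> sqrt pi ^ CARD('n)"
proof -
  define u where "u j = ((fst z $ j)\<^sup>2 + (snd z $ j)\<^sup>2) / 2" for j
  have "(cmod (coherent_hermite \<alpha> z))\<^sup>2 = (\<Prod>j\<in>UNIV. sqrt pi * exp (- u j) * (u j ^ \<alpha> j /\<^sub>R fact (\<alpha> j)))" for \<alpha>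
    unfolding coherent_hermite_def u_def prod_norm[symmetric] prod_power_distrib coherent1_coeff_square ..
  hence eq: "(\<Sum>\<alpha>\<in>multi_box k. (cmod (coherent_hermite \<alpha> z))\<^sup>2) = (\<Prod>j\<in>UNIV. \<Sum>i<k. sqrt pi * exp (- u j) * (u j ^ i /\<^sub>R fact i))" for k
    unfolding multi_box_def by (subst prod_sum_PiE) auto
  have "(\<lambda>k. \<Prod>j\<in>(UNIV::'n set). \<Sum>i<k. sqrt pi * exp (- u j) * (u j ^ i /\<^sub>R fact i)) \<longlonglongrightarrow> (\<Prod>j\<in>(UNIV::'n set). sqrt pi)"
  proof (rule tendsto_prod)
    fix j
    have "(\<lambda>k. \<Sum>i<k. u j ^ i /\<^sub>R fact i) \<longlonglongrightarrow> exp (u j)" using exp_converges[of "u j"] unfolding sums_def .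
    hence "(\<lambda>k. sqrt pi * exp (- u j) * (\<Sum>i<k. u j ^ i /\<^sub>R fact i)) \<longlonglongrightarrow> sqrt pi * exp (- u j) * exp (u j)"
      by (intro tendsto_mult tendsto_const)
    moreover have "sqrt pi * exp (- u j) * exp (u j) = sqrt pi" by (simp add: exp_minus)
    ultimately show "(\<lambda>k. \<Sum>i<k. sqrt pi * exp (- u j) * (u j ^ i /\<^sub>R fact i)) \<longlonglongrightarrow> sqrt pi"
      by (simp only: sum_distrib_left)
  qed
  thus ?thesis unfolding eq by simp
qed

section \<open>Bessel's identity and Minkowski's inequality in L2\<close>

lemma L2_diff_cmult:
  fixes f k :: "real^'n::finite \<Rightarrow> complex"
  assumes f: "f \<in> L2_space" and k: "k \<in> L2_space"
  shows "(\<integral>x. (cmod (f x - c * k x))\<^sup>2 \<partial>lborel) = (\<integral>x. (cmod (f x))\<^sup>2 \<partial>lborel)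
    - 2 * Re (cnj c * (\<integral>x. f x * cnj (k x) \<partial>lborel)) + (cmod c)\<^sup>2 * (\<integral>x. (cmod (k x))\<^sup>2 \<partial>lborel)"
proof -
  have i: "integrable lborel (\<lambda>x. f x * cnj (k x))" by (intro L2_mult_integrable f L2_space_cnj k)
  have fi: "integrable lborel (\<lambda>x. (cmod (f x))\<^sup>2)" and ki: "integrable lborel (\<lambda>x. (cmod (k x))\<^sup>2)" using f k by (auto simp: L2_space_def)
  have eq: "(cmod (f x - c * k x))\<^sup>2 = (cmod (f x))\<^sup>2 - 2 * Re (cnj c * (f x * cnj (k x))) + (cmod c)\<^sup>2 * (cmod (k x))\<^sup>2" for x
    unfolding power_mult_distrib[symmetric] norm_mult[symmetric] cmod_power2
    by (simp add: power2_eq_square algebra_simps)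
  have ri: "integrable lborel (\<lambda>x. Re (cnj c * (f x * cnj (k x))))"
    by (intro integrable_Re integrable_mult_right i)
  have rI: "(\<integral>x. Re (cnj c * (f x * cnj (k x))) \<partial>lborel) = Re (cnj c * (\<integral>x. f x * cnj (k x) \<partial>lborel))"
    by (subst integral_Re) (auto intro!: integrable_mult_right i)
  show ?thesis unfolding eq
    by (simp only: Bochner_Integration.integral_add Bochner_Integration.integral_diff Bochner_Integration.integrable_diff
      integral_mult_right_zero integrable_mult_right fi ki ri rI)
qed

lemma hermite_coeff_sum_diff:
  fixes h :: "real^'n::finite \<Rightarrow> complex"
  assumes h: "h \<in> L2_space" and A: "finite A"
  shows "(\<lambda>x. h x - (\<Sum>\<alpha>\<in>A. d \<alpha> * hermite_fun \<alpha> x)) \<in> L2_space"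
    and "hermite_coeff (\<lambda>x. h x - (\<Sum>\<alpha>\<in>A. d \<alpha> * hermite_fun \<alpha> x)) \<beta> = hermite_coeff h \<beta> - (if \<beta> \<in> A then d \<beta> else 0)"
proof -
  have "(\<lambda>x. h x - (\<Sum>\<alpha>\<in>A. d \<alpha> * hermite_fun \<alpha> x)) \<in> L2_space \<and>
    hermite_coeff (\<lambda>x. h x - (\<Sum>\<alpha>\<in>A. d \<alpha> * hermite_fun \<alpha> x)) \<beta> = hermite_coeff h \<beta> - (if \<beta> \<in> A then d \<beta> else 0)"
    using A
  proof (induct A)
    case empty thus ?case using h by simp
  next
    case (insert a A)
    let ?r = "\<lambda>x. h x - (\<Sum>\<alpha>\<in>A. d \<alpha> * hermite_fun \<alpha> x)"
    have eq: "(\<lambda>x. h x - (\<Sum>\<alpha>\<in>insert a A. d \<alpha> * hermite_fun \<alpha> x)) = (\<lambda>x. ?r x - d a * hermite_fun a x)"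
      using insert by (auto simp: algebra_simps)
    have r: "?r \<in> L2_space" using insert by simp
    have L: "(\<lambda>x. ?r x - d a * hermite_fun a x) \<in> L2_space"
      by (intro L2_space_diff r L2_space_cmult hermite_fun_L2)
    have i1: "integrable lborel (\<lambda>x. ?r x * cnj (hermite_fun \<beta> x))"
      by (intro L2_mult_integrable r L2_space_cnj hermite_fun_L2)
    have "hermite_coeff (\<lambda>x. ?r x - d a * hermite_fun a x) \<beta> = (\<integral>x. ?r x * cnj (hermite_fun \<beta> x) - d a * (hermite_fun a x * cnj (hermite_fun \<beta> x)) \<partial>lborel)"
      unfolding hermite_coeff_def by (simp only: left_diff_distrib mult.assoc)
    also have "\<dots> = hermite_coeff ?r \<beta> - d a * (if a = \<beta> then 1 else 0)"
      unfolding hermite_coeff_def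
      by (subst Bochner_Integration.integral_diff[OF i1 integrable_mult_right[OF hermite_fun_orthonormal(1)]])
        (simp only: integral_mult_right_zero hermite_fun_orthonormal(2))
    finally show ?case unfolding eq using L insert by auto
  qed
  thus "(\<lambda>x. h x - (\<Sum>\<alpha>\<in>A. d \<alpha> * hermite_fun \<alpha> x)) \<in> L2_space"
    "hermite_coeff (\<lambda>x. h x - (\<Sum>\<alpha>\<in>A. d \<alpha> * hermite_fun \<alpha> x)) \<beta> = hermite_coeff h \<beta> - (if \<beta> \<in> A then d \<beta> else 0)" by auto
qed

text \<open>Basis functions are removed one at a time: by orthonormality the coefficient of the next
  one in the remainder is still its coefficient in h.\<close>

lemma bessel_identity:
  fixes h :: "real^'n::finite \<Rightarrow> complex"
  assumes h: "h \<in> L2_space" and A: "finite A"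
  shows "(\<integral>x. (cmod (h x - (\<Sum>\<alpha>\<in>A. hermite_coeff h \<alpha> * hermite_fun \<alpha> x)))\<^sup>2 \<partial>lborel)
    = (\<integral>x. (cmod (h x))\<^sup>2 \<partial>lborel) - (\<Sum>\<alpha>\<in>A. (cmod (hermite_coeff h \<alpha>))\<^sup>2)"
  using A
proof (induct A)
  case (insert a A)
  let ?d = "hermite_coeff h"
  let ?r = "\<lambda>x. h x - (\<Sum>\<alpha>\<in>A. ?d \<alpha> * hermite_fun \<alpha> x)"
  have eq: "h x - (\<Sum>\<alpha>\<in>insert a A. ?d \<alpha> * hermite_fun \<alpha> x) = ?r x - ?d a * hermite_fun a x" for x
    using insert by (auto simp: algebra_simps)
  have r: "?r \<in> L2_space" by (rule hermite_coeff_sum_diff(1)[OF h insert(1)])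
  have "(\<integral>x. ?r x * cnj (hermite_fun a x) \<partial>lborel) = ?d a"
    using hermite_coeff_sum_diff(2)[OF h insert(1), of ?d a] insert(2) unfolding hermite_coeff_def[of ?r] by simp
  hence "(\<integral>x. (cmod (?r x - ?d a * hermite_fun a x))\<^sup>2 \<partial>lborel) = (\<integral>x. (cmod (?r x))\<^sup>2 \<partial>lborel) - 2 * Re (cnj (?d a) * ?d a) + (cmod (?d a))\<^sup>2"
    unfolding L2_diff_cmult[OF r hermite_fun_L2] hermite_fun_norm by (simp only: mult_1_right)
  also have "Re (cnj (?d a) * ?d a) = (cmod (?d a))\<^sup>2"
    by (metis complex_norm_square Re_complex_of_real mult.commute)
  finally show ?case unfolding eq using insert by simp
qed simp

lemma L2_nn_cauchy_schwarz:
  fixes h k :: "real^'n::finite \<Rightarrow> complex"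
  assumes h: "h \<in> L2_space" and k: "k \<in> L2_space"
    and a: "(\<integral>x. (cmod (h x))\<^sup>2 \<partial>lborel) \<le> a\<^sup>2" "a \<ge> 0" and b: "(\<integral>x. (cmod (k x))\<^sup>2 \<partial>lborel) \<le> b\<^sup>2" "b \<ge> 0"
  shows "(\<integral>\<^sup>+x. ennreal (cmod (h x)) * ennreal (cmod (k x)) \<partial>lborel) \<le> ennreal (a * b)"
proof -
  have [measurable]: "h \<in> borel_measurable borel" "k \<in> borel_measurable borel" using h k by (auto simp: L2_space_def)
  have hi: "integrable lborel (\<lambda>x. (cmod (h x))\<^sup>2)" and ki: "integrable lborel (\<lambda>x. (cmod (k x))\<^sup>2)" using h k by (auto simp: L2_space_def)
  have hk: "integrable lborel (\<lambda>x. cmod (h x) * cmod (k x))"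
    using integrable_norm[OF L2_mult_integrable(1)[OF h k]] by (simp add: norm_mult)
  define I where "I = (\<integral>x. cmod (h x) * cmod (k x) \<partial>lborel)"
  have I0: "I \<ge> 0" unfolding I_def by simp
  have e: "(\<integral>\<^sup>+x. ennreal (cmod (h x)) * ennreal (cmod (k x)) \<partial>lborel) = ennreal I"
    unfolding I_def by (subst nn_integral_eq_integral[symmetric, OF hk]) (auto simp: ennreal_mult)
  have sq: "(\<integral>\<^sup>+x. ennreal (cmod (f x)) ^ 2 \<partial>lborel) = ennreal (\<integral>x. (cmod (f x))\<^sup>2 \<partial>lborel)"
    if "integrable lborel (\<lambda>x. (cmod (f x))\<^sup>2)" for f :: "real^'n \<Rightarrow> complex"
    by (subst nn_integral_eq_integral[symmetric, OF that]) (auto simp: ennreal_power)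
  have "(ennreal I)\<^sup>2 \<le> ennreal (\<integral>x. (cmod (h x))\<^sup>2 \<partial>lborel) * ennreal (\<integral>x. (cmod (k x))\<^sup>2 \<partial>lborel)"
    using Cauchy_Schwarz_nn_integral[of "\<lambda>x. ennreal (cmod (h x))" lborel "\<lambda>x. ennreal (cmod (k x))"]
    unfolding e sq[OF hi] sq[OF ki] by simp
  also have "\<dots> \<le> ennreal (a\<^sup>2) * ennreal (b\<^sup>2)" by (intro mult_mono ennreal_leI a b) auto
  also have "\<dots> = ennreal ((a * b)\<^sup>2)" by (simp add: ennreal_mult power_mult_distrib)
  finally have "ennreal (I\<^sup>2) \<le> ennreal ((a * b)\<^sup>2)" using I0 by (simp add: ennreal_power)
  hence "I\<^sup>2 \<le> (a * b)\<^sup>2" by (subst (asm) ennreal_le_iff) auto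
  hence "I \<le> a * b" using a b by (intro power2_le_imp_le[of I "a * b"]) auto
  thus ?thesis unfolding e by (rule ennreal_leI)
qed

text \<open>Minkowski's integral inequality in L2: the square of the superposition is bounded by a
  double integral over p and q, and Tonelli followed by Cauchy-Schwarz in x separates the two.
  Nonnegative integrals are used since absolute convergence of the superposition is not known at
  every x.\<close>

lemma L2_norm_superposition:
  fixes K :: "'p::euclidean_space \<Rightarrow> real^'n::finite \<Rightarrow> complex"
  assumes c: "integrable lborel c" and Km[measurable]: "(\<lambda>(p, x). K p x) \<in> borel_measurable (borel \<Otimes>\<^sub>M borel)"
    and K: "\<And>p. K p \<in> L2_space" "\<And>p. (\<integral>x. (cmod (K p x))\<^sup>2 \<partial>lborel) \<le> (\<rho> p)\<^sup>2"
    and \<rho>: "\<And>p. \<rho> p \<ge> 0" "\<rho> \<in> borel_measurable borel" "integrable lborel (\<lambda>p. cmod (c p) * \<rho> p)"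
  shows "L2_norm (\<lambda>x. \<integral>p. c p * K p x \<partial>lborel) \<le> (\<integral>p. cmod (c p) * \<rho> p \<partial>lborel)"
proof -
  have [measurable]: "c \<in> borel_measurable borel" using c by auto
  note \<rho>(2)[measurable]
  define S where "S = (\<integral>p. cmod (c p) * \<rho> p \<partial>lborel)"
  have S0: "S \<ge> 0" unfolding S_def using \<rho>(1) by simp
  define f where "f x = (\<integral>p. c p * K p x \<partial>lborel)" for x
  have fm[measurable]: "f \<in> borel_measurable borel" unfolding f_def by measurable
  define v where "v p x = ennreal (cmod (c p * K p x))" for p x
  have vm[measurable]: "(\<lambda>(p, x). v p x) \<in> borel_measurable (borel \<Otimes>\<^sub>M borel)" unfolding v_def by measurable
  \<comment> \<open>Where the superposition is not absolutely convergent its integral has the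
    default value 0, for which the bound is trivial.\<close>
  have fle: "ennreal (cmod (f x)) \<le> (\<integral>\<^sup>+p. v p x \<partial>lborel)" for x
  proof (cases "integrable lborel (\<lambda>p. c p * K p x)")
    case True thus ?thesis unfolding f_def v_def by (rule integral_norm_bound_ennreal)
  next
    case False thus ?thesis unfolding f_def by (simp add: not_integrable_integral_eq)
  qed
  have "(\<integral>\<^sup>+x. ennreal ((cmod (f x))\<^sup>2) \<partial>lborel) \<le> (\<integral>\<^sup>+x. (\<integral>\<^sup>+p. v p x \<partial>lborel) * (\<integral>\<^sup>+q. v q x \<partial>lborel) \<partial>lborel)"
  proof (intro nn_integral_mono)
    fix x :: "real^'n"
    have "ennreal ((cmod (f x))\<^sup>2) = ennreal (cmod (f x)) * ennreal (cmod (f x))"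
      by (simp add: power2_eq_square ennreal_mult)
    also have "\<dots> \<le> (\<integral>\<^sup>+p. v p x \<partial>lborel) * (\<integral>\<^sup>+q. v q x \<partial>lborel)" by (intro mult_mono fle) auto
    finally show "ennreal ((cmod (f x))\<^sup>2) \<le> (\<integral>\<^sup>+p. v p x \<partial>lborel) * (\<integral>\<^sup>+q. v q x \<partial>lborel)" .
  qed
  also have "\<dots> = (\<integral>\<^sup>+x. (\<integral>\<^sup>+p. (\<integral>\<^sup>+q. v p x * v q x \<partial>lborel) \<partial>lborel) \<partial>lborel)"
    by (simp add: nn_integral_cmult nn_integral_multc)
  also have "\<dots> = (\<integral>\<^sup>+p. (\<integral>\<^sup>+x. (\<integral>\<^sup>+q. v p x * v q x \<partial>lborel) \<partial>lborel) \<partial>lborel)"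
    by (rule lborel_pair.Fubini') measurable
  also have "\<dots> = (\<integral>\<^sup>+p. (\<integral>\<^sup>+q. (\<integral>\<^sup>+x. v p x * v q x \<partial>lborel) \<partial>lborel) \<partial>lborel)"
    by (intro nn_integral_cong lborel_pair.Fubini') measurable
  also have "\<dots> \<le> (\<integral>\<^sup>+p. (\<integral>\<^sup>+q. ennreal (cmod (c p) * \<rho> p) * ennreal (cmod (c q) * \<rho> q) \<partial>lborel) \<partial>lborel)"
  proof (intro nn_integral_mono)
    fix p q :: 'p
    have "(\<integral>\<^sup>+x. v p x * v q x \<partial>lborel) = (\<integral>\<^sup>+x. ennreal (cmod (c p) * cmod (c q)) * (ennreal (cmod (K p x)) * ennreal (cmod (K q x))) \<partial>lborel)"
      unfolding v_def by (intro nn_integral_cong) (simp add: norm_mult mult_ac flip: ennreal_mult)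
    also have "\<dots> = ennreal (cmod (c p) * cmod (c q)) * (\<integral>\<^sup>+x. ennreal (cmod (K p x)) * ennreal (cmod (K q x)) \<partial>lborel)"
      by (rule nn_integral_cmult) measurable
    also have "\<dots> \<le> ennreal (cmod (c p) * cmod (c q)) * ennreal (\<rho> p * \<rho> q)"
      by (intro mult_left_mono L2_nn_cauchy_schwarz K \<rho>) auto
    also have "\<dots> = ennreal (cmod (c p) * \<rho> p) * ennreal (cmod (c q) * \<rho> q)"
      using \<rho>(1) by (simp add: mult_ac flip: ennreal_mult)
    finally show "(\<integral>\<^sup>+x. v p x * v q x \<partial>lborel) \<le> ennreal (cmod (c p) * \<rho> p) * ennreal (cmod (c q) * \<rho> q)" .
  qed
  also have "\<dots> = (\<integral>\<^sup>+p. ennreal (cmod (c p) * \<rho> p) \<partial>lborel) * (\<integral>\<^sup>+q. ennreal (cmod (c q) * \<rho> q) \<partial>lborel)"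
    by (simp add: nn_integral_cmult nn_integral_multc)
  also have "\<dots> = ennreal S * ennreal S"
    unfolding S_def by (subst (1 2) nn_integral_eq_integral[OF \<rho>(3)]) (use \<rho>(1) in auto)
  also have "\<dots> = ennreal (S\<^sup>2)" using S0 by (simp add: power2_eq_square ennreal_mult)
  finally have le: "(\<integral>\<^sup>+x. ennreal ((cmod (f x))\<^sup>2) \<partial>lborel) \<le> ennreal (S\<^sup>2)" .
  have "(\<integral>x. (cmod (f x))\<^sup>2 \<partial>lborel) = enn2real (\<integral>\<^sup>+x. ennreal ((cmod (f x))\<^sup>2) \<partial>lborel)"
    by (rule integral_eq_nn_integral) auto
  also have "\<dots> \<le> enn2real (ennreal (S\<^sup>2))" by (intro enn2real_mono le) auto
  finally have "(\<integral>x. (cmod (f x))\<^sup>2 \<partial>lborel) \<le> S\<^sup>2" by simp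
  hence "sqrt (\<integral>x. (cmod (f x))\<^sup>2 \<partial>lborel) \<le> S" using S0 by (simp add: real_le_lsqrt real_sqrt_le_iff)
  thus ?thesis unfolding L2_norm_def f_def S_def .
qed

lemma superposition_pairing:
  fixes A :: "'p::euclidean_space \<Rightarrow> 'q::euclidean_space \<Rightarrow> complex"
  assumes c: "integrable lborel c" and Am[measurable]: "(\<lambda>(p, t). A p t) \<in> borel_measurable (borel \<Otimes>\<^sub>M borel)"
    and A0: "\<And>p t. cmod (A p t) \<le> B" and k: "integrable lborel k"
  shows "(\<integral>t. (\<integral>p. c p * A p t \<partial>lborel) * k t \<partial>lborel) = (\<integral>p. c p * (\<integral>t. A p t * k t \<partial>lborel) \<partial>lborel)"
    and "integrable lborel (\<lambda>p. c p * (\<integral>t. A p t * k t \<partial>lborel))"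
proof -
  have [measurable]: "c \<in> borel_measurable borel" "k \<in> borel_measurable borel" using c k by auto
  have B0: "0 \<le> B" using A0[of undefined undefined] norm_ge_zero order_trans by blast
  have int: "integrable (lborel \<Otimes>\<^sub>M lborel) (\<lambda>(p, t). c p * A p t * k t)"
  proof (rule Bochner_Integration.integrable_bound)
    show "integrable (lborel \<Otimes>\<^sub>M lborel) (\<lambda>p. complex_of_real B * (case p of (p, t) \<Rightarrow> c p * k t))"
      by (intro integrable_mult_right integrable_prod_pair c k)
    show "AE p in lborel \<Otimes>\<^sub>M lborel. norm (case p of (p, t) \<Rightarrow> c p * A p t * k t) \<le> norm (complex_of_real B * (case p of (p, t) \<Rightarrow> c p * k t))"
    proof (intro AE_I2, clarify)
      fix p t
      show "norm (c p * A p t * k t) \<le> norm (complex_of_real B * (c p * k t))"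
        using mult_right_mono[OF A0[of p t], of "cmod (c p) * cmod (k t)"] B0 by (simp add: norm_mult mult_ac)
    qed
  qed measurable
  have "(\<integral>t. (\<integral>p. c p * A p t \<partial>lborel) * k t \<partial>lborel) = (\<integral>t. (\<integral>p. c p * A p t * k t \<partial>lborel) \<partial>lborel)"
    by (simp only: integral_mult_left_zero)
  also have "\<dots> = (\<integral>p. (\<integral>t. c p * A p t * k t \<partial>lborel) \<partial>lborel)"
    by (rule lborel_pair.Fubini_integral[OF int])
  also have "\<dots> = (\<integral>p. c p * (\<integral>t. A p t * k t \<partial>lborel) \<partial>lborel)"
    by (simp only: mult.assoc integral_mult_right_zero)
  finally show "(\<integral>t. (\<integral>p. c p * A p t \<partial>lborel) * k t \<partial>lborel) = (\<integral>p. c p * (\<integral>t. A p t * k t \<partial>lborel) \<partial>lborel)" .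
  have "integrable lborel (\<lambda>p. \<integral>t. c p * A p t * k t \<partial>lborel)"
    using lborel_pair.integrable_fst'[OF int] by simp
  thus "integrable lborel (\<lambda>p. c p * (\<integral>t. A p t * k t \<partial>lborel))" by (simp only: mult.assoc integral_mult_right_zero)
qed

section \<open>The Hermite propagator on \<open>M\<^sup>1\<^sup>,\<^sup>1\<close>\<close>

text \<open>With (x, y) read as x + i y this is multiplication by exp(-i \<theta>), the classical
  flow of the harmonic oscillator.\<close>

definition phase_rotation :: "real \<Rightarrow> (real^'n::finite) \<times> (real^'n) \<Rightarrow> (real^'n) \<times> (real^'n)" where
  "phase_rotation \<theta> z = (cos \<theta> *\<^sub>R fst z + sin \<theta> *\<^sub>R snd z, cos \<theta> *\<^sub>R snd z - sin \<theta> *\<^sub>R fst z)"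

text \<open>The closed form of the propagator applied to a coherent state. The angle 2t reflects the
  spacing 2 of the eigenvalues, and the scalar phase is that of the lowest eigenvalue, the
  dimension.\<close>

definition evolved :: "real \<Rightarrow> (real^'n::finite) \<times> (real^'n) \<Rightarrow> real^'n \<Rightarrow> complex" where
  "evolved t z x = cis (- (t * CARD('n))) * coherent (phase_rotation (2 * t) z) x"

lemma evolved_packet:
  "evolved t z x = (cis (- (t * CARD('n))) * cis (- (fst (phase_rotation (2 * t) z) \<bullet> snd (phase_rotation (2 * t) z)) / 2)) *
     packet (1/2) (fst (phase_rotation (2 * t) z)) (snd (phase_rotation (2 * t) z)) (x :: real^'n::finite)"
  unfolding evolved_def coherent_def by (simp only: mult.assoc)

lemma evolved_le_1: "cmod (evolved t z x) \<le> 1"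
  using coherent_le_1 by (simp add: evolved_def norm_mult)

lemma phase_rotation_measurable [measurable]: "phase_rotation \<theta> \<in> borel_measurable borel"
  unfolding phase_rotation_def by (intro borel_measurable_continuous_onI continuous_intros)

lemma evolved_measurable_pair: "(\<lambda>(z, x). evolved t z x) \<in> borel_measurable (borel \<Otimes>\<^sub>M borel)"
  unfolding evolved_packet packet_def by measurable

text \<open>A rotation preserves every x_j^2 + y_j^2 and multiplies every x_j + i y_j by the same
  unimodular number, so the product of the powers acquires that number to the total degree of
  \<alpha>.\<close>

lemma coherent_hermite_rotation:
  "coherent_hermite \<alpha> (phase_rotation \<theta> z) = cis (- (\<theta> * real (\<Sum>j\<in>UNIV. \<alpha> j))) * coherent_hermite \<alpha> z"
proof -
  let ?z = "phase_rotation \<theta> z"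
  have 1: "(fst ?z $ j)\<^sup>2 + (snd ?z $ j)\<^sup>2 = (fst z $ j)\<^sup>2 + (snd z $ j)\<^sup>2" for j
  proof -
    have "(c * a + s * b)\<^sup>2 + (c * b - s * a)\<^sup>2 = (a\<^sup>2 + b\<^sup>2) * (c\<^sup>2 + s\<^sup>2)" for a b c s :: real
      by (simp add: power2_eq_square algebra_simps)
    thus ?thesis by (simp add: phase_rotation_def)
  qed
  have 2: "of_real (fst ?z $ j) + \<i> * of_real (snd ?z $ j) = cis (- \<theta>) * (of_real (fst z $ j) + \<i> * of_real (snd z $ j))" for j
    by (simp add: phase_rotation_def complex_eq_iff algebra_simps)
  have "coherent_hermite \<alpha> ?z = (\<Prod>j\<in>UNIV. cis (- \<theta>) ^ \<alpha> j) * coherent_hermite \<alpha> z"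
    unfolding coherent_hermite_def 1 2 power_mult_distrib prod.distrib[symmetric] by (simp only: mult_ac)
  also have "(\<Prod>j\<in>UNIV. cis (- \<theta>) ^ \<alpha> j) = cis (- (\<theta> * real (\<Sum>j\<in>UNIV. \<alpha> j)))"
    unfolding Complex.DeMoivre cis_sum[symmetric] by (simp add: sum_distrib_left mult.commute sum_negf)
  finally show ?thesis .
qed

definition hermite_phase :: "real \<Rightarrow> ('n::finite \<Rightarrow> nat) \<Rightarrow> complex" where
  "hermite_phase t \<alpha> = exp (- \<i> * complex_of_real (t * hermite_eigenvalue \<alpha>))"

lemma hermite_phase_add: "hermite_phase (s + t) \<alpha> = hermite_phase s \<alpha> * hermite_phase t \<alpha>"
  unfolding hermite_phase_def by (simp add: distrib_right distrib_left flip: exp_add)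

lemma norm_hermite_phase [simp]: "cmod (hermite_phase t \<alpha>) = 1"
  by (simp add: hermite_phase_def)

lemma hermite_coeff_evolved: "hermite_coeff (evolved t z) \<alpha> = hermite_phase t \<alpha> * coherent_hermite \<alpha> (z :: (real^'n::finite) \<times> (real^'n))"
proof -
  have "hermite_coeff (evolved t z) \<alpha> = cis (- (t * CARD('n))) * hermite_coeff (coherent (phase_rotation (2 * t) z)) \<alpha>"
    unfolding hermite_coeff_def evolved_def by (simp only: mult.assoc integral_mult_right_zero)
  also have "\<dots> = (cis (- (t * CARD('n))) * cis (- (2 * t * real (\<Sum>j\<in>UNIV. \<alpha> j)))) * coherent_hermite \<alpha> z"
    unfolding hermite_coeff_coherent(2) coherent_hermite_rotation by (simp only: mult.assoc)
  also have "cis (- (t * CARD('n))) * cis (- (2 * t * real (\<Sum>j\<in>UNIV. \<alpha> j))) = hermite_phase t \<alpha>"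
  proof -
    have "cis (- (t * CARD('n))) * cis (- (2 * t * real (\<Sum>j\<in>UNIV. \<alpha> j))) = cis (- (t * hermite_eigenvalue \<alpha>))"
      unfolding cis_mult hermite_eigenvalue_def by (rule arg_cong[of _ _ cis]) (simp add: algebra_simps)
    thus ?thesis by (simp add: hermite_phase_def cis_conv_exp)
  qed
  finally show ?thesis .
qed

lemma evolved_norm: "(\<integral>x. (cmod (evolved t z x))\<^sup>2 \<partial>lborel) = sqrt pi ^ CARD('n::finite)" for z :: "(real^'n) \<times> (real^'n)"
  by (simp add: evolved_def norm_mult coherent_norm)

text \<open>Superposing evolved coherent states makes the bounds immediate; the agreement with the
  spectral series is established afterwards in \<open>m11_evolve_hermite_series\<close>.\<close>

definition m11_evolve :: "real \<Rightarrow> 'n::finite m11 \<Rightarrow> 'n m11" where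
  "m11_evolve t f = abs_m11 (\<lambda>x. \<integral>z. coherent_coeff (rep_m11 f) z * evolved t z x \<partial>lborel)"

lemma evolved_superposition:
  fixes c :: "(real^'n::finite) \<times> (real^'n) \<Rightarrow> complex"
  assumes c: "integrable lborel c"
  shows "(\<lambda>x. \<integral>z. c z * evolved t z x \<partial>lborel) \<in> m11_set"
    and "m11_set_norm (\<lambda>x. \<integral>z. c z * evolved t z x \<partial>lborel)
      \<le> m11_set_norm (base_window :: real^'n \<Rightarrow> complex) * (\<integral>z. cmod (c z) \<partial>lborel)"
proof -
  have mm: "(\<lambda>z. cis (- (t * CARD('n))) * cis (- (fst (phase_rotation (2 * t) z) \<bullet> snd (phase_rotation (2 * t) z)) / 2)) \<in> borel_measurable (borel :: ((real^'n) \<times> (real^'n)) measure)"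
    "(\<lambda>z. fst (phase_rotation (2 * t) z)) \<in> borel_measurable (borel :: ((real^'n) \<times> (real^'n)) measure)"
    "(\<lambda>z. snd (phase_rotation (2 * t) z)) \<in> borel_measurable (borel :: ((real^'n) \<times> (real^'n)) measure)"
    by measurable
  note PS = packet_superposition_m11[where a="1/2", OF _ c _ mm]
  show "(\<lambda>x. \<integral>z. c z * evolved t z x \<partial>lborel) \<in> m11_set"
    unfolding evolved_packet by (rule PS(1)) (auto simp: norm_mult)
  show "m11_set_norm (\<lambda>x. \<integral>z. c z * evolved t z x \<partial>lborel)
      \<le> m11_set_norm (base_window :: real^'n \<Rightarrow> complex) * (\<integral>z. cmod (c z) \<partial>lborel)"
    unfolding evolved_packet by (rule PS(2)) (auto simp: norm_mult)
qed

lemma rep_m11_evolve: "rep_m11 (m11_evolve t f) = (\<lambda>x. \<integral>z. coherent_coeff (rep_m11 f) z * evolved t z x \<partial>lborel)"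
  unfolding m11_evolve_def
  by (rule abs_m11_inverse[OF evolved_superposition(1)[OF coherent_coeff_integrable(1)[OF rep_m11]]])

lemma m11_evolve_bound: "\<exists>C\<ge>1. \<forall>t. \<forall>f :: 'n::finite m11. norm (m11_evolve t f) \<le> C * norm f"
proof -
  define K where "K = m11_set_norm (base_window :: real^'n \<Rightarrow> complex) * cmod (coherent_const TYPE('n))"
  have "norm (m11_evolve t f) \<le> max 1 K * norm f" for t and f :: "'n m11"
  proof -
    have "norm (m11_evolve t f) \<le> m11_set_norm (base_window :: real^'n \<Rightarrow> complex) * (\<integral>z. cmod (coherent_coeff (rep_m11 f) z) \<partial>lborel)"
      unfolding norm_m11_def rep_m11_evolve by (rule evolved_superposition(2)[OF coherent_coeff_integrable(1)[OF rep_m11]])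
    also have "\<dots> = K * norm f" by (simp add: coherent_coeff_integrable(2)[OF rep_m11] norm_m11_def K_def)
    also have "\<dots> \<le> max 1 K * norm f" by (intro mult_right_mono) auto
    finally show ?thesis .
  qed
  thus ?thesis by (intro exI[of _ "max 1 K"]) auto
qed

section \<open>Linearity and Hermite coefficients of the evolution\<close>

lemma coherent_coeff_add: "coherent_coeff (rep_m11 (f + g)) z = coherent_coeff (rep_m11 f) z + coherent_coeff (rep_m11 g) z"
  unfolding coherent_coeff_def rep_plus_m11 by (subst gabor_add) (auto intro: base_window_L2 simp: algebra_simps)

lemma coherent_coeff_cscale: "coherent_coeff (rep_m11 (cscale c f)) z = c * coherent_coeff (rep_m11 f) z"
  unfolding coherent_coeff_def rep_cscale gabor_cmult by (simp only: mult_ac)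

lemma coherent_coeff_evolved_integrable:
  "integrable lborel (\<lambda>z. coherent_coeff (rep_m11 f) z * evolved t z x)"
proof -
  have [measurable]: "(\<lambda>z. evolved t z x) \<in> borel_measurable borel" unfolding evolved_packet packet_def by measurable
  note c = coherent_coeff_integrable(1)[OF rep_m11[of f]]
  show ?thesis
    by (rule integral_norm_le(1)[OF integrable_norm[OF c]])
      (use c in \<open>auto simp: norm_mult intro!: mult_left_le evolved_le_1\<close>)
qed

lemma m11_evolve_add: "m11_evolve t (f + g) = m11_evolve t f + m11_evolve t g"
  by (rule m11_eqI)
    (simp add: rep_plus_m11[of "m11_evolve t f"] rep_m11_evolve coherent_coeff_add distrib_right coherent_coeff_evolved_integrable)

lemma m11_evolve_cscale: "m11_evolve t (cscale c f) = cscale c (m11_evolve t f)"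
  by (rule m11_eqI) (simp only: rep_m11_evolve coherent_coeff_cscale rep_cscale[of c "m11_evolve t f"] mult.assoc integral_mult_right_zero)

lemma bounded_linear_m11_evolve: "bounded_linear (m11_evolve t :: 'n::finite m11 \<Rightarrow> 'n m11)"
proof -
  obtain C where "\<And>f :: 'n m11. norm (m11_evolve t f) \<le> C * norm f" using m11_evolve_bound by blast
  thus ?thesis
    by (intro bounded_linear_intro[where K=C]) (auto simp: m11_evolve_add scaleR_m11_def m11_evolve_cscale mult.commute)
qed

lemma hermite_coeff_superposition:
  fixes A :: "(real^'n::finite) \<times> (real^'n) \<Rightarrow> real^'n \<Rightarrow> complex"
  assumes c: "integrable lborel c" and Am: "(\<lambda>(p, t). A p t) \<in> borel_measurable (borel \<Otimes>\<^sub>M borel)"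
    and A0: "\<And>p t. cmod (A p t) \<le> 1"
  shows "hermite_coeff (\<lambda>x. \<integral>p. c p * A p x \<partial>lborel) \<alpha> = (\<integral>p. c p * hermite_coeff (A p) \<alpha> \<partial>lborel)"
    and "integrable lborel (\<lambda>p. c p * hermite_coeff (A p) \<alpha>)"
  unfolding hermite_coeff_def
  by (rule superposition_pairing[OF c Am A0], simp add: hermite_fun_integrable)+

lemma coherent_measurable_pair: "(\<lambda>(z, x). coherent z x) \<in> borel_measurable (borel \<Otimes>\<^sub>M borel)"
  unfolding coherent_def packet_def by measurable

lemma hermite_coeff_rep_m11:
  "hermite_coeff (rep_m11 f) \<alpha> = (\<integral>z. coherent_coeff (rep_m11 f) z * coherent_hermite \<alpha> z \<partial>lborel)"
  "integrable lborel (\<lambda>z. coherent_coeff (rep_m11 f) z * coherent_hermite \<alpha> z)"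
proof -
  note S = hermite_coeff_superposition[OF coherent_coeff_integrable(1)[OF rep_m11[of f]] coherent_measurable_pair coherent_le_1, of \<alpha>]
  show "hermite_coeff (rep_m11 f) \<alpha> = (\<integral>z. coherent_coeff (rep_m11 f) z * coherent_hermite \<alpha> z \<partial>lborel)"
    by (subst m11_inversion[OF rep_m11], subst S(1)) (simp only: hermite_coeff_coherent(2))
  show "integrable lborel (\<lambda>z. coherent_coeff (rep_m11 f) z * coherent_hermite \<alpha> z)"
    using S(2) by (simp only: hermite_coeff_coherent(2))
qed

lemma hermite_coeff_m11_evolve: "hermite_coeff (rep_m11 (m11_evolve t f)) \<alpha> = hermite_phase t \<alpha> * hermite_coeff (rep_m11 f) \<alpha>"
proof -
  have "hermite_coeff (rep_m11 (m11_evolve t f)) \<alpha> = (\<integral>z. coherent_coeff (rep_m11 f) z * (hermite_phase t \<alpha> * coherent_hermite \<alpha> z) \<partial>lborel)"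
    unfolding rep_m11_evolve
    by (subst hermite_coeff_superposition(1)[OF coherent_coeff_integrable(1)[OF rep_m11[of f]] evolved_measurable_pair evolved_le_1])
      (simp only: hermite_coeff_evolved)
  also have "\<dots> = (\<integral>z. hermite_phase t \<alpha> * (coherent_coeff (rep_m11 f) z * coherent_hermite \<alpha> z) \<partial>lborel)"
    by (simp only: mult.left_commute)
  also have "\<dots> = hermite_phase t \<alpha> * hermite_coeff (rep_m11 f) \<alpha>"
    unfolding hermite_coeff_rep_m11(1) by (rule integral_mult_right_zero)
  finally show ?thesis .
qed

lemma coherent_hermite_measurable [measurable]: "coherent_hermite \<alpha> \<in> borel_measurable borel"
  unfolding coherent_hermite_def by (intro borel_measurable_continuous_onI continuous_intros) auto

text \<open>For finite A, the L2 distance of a coherent state from its Hermite expansion over A, by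
  Bessel's identity. The evolution leaves it unchanged because it multiplies the coefficients by
  unimodular numbers.\<close>

definition hermite_defect :: "('n::finite \<Rightarrow> nat) set \<Rightarrow> (real^'n) \<times> (real^'n) \<Rightarrow> real" where
  "hermite_defect A z = sqrt (sqrt pi ^ CARD('n) - (\<Sum>\<alpha>\<in>A. (cmod (coherent_hermite \<alpha> z))\<^sup>2))"

lemma evolved_L2: "evolved t z \<in> L2_space"
proof -
  have "evolved t z x = (cis (- (t * CARD('n))) * cis (- (fst (phase_rotation (2 * t) z) \<bullet> snd (phase_rotation (2 * t) z)) / 2)) *
     packet (1/2) (fst (phase_rotation (2 * t) z)) (snd (phase_rotation (2 * t) z)) x" for x :: "real^'n" and z
    by (rule evolved_packet)
  have i: "integrable lborel (\<lambda>x::real^'n. gaussian (1/2) (x - y))" for y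
    by (rule lborel_integrable_translate(3)[OF schwartz_integrable[OF base_window_schwartz]])
  have m: "evolved t z \<in> borel_measurable borel" unfolding evolved_packet[abs_def] packet_def by measurable
  show ?thesis
  proof (rule L2_spaceI_bounded_integrable[OF _ evolved_le_1])
    show "integrable lborel (evolved t z)"
      by (rule Bochner_Integration.integrable_bound[OF i[of "fst (phase_rotation (2 * t) z)"]])
        (use m in \<open>auto simp: evolved_packet packet_def norm_mult\<close>)
  qed
qed

lemma hermite_defect_integral:
  fixes z :: "(real^'n::finite) \<times> (real^'n)"
  assumes A: "finite A"
  shows "(\<integral>x. (cmod (evolved t z x - (\<Sum>\<alpha>\<in>A. hermite_phase t \<alpha> * coherent_hermite \<alpha> z * hermite_fun \<alpha> x)))\<^sup>2 \<partial>lborel) = (hermite_defect A z)\<^sup>2"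
    and "0 \<le> hermite_defect A z" and "hermite_defect A z \<le> sqrt (sqrt pi ^ CARD('n))"
proof -
  have *: "(\<integral>x. (cmod (evolved t z x - (\<Sum>\<alpha>\<in>A. hermite_phase t \<alpha> * coherent_hermite \<alpha> z * hermite_fun \<alpha> x)))\<^sup>2 \<partial>lborel)
    = sqrt pi ^ CARD('n) - (\<Sum>\<alpha>\<in>A. (cmod (coherent_hermite \<alpha> z))\<^sup>2)"
    using bessel_identity[OF evolved_L2[of t z] A] unfolding evolved_norm hermite_coeff_evolved by (simp add: norm_mult)
  have nn: "0 \<le> sqrt pi ^ CARD('n) - (\<Sum>\<alpha>\<in>A. (cmod (coherent_hermite \<alpha> z))\<^sup>2)"
    unfolding *[symmetric] by simp
  show "(\<integral>x. (cmod (evolved t z x - (\<Sum>\<alpha>\<in>A. hermite_phase t \<alpha> * coherent_hermite \<alpha> z * hermite_fun \<alpha> x)))\<^sup>2 \<partial>lborel) = (hermite_defect A z)\<^sup>2"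
    unfolding * hermite_defect_def using nn by simp
  show "0 \<le> hermite_defect A z" unfolding hermite_defect_def using nn by simp
  show "hermite_defect A z \<le> sqrt (sqrt pi ^ CARD('n))" unfolding hermite_defect_def by (simp add: sum_nonneg)
qed

lemma hermite_defect_measurable [measurable]: "hermite_defect A \<in> borel_measurable borel"
  unfolding hermite_defect_def by measurable

lemma hermite_defect_antimono: "A \<subseteq> B \<Longrightarrow> finite B \<Longrightarrow> hermite_defect B z \<le> hermite_defect A z"
  unfolding hermite_defect_def by (auto intro!: sum_mono2)

lemma hermite_defect_tendsto:
  fixes z :: "(real^'n::finite) \<times> (real^'n)"
  shows "(\<lambda>k. hermite_defect (multi_box k) z) \<longlonglongrightarrow> 0"
proof -
  have "(\<lambda>k. sqrt (sqrt pi ^ CARD('n) - (\<Sum>\<alpha>\<in>multi_box k. (cmod (coherent_hermite \<alpha> z))\<^sup>2))) \<longlonglongrightarrow> sqrt (sqrt pi ^ CARD('n) - sqrt pi ^ CARD('n))"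
    by (intro tendsto_intros coherent_parseval)
  thus ?thesis by (simp add: hermite_defect_def[abs_def])
qed

text \<open>The remainder of the series for f is the superposition of the remainders of the evolved
  coherent states, so by Minkowski its L2 norm is at most the integral of |c| times the defect.
  Along cubes this tends to zero by dominated convergence, and since the defect decreases when A
  grows, the limit extends from cubes to the net of all finite sets.\<close>

lemma m11_evolve_hermite_series:
  fixes f :: "'n::finite m11"
  shows "((\<lambda>A. L2_norm (\<lambda>x. rep_m11 (m11_evolve t f) x -
         (\<Sum>\<alpha>\<in>A. exp (- \<i> * complex_of_real (t * hermite_eigenvalue \<alpha>)) *
                  hermite_coeff (rep_m11 f) \<alpha> * hermite_fun \<alpha> x))) \<longlongrightarrow> 0) (finite_subsets_at_top UNIV)"
proof -
  define c where "c = coherent_coeff (rep_m11 f)"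
  have c: "integrable lborel c" unfolding c_def by (rule coherent_coeff_integrable(1)[OF rep_m11])
  have [measurable]: "c \<in> borel_measurable borel" using c by auto
  define K :: "('n \<Rightarrow> nat) set \<Rightarrow> (real^'n) \<times> (real^'n) \<Rightarrow> real^'n \<Rightarrow> complex"
    where "K A z x = evolved t z x - (\<Sum>\<alpha>\<in>A. hermite_phase t \<alpha> * coherent_hermite \<alpha> z * hermite_fun \<alpha> x)" for A z x
  define E where "E A = L2_norm (\<lambda>x. rep_m11 (m11_evolve t f) x - (\<Sum>\<alpha>\<in>A. hermite_phase t \<alpha> * hermite_coeff (rep_m11 f) \<alpha> * hermite_fun \<alpha> x))" for A
  have di: "integrable lborel (\<lambda>z. cmod (c z) * hermite_defect A z)" if A: "finite A" for A
  proof (rule integral_norm_le(1))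
    show "integrable lborel (\<lambda>z. cmod (c z) * sqrt (sqrt pi ^ CARD('n)))" using c by auto
    show "norm (cmod (c z) * hermite_defect A z) \<le> cmod (c z) * sqrt (sqrt pi ^ CARD('n))" for z
      using hermite_defect_integral(2,3)[OF A, of z] by (auto simp: abs_mult intro!: mult_left_mono)
  qed measurable
  have bound: "E A \<le> (\<integral>z. cmod (c z) * hermite_defect A z \<partial>lborel)" if A: "finite A" for A
  proof -
    have eq: "rep_m11 (m11_evolve t f) x - (\<Sum>\<alpha>\<in>A. hermite_phase t \<alpha> * hermite_coeff (rep_m11 f) \<alpha> * hermite_fun \<alpha> x) = (\<integral>z. c z * K A z x \<partial>lborel)" for x
    proof -
      have i1: "integrable lborel (\<lambda>z. c z * evolved t z x)" unfolding c_def by (rule coherent_coeff_evolved_integrable)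
      have i2: "integrable lborel (\<lambda>z. (hermite_phase t \<alpha> * hermite_fun \<alpha> x) * (c z * coherent_hermite \<alpha> z))" for \<alpha>
        unfolding c_def by (intro integrable_mult_right hermite_coeff_rep_m11)
      have "(\<integral>z. c z * K A z x \<partial>lborel) = (\<integral>z. c z * evolved t z x - (\<Sum>\<alpha>\<in>A. (hermite_phase t \<alpha> * hermite_fun \<alpha> x) * (c z * coherent_hermite \<alpha> z)) \<partial>lborel)"
        by (intro Bochner_Integration.integral_cong refl) (simp add: K_def right_diff_distrib sum_distrib_left mult_ac)
      also have "\<dots> = (\<integral>z. c z * evolved t z x \<partial>lborel) - (\<Sum>\<alpha>\<in>A. (hermite_phase t \<alpha> * hermite_fun \<alpha> x) * (\<integral>z. c z * coherent_hermite \<alpha> z \<partial>lborel))"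
        by (subst Bochner_Integration.integral_diff[OF i1 Bochner_Integration.integrable_sum[OF i2]], subst Bochner_Integration.integral_sum[OF i2])
          (simp only: integral_mult_right_zero)
      finally show ?thesis unfolding rep_m11_evolve hermite_coeff_rep_m11(1) c_def[symmetric] by (simp add: mult_ac)
    qed
    show ?thesis unfolding E_def eq
    proof (rule L2_norm_superposition[OF c _ _ _ _ _ di[OF A]])
      show "(\<lambda>(z, x). K A z x) \<in> borel_measurable (borel \<Otimes>\<^sub>M borel)"
        unfolding K_def using evolved_measurable_pair[of t, measurable] by measurable
      show "K A z \<in> L2_space" for z
        unfolding K_def[abs_def] by (rule hermite_coeff_sum_diff(1)[OF evolved_L2 A])
      show "(\<integral>x. (cmod (K A z x))\<^sup>2 \<partial>lborel) \<le> (hermite_defect A z)\<^sup>2" for z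
        unfolding K_def hermite_defect_integral(1)[OF A] by simp
      show "0 \<le> hermite_defect A z" for z by (rule hermite_defect_integral(2)[OF A])
    qed measurable
  qed
  have lim: "(\<lambda>k. \<integral>z. cmod (c z) * hermite_defect (multi_box k) z \<partial>lborel) \<longlonglongrightarrow> (\<integral>z. cmod (c z) * 0 \<partial>lborel)"
  proof (rule integral_dominated_convergence[where w="\<lambda>z. cmod (c z) * sqrt (sqrt pi ^ CARD('n))"])
    show "integrable lborel (\<lambda>z. cmod (c z) * sqrt (sqrt pi ^ CARD('n)))" using c by auto
    show "AE z in lborel. (\<lambda>k. cmod (c z) * hermite_defect (multi_box k) z) \<longlonglongrightarrow> cmod (c z) * 0"
      by (intro AE_I2 tendsto_mult tendsto_const hermite_defect_tendsto)
    show "AE z in lborel. norm (cmod (c z) * hermite_defect (multi_box k) z) \<le> cmod (c z) * sqrt (sqrt pi ^ CARD('n))" for k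
    proof (intro AE_I2)
      fix z show "norm (cmod (c z) * hermite_defect (multi_box k) z) \<le> cmod (c z) * sqrt (sqrt pi ^ CARD('n))"
        using hermite_defect_integral(2,3)[OF finite_multi_box[of k], of z] by (auto simp: abs_mult intro!: mult_left_mono)
    qed
  qed measurable
  have E0: "E A \<ge> 0" for A by (simp add: E_def L2_norm_def)
  have "(E \<longlongrightarrow> 0) (finite_subsets_at_top UNIV)"
    unfolding tendsto_iff
  proof (intro allI impI)
    fix e :: real assume "e > 0"
    then obtain k where k: "(\<integral>z. cmod (c z) * hermite_defect (multi_box k) z \<partial>lborel) < e"
      using order_tendstoD(2)[OF lim, of e] by (auto simp: eventually_sequentially)
    show "\<forall>\<^sub>F A in finite_subsets_at_top UNIV. dist (E A) 0 < e"
      unfolding eventually_finite_subsets_at_top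
    proof (intro exI[of _ "multi_box k"] conjI allI impI)
      fix Y :: "('n \<Rightarrow> nat) set" assume Y: "finite Y \<and> multi_box k \<subseteq> Y \<and> Y \<subseteq> UNIV"
      have "E Y \<le> (\<integral>z. cmod (c z) * hermite_defect Y z \<partial>lborel)" using bound Y by auto
      also have "\<dots> \<le> (\<integral>z. cmod (c z) * hermite_defect (multi_box k) z \<partial>lborel)"
        using Y di[of Y] di[OF finite_multi_box[of k]] by (intro integral_mono mult_left_mono hermite_defect_antimono) auto
      finally show "dist (E Y) 0 < e" using k E0[of Y] by simp
    qed (auto simp: finite_multi_box)
  qed
  thus ?thesis unfolding E_def hermite_phase_def .
qed

section \<open>Identification with the spectral propagator and the group law\<close>

lemma L2_limit_unique:
  fixes w w' :: "real^'n::finite \<Rightarrow> complex"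
  assumes w: "w \<in> L2_space" "w' \<in> L2_space" and S: "\<And>A. finite A \<Longrightarrow> S A \<in> L2_space"
    and 1: "((\<lambda>A. L2_norm (\<lambda>x. w x - S A x)) \<longlongrightarrow> 0) (finite_subsets_at_top UNIV)"
    and 2: "((\<lambda>A. L2_norm (\<lambda>x. w' x - S A x)) \<longlongrightarrow> 0) (finite_subsets_at_top UNIV)"
  shows "AE x in lborel. w x = w' x"
proof -
  have sq: "(L2_norm h)\<^sup>2 = (\<integral>x. (cmod (h x))\<^sup>2 \<partial>lborel)" for h :: "real^'n \<Rightarrow> complex"
    by (simp add: L2_norm_def)
  have ww: "integrable lborel (\<lambda>x. (cmod (w x - w' x))\<^sup>2)" using L2_space_diff[OF w] by (simp add: L2_space_def)
  have le: "(L2_norm (\<lambda>x. w x - w' x))\<^sup>2 \<le> 2 * (L2_norm (\<lambda>x. w x - S A x))\<^sup>2 + 2 * (L2_norm (\<lambda>x. w' x - S A x))\<^sup>2" if A: "finite A" for A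
  proof -
    have i: "integrable lborel (\<lambda>x. (cmod (w x - S A x))\<^sup>2)" "integrable lborel (\<lambda>x. (cmod (w' x - S A x))\<^sup>2)"
      using L2_space_diff[OF w(1) S[OF A]] L2_space_diff[OF w(2) S[OF A]] by (simp_all add: L2_space_def)
    have "(\<integral>x. (cmod (w x - w' x))\<^sup>2 \<partial>lborel) \<le> (\<integral>x. 2 * (cmod (w x - S A x))\<^sup>2 + 2 * (cmod (w' x - S A x))\<^sup>2 \<partial>lborel)"
    proof (rule integral_mono)
      fix x
      have "cmod (w x - w' x) \<le> cmod (w x - S A x) + cmod (w' x - S A x)"
        using norm_triangle_ineq4[of "w x - S A x" "w' x - S A x"] by simp
      hence "(cmod (w x - w' x))\<^sup>2 \<le> (cmod (w x - S A x) + cmod (w' x - S A x))\<^sup>2" by (intro power_mono) auto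
      also have "\<dots> \<le> 2 * (cmod (w x - S A x))\<^sup>2 + 2 * (cmod (w' x - S A x))\<^sup>2"
        using sum_squares_bound[of "cmod (w x - S A x)" "cmod (w' x - S A x)"] by (simp add: power2_sum)
      finally show "(cmod (w x - w' x))\<^sup>2 \<le> 2 * (cmod (w x - S A x))\<^sup>2 + 2 * (cmod (w' x - S A x))\<^sup>2" .
    qed (use ww i in auto)
    also have "\<dots> = 2 * (\<integral>x. (cmod (w x - S A x))\<^sup>2 \<partial>lborel) + 2 * (\<integral>x. (cmod (w' x - S A x))\<^sup>2 \<partial>lborel)"
      using i by simp
    finally show ?thesis unfolding sq .
  qed
  have "((\<lambda>A. 2 * (L2_norm (\<lambda>x. w x - S A x))\<^sup>2 + 2 * (L2_norm (\<lambda>x. w' x - S A x))\<^sup>2) \<longlongrightarrow> 2 * 0\<^sup>2 + 2 * 0\<^sup>2) (finite_subsets_at_top UNIV)"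
    by (intro tendsto_intros 1 2)
  hence "(L2_norm (\<lambda>x. w x - w' x))\<^sup>2 \<le> 2 * 0\<^sup>2 + 2 * 0\<^sup>2"
    by (rule tendsto_lowerbound) (use le in \<open>auto intro: eventually_finite_subsets_at_top_weakI\<close>)
  moreover have "0 \<le> (\<integral>x. (cmod (w x - w' x))\<^sup>2 \<partial>lborel)" by simp
  ultimately have "(\<integral>x. (cmod (w x - w' x))\<^sup>2 \<partial>lborel) = 0" unfolding sq by simp
  hence "AE x in lborel. (cmod (w x - w' x))\<^sup>2 = 0"
    by (subst (asm) integral_nonneg_eq_0_iff_AE[OF ww]) auto
  thus ?thesis by eventually_elim simp
qed

lemma hermite_sum_L2: "finite A \<Longrightarrow> (\<lambda>x. \<Sum>\<alpha>\<in>A. d \<alpha> * hermite_fun \<alpha> x) \<in> L2_space"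
proof (induct A rule: finite_induct)
  case (insert a A)
  thus ?case using L2_space_add[OF L2_space_cmult[OF hermite_fun_L2, of "d a"]] by simp
qed (simp add: L2_space_def)

text \<open>The function selected by \<open>SOME\<close> is determined only up to a null set:
  \<open>m11_evolve t f\<close> shows that a limit of the spectral series exists, and L2 limits
  agree almost everywhere.\<close>

lemma represents_propagator:
  assumes r: "represents h f"
  shows "represents (propagator t h) (m11_evolve t f)"
proof -
  have [measurable]: "h \<in> borel_measurable borel" and ae: "AE x in lborel. h x = rep_m11 f x" using r by (auto simp: represents_def)
  have hc: "hermite_coeff h \<alpha> = hermite_coeff (rep_m11 f) \<alpha>" for \<alpha>
    unfolding hermite_coeff_def by (rule integral_cong_AE) (use ae in \<open>auto elim!: eventually_mono\<close>)
  let ?S = "\<lambda>A x. \<Sum>\<alpha>\<in>A. exp (- \<i> * complex_of_real (t * hermite_eigenvalue \<alpha>)) * hermite_coeff h \<alpha> * hermite_fun \<alpha> x"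
  let ?P = "\<lambda>w. w \<in> L2_space \<and> ((\<lambda>A. L2_norm (\<lambda>x. w x - ?S A x)) \<longlongrightarrow> 0) (finite_subsets_at_top UNIV)"
  have P: "?P (rep_m11 (m11_evolve t f))" using m11_evolve_hermite_series[of t f] by (simp add: hc)
  have Q: "?P (propagator t h)" unfolding propagator_def by (rule someI[of ?P, OF P])
  have "AE x in lborel. propagator t h x = rep_m11 (m11_evolve t f) x"
    by (rule L2_limit_unique[of _ _ ?S]) (use P Q hermite_sum_L2 in auto)
  thus ?thesis using Q by (auto simp: represents_def L2_space_def)
qed

text \<open>The comparison is made through the Hermite series, whose phases multiply. Composing the
  two superpositions directly would call for the coherent coefficients of an evolved
  function.\<close>

lemma m11_evolve_group: "m11_evolve s (m11_evolve t f) = m11_evolve (s + t) f"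
proof -
  let ?S = "\<lambda>A x. \<Sum>\<alpha>\<in>A. hermite_phase (s + t) \<alpha> * hermite_coeff (rep_m11 f) \<alpha> * hermite_fun \<alpha> x"
  have 1: "((\<lambda>A. L2_norm (\<lambda>x. rep_m11 (m11_evolve (s + t) f) x - ?S A x)) \<longlongrightarrow> 0) (finite_subsets_at_top UNIV)"
    using m11_evolve_hermite_series[of "s + t" f] unfolding hermite_phase_def .
  have 2: "((\<lambda>A. L2_norm (\<lambda>x. rep_m11 (m11_evolve s (m11_evolve t f)) x - ?S A x)) \<longlongrightarrow> 0) (finite_subsets_at_top UNIV)"
    using m11_evolve_hermite_series[of s "m11_evolve t f"]
    unfolding hermite_phase_add hermite_coeff_m11_evolve mult.assoc hermite_phase_def[symmetric] .
  have "AE x in lborel. rep_m11 (m11_evolve s (m11_evolve t f)) x = rep_m11 (m11_evolve (s + t) f) x"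
    by (rule L2_limit_unique[of _ _ ?S]) (use 1 2 hermite_sum_L2 in auto)
  hence "rep_m11 (m11_evolve s (m11_evolve t f)) = rep_m11 (m11_evolve (s + t) f)"
    by (rule continuous_AE_eq[OF rep_m11_continuous rep_m11_continuous])
  thus ?thesis by (simp add: rep_m11_inject)
qed

lemma m11_evolve_0: "m11_evolve 0 f = (f :: 'n::finite m11)"
proof -
  have e: "evolved 0 z x = coherent z x" for z and x :: "real^'n" by (simp add: evolved_def phase_rotation_def)
  have "rep_m11 (m11_evolve 0 f) = rep_m11 f"
    unfolding rep_m11_evolve e by (rule m11_inversion[OF rep_m11, symmetric])
  thus ?thesis by (simp add: rep_m11_inject)
qed

text \<open>For fixed z the rotated point stays in a bounded set, so by Peetre's inequality all
  translates of one rapidly decaying function share a single majorant, integrable over phase space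
  and independent of t.\<close>

lemma gabor_evolved_bound:
  fixes z :: "(real^'n::finite) \<times> (real^'n)"
  shows "\<exists>C\<ge>0. \<forall>t w. cmod (gabor base_window (evolved t z) w) \<le> C * (decay (fst w) ^ (2 * CARD('n)) * decay (snd w) ^ (2 * CARD('n)))"
proof -
  let ?K = "2 * CARD('n)"
  obtain C where C: "C \<ge> 0" "\<And>x y. cmod (gabor base_window (base_window :: real^'n \<Rightarrow> complex) (x, y)) \<le> C * (decay x ^ ?K * decay y ^ ?K)"
    using gabor_schwartz_decay[OF base_window_schwartz base_window_schwartz] by blast
  \<comment> \<open>Bounds 1 plus the norm of either component of any rotation of z, as |cos| and
    |sin| are at most 1.\<close>
  define m where "m = 1 + (norm (fst z) + norm (snd z))"
  have m: "m \<ge> 0" by (simp add: m_def)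
  have main: "cmod (gabor base_window (evolved t z) w) \<le> (C * (m ^ ?K * m ^ ?K)) * (decay (fst w) ^ ?K * decay (snd w) ^ ?K)" for t w
  proof -
    define r where "r = phase_rotation (2 * t) z"
    have cs: "\<bar>cos \<theta>\<bar> * a \<le> a" "\<bar>sin \<theta>\<bar> * a \<le> a" if "a \<ge> 0" for a \<theta> :: real
      using that by (auto intro!: mult_left_le_one_le)
    have r1: "1 + norm (fst r) \<le> m" unfolding r_def m_def phase_rotation_def fst_conv
      using norm_triangle_ineq[of "cos (2 * t) *\<^sub>R fst z" "sin (2 * t) *\<^sub>R snd z"] cs(1)[of "norm (fst z)" "2 * t"] cs(2)[of "norm (snd z)" "2 * t"]
      unfolding norm_scaleR using norm_ge_zero[of "fst z"] norm_ge_zero[of "snd z"] by linarith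
    have r2: "1 + norm (snd r) \<le> m" unfolding r_def m_def phase_rotation_def snd_conv
      using norm_triangle_ineq4[of "cos (2 * t) *\<^sub>R snd z" "sin (2 * t) *\<^sub>R fst z"] cs(1)[of "norm (snd z)" "2 * t"] cs(2)[of "norm (fst z)" "2 * t"]
      unfolding norm_scaleR using norm_ge_zero[of "fst z"] norm_ge_zero[of "snd z"] by linarith
    have d: "decay (u - v) ^ ?K \<le> m ^ ?K * decay u ^ ?K" if "1 + norm v \<le> m" for u v :: "real^'n"
      using that by (intro order_trans[OF decay_diff_power] mult_right_mono power_mono) auto
    have "cmod (gabor base_window (evolved t z) w) = cmod (gabor base_window (base_window :: real^'n \<Rightarrow> complex) (w - (fst r, snd r)))"
    proof -
      have e: "evolved t z = (\<lambda>x. (cis (- (t * CARD('n))) * cis (- (fst r \<bullet> snd r) / 2)) * packet (1/2) (fst r) (snd r) x)"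
        unfolding r_def by (rule ext) (rule evolved_packet)
      show ?thesis unfolding e gabor_cmult gabor_packet[OF gaussian_measurable] norm_mult norm_cis by (simp only: mult_1_left)
    qed
    also have "\<dots> \<le> C * (decay (fst w - fst r) ^ ?K * decay (snd w - snd r) ^ ?K)"
      using C(2)[of "fst w - fst r" "snd w - snd r"] by (simp add: minus_prod_def)
    also have "\<dots> \<le> C * ((m ^ ?K * decay (fst w) ^ ?K) * (m ^ ?K * decay (snd w) ^ ?K))"
      using C(1) m by (intro mult_left_mono mult_mono d r1 r2) auto
    finally show ?thesis by (simp only: mult_ac)
  qed
  have "0 \<le> C * (m ^ ?K * m ^ ?K)" using C(1) m by (intro mult_nonneg_nonneg zero_le_power)
  with main show ?thesis by blast
qed

lemma evolved_continuous_time: "continuous_on UNIV (\<lambda>t. evolved t z x)"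
proof -
  have r: "continuous_on UNIV (\<lambda>t. fst (phase_rotation (2 * t) z))" "continuous_on UNIV (\<lambda>t. snd (phase_rotation (2 * t) z))"
    unfolding phase_rotation_def fst_conv snd_conv by (intro continuous_intros)+
  show ?thesis unfolding evolved_packet packet_def
    by (intro continuous_on_mult continuous_on_cis continuous_on_divide continuous_on_inner
        continuous_on_minus gaussian_continuous_on continuous_on_diff
        continuous_on_const continuous_on_id r) simp_all
qed

lemma gabor_evolved_tendsto:
  fixes z :: "(real^'n::finite) \<times> (real^'n)"
  assumes "s \<longlonglongrightarrow> t"
  shows "(\<lambda>k. gabor base_window (evolved (s k) z) w) \<longlonglongrightarrow> gabor base_window (evolved t z) w"
  unfolding gabor_def
proof (rule integral_dominated_convergence[where w="\<lambda>x. cmod (base_window (x - fst w))"])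
  have m[measurable]: "evolved t z \<in> borel_measurable borel" for t using evolved_L2[of t z] by (simp add: L2_space_def)
  have ms: "(\<lambda>x. evolved t z x * cnj (base_window (x - fst w)) * cis (- (snd w \<bullet> x))) \<in> borel_measurable lborel" for t by measurable
  show "(\<lambda>x. evolved t z x * cnj (base_window (x - fst w)) * cis (- (snd w \<bullet> x))) \<in> borel_measurable lborel" by (rule ms)
  show "(\<lambda>x. evolved (s k) z x * cnj (base_window (x - fst w)) * cis (- (snd w \<bullet> x))) \<in> borel_measurable lborel" for k by (rule ms)
  show "integrable lborel (\<lambda>x. cmod (base_window (x - fst w)))"
    by (intro integrable_norm lborel_integrable_translate(3) schwartz_integrable base_window_schwartz)
  show "AE x in lborel. (\<lambda>k. evolved (s k) z x * cnj (base_window (x - fst w)) * cis (- (snd w \<bullet> x))) \<longlonglongrightarrow> evolved t z x * cnj (base_window (x - fst w)) * cis (- (snd w \<bullet> x))"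
    by (intro AE_I2 tendsto_mult tendsto_const continuous_on_tendsto_compose[OF evolved_continuous_time assms]) auto
  show "AE x in lborel. norm (evolved (s k) z x * cnj (base_window (x - fst w)) * cis (- (snd w \<bullet> x))) \<le> cmod (base_window (x - fst w))" for k
    by (intro AE_I2) (auto simp: norm_mult intro!: mult_left_le_one_le evolved_le_1)
qed

text \<open>Dominated convergence twice. For a fixed coherent state the Gabor transforms of the
  differences tend to zero in L1, by the time-independent majorant; then the superposition of these
  norms tends to zero, dominated by a constant multiple of |c| because by covariance all coherent
  states have the same norm.\<close>

lemma m11_evolve_continuous:
  fixes f :: "'n::finite m11"
  shows "continuous_on UNIV (\<lambda>t. m11_evolve t f)"
proof (rule continuous_on_sequentiallyI)
  fix s :: "nat \<Rightarrow> real" and t assume s: "s \<longlonglongrightarrow> t"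
  let ?K = "2 * CARD('n)"
  define c where "c = coherent_coeff (rep_m11 f)"
  have c: "integrable lborel c" unfolding c_def by (rule coherent_coeff_integrable(1)[OF rep_m11])
  have cm[measurable]: "c \<in> borel_measurable borel" using c by auto
  define A :: "nat \<Rightarrow> (real^'n) \<times> (real^'n) \<Rightarrow> real^'n \<Rightarrow> complex"
    where "A k z x = evolved (s k) z x - evolved t z x" for k z x
  define D where "D k z = (\<integral>w. cmod (gabor base_window (A k z) w) \<partial>lborel)" for k z
  define N where "N = m11_set_norm (base_window :: real^'n \<Rightarrow> complex)"
  define G where "G = (\<integral>x. cmod (base_window (x::real^'n)) \<partial>lborel)"
  have G0: "G \<ge> 0" by (simp add: G_def)
  have em[measurable]: "evolved t z \<in> borel_measurable borel" for t z using evolved_L2[of t z] by (simp add: L2_space_def)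
  have Am[measurable]: "(\<lambda>(z, x). A k z x) \<in> borel_measurable (borel \<Otimes>\<^sub>M borel)" for k
    using evolved_measurable_pair[of "s k"] evolved_measurable_pair[of t] unfolding A_def case_prod_unfold by measurable
  have gm[measurable]: "(base_window :: real^'n \<Rightarrow> complex) \<in> borel_measurable borel" by measurable
  have ei: "integrable lborel (evolved t z)" "(\<integral>x. cmod (evolved t z x) \<partial>lborel) = G" for t and z :: "(real^'n) \<times> (real^'n)"
  proof -
    have i: "integrable lborel (\<lambda>x::real^'n. base_window (x - y))" for y
      by (rule lborel_integrable_translate(3)[OF schwartz_integrable[OF base_window_schwartz]])
    have n: "cmod (evolved t z x) = cmod (base_window (x - fst (phase_rotation (2 * t) z)))" for x
      by (simp add: evolved_packet packet_def norm_mult)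
    show "integrable lborel (evolved t z)"
      by (rule Bochner_Integration.integrable_bound[OF i[of "fst (phase_rotation (2 * t) z)"]]) (auto simp: n)
    show "(\<integral>x. cmod (evolved t z x) \<partial>lborel) = G"
      unfolding n G_def by (rule lborel_integral_translate(3)) measurable
  qed
  have eg: "integrable lborel (gabor base_window (evolved t z))" "(\<integral>w. cmod (gabor base_window (evolved t z) w) \<partial>lborel) = N" for t and z :: "(real^'n) \<times> (real^'n)"
    unfolding evolved_packet[abs_def] N_def m11_set_norm_def
    by (rule gabor_packet_integral[OF base_window_schwartz], simp, simp add: norm_mult)+
  have gA: "gabor base_window (A k z) w = gabor base_window (evolved (s k) z) w - gabor base_window (evolved t z) w" for k z w
    unfolding A_def by (intro gabor_diff evolved_L2 base_window_L2)
  \<comment> \<open>\<open>superposition\<close> asks for one constant that bounds the atoms both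
    pointwise, where 2 is enough, and in L1, where the bound is 2G.\<close>
  have A0: "cmod (A k z x) \<le> 2 + 2 * G" for k z x
    unfolding A_def using norm_triangle_ineq4[of "evolved (s k) z x" "evolved t z x"] evolved_le_1[of "s k" z x] evolved_le_1[of t z x] G0 by linarith
  have A1: "integrable lborel (A k z)" for k z unfolding A_def by (intro Bochner_Integration.integrable_diff ei)
  have A2: "(\<integral>x. cmod (A k z x) \<partial>lborel) \<le> 2 + 2 * G" for k z
  proof -
    have "(\<integral>x. cmod (A k z x) \<partial>lborel) \<le> (\<integral>x. cmod (evolved (s k) z x) + cmod (evolved t z x) \<partial>lborel)"
      using ei(1)[of "s k" z] ei(1)[of t z] by (intro integral_mono integrable_norm A1) (auto simp: A_def norm_triangle_ineq4)
    also have "\<dots> = 2 * G" using ei(1)[of "s k" z] ei(1)[of t z] ei(2)[of "s k" z] ei(2)[of t z] by simp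
    finally show ?thesis by simp
  qed
  have G1: "integrable lborel (gabor base_window (A k z))" for k z
    unfolding gA[abs_def] by (intro Bochner_Integration.integrable_diff eg)
  have G2: "(\<integral>w. cmod (gabor base_window (A k z) w) \<partial>lborel) \<le> 2 * N" for k z
  proof -
    have "(\<integral>w. cmod (gabor base_window (A k z) w) \<partial>lborel) \<le> (\<integral>w. cmod (gabor base_window (evolved (s k) z) w) + cmod (gabor base_window (evolved t z) w) \<partial>lborel)"
      using eg(1)[of "s k" z] eg(1)[of t z] by (intro integral_mono integrable_norm G1) (auto simp: gA norm_triangle_ineq4)
    also have "\<dots> = 2 * N" using eg(1)[of "s k" z] eg(1)[of t z] eg(2)[of "s k" z] eg(2)[of t z] by simp
    finally show ?thesis .
  qed
  have repA: "rep_m11 (m11_evolve (s k) f - m11_evolve t f) = (\<lambda>x. \<integral>z. c z * A k z x \<partial>lborel)" for k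
    unfolding rep_minus_m11 rep_m11_evolve A_def right_diff_distrib c_def
    by (intro ext Bochner_Integration.integral_diff[symmetric] coherent_coeff_evolved_integrable)
  note S = superposition[OF c Am A0 A1 A2 schwartz_integrable[OF base_window_schwartz] G1 G2]
  have le: "norm (m11_evolve (s k) f - m11_evolve t f) \<le> (\<integral>z. cmod (c z) * D k z \<partial>lborel)" for k
    unfolding norm_m11_def m11_set_norm_def repA D_def by (rule S(6))
  have Dm[measurable]: "D k \<in> borel_measurable borel" for k
  proof -
    have "(\<lambda>(z, w). gabor base_window (A k z) w) \<in> borel_measurable (borel \<Otimes>\<^sub>M borel)"
      by (rule gabor_measurable_param[OF gm Am])
    thus ?thesis unfolding D_def by measurable
  qed
  have Dlim: "(\<lambda>k. D k z) \<longlonglongrightarrow> 0" for z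
  proof -
    obtain C where C': "C \<ge> 0 \<and> (\<forall>t w. cmod (gabor base_window (evolved t z) w) \<le> C * (decay (fst w) ^ ?K * decay (snd w) ^ ?K))"
      using gabor_evolved_bound[of z] ..
    have C: "cmod (gabor base_window (evolved t z) w) \<le> C * (decay (fst w) ^ ?K * decay (snd w) ^ ?K)" for t w
      using conjunct2[OF C'] by (elim allE)
    have "(\<lambda>k. D k z) \<longlonglongrightarrow> (\<integral>w. 0 \<partial>(lborel :: ((real^'n) \<times> (real^'n)) measure))"
      unfolding D_def
    proof (rule integral_dominated_convergence[where w="\<lambda>w. 2 * (C * (decay (fst w) ^ ?K * decay (snd w) ^ ?K))"])
      show "integrable lborel (\<lambda>w::(real^'n) \<times> (real^'n). 2 * (C * (decay (fst w) ^ ?K * decay (snd w) ^ ?K)))"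
        by (intro integrable_mult_right integrable_decay_pair) auto
      show "(\<lambda>w. cmod (gabor base_window (A k z) w)) \<in> borel_measurable lborel" for k
        using G1[of k z] by auto
      show "AE w in lborel. (\<lambda>k. cmod (gabor base_window (A k z) w)) \<longlonglongrightarrow> 0"
      proof (intro AE_I2)
        fix w
        have "(\<lambda>k. gabor base_window (evolved (s k) z) w - gabor base_window (evolved t z) w) \<longlonglongrightarrow> gabor base_window (evolved t z) w - gabor base_window (evolved t z) w"
          by (intro tendsto_diff tendsto_const gabor_evolved_tendsto s)
        thus "(\<lambda>k. cmod (gabor base_window (A k z) w)) \<longlonglongrightarrow> 0" unfolding gA by (intro tendsto_norm_zero) simp
      qed
      show "AE w in lborel. norm (cmod (gabor base_window (A k z) w)) \<le> 2 * (C * (decay (fst w) ^ ?K * decay (snd w) ^ ?K))" for k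
      proof (intro AE_I2)
        fix w
        show "norm (cmod (gabor base_window (A k z) w)) \<le> 2 * (C * (decay (fst w) ^ ?K * decay (snd w) ^ ?K))"
          unfolding gA using norm_triangle_ineq4[of "gabor base_window (evolved (s k) z) w" "gabor base_window (evolved t z) w"] C[of "s k" w] C[of t w]
          unfolding real_norm_def abs_norm_cancel by linarith
      qed
    qed simp
    thus ?thesis by simp
  qed
  have "(\<lambda>k. \<integral>z. cmod (c z) * D k z \<partial>lborel) \<longlonglongrightarrow> (\<integral>z. cmod (c z) * 0 \<partial>lborel)"
  proof (rule integral_dominated_convergence[where w="\<lambda>z. cmod (c z) * (2 * N)"])
    show "integrable lborel (\<lambda>z. cmod (c z) * (2 * N))" using c by auto
    show "AE z in lborel. (\<lambda>k. cmod (c z) * D k z) \<longlonglongrightarrow> cmod (c z) * 0"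
      by (intro AE_I2 tendsto_mult tendsto_const Dlim)
    show "AE z in lborel. norm (cmod (c z) * D k z) \<le> cmod (c z) * (2 * N)" for k
      using G2 by (intro AE_I2) (auto simp: abs_mult D_def intro!: mult_left_mono)
  qed measurable
  hence lim: "(\<lambda>k. \<integral>z. cmod (c z) * D k z \<partial>lborel) \<longlonglongrightarrow> 0" by simp
  have "(\<lambda>k. norm (m11_evolve (s k) f - m11_evolve t f)) \<longlonglongrightarrow> 0"
    by (rule tendsto_sandwich[OF always_eventually always_eventually tendsto_const lim]) (use le in simp_all)
  thus "(\<lambda>k. m11_evolve (s k) f) \<longlonglongrightarrow> m11_evolve t f"
    by (simp add: tendsto_norm_zero_iff LIM_zero_iff)
qed

section \<open>Semilinear evolution equations\<close>

text \<open>A strongly continuous, uniformly bounded group with a locally Lipschitz nonlinearity.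
  The factor -i of the equation is meant to be part of N, so that Duhamel's formula has a plus
  sign.\<close>

locale semilinear_evolution =
  fixes U :: "real \<Rightarrow> 'a::banach \<Rightarrow> 'a" and C :: real and N :: "'a \<Rightarrow> 'a"
  assumes U_linear: "bounded_linear (U t)"
    and U_bound: "norm (U t x) \<le> C * norm x"
    and U_continuous: "continuous_on UNIV (\<lambda>t. U t x)"
    and U_group: "U s (U t x) = U (s + t) x"
    and U_0: "U 0 x = x"
    and C_ge_1: "C \<ge> 1"
    and N_0: "N 0 = 0"
    and N_lipschitz: "\<exists>L\<ge>0. \<forall>x y. norm x \<le> R \<longrightarrow> norm y \<le> R \<longrightarrow> norm (N x - N y) \<le> L * norm (x - y)"
begin

lemma U_diff: "U t x - U t y = U t (x - y)"
  by (rule linear_diff[OF bounded_linear.linear[OF U_linear], symmetric])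

text \<open>Strong continuity and the bound uniform in time give joint continuity, by splitting off
  the change of the vector from the change of the time.\<close>

lemma U_continuous_on:
  assumes f: "continuous_on S f" and w: "continuous_on S w"
  shows "continuous_on S (\<lambda>s. U (f s) (w s))"
  unfolding continuous_on_def
proof
  fix x assume x: "x \<in> S"
  have "((\<lambda>s. U (f s) (w x)) \<longlongrightarrow> U (f x) (w x)) (at x within S)"
    using continuous_on_compose2[OF U_continuous f subset_UNIV, of "w x"] x by (simp add: continuous_on_def)
  hence 1: "((\<lambda>s. U (f s) (w x) - U (f x) (w x)) \<longlongrightarrow> 0) (at x within S)" by (simp add: LIM_zero)
  have "((\<lambda>s. w s - w x) \<longlongrightarrow> 0) (at x within S)" using w x by (simp add: continuous_on_def LIM_zero)
  hence 2: "((\<lambda>s. C * norm (w s - w x)) \<longlongrightarrow> 0) (at x within S)" by (intro tendsto_mult_right_zero tendsto_norm_zero)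
  have "((\<lambda>s. U (f s) (w s) - U (f x) (w x)) \<longlongrightarrow> 0) (at x within S)"
  proof (rule Lim_null_comparison)
    show "\<forall>\<^sub>F s in at x within S. norm (U (f s) (w s) - U (f x) (w x)) \<le> C * norm (w s - w x) + norm (U (f s) (w x) - U (f x) (w x))"
    proof (intro always_eventually allI)
      fix s
      have e: "U (f s) (w s) - U (f x) (w x) = U (f s) (w s - w x) + (U (f s) (w x) - U (f x) (w x))"
        unfolding U_diff[symmetric] by simp
      thus "norm (U (f s) (w s) - U (f x) (w x)) \<le> C * norm (w s - w x) + norm (U (f s) (w x) - U (f x) (w x))"
        unfolding e using norm_triangle_ineq[of "U (f s) (w s - w x)" "U (f s) (w x) - U (f x) (w x)"] U_bound[of "f s" "w s - w x"]
        by linarith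
    qed
    show "((\<lambda>s. C * norm (w s - w x) + norm (U (f s) (w x) - U (f x) (w x))) \<longlongrightarrow> 0) (at x within S)"
      using tendsto_add[OF 2 tendsto_norm_zero[OF 1]] by simp
  qed
  thus "((\<lambda>s. U (f s) (w s)) \<longlongrightarrow> U (f x) (w x)) (at x within S)" by (simp add: LIM_zero_iff)
qed

lemma N_continuous: "continuous_on UNIV N"
  unfolding continuous_on_def
proof
  fix x :: 'a
  obtain L where L: "L \<ge> 0" "\<And>y z. norm y \<le> norm x + 1 \<Longrightarrow> norm z \<le> norm x + 1 \<Longrightarrow> norm (N y - N z) \<le> L * norm (y - z)"
    using N_lipschitz[of "norm x + 1"] by auto
  have "((\<lambda>y. y - x) \<longlongrightarrow> 0) (at x)" by (intro LIM_zero tendsto_ident_at)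
  hence 1: "((\<lambda>y. L * norm (y - x)) \<longlongrightarrow> 0) (at x)" by (intro tendsto_mult_right_zero tendsto_norm_zero)
  have "((\<lambda>y. N y - N x) \<longlongrightarrow> 0) (at x)"
  proof (rule Lim_null_comparison[OF _ 1])
    have "\<forall>\<^sub>F y in at x. dist y x < 1" by (rule eventually_at_ball'[of 1 x UNIV, simplified, THEN eventually_mono]) (auto simp: dist_commute)
    thus "\<forall>\<^sub>F y in at x. norm (N y - N x) \<le> L * norm (y - x)"
    proof eventually_elim
      case (elim y)
      have "norm y \<le> norm x + 1" using elim norm_triangle_ineq2[of y x] by (simp add: dist_norm)
      thus ?case by (intro L(2)) auto
    qed
  qed
  thus "(N \<longlongrightarrow> N x) (at x within UNIV)" by (simp add: LIM_zero_iff)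
qed

lemmas N_continuous_on = continuous_on_compose2[OF N_continuous _ subset_UNIV]

section \<open>Duhamel's formula and mild solutions\<close>

definition duhamel :: "'a \<Rightarrow> (real \<Rightarrow> 'a) \<Rightarrow> real \<Rightarrow> 'a" where
  "duhamel u0 u t = U t u0 + integral {0..t} (\<lambda>\<tau>. U (t - \<tau>) (N (u \<tau>)))"

definition mild_solution :: "'a \<Rightarrow> real set \<Rightarrow> (real \<Rightarrow> 'a) \<Rightarrow> bool" where
  "mild_solution u0 I u \<longleftrightarrow> continuous_on I u \<and> (\<forall>t\<in>I. u t = duhamel u0 u t)"

lemma duhamel_integrand_continuous:
  assumes "continuous_on {a..b} u"
  shows "continuous_on {a..b} (\<lambda>\<tau>. U (t - \<tau>) (N (u \<tau>)))"
  by (intro U_continuous_on N_continuous_on assms continuous_on_diff continuous_on_const continuous_on_id)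

text \<open>The group law takes t out of the integrand. What remains is an indefinite integral of a
  fixed continuous function, from which continuity in t follows.\<close>

lemma duhamel_factor:
  assumes "continuous_on {0..t} u"
  shows "duhamel u0 u t = U t (u0 + integral {0..t} (\<lambda>\<tau>. U (- \<tau>) (N (u \<tau>))))"
proof -
  have c: "continuous_on {0..t} (\<lambda>\<tau>. U (- \<tau>) (N (u \<tau>)))"
    using duhamel_integrand_continuous[OF assms, of 0] by simp
  have "integral {0..t} (\<lambda>\<tau>. U (t - \<tau>) (N (u \<tau>))) = integral {0..t} (U t \<circ> (\<lambda>\<tau>. U (- \<tau>) (N (u \<tau>))))"
    by (simp add: o_def U_group)
  also have "\<dots> = U t (integral {0..t} (\<lambda>\<tau>. U (- \<tau>) (N (u \<tau>))))"
    by (rule integral_linear[OF integrable_continuous_real[OF c] U_linear])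
  finally show ?thesis by (simp add: duhamel_def linear_add[OF bounded_linear.linear[OF U_linear]])
qed

lemma duhamel_continuous:
  assumes u: "continuous_on {0..T} u"
  shows "continuous_on {0..T} (duhamel u0 u)"
proof -
  have c: "continuous_on {0..T} (\<lambda>\<tau>. U (- \<tau>) (N (u \<tau>)))"
    using duhamel_integrand_continuous[OF u, of 0] by simp
  have "continuous_on {0..T} (\<lambda>t. U t (u0 + integral {0..t} (\<lambda>\<tau>. U (- \<tau>) (N (u \<tau>)))))"
    by (intro U_continuous_on continuous_on_add continuous_on_const continuous_on_id
        indefinite_integral_continuous_1 integrable_continuous_real c)
  thus ?thesis
    by (rule continuous_on_eq) (use u in \<open>auto intro!: duhamel_factor[symmetric] intro: continuous_on_subset\<close>)
qed

text \<open>The majorant b is left free because it is constant in the contraction argument and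
  exponential in the uniqueness argument.\<close>

lemma duhamel_diff_le:
  assumes u: "continuous_on {0..t} u" and v: "continuous_on {0..t} v"
    and L: "L \<ge> 0" "\<And>x y. norm x \<le> R \<Longrightarrow> norm y \<le> R \<Longrightarrow> norm (N x - N y) \<le> L * norm (x - y)"
    and R: "\<And>s. s \<in> {0..t} \<Longrightarrow> norm (u s) \<le> R" "\<And>s. s \<in> {0..t} \<Longrightarrow> norm (v s) \<le> R"
    and b: "b integrable_on {0..t}" "\<And>s. s \<in> {0..t} \<Longrightarrow> norm (u s - v s) \<le> b s"
  shows "norm (duhamel u0 u t - duhamel u0 v t) \<le> C * L * integral {0..t} b"
proof -
  let ?g = "\<lambda>w \<tau>. U (t - \<tau>) (N (w \<tau>))"
  have i: "?g u integrable_on {0..t}" "?g v integrable_on {0..t}"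
    by (intro integrable_continuous_real duhamel_integrand_continuous u v)+
  have "duhamel u0 u t - duhamel u0 v t = integral {0..t} (\<lambda>\<tau>. ?g u \<tau> - ?g v \<tau>)"
    by (simp add: duhamel_def Henstock_Kurzweil_Integration.integral_diff[OF i])
  also have "norm \<dots> \<le> integral {0..t} (\<lambda>\<tau>. (C * L) * b \<tau>)"
  proof (rule integral_norm_bound_integral)
    show "(\<lambda>\<tau>. ?g u \<tau> - ?g v \<tau>) integrable_on {0..t}" by (intro integrable_diff i)
    show "(\<lambda>\<tau>. (C * L) * b \<tau>) integrable_on {0..t}" using b(1) by (rule integrable_on_mult_right)
    fix s assume s: "s \<in> {0..t}"
    have "norm (?g u s - ?g v s) \<le> C * norm (N (u s) - N (v s))" unfolding U_diff by (rule U_bound)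
    also have "\<dots> \<le> C * (L * norm (u s - v s))" using C_ge_1 by (intro mult_left_mono L R s) auto
    also have "\<dots> \<le> C * (L * b s)" using C_ge_1 L(1) by (intro mult_left_mono b s) auto
    finally show "norm (?g u s - ?g v s) \<le> (C * L) * b s" by (simp only: mult.assoc)
  qed
  finally show ?thesis by simp
qed

text \<open>The supremum of \<open>exp (- \<lambda> s) * norm (u s - v s)\<close> is at most half of itself when \<open>\<lambda>\<close> is large.\<close>

lemma mild_solution_unique:
  assumes u: "mild_solution u0 {0..<T} u" and v: "mild_solution u0 {0..<T} v" and t: "t \<in> {0..<T}"
  shows "u t = v t"
proof -
  have sub: "{0..t} \<subseteq> {0..<T}" using t by auto
  have cu: "continuous_on {0..t} u" and cv: "continuous_on {0..t} v"
    using u v sub by (auto simp: mild_solution_def intro: continuous_on_subset)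
  have "bounded (u ` {0..t} \<union> v ` {0..t})"
    by (intro bounded_Un[THEN iffD2] conjI compact_imp_bounded compact_continuous_image cu cv compact_Icc)
  then obtain R where R: "\<And>x. x \<in> u ` {0..t} \<union> v ` {0..t} \<Longrightarrow> norm x \<le> R"
    unfolding bounded_iff by auto
  obtain L where L: "L \<ge> 0" "\<And>x y. norm x \<le> R \<Longrightarrow> norm y \<le> R \<Longrightarrow> norm (N x - N y) \<le> L * norm (x - y)"
    using N_lipschitz[of R] by auto
  \<comment> \<open>Large enough for C L / l to be at most 1/2; the summand 1 keeps l positive when
    L = 0.\<close>
  define l where "l = 2 * C * L + 1"
  have l: "l > 0" "2 * C * L \<le> l" using C_ge_1 L(1) by (auto simp: l_def intro!: add_nonneg_pos mult_nonneg_nonneg)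
  define d where "d s = exp (- (l * s)) * norm (u s - v s)" for s
  have "continuous_on {0..t} d" unfolding d_def by (intro continuous_intros cu cv)
  then obtain s where s: "s \<in> {0..t}" and max: "\<And>r. r \<in> {0..t} \<Longrightarrow> d r \<le> d s"
    using continuous_attains_sup[of "{0..t}" d] t by auto
  have d0: "d s \<ge> 0" by (simp add: d_def)
  have dle: "norm (u r - v r) \<le> d s * exp (l * r)" if "r \<in> {0..s}" for r
  proof -
    have "norm (u r - v r) = d r * exp (l * r)" by (simp add: d_def exp_minus)
    also have "\<dots> \<le> d s * exp (l * r)" using that s by (intro mult_right_mono max) auto
    finally show ?thesis .
  qed
  have "((\<lambda>r. d s * exp (l * r)) has_integral d s * exp (l * s) / l - d s * exp (l * 0) / l) {0..s}"
  proof (rule fundamental_theorem_of_calculus)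
    show "0 \<le> s" using s by simp
    fix r
    show "((\<lambda>r. d s * exp (l * r) / l) has_vector_derivative d s * exp (l * r)) (at r within {0..s})"
      unfolding has_real_derivative_iff_has_vector_derivative[symmetric]
      using l(1) by (auto intro!: derivative_eq_intros)
  qed
  hence hi: "(\<lambda>r. d s * exp (l * r)) integrable_on {0..s}" "integral {0..s} (\<lambda>r. d s * exp (l * r)) = d s * exp (l * s) / l - d s / l"
    by (auto simp: has_integral_iff)
  have ss: "{0..s} \<subseteq> {0..t}" "s \<in> {0..<T}" using s t by auto
  have "norm (u s - v s) = norm (duhamel u0 u s - duhamel u0 v s)"
    using u v ss(2) by (simp add: mild_solution_def)
  also have "\<dots> \<le> C * L * integral {0..s} (\<lambda>r. d s * exp (l * r))"
    by (rule duhamel_diff_le[OF continuous_on_subset[OF cu ss(1)] continuous_on_subset[OF cv ss(1)] L _ _ hi(1) dle])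
      (use R ss in auto)
  also have "\<dots> \<le> C * L * (d s * exp (l * s) / l)"
    using C_ge_1 L(1) d0 l(1) unfolding hi(2) by (intro mult_left_mono) auto
  also have "\<dots> = (C * L / l) * (d s * exp (l * s))" by simp
  also have "\<dots> \<le> (1 / 2) * (d s * exp (l * s))"
    using l d0 by (intro mult_right_mono) (auto simp: field_simps)
  finally have "exp (- (l * s)) * norm (u s - v s) \<le> exp (- (l * s)) * ((1 / 2) * (d s * exp (l * s)))"
    by (intro mult_left_mono) auto
  hence "d s \<le> d s / 2" unfolding d_def[of s, symmetric] by (simp add: mult.left_commute[of "exp (- (l * s))"] exp_add[symmetric])
  hence "d t \<le> 0" using max[of t] t by auto
  thus ?thesis by (auto simp: d_def mult_le_0_iff)
qed

text \<open>The radius R, the Lipschitz constant L and the time T are fixed by the bound r alone,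
  which makes the existence time uniform over all data of norm at most r.\<close>

lemma mild_solution_exists:
  "\<exists>T>0. \<forall>u0. norm u0 \<le> r \<longrightarrow> (\<exists>u. mild_solution u0 {0..T} u)"
proof -
  \<comment> \<open>Bounds the free evolution of the datum; the absolute value keeps it nonnegative
    for every r. In the ball of radius R = 2a + 1 the free part takes less than R/2 and leaves R/2
    for the integral.\<close>
  define a where "a = C * \<bar>r\<bar>"
  define R where "R = 2 * a + 1"
  obtain L where L: "L \<ge> 0" "\<And>x y. norm x \<le> R \<Longrightarrow> norm y \<le> R \<Longrightarrow> norm (N x - N y) \<le> L * norm (x - y)"
    using N_lipschitz[of R] by auto
  \<comment> \<open>Chosen so that C L T is at most 1/2, the contraction factor; the summand 1
    covers L = 0.\<close>
  define T where "T = 1 / (2 * (C * L + 1))"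
  have CL: "C * L \<ge> 0" using C_ge_1 L(1) by simp
  have T: "T > 0" "C * L * T \<le> 1 / 2" using CL by (auto simp: T_def field_simps)
  have R0: "R \<ge> 0" using C_ge_1 by (simp add: R_def a_def)
  have "\<exists>u. mild_solution u0 {0..T} u" if u0: "norm u0 \<le> r" for u0
  proof -
    \<comment> \<open>Clamping the time to [0, T] lets the iteration run on bounded continuous
      functions on the whole line, a complete space for the supremum norm.\<close>
    define c where "c t = max 0 (min T t)" for t
    have c: "c t \<in> {0..T}" "t \<in> {0..T} \<Longrightarrow> c t = t" for t using T(1) by (auto simp: c_def)
    have cc: "continuous_on UNIV c" unfolding c_def by (intro continuous_intros)
    define \<Phi> where "\<Phi> u = Bcontfun (\<lambda>t. duhamel u0 (apply_bcontfun u) (c t))" for u :: "real \<Rightarrow>\<^sub>C 'a"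
    have cu: "continuous_on S (apply_bcontfun u)" for u :: "real \<Rightarrow>\<^sub>C 'a" and S
      using continuous_on_subset[OF continuous_on_apply_bcontfun[of UNIV u]] by auto
    have diff: "norm (duhamel u0 (apply_bcontfun u) (c t) - duhamel u0 w (c t)) \<le> B / 2"
      if "\<And>t. norm (apply_bcontfun u t) \<le> R" "continuous_on UNIV w" "\<And>t. norm (w t) \<le> R" "\<And>t. norm (apply_bcontfun u t - w t) \<le> B"
      for u t w B
    proof -
      have B: "B \<ge> 0" using that(4)[of 0] norm_ge_zero order_trans by blast
      have "norm (duhamel u0 (apply_bcontfun u) (c t) - duhamel u0 w (c t)) \<le> C * L * integral {0..c t} (\<lambda>_. B)"
        by (rule duhamel_diff_le[OF cu continuous_on_subset[OF that(2) subset_UNIV] L]) (use that in auto)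
      also have "\<dots> = (C * L * c t) * B" using c(1)[of t] by simp
      also have "\<dots> \<le> (C * L * T) * B" using B CL c(1)[of t] by (intro mult_right_mono mult_left_mono) auto
      also have "\<dots> \<le> (1 / 2) * B" using B T(2) by (intro mult_right_mono)
      finally show ?thesis by simp
    qed
    \<comment> \<open>Comparison with the zero function, whose Duhamel expression is the free
      evolution since N vanishes at 0.\<close>
    have bd: "norm (duhamel u0 (apply_bcontfun u) (c t)) \<le> R" if "\<And>t. norm (apply_bcontfun u t) \<le> R" for u t
    proof -
      have z: "duhamel u0 (\<lambda>_. 0) (c t) = U (c t) u0"
        by (simp add: duhamel_def N_0 linear_0[OF bounded_linear.linear[OF U_linear]])
      have "norm (duhamel u0 (apply_bcontfun u) (c t) - duhamel u0 (\<lambda>_. 0) (c t)) \<le> R / 2"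
        by (rule diff) (use that R0 in auto)
      moreover have "norm (U (c t) u0) \<le> a"
        unfolding a_def using C_ge_1 u0 by (intro order_trans[OF U_bound] mult_left_mono) auto
      ultimately show ?thesis
        using norm_triangle_ineq2[of "duhamel u0 (apply_bcontfun u) (c t)" "U (c t) u0"] unfolding z R_def by (simp add: field_simps)
    qed
    have cd: "continuous_on UNIV (\<lambda>t. duhamel u0 (apply_bcontfun u) (c t))" for u :: "real \<Rightarrow>\<^sub>C 'a"
      by (rule continuous_on_compose2[OF duhamel_continuous[OF cu, of T] cc]) (use c(1) in \<open>simp add: image_subset_iff\<close>)
    define X where "X = cball (0 :: real \<Rightarrow>\<^sub>C 'a) R"
    have X: "norm (apply_bcontfun u t) \<le> R" if "u \<in> X" for u t
      using that norm_bounded[of u t] by (simp add: X_def)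
    have \<Phi>: "apply_bcontfun (\<Phi> u) t = duhamel u0 (apply_bcontfun u) (c t)" if "u \<in> X" for u t
      unfolding \<Phi>_def
      by (subst Bcontfun_inverse) (use bd[OF X[OF that]] in \<open>auto simp: bcontfun_def cd bounded_iff\<close>)
    have "\<exists>!u. u \<in> X \<and> \<Phi> u = u"
    proof (rule Banach_fix)
      show "Topological_Spaces.complete X" unfolding X_def by (simp add: complete_eq_closed)
      show "X \<noteq> {}" using R0 by (auto simp: X_def)
      show "0 \<le> (1 / 2 :: real)" "(1 / 2 :: real) < 1" by auto
      show "\<Phi> ` X \<subseteq> X"
      proof
        fix w assume "w \<in> \<Phi> ` X"
        then obtain u where u: "u \<in> X" "w = \<Phi> u" by auto
        have "norm (\<Phi> u) \<le> R" by (rule norm_bound) (use bd[OF X[OF u(1)]] in \<open>simp add: \<Phi>[OF u(1)]\<close>)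
        thus "w \<in> X" by (simp add: X_def u(2))
      qed
      fix u v assume u: "u \<in> X" and v: "v \<in> X"
      show "dist (\<Phi> u) (\<Phi> v) \<le> 1 / 2 * dist u v"
      proof (rule dist_bound)
        fix t
        have "norm (duhamel u0 (apply_bcontfun u) (c t) - duhamel u0 (apply_bcontfun v) (c t)) \<le> dist u v / 2"
          by (rule diff) (use X[OF u] X[OF v] cu dist_bounded[of u _ v] in \<open>auto simp: dist_norm\<close>)
        thus "dist (apply_bcontfun (\<Phi> u) t) (apply_bcontfun (\<Phi> v) t) \<le> 1 / 2 * dist u v"
          by (simp add: \<Phi> u v dist_norm)
      qed
    qed
    then obtain u where u: "u \<in> X" "\<Phi> u = u" by blast
    have "mild_solution u0 {0..T} (apply_bcontfun u)"
      unfolding mild_solution_def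
    proof (intro conjI ballI cu)
      fix t assume "t \<in> {0..T}"
      thus "apply_bcontfun u t = duhamel u0 (apply_bcontfun u) t" using \<Phi>[OF u(1), of t] by (simp add: u(2) c(2))
    qed
    thus ?thesis by (rule exI[of _ "apply_bcontfun u"])
  qed
  thus ?thesis using T(1) by blast
qed

end

section \<open>Duhamel's formula in \<open>M\<^sup>1\<^sup>,\<^sup>1\<close>\<close>

text \<open>Uniform continuity gives one mesh size that serves all tagged divisions, and the errors
  on the pieces add up to at most \<eta> times the length of the interval.\<close>

lemma riemann_sums_tend_to_integral:
  fixes G :: "real \<Rightarrow> 'a::banach"
  assumes G: "continuous_on {a..b} G" and ab: "a \<le> b" and \<epsilon>: "\<epsilon> > 0"
  shows "\<exists>\<delta>>0. \<forall>p. p tagged_division_of {a..b} \<and> (\<lambda>\<tau>. ball \<tau> \<delta>) fine p \<longrightarrow>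
    norm ((\<Sum>(\<tau>, K)\<in>p. measure lborel K *\<^sub>R G \<tau>) - integral {a..b} G) < \<epsilon>"
proof -
  \<comment> \<open>The summand 1 makes the final inequality strict and admits a = b.\<close>
  define \<eta> where "\<eta> = \<epsilon> / (b - a + 1)"
  have \<eta>: "\<eta> > 0" "\<eta> * (b - a) < \<epsilon>" using ab \<epsilon> by (auto simp: \<eta>_def field_simps)
  have "uniformly_continuous_on {a..b} G" by (rule compact_uniformly_continuous[OF G compact_Icc])
  then obtain \<delta> where \<delta>: "\<delta> > 0" "\<And>x y. x \<in> {a..b} \<Longrightarrow> y \<in> {a..b} \<Longrightarrow> dist y x < \<delta> \<Longrightarrow> dist (G y) (G x) < \<eta>"
    unfolding uniformly_continuous_on_def using \<eta>(1) by meson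
  have "norm ((\<Sum>(\<tau>, K)\<in>p. measure lborel K *\<^sub>R G \<tau>) - integral {a..b} G) < \<epsilon>"
    if p: "p tagged_division_of {a..b}" "(\<lambda>\<tau>. ball \<tau> \<delta>) fine p" for p
  proof -
    have pc: "p tagged_division_of cbox a b" using p(1) by simp
    have fin: "finite p" using p(1) by auto
    have "integral {a..b} G = (\<Sum>(\<tau>, K)\<in>p. integral K G)"
      using integral_combine_tagged_division_topdown[OF integrable_continuous[of a b G] pc] G by simp
    hence "(\<Sum>(\<tau>, K)\<in>p. measure lborel K *\<^sub>R G \<tau>) - integral {a..b} G = (\<Sum>(\<tau>, K)\<in>p. measure lborel K *\<^sub>R G \<tau> - integral K G)"
      by (simp add: sum_subtractf case_prod_unfold)
    also have "norm \<dots> \<le> (\<Sum>(\<tau>, K)\<in>p. \<eta> * measure lborel K)"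
    proof (rule sum_norm_le)
      fix q assume q: "q \<in> p"
      obtain \<tau> K where qe: "q = (\<tau>, K)" by (cases q)
      have qp: "(\<tau>, K) \<in> p" using q qe by simp
      have \<tau>: "\<tau> \<in> K" and sub: "K \<subseteq> {a..b}" by (rule tagged_division_ofD(2,3)[OF p(1) qp])+
      obtain c d where K: "K = cbox c d" using tagged_division_ofD(4)[OF p(1) qp] by (elim exE)
      have near: "K \<subseteq> ball \<tau> \<delta>" using p(2) q qe by (auto simp: fine_def)
      have Gi: "G integrable_on K" unfolding K by (rule integrable_continuous) (use continuous_on_subset[OF G sub] K in simp)
      have c: "((\<lambda>x. G \<tau>) has_integral (measure lborel K *\<^sub>R G \<tau>)) (cbox c d)" unfolding K by (rule has_integral_const)
      have "((\<lambda>x. G \<tau> - G x) has_integral (measure lborel K *\<^sub>R G \<tau> - integral K G)) (cbox c d)"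
        using has_integral_diff[OF c integrable_integral[OF Gi[unfolded K]]] by (simp add: K)
      hence "norm (measure lborel K *\<^sub>R G \<tau> - integral K G) \<le> \<eta> * measure lborel (cbox c d)"
      proof (rule has_integral_bound[rotated])
        show "0 \<le> \<eta>" using \<eta> by simp
        fix x assume x: "x \<in> cbox c d"
        have "dist \<tau> x < \<delta>" using near x K by auto
        hence "dist (G \<tau>) (G x) < \<eta>" by (intro \<delta>(2)) (use x \<tau> sub K in auto)
        thus "norm (G \<tau> - G x) \<le> \<eta>" by (simp add: dist_norm)
      qed
      thus "norm (case q of (\<tau>, K) \<Rightarrow> measure lborel K *\<^sub>R G \<tau> - integral K G) \<le> (case q of (\<tau>, K) \<Rightarrow> \<eta> * measure lborel K)"
        by (simp add: qe K)
    qed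
    also have "\<dots> = \<eta> * (\<Sum>(\<tau>, K)\<in>p. measure lborel K)" by (simp add: sum_distrib_left case_prod_unfold)
    also have "\<dots> = \<eta> * (b - a)" using additive_content_tagged_division[OF pc] ab by simp
    finally show ?thesis using \<eta>(2) by linarith
  qed
  thus ?thesis using \<delta>(1) by blast
qed

lemma represents_AE_imp_eq:
  assumes h: "represents h f" and k: "represents k f'" and eq: "AE x in lborel. h x = k x"
  shows "f = f'"
proof -
  have "AE x in lborel. h x = rep_m11 f' x" using k eq by (auto simp: represents_def)
  hence "represents h f'" using h by (simp add: represents_def)
  thus ?thesis by (rule represents_unique[OF h])
qed

lemma M11_fun_imp_represented:
  assumes "g \<in> schwartz_space" "g \<noteq> (\<lambda>_. 0)" "h \<in> M11_fun g"
  shows "\<exists>f. represents h f"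
  using M11_fun_represented[OF assms(1,2)] assms(3) by blast

lemma represents_imp_M11_fun:
  assumes "g \<in> schwartz_space" "represents h f"
  shows "h \<in> M11_fun g"
  using represents_M11_fun[OF assms(1)] assms(2) by blast

lemma M11_fun_norm_nonneg: "0 \<le> M11_fun_norm g h"
  unfolding M11_fun_norm_gabor by simp

text \<open>A representative determines the element that it represents, so the bound known for some
  represented element applies to f itself; the larger of the two constants serves both
  directions.\<close>

lemma M11_fun_norm_equivalent:
  fixes g :: "real^'n::finite \<Rightarrow> complex"
  assumes g: "g \<in> schwartz_space" and nz: "g \<noteq> (\<lambda>_. 0)"
  shows "\<exists>K>0. \<forall>h f. represents h f \<longrightarrow> M11_fun_norm g h \<le> K * norm f \<and> norm f \<le> K * M11_fun_norm g h"
proof -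
  obtain K1 where K1: "K1 > 0" "\<forall>h\<in>M11_fun g. \<exists>f. represents h f \<and> norm f \<le> K1 * M11_fun_norm g h"
    using M11_fun_represented[OF g nz] by auto
  obtain K2 where K2: "K2 > 0" "\<forall>h f. represents h f \<longrightarrow> h \<in> M11_fun g \<and> M11_fun_norm g h \<le> K2 * norm f"
    using represents_M11_fun[OF g] by auto
  have main: "M11_fun_norm g h \<le> max K1 K2 * norm f \<and> norm f \<le> max K1 K2 * M11_fun_norm g h"
    if r: "represents h f" for h f
  proof
    have "M11_fun_norm g h \<le> K2 * norm f" using K2(2) r by blast
    also have "\<dots> \<le> max K1 K2 * norm f" by (intro mult_right_mono) auto
    finally show "M11_fun_norm g h \<le> max K1 K2 * norm f" .
    obtain f' where f': "represents h f'" "norm f' \<le> K1 * M11_fun_norm g h"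
      using bspec[OF K1(2) represents_imp_M11_fun[OF g r]] by auto
    have "norm f \<le> K1 * M11_fun_norm g h" using f' represents_unique[OF r f'(1)] by simp
    also have "\<dots> \<le> max K1 K2 * M11_fun_norm g h" by (intro mult_right_mono M11_fun_norm_nonneg) auto
    finally show "norm f \<le> max K1 K2 * M11_fun_norm g h" .
  qed
  have "max K1 K2 > 0" using K1(1) by simp
  with main show ?thesis by blast
qed

text \<open>Differences of representatives represent differences, so each of the two distances is
  bounded by a multiple of the other.\<close>

lemma M11_continuous_on_iff:
  fixes g :: "real^'n::finite \<Rightarrow> complex"
  assumes g: "g \<in> schwartz_space" and nz: "g \<noteq> (\<lambda>_. 0)"
    and r: "\<And>t. t \<in> I \<Longrightarrow> represents (u t) (v t)"
  shows "M11_continuous_on g I u \<longleftrightarrow> continuous_on I v"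
proof -
  obtain K where K: "K > 0" "\<And>h f. represents h f \<Longrightarrow> M11_fun_norm g h \<le> K * norm f"
    "\<And>h f. represents h f \<Longrightarrow> norm f \<le> K * M11_fun_norm g h"
    using M11_fun_norm_equivalent[OF g nz] by auto
  have "((\<lambda>s. M11_fun_norm g (\<lambda>x. u s x - u t x)) \<longlongrightarrow> 0) (at t within I) \<longleftrightarrow> (v \<longlongrightarrow> v t) (at t within I)"
    (is "(?M \<longlongrightarrow> 0) ?F \<longleftrightarrow> _") if t: "t \<in> I" for t
  proof -
    have in_I: "\<forall>\<^sub>F s in ?F. s \<in> I" by (auto simp: eventually_at_filter)
    have 1: "\<forall>\<^sub>F s in ?F. norm (?M s) \<le> K * norm (v s - v t)"
      using in_I by eventually_elim (simp add: M11_fun_norm_nonneg K(2) represents_diff r t)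
    have 2: "\<forall>\<^sub>F s in ?F. norm (v s - v t) \<le> K * ?M s"
      using in_I by eventually_elim (intro K(3) represents_diff r t)
    show ?thesis
    proof
      assume "(?M \<longlongrightarrow> 0) ?F"
      hence "((\<lambda>s. K * ?M s) \<longlongrightarrow> 0) ?F" by (rule tendsto_mult_right_zero)
      hence "((\<lambda>s. v s - v t) \<longlongrightarrow> 0) ?F" by (rule Lim_null_comparison[OF 2])
      thus "(v \<longlongrightarrow> v t) ?F" by (simp add: LIM_zero_iff)
    next
      assume "(v \<longlongrightarrow> v t) ?F"
      hence "((\<lambda>s. K * norm (v s - v t)) \<longlongrightarrow> 0) ?F" by (intro tendsto_mult_right_zero tendsto_norm_zero LIM_zero)
      thus "(?M \<longlongrightarrow> 0) ?F" by (rule Lim_null_comparison[OF 1])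
    qed
  qed
  thus ?thesis unfolding M11_continuous_on_def continuous_on_def using represents_imp_M11_fun[OF g r] by auto
qed

text \<open>If w is an integral, the element it represents is compared with the Banach space
  integral through the Riemann sum of one division fine enough for both limits; such a division
  exists by Cousin's lemma. Conversely, convergence of Riemann sums is transported by the
  equivalence of norms.\<close>

lemma has_M11_integral_iff:
  fixes g :: "real^'n::finite \<Rightarrow> complex"
  assumes g: "g \<in> schwartz_space" and nz: "g \<noteq> (\<lambda>_. 0)" and ab: "a \<le> b"
    and r: "\<And>\<tau>. \<tau> \<in> {a..b} \<Longrightarrow> represents (H \<tau>) (G \<tau>)" and G: "continuous_on {a..b} G"
  shows "has_M11_integral g H a b w \<longleftrightarrow> represents w (integral {a..b} G)"
proof -
  obtain K where K: "K > 0" "\<And>h f. represents h f \<Longrightarrow> M11_fun_norm g h \<le> K * norm f"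
    "\<And>h f. represents h f \<Longrightarrow> norm f \<le> K * M11_fun_norm g h"
    using M11_fun_norm_equivalent[OF g nz] by auto
  let ?S = "\<lambda>p. \<Sum>(\<tau>, K)\<in>p. measure lborel K *\<^sub>R G \<tau>"
  let ?D = "\<lambda>p x. (\<Sum>(\<tau>, K)\<in>p. measure lborel K *\<^sub>R H \<tau> x) - w x"
  have S: "represents (?D p) (?S p - f)" if p: "p tagged_division_of {a..b}" and "represents w f" for p f
  proof (rule represents_diff[OF _ that(2)])
    have "fst q \<in> {a..b}" if "q \<in> p" for q
      using tagged_division_ofD(2,3)[OF p, of "fst q" "snd q"] that by auto
    thus "represents (\<lambda>x. \<Sum>(\<tau>, K)\<in>p. measure lborel K *\<^sub>R H \<tau> x) (?S p)"
      unfolding case_prod_unfold by (intro represents_sum represents_scaleR r)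
  qed
  show ?thesis
  proof
    assume I: "has_M11_integral g H a b w"
    hence "w \<in> M11_fun g" by (simp add: has_M11_integral_def)
    then obtain f where f: "represents w f" using M11_fun_imp_represented[OF g nz] by blast
    have "norm (f - integral {a..b} G) \<le> e" if e: "e > 0" for e
    proof -
      \<comment> \<open>The two errors are K \<epsilon> for the transported norm and \<epsilon> for
        the Banach space norm, e in total.\<close>
      define \<epsilon> where "\<epsilon> = e / (K + 1)"
      have \<epsilon>: "\<epsilon> > 0" "K * \<epsilon> + \<epsilon> = e"
        using e K(1) distrib_right[of K 1 \<epsilon>, symmetric] by (auto simp: \<epsilon>_def)
      obtain d1 where d1: "d1 > 0" "\<And>p. p tagged_division_of {a..b} \<Longrightarrow> (\<lambda>\<tau>. ball \<tau> d1) fine p \<Longrightarrow> M11_fun_norm g (?D p) < \<epsilon>"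
        using I \<epsilon>(1) unfolding has_M11_integral_def by meson
      obtain d2 where d2: "d2 > 0" "\<And>p. p tagged_division_of {a..b} \<Longrightarrow> (\<lambda>\<tau>. ball \<tau> d2) fine p \<Longrightarrow> norm (?S p - integral {a..b} G) < \<epsilon>"
        using riemann_sums_tend_to_integral[OF G ab \<epsilon>(1)] by meson
      have ga: "gauge (\<lambda>\<tau>::real. ball \<tau> (min d1 d2))" using d1(1) d2(1) by (intro gauge_ball) auto
      obtain p where p: "p tagged_division_of {a..b}" "(\<lambda>\<tau>. ball \<tau> (min d1 d2)) fine p"
        using fine_division_exists_real[OF ga] by blast
      have fine: "(\<lambda>\<tau>. ball \<tau> d1) fine p" "(\<lambda>\<tau>. ball \<tau> d2) fine p" using p(2) by (force simp: fine_def)+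
      have "norm (?S p - f) \<le> K * M11_fun_norm g (?D p)" by (rule K(3)[OF S[OF p(1) f]])
      also have "\<dots> \<le> K * \<epsilon>" using K(1) d1(2)[OF p(1) fine(1)] by (intro mult_left_mono) auto
      finally have "norm (?S p - f) \<le> K * \<epsilon>" .
      moreover have "norm (f - integral {a..b} G) \<le> norm (?S p - f) + norm (?S p - integral {a..b} G)"
        using norm_triangle_ineq[of "f - ?S p" "?S p - integral {a..b} G"] by (simp add: norm_minus_commute)
      ultimately show ?thesis using d2(2)[OF p(1) fine(2)] \<epsilon>(2) by linarith
    qed
    hence "norm (f - integral {a..b} G) \<le> 0" by (rule field_le_epsilon[of _ 0, simplified])
    thus "represents w (integral {a..b} G)" using f by simp
  next
    assume w: "represents w (integral {a..b} G)"
    show "has_M11_integral g H a b w"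
      unfolding has_M11_integral_def
    proof (intro conjI ballI allI impI represents_imp_M11_fun[OF g w] represents_imp_M11_fun[OF g r])
      fix \<epsilon> :: real assume "\<epsilon> > 0"
      hence "\<epsilon> / K > 0" using K(1) by simp
      then obtain d where d: "d > 0" "\<And>p. p tagged_division_of {a..b} \<Longrightarrow> (\<lambda>\<tau>. ball \<tau> d) fine p \<Longrightarrow> norm (?S p - integral {a..b} G) < \<epsilon> / K"
        using riemann_sums_tend_to_integral[OF G ab] by meson
      have "M11_fun_norm g (?D p) < \<epsilon>" if p: "p tagged_division_of {a..b}" "(\<lambda>\<tau>. ball \<tau> d) fine p" for p
      proof -
        have "M11_fun_norm g (?D p) \<le> K * norm (?S p - integral {a..b} G)" by (rule K(2)[OF S[OF p(1) w]])
        also have "\<dots> < K * (\<epsilon> / K)" using K(1) d(2)[OF p] by (intro mult_strict_left_mono)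
        finally show ?thesis using K(1) by simp
      qed
      thus "\<exists>\<delta>>0. \<forall>p. p tagged_division_of {a..b} \<and> (\<lambda>\<tau>. ball \<tau> \<delta>) fine p \<longrightarrow> M11_fun_norm g (?D p) < \<epsilon>"
        using d(1) by blast
    qed
  qed
qed

section \<open>Translation of the Cauchy problem to the Banach space\<close>

lemma cscale_cscale: "cscale c (cscale d f) = cscale (c * d) f"
  by (rule m11_eqI) (simp add: rep_cscale[of c "cscale d f"] rep_cscale[of d f] rep_cscale[of "c * d" f] mult.assoc)

lemma cscale_1: "cscale 1 f = f"
  by (rule m11_eqI) (simp add: rep_cscale)

lemma cscale_diff: "cscale c f - cscale c f' = cscale c (f - f')"
  by (rule m11_eqI) (simp add: rep_minus_m11 rep_cscale right_diff_distrib)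

lemma bounded_linear_cscale: "bounded_linear (cscale c :: 'n::finite m11 \<Rightarrow> 'n m11)"
proof (rule bounded_linear_intro[where K="cmod c"])
  show "cscale c (x + y) = cscale c x + cscale c y" for x y :: "'n m11"
    by (rule m11_eqI) (simp add: rep_cscale rep_plus_m11 distrib_left)
  show "cscale c (r *\<^sub>R x) = r *\<^sub>R cscale c x" for r and x :: "'n m11"
    by (simp add: scaleR_m11_def cscale_cscale mult.commute)
  show "norm (cscale c x) \<le> norm x * cmod c" for x :: "'n m11" by (simp add: norm_cscale mult.commute)
qed

lemma represents_nonlinearity:
  assumes F: "real_entire F" and N: "\<And>x. rep_m11 f' x = F (Re (rep_m11 f x)) (Im (rep_m11 f x))"
    and r: "represents h f"
  shows "represents (nonlinearity F h) f'"
proof -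
  have "AE x in lborel. nonlinearity F h x = rep_m11 f' x"
    using r unfolding represents_def by (auto simp: nonlinearity_def N)
  thus ?thesis using nonlinearity_measurable[OF F] r by (auto simp: represents_def)
qed

text \<open>Apart from the translation of each notion, the point is the factor i. The abstract
  nonlinearity contains -i, while the integral in the definition of a solution is formed without it:
  if J is the abstract integral, w represents i J, and -i w represents J again.\<close>

lemma M11_solution_iff:
  fixes g :: "real^'n::finite \<Rightarrow> complex" and N :: "'n m11 \<Rightarrow> 'n m11"
  assumes g: "g \<in> schwartz_space" and nz: "g \<noteq> (\<lambda>_. 0)" and F: "real_entire F"
    and N: "\<And>f x. rep_m11 (N f) x = F (Re (rep_m11 f x)) (Im (rep_m11 f x))"
    and evol: "semilinear_evolution m11_evolve C (\<lambda>f. cscale (- \<i>) (N f))"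
    and r0: "represents u0 f0" and r: "\<And>t. t \<in> {0..<T} \<Longrightarrow> represents (u t) (v t)"
  shows "M11_solution g F u0 T u \<longleftrightarrow>
    semilinear_evolution.mild_solution m11_evolve (\<lambda>f. cscale (- \<i>) (N f)) f0 {0..<T} v"
proof -
  interpret semilinear_evolution m11_evolve C "\<lambda>f. cscale (- \<i>) (N f)" by (rule evol)
  have duh: "(\<exists>w. has_M11_integral g (\<lambda>\<tau>. propagator (t - \<tau>) (nonlinearity F (u \<tau>))) 0 t w \<and>
          (AE x in lborel. u t x = propagator t u0 x - \<i> * w x)) \<longleftrightarrow> v t = duhamel f0 v t"
    if v: "continuous_on {0..<T} v" and t: "t \<in> {0..<T}" for t
  proof -
    let ?g = "\<lambda>\<tau>. m11_evolve (t - \<tau>) (cscale (- \<i>) (N (v \<tau>)))"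
    define G where "G \<tau> = m11_evolve (t - \<tau>) (N (v \<tau>))" for \<tau>
    define J where "J = integral {0..t} ?g"
    have G: "G \<tau> = cscale \<i> (?g \<tau>)" for \<tau>
      by (simp add: G_def m11_evolve_cscale cscale_cscale cscale_1)
    have sub: "{0..t} \<subseteq> {0..<T}" using t by auto
    have gc: "continuous_on {0..t} ?g" by (rule duhamel_integrand_continuous[OF continuous_on_subset[OF v sub]])
    have Gc: "continuous_on {0..t} G"
      unfolding G[abs_def] by (rule bounded_linear.continuous_on[OF bounded_linear_cscale gc])
    have IG: "integral {0..t} G = cscale \<i> J"
      using integral_linear[OF integrable_continuous_real[OF gc] bounded_linear_cscale, of \<i>]
      by (simp add: J_def G[abs_def] o_def)
    have rG: "represents (propagator (t - \<tau>) (nonlinearity F (u \<tau>))) (G \<tau>)" if "\<tau> \<in> {0..t}" for \<tau>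
      unfolding G_def using that sub by (intro represents_propagator represents_nonlinearity[OF F N] r) auto
    have I: "has_M11_integral g (\<lambda>\<tau>. propagator (t - \<tau>) (nonlinearity F (u \<tau>))) 0 t w \<longleftrightarrow> represents w (cscale \<i> J)" for w
      unfolding IG[symmetric] by (rule has_M11_integral_iff[OF g nz _ rG Gc]) (use t in auto)
    have D: "represents (\<lambda>x. propagator t u0 x - \<i> * w x) (duhamel f0 v t)" if "represents w (cscale \<i> J)" for w
    proof -
      have "J = - cscale \<i> (cscale \<i> J)" by (rule m11_eqI) (simp add: rep_cscale rep_uminus_m11)
      hence "duhamel f0 v t = m11_evolve t f0 - cscale \<i> (cscale \<i> J)" by (simp add: duhamel_def J_def[symmetric])
      thus ?thesis by (simp only: represents_diff represents_propagator[OF r0] represents_cscale that)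
    qed
    show ?thesis
    proof
      assume "\<exists>w. has_M11_integral g (\<lambda>\<tau>. propagator (t - \<tau>) (nonlinearity F (u \<tau>))) 0 t w \<and>
          (AE x in lborel. u t x = propagator t u0 x - \<i> * w x)"
      then obtain w where "represents w (cscale \<i> J)" and ae: "AE x in lborel. u t x = propagator t u0 x - \<i> * w x"
        unfolding I by blast
      thus "v t = duhamel f0 v t" by (intro represents_AE_imp_eq[OF r[OF t] D ae])
    next
      assume vt: "v t = duhamel f0 v t"
      have w: "represents (rep_m11 (cscale \<i> J)) (cscale \<i> J)" by (rule represents_rep_m11)
      show "\<exists>w. has_M11_integral g (\<lambda>\<tau>. propagator (t - \<tau>) (nonlinearity F (u \<tau>))) 0 t w \<and>
          (AE x in lborel. u t x = propagator t u0 x - \<i> * w x)"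
        unfolding I using w represents_AE_eq[OF r[OF t, unfolded vt] D[OF w]] by (intro exI conjI)
    qed
  qed
  show ?thesis
    unfolding M11_solution_def mild_solution_def
    by (intro conj_cong ball_cong refl duh M11_continuous_on_iff[OF g nz r])
qed

theorem theorem1p3:
  fixes g :: "real^'n::finite \<Rightarrow> complex" and F :: "real \<Rightarrow> real \<Rightarrow> complex"
  assumes "g \<in> schwartz_space" and "g \<noteq> (\<lambda>_. 0)"
    and "real_entire F" and "F 0 0 = 0"
  shows "\<exists>Tstar :: real \<Rightarrow> real. (\<forall>r. 0 < Tstar r) \<and>
    (\<forall>u0 \<in> M11_fun g.
       (\<exists>u. M11_solution g F u0 (Tstar (M11_fun_norm g u0)) u) \<and>
       (\<forall>u v. M11_solution g F u0 (Tstar (M11_fun_norm g u0)) u \<longrightarrow>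
              M11_solution g F u0 (Tstar (M11_fun_norm g u0)) v \<longrightarrow>
              (\<forall>t\<in>{0..<Tstar (M11_fun_norm g u0)}. AE x in lborel. u t x = v t x)))"
proof -
  obtain K where K: "K > 0" "\<And>h f. represents h f \<Longrightarrow> M11_fun_norm g h \<le> K * norm f"
    "\<And>h f. represents h f \<Longrightarrow> norm f \<le> K * M11_fun_norm g h"
    using M11_fun_norm_equivalent[OF assms(1,2)] by auto
  obtain N :: "'n m11 \<Rightarrow> 'n m11" where N: "\<And>f x. rep_m11 (N f) x = F (Re (rep_m11 f x)) (Im (rep_m11 f x))"
    and lip: "\<And>R. \<exists>L\<ge>0. \<forall>f h. norm f \<le> R \<longrightarrow> norm h \<le> R \<longrightarrow> norm (N f - N h) \<le> L * norm (f - h)"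
    using m11_nonlinearity[OF assms(3,4)] by blast
  obtain C where C: "C \<ge> 1" "\<And>t (f :: 'n m11). norm (m11_evolve t f) \<le> C * norm f"
    using m11_evolve_bound by blast
  let ?N = "\<lambda>f. cscale (- \<i>) (N f)"
  have evol: "semilinear_evolution m11_evolve C ?N"
  proof (rule semilinear_evolution.intro)
    show "?N 0 = 0" by (rule m11_eqI) (simp add: rep_cscale N rep_zero_m11 assms(4))
    show "\<exists>L\<ge>0. \<forall>x y. norm x \<le> R \<longrightarrow> norm y \<le> R \<longrightarrow> norm (?N x - ?N y) \<le> L * norm (x - y)" for R
      using lip[of R] by (simp add: cscale_diff norm_cscale)
  qed (rule bounded_linear_m11_evolve C m11_evolve_continuous m11_evolve_group m11_evolve_0)+
  interpret semilinear_evolution m11_evolve C ?N by (rule evol)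
  note sol_iff = M11_solution_iff[OF assms(1-3) N evol]
  \<comment> \<open>The time is chosen from the norm bound alone, before the datum. It is evaluated
    at K times the given norm, which dominates the norm of the represented datum.\<close>
  obtain T where T: "\<And>r. T r > 0" "\<And>r f. norm f \<le> r \<Longrightarrow> \<exists>v. mild_solution f {0..T r} v"
    using mild_solution_exists by metis
  have "(\<exists>u. M11_solution g F u0 \<tau> u) \<and> (\<forall>u v. M11_solution g F u0 \<tau> u \<longrightarrow> M11_solution g F u0 \<tau> v \<longrightarrow>
      (\<forall>t\<in>{0..<\<tau>}. AE x in lborel. u t x = v t x))"
    if u0: "u0 \<in> M11_fun g" and \<tau>: "\<tau> = T (K * M11_fun_norm g u0)" for u0 \<tau>
  proof -
    obtain f0 where f0: "represents u0 f0" using M11_fun_imp_represented[OF assms(1,2) u0] by blast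
    obtain v where v: "mild_solution f0 {0..\<tau>} v" using T(2)[OF K(3)[OF f0]] \<tau> by blast
    have "mild_solution f0 {0..<\<tau>} v"
      using v continuous_on_subset[of "{0..\<tau>}" v "{0..<\<tau>}", OF _ atLeastLessThan_subseteq_atLeastAtMost_iff[THEN iffD2]] by (auto simp: mild_solution_def)
    hence ex: "M11_solution g F u0 \<tau> (\<lambda>t. rep_m11 (v t))" by (subst sol_iff[OF f0 represents_rep_m11])
    \<comment> \<open>Uniqueness concerns arbitrary representatives, so each solution is lifted: at
      every time an element that it represents is chosen, and the lift is a mild solution.\<close>
    have mild: "\<exists>w. (\<forall>t\<in>{0..<\<tau>}. represents (u t) (w t)) \<and> mild_solution f0 {0..<\<tau>} w"
      if u: "M11_solution g F u0 \<tau> u" for u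
    proof -
      have "\<forall>t\<in>{0..<\<tau>}. \<exists>f. represents (u t) f"
        using u M11_fun_imp_represented[OF assms(1,2)] by (auto simp: M11_solution_def M11_continuous_on_def)
      then obtain w where w: "\<forall>t\<in>{0..<\<tau>}. represents (u t) (w t)" by (rule bchoice[THEN exE])
      have "mild_solution f0 {0..<\<tau>} w" using u by (subst (asm) sol_iff[OF f0]) (use w in auto)
      with w show ?thesis by blast
    qed
    have "AE x in lborel. u t x = u' t x"
      if u: "M11_solution g F u0 \<tau> u" and u': "M11_solution g F u0 \<tau> u'" and t: "t \<in> {0..<\<tau>}" for u u' t
    proof -
      obtain w where w: "\<forall>t\<in>{0..<\<tau>}. represents (u t) (w t)" "mild_solution f0 {0..<\<tau>} w" using mild[OF u] by blast
      obtain w' where w': "\<forall>t\<in>{0..<\<tau>}. represents (u' t) (w' t)" "mild_solution f0 {0..<\<tau>} w'" using mild[OF u'] by blast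
      have "w t = w' t" by (rule mild_solution_unique[OF w(2) w'(2) t])
      thus ?thesis using represents_AE_eq bspec[OF w(1) t] bspec[OF w'(1) t] by auto
    qed
    thus ?thesis using ex by blast
  qed
  thus ?thesis by (intro exI[of _ "\<lambda>r. T (K * r)"] conjI allI T ballI) auto
qed

end
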